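(* Let $0<s\le\frac{\alpha q}{2k\alpha+kq}$ and let $I\subset\mathbb{R}$ be a finite interval of energies. There exists a constant $C>0$, independent of $g$, $\mathbf{m}$, $\mathbf{n}$, such that if $$g \geq \frac{C d^{1/s}}{1 + \min_{\lambda \in I} |\lambda|},$$ then for any $\mathbf{m} \neq \mathbf{n} \in \mathbb{Z}^d$ $$\Big\langle \sup_{t \geq 0} \left\| e^{i t H_I}(\mathbf{m}, \mathbf{n}) \right\| \Big\rangle \leq C\, \mathrm{dist}(\mathbf{m},\mathbf{n})^{2d} \left( \frac{C d}{g^s (1+\min_{\lambda\in I}|\lambda|)^s}\right)^{\frac{s\, \mathrm{dist}(\mathbf{m},\mathbf{n})}{8}},$$ where $H_I = P_I H P_I$ and $P_I$ is the spectral projector of $H$ corresponding to $I$; therefore the spectrum of $H$ in $I$ is almost surely pure point.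
   Context: The lattice $\mathbb{Z}^d$ is regarded as a graph in which $\mathbf{m}\sim\mathbf{n}$ iff $\|\mathbf{m}-\mathbf{n}\|_1=1$, and $\mathrm{dist}(\mathbf{m},\mathbf{n})=\|\mathbf{m}-\mathbf{n}\|_1$. Let $(v(\mathbf{n}))_{\mathbf{n}\in\mathbb{Z}^d}$ be independent identically distributed real random variables with common distribution $\mu$ such that, for some $\alpha>0$ and $q>0$: (A1) $\mu[t-\epsilon,t+\epsilon]\le C_{A1}\epsilon^\alpha$ for all $\epsilon>0$, $t\in\mathbb{R}$; (A2) $\int |x|^q\,d\mu(x)\le C_{A2}$. Expectation is denoted $\langle\cdot\rangle$. Fix an integer $k\ge1$ and let $V(\mathbf{n})=v(\mathbf{n})A+B$, where $A,B$ are Hermitian $k\times k$ matrices not depending on $\mathbf{n}$, with (B1) $\|A\|,\|A^{-1}\|\le C_{B1}$ and (B2) $\|B\|\le C_{B2}$. For adjacent $\mathbf{m},\mathbf{n}$ let $K(\mathbf{m},\mathbf{n})=K(\mathbf{m}-\mathbf{n})$ be a $k\times k$ matrix depending only on $\mathbf{m}-\mathbf{n}$, with (B3) $K(\mathbf{n},\mathbf{m})=K(\mathbf{m},\mathbf{n})^*$ and $\|K(\mathbf{m},\mathbf{n})\|\le C_{B3}$. For $g>0$, $H$ is the random operator on $\ell^2(\mathbb{Z}^d)\otimes\mathbb{C}^k$ given by $$(H\psi)(\mathbf{n})=V(\mathbf{n})\psi(\mathbf{n})+g^{-1}\sum_{\mathbf{m}\sim\mathbf{n}}K(\mathbf{n},\mathbf{m})\psi(\mathbf{m}).$$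 For an operator $T$ on $\ell^2(\mathbb{Z}^d)\otimes\mathbb{C}^k$, $T(\mathbf{m},\mathbf{n})$ denotes its $k\times k$ matrix block at $(\mathbf{m},\mathbf{n})$. *)

theory Defs
  imports "HOL-Probability.Probability"
begin

section \<open>The lattice and matrices\<close>

definition l1_dist :: "int ^ 'd \<Rightarrow> int ^ 'd \<Rightarrow> int" where
  "l1_dist m n = (\<Sum>i\<in>UNIV. \<bar>m $ i - n $ i\<bar>)"

definition adjacent :: "int ^ 'd \<Rightarrow> int ^ 'd \<Rightarrow> bool" where
  "adjacent m n \<longleftrightarrow> l1_dist m n = 1"

lemma finite_adjacent: "finite {m :: int ^ 'd. adjacent n m}"
proof (rule finite_imageD)
  show "finite (vec_nth ` {m :: int ^ 'd. adjacent n m})"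
  proof (rule finite_subset)
    show "vec_nth ` {m :: int ^ 'd. adjacent n m} \<subseteq> (\<Pi>\<^sub>E i\<in>UNIV. {n $ i - 1..n $ i + 1})"
    proof (rule image_subsetI, rule PiE_I)
      fix m :: "int ^ 'd" and i
      assume "m \<in> {m. adjacent n m}"
      then have "(\<Sum>i\<in>UNIV. \<bar>n $ i - m $ i\<bar>) = 1"
        by (simp add: adjacent_def l1_dist_def)
      moreover have "\<bar>n $ i - m $ i\<bar> \<le> (\<Sum>i\<in>UNIV. \<bar>n $ i - m $ i\<bar>)"
        by (intro member_le_sum) auto
      ultimately show "m $ i \<in> {n $ i - 1..n $ i + 1}"
        by auto
    qed simp
  qed (auto intro: finite_PiE)
qed (simp add: inj_on_def vec_eq_iff)

definition conj_transpose :: "complex ^ 'k ^ 'k \<Rightarrow> complex ^ 'k ^ 'k" where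
  "conj_transpose A = (\<chi> i j. cnj (A $ j $ i))"

definition hermitian :: "complex ^ 'k ^ 'k \<Rightarrow> bool" where
  "hermitian A \<longleftrightarrow> conj_transpose A = A"

definition mat_norm :: "complex ^ 'k ^ 'k \<Rightarrow> real" where
  "mat_norm A = onorm (\<lambda>x. A *v x)"

section \<open>Square-summable functions and operators on them\<close>

text \<open>
  The Hilbert space is the carrier set \<open>ell2\<close> inside the type of all functions from the
  lattice to \<open>complex ^ 'k\<close>.  An operator is a function on the latter type, of which only the
  values on its domain (a subset of \<open>ell2\<close>) matter.
\<close>

type_synonym ('d, 'k) field_config = "int ^ 'd \<Rightarrow> complex ^ 'k"

definition ell2 :: "('d::finite, 'k::finite) field_config set" where
  "ell2 = {\<psi>. (\<lambda>n. (norm (\<psi> n))\<^sup>2) summable_on UNIV}"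

definition ell2_inner :: "('d::finite, 'k::finite) field_config \<Rightarrow> ('d, 'k) field_config \<Rightarrow> complex" where
  "ell2_inner \<phi> \<psi> = (\<Sum>\<^sub>\<infinity>n. \<Sum>i\<in>UNIV. cnj (\<phi> n $ i) * \<psi> n $ i)"

definition ell2_norm :: "('d::finite, 'k::finite) field_config \<Rightarrow> real" where
  "ell2_norm \<psi> = sqrt (\<Sum>\<^sub>\<infinity>n. (norm (\<psi> n))\<^sup>2)"

type_synonym ('d, 'k) operator = "('d, 'k) field_config \<Rightarrow> ('d, 'k) field_config"

definition block :: "('d::finite, 'k::finite) operator \<Rightarrow> int ^ 'd \<Rightarrow> int ^ 'd \<Rightarrow> complex ^ 'k ^ 'k" where
  "block T m n = (\<chi> i j. T (\<lambda>l. if l = n then axis j 1 else 0) m $ i)"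

text \<open>
  The exponential series of \<open>z T\<close> for a bounded operator \<open>T\<close>.  Such a series converges in
  operator norm, so it may be summed separately at each site.
\<close>

definition op_exp :: "complex \<Rightarrow> ('d::finite, 'k::finite) operator \<Rightarrow> ('d, 'k) operator" where
  "op_exp z T \<psi> = (\<lambda>n. \<Sum>j. (z ^ j / fact j) *s (T ^^ j) \<psi> n)"

definition orthogonal_projection :: "('d::finite, 'k::finite) operator \<Rightarrow> bool" where
  "orthogonal_projection P \<longleftrightarrow>
     (\<forall>\<psi>\<in>ell2. P \<psi> \<in> ell2) \<and>
     (\<forall>\<phi>\<in>ell2. \<forall>\<psi>\<in>ell2. P (\<lambda>n. \<phi> n + \<psi> n) = (\<lambda>n. P \<phi> n + P \<psi> n)) \<and>
     (\<forall>c. \<forall>\<psi>\<in>ell2. P (\<lambda>n. c *s \<psi> n) = (\<lambda>n. c *s P \<psi> n)) \<and>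
     (\<forall>\<psi>\<in>ell2. P (P \<psi>) = P \<psi>) \<and>
     (\<forall>\<phi>\<in>ell2. \<forall>\<psi>\<in>ell2. ell2_inner \<phi> (P \<psi>) = ell2_inner (P \<phi>) \<psi>)"

section \<open>Spectral measures of self-adjoint operators\<close>

definition projection_valued_measure :: "(real set \<Rightarrow> ('d::finite, 'k::finite) operator) \<Rightarrow> bool" where
  "projection_valued_measure E \<longleftrightarrow>
     (\<forall>S\<in>sets borel. orthogonal_projection (E S)) \<and>
     (\<forall>\<psi>\<in>ell2. E UNIV \<psi> = \<psi>) \<and>
     (\<forall>F :: nat \<Rightarrow> real set. range F \<subseteq> sets borel \<longrightarrow> disjoint_family F \<longrightarrow>
        (\<forall>\<psi>\<in>ell2. (\<lambda>N. ell2_norm (\<lambda>n. (\<Sum>i<N. E (F i) \<psi> n) - E (\<Union>i. F i) \<psi> n))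
           \<longlonglongrightarrow> 0))"

text \<open>The scalar measure taking \<open>S\<close> to the inner product of \<open>\<psi>\<close> and \<open>E S \<psi>\<close>.\<close>

definition scalar_spectral_measure ::
    "(real set \<Rightarrow> ('d::finite, 'k::finite) operator) \<Rightarrow> ('d, 'k) field_config \<Rightarrow> real measure" where
  "scalar_spectral_measure E \<psi> =
     measure_of UNIV (sets borel) (\<lambda>S. ennreal ((ell2_norm (E S \<psi>))\<^sup>2))"

text \<open>
  \<open>T\<close>, with domain \<open>D\<close>, is the integral of the identity function against \<open>E\<close>.  By
  polarization the quadratic form of \<open>T\<close> on \<open>D\<close> determines \<open>T\<close>.
\<close>

definition is_spectral_measure ::
    "('d::finite, 'k::finite) field_config set \<Rightarrow> ('d, 'k) operator \<Rightarrow> (real set \<Rightarrow> ('d, 'k) operator) \<Rightarrow> bool"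
  where
  "is_spectral_measure D T E \<longleftrightarrow>
     projection_valued_measure E \<and>
     D = {\<psi> \<in> ell2. integrable (scalar_spectral_measure E \<psi>) (\<lambda>x. x\<^sup>2)} \<and>
     (\<forall>\<psi>\<in>D. ell2_inner \<psi> (T \<psi>) =
        complex_of_real (\<integral>x. x \<partial>scalar_spectral_measure E \<psi>))"

text \<open>
  For a self-adjoint operator the spectral theorem gives existence, and uniqueness of \<open>E S\<close> on
  \<open>ell2\<close> for every Borel set \<open>S\<close>; \<open>SOME\<close> only fixes irrelevant values elsewhere.
\<close>

definition spectral_projection ::
    "('d::finite, 'k::finite) field_config set \<Rightarrow> ('d, 'k) operator \<Rightarrow> real set \<Rightarrow> ('d, 'k) operator" where
  "spectral_projection D T = (SOME E. is_spectral_measure D T E)"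

text \<open>
  The spectrum in \<open>I\<close> is pure point if every scalar spectral measure, restricted to \<open>I\<close>, is
  carried by countably many points.
\<close>

definition pure_point_spectrum_in ::
    "('d::finite, 'k::finite) field_config set \<Rightarrow> ('d, 'k) operator \<Rightarrow> real set \<Rightarrow> bool" where
  "pure_point_spectrum_in D T I \<longleftrightarrow>
     (\<forall>\<psi>\<in>ell2. \<exists>X. countable X \<and>
        emeasure (scalar_spectral_measure (spectral_projection D T) \<psi>) (I - X) = 0)"

section \<open>The Hamiltonian\<close>

text \<open>\<open>u\<close> is a realization of the random field; the hopping matrix from \<open>m\<close> to \<open>n\<close> is \<open>K (n - m)\<close>.\<close>

definition hamiltonian ::
    "complex ^ 'k ^ 'k \<Rightarrow> complex ^ 'k ^ 'k \<Rightarrow> (int ^ 'd \<Rightarrow> complex ^ 'k ^ 'k) \<Rightarrow> real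
     \<Rightarrow> (int ^ 'd \<Rightarrow> real) \<Rightarrow> ('d, 'k) operator" where
  "hamiltonian A B K g u \<psi> = (\<lambda>n.
     (u n *\<^sub>R A + B) *v \<psi> n + inverse g *\<^sub>R (\<Sum>m\<in>{m. adjacent n m}. K (n - m) *v \<psi> m))"

text \<open>
  The hopping term is bounded and the potential term is a direct sum of Hermitian matrices, so
  the operator is self-adjoint on its maximal domain, also when the potential is unbounded.
\<close>

definition hamiltonian_domain ::
    "complex ^ 'k ^ 'k \<Rightarrow> complex ^ 'k ^ 'k \<Rightarrow> (int ^ 'd \<Rightarrow> complex ^ 'k ^ 'k) \<Rightarrow> real
     \<Rightarrow> (int ^ 'd \<Rightarrow> real) \<Rightarrow> ('d, 'k) field_config set" where
  "hamiltonian_domain A B K g u = {\<psi> \<in> ell2. hamiltonian A B K g u \<psi> \<in> ell2}"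

definition hamiltonian_projection ::
    "complex ^ 'k ^ 'k \<Rightarrow> complex ^ 'k ^ 'k \<Rightarrow> (int ^ 'd \<Rightarrow> complex ^ 'k ^ 'k) \<Rightarrow> real
     \<Rightarrow> (int ^ 'd \<Rightarrow> real) \<Rightarrow> real set \<Rightarrow> ('d, 'k) operator" where
  "hamiltonian_projection A B K g u =
     spectral_projection (hamiltonian_domain A B K g u) (hamiltonian A B K g u)"

definition hamiltonian_on ::
    "complex ^ 'k ^ 'k \<Rightarrow> complex ^ 'k ^ 'k \<Rightarrow> (int ^ 'd \<Rightarrow> complex ^ 'k ^ 'k) \<Rightarrow> real
     \<Rightarrow> (int ^ 'd \<Rightarrow> real) \<Rightarrow> real set \<Rightarrow> ('d, 'k) operator" where
  "hamiltonian_on A B K g u I =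
     hamiltonian_projection A B K g u I \<circ> hamiltonian A B K g u \<circ> hamiltonian_projection A B K g u I"

end

theory Submission
 imports Defs "HOL-Computational_Algebra.Fundamental_Theorem_Algebra"
begin

text \<open>
 The constant may depend on everything except \<open>g\<close> and the two sites, and \<open>s <= 1\<close> because a
 Hoelder exponent cannot exceed one.  Hence it suffices to bound the expectation for large \<open>g\<close>, with
 \<open>r\<close> the distance of the sites and \<open>d\<close> the dimension, by a constant times
 \<open>r ^ (2 * d) * D1 ^ r * g powr (- (s^2 * r / 8))\<close> (\<open>dynamical_bound\<close>): choosing \<open>C\<close> large absorbs
 \<open>D1 ^ r\<close> and makes the threshold on \<open>g\<close> as high as needed.

 Fractional moments.  The Green function of a finite box is, as a function of the potential at one
 site, a quotient of polynomials of degree at most \<open>k\<close>.  Values of the potential in a set of small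
 probability carry at most half of its fractional moment (\<open>decoupling\<close>), and off such a set
 the block at the site, shifted by the energy, has a bounded inverse (\<open>single_site\<close>).  So the moment of
 order \<open>s / 3\<close> at a site is bounded by \<open>g powr (- s / 3)\<close> times the moments at its neighbours
 (\<open>FM_step\<close>), uniformly in the energy and the box, and it decays exponentially (\<open>FM_decay\<close>).

 Two boxes.  An energy is resonant for a box if the Green function from the centre to the
 boundary is not small.  At a fixed energy this is unlikely (\<open>reson_prob\<close>), and the resonant energies
 are those where a certain polynomial is nonnegative.  If two disjoint, hence independent, boxes
 are resonant at a common energy, then the least such energy is the left end of the window or a zero of
 one of the polynomials, so that the estimate at a fixed energy suffices (\<open>double_resonance\<close>).
 Otherwise \<open>I\<close> splits into two Borel sets, each free of resonances of one box.  Approximate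
 eigenvectors nearly solve the eigenvalue equation in a box; therefore each of the two spectral projections
 nearly annihilates the unit vectors at the centre of its box (\<open>norm_PE_nonresonant\<close>), and these
 norms bound the entries of the exponential at all times (\<open>expform_split_bound\<close>).

 Pure point spectrum.  Fix a site.  Energies resonant for all large boxes around it are, almost
 surely, nonresonant for the boxes of equal size around all sites far away; so the spectral
 projection onto them has finite trace and is atomic (\<open>finite_trace_atomic\<close>).  The other
 energies are nonresonant for infinitely many boxes around the site, and by the Borel-Cantelli
 lemma they carry no mass of the unit vectors there (\<open>atomic_at_site\<close>).

 Spectral theory.  The spectral projections belong to an arbitrarily chosen spectral measure, so existence
 and measurability in the disorder need proof.  For the Cayley transform, measures on the circle
 are obtained as weak limits of Fejer means, and functions of it by mean-square approximation by
 trigonometric polynomials; this gives the spectral theorem (\<open>spectral_theorem\<close>).  By uniqueness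
 (\<open>spectral_unique\<close>) the scalar spectral measures are images of those measures on the circle, which
 depend measurably on the disorder because their moments do (\<open>measurable_from_moments\<close>).
\<close>

text \<open>Plain-character notation for convergence of sequences.\<close>

abbreviation (input) seq_tendsto (infix "---->" 60) where
 "X ----> L == X \<longlonglongrightarrow> L"

section \<open>Complex Hilbert spaces\<close>

text \<open>A complex Hilbert space is a real one with a compatible multiplication by complex
 scalars: multiplication by \<open>\<i>\<close> preserves the real inner product.\<close>

class complex_hilbert = real_inner + complete_space +
 fixes scaleC :: "complex => 'a => 'a"  (infixr "*C" 75)
 assumes scaleC_add_right: "c *C (x + y) = c *C x + c *C y"
  and scaleC_add_left: "(c + d) *C x = c *C x + d *C x"
  and scaleC_scaleC [simp]: "c *C d *C x = (c * d) *C x"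
  and scaleR_scaleC: "r *\<^sub>R x = complex_of_real r *C x"
  and inner_ii_ii: "(\<i> *C x) \<bullet> (\<i> *C y) = x \<bullet> y"

subclass (in complex_hilbert) banach ..

text \<open>The complex inner product, linear in the second argument.\<close>

definition cinner :: "'a::complex_hilbert => 'a => complex" where
 "cinner x y = Complex (x \<bullet> y) ((\<i> *C x) \<bullet> y)"

lemma Re_cinner [simp]: "Re (cinner x y) = x \<bullet> y"
 by(simp add:cinner_def)

lemma scaleC_one [simp]: "1 *C (x::'a::complex_hilbert) = x"
 using scaleR_scaleC[of 1 x] by simp

lemma scaleC_zero_left [simp]: "0 *C (x::'a::complex_hilbert) = 0"
 using scaleR_scaleC[of 0 x] by simp

lemma scaleC_zero_right [simp]: "c *C (0::'a::complex_hilbert) = 0"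
 using scaleC_add_right[of c 0 "0::'a"] by simp

lemma scaleC_minus_left [simp]: "(- c) *C (x::'a::complex_hilbert) = - (c *C x)"
 using scaleC_add_left[of c "-c" x] by(simp add:eq_neg_iff_add_eq_0 add.commute)

lemma scaleC_minus_right [simp]: "c *C (- (x::'a::complex_hilbert)) = - (c *C x)"
 using scaleC_add_right[of c x "-x"] by(simp add:eq_neg_iff_add_eq_0 add.commute)

lemma scaleC_diff_right: "c *C (x - y) = c *C x - c *C (y::'a::complex_hilbert)"
 using scaleC_add_right[of c x "-y"] by simp

lemma scaleC_sum_right: "c *C (\<Sum>i\<in>A. f i) = (\<Sum>i\<in>A. c *C (f i::'a::complex_hilbert))"
 by(induction A rule: infinite_finite_induct) (auto simp:scaleC_add_right)

lemma scaleC_Complex: "c *C (x::'a::complex_hilbert) = Re c *\<^sub>R x + Im c *\<^sub>R (\<i> *C x)"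
proof -
 have "c = of_real (Re c) + of_real (Im c) * \<i>" by(simp add:complex_eq_iff)
 hence "c *C x = (of_real (Re c) + of_real (Im c) * \<i>) *C x" by simp
 thus ?thesis by(simp add:scaleC_add_left scaleR_scaleC)
qed

lemma inner_ii_left: "(\<i> *C x) \<bullet> y = - (x \<bullet> (\<i> *C (y::'a::complex_hilbert)))"
 using inner_ii_ii[of x "\<i> *C y"] by simp

lemma cinner_commute: "cinner y x = cnj (cinner x y)"
 using inner_ii_left[of x y] by(simp add:cinner_def complex_eq_iff inner_commute)

lemma cinner_add_left: "cinner (x + y) z = cinner x z + cinner y z"
 by(simp add:cinner_def complex_eq_iff inner_add_left scaleC_add_right)

lemma cinner_add_right: "cinner x (y + z) = cinner x y + cinner x z"
 by(simp add:cinner_def complex_eq_iff inner_add_right)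

lemma cinner_scaleC_right [simp]: "cinner x (c *C y) = c * cinner x y"
 by(subst scaleC_Complex) (simp add:cinner_def complex_eq_iff inner_add_right inner_ii_ii inner_ii_left algebra_simps)

lemma cinner_scaleC_left [simp]: "cinner (c *C x) y = cnj c * cinner x y"
 by(metis cinner_commute cinner_scaleC_right complex_cnj_cnj complex_cnj_mult)

lemma cinner_zero_left [simp]: "cinner 0 x = 0"
 and cinner_zero_right [simp]: "cinner x 0 = 0"
 by(simp_all add: cinner_def complex_eq_iff)

lemma cinner_minus_left [simp]: "cinner (- x) y = - cinner x y"
 and cinner_minus_right [simp]: "cinner x (- y) = - cinner x y"
 by(simp_all add: cinner_def complex_eq_iff)

lemma cinner_diff_left: "cinner (x - y) z = cinner x z - cinner y z"
 and cinner_diff_right: "cinner x (y - z) = cinner x y - cinner x z"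
 using cinner_add_left[of x "- y" z] cinner_add_right[of x y "- z"] by simp_all

lemma cinner_sum_left: "cinner (\<Sum>i\<in>A. f i) y = (\<Sum>i\<in>A. cinner (f i) y)"
 by(induction A rule: infinite_finite_induct) (auto simp:cinner_add_left)

lemma cinner_sum_right: "cinner x (\<Sum>i\<in>A. f i) = (\<Sum>i\<in>A. cinner x (f i))"
 by(induction A rule: infinite_finite_induct) (auto simp:cinner_add_right)

lemma cinner_self: "cinner x x = of_real ((norm x)^2)"
proof -
 have "(\<i> *C x) \<bullet> x = 0" using inner_ii_left[of x x] by(simp add:inner_commute)
 thus ?thesis by(simp add:cinner_def complex_eq_iff dot_square_norm)
qed

lemma norm_scaleC [simp]: "norm (c *C (x::'a::complex_hilbert)) = cmod c * norm x"
proof -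
 have "of_real ((norm (c *C x))^2) = cnj c * c * of_real ((norm x)^2)" unfolding cinner_self[symmetric] by simp
 also have "... = of_real ((cmod c * norm x)^2)"
  by(simp add:power_mult_distrib mult.commute[of "cnj c"] complex_norm_square[symmetric])
 finally have "(norm (c *C x))^2 = (cmod c * norm x)^2" using of_real_eq_iff by blast
 thus ?thesis by(simp add:power2_eq_iff_nonneg)
qed

lemma cmod_cinner_le: "cmod (cinner x y) <= norm x * norm y"
proof (cases "cinner x y = 0")
 case False
 define u where "u = cnj (cinner x y) / cmod (cinner x y)"
 have "cmod u = 1" using False by(simp add:u_def norm_divide)
 have "cinner x (u *C y) = of_real (cmod (cinner x y))"
  using False by(simp add:u_def complex_norm_square[symmetric] power2_eq_square mult.commute)
 hence "cmod (cinner x y) = x \<bullet> (u *C y)" by(metis Re_cinner Re_complex_of_real)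
 also have "... <= norm x * norm (u *C y)" by(rule norm_cauchy_schwarz)
 finally show ?thesis using `cmod u = 1` by simp
qed simp

lemma cinner_eq_zero_imp: "(!!y. cinner y x = 0) ==> x = 0"
 using cinner_self[of x] by simp

lemma bounded_linear_cinner_right: "bounded_linear (cinner x)"
 by(rule bounded_linear_intro[where K="norm x"])
  (auto simp:cinner_add_right scaleR_scaleC scaleR_conv_of_real mult.commute
   intro:order_trans[OF cmod_cinner_le])

lemma norm_add_sq: "(norm (x + y))^2 = (norm x)^2 + 2 * Re (cinner x y) + (norm y)^2"
 by(simp add:power2_norm_eq_inner inner_add_left inner_add_right inner_commute)

lemma polarization:
 "4 * cinner x y = (norm (x + y))^2 - (norm (x - y))^2
   - \<i> * (norm (x + \<i> *C y))^2 + \<i> * (norm (x - \<i> *C y))^2"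
proof -
 have "of_real ((norm (x + y))^2) - of_real ((norm (x - y))^2)
   - \<i> * of_real ((norm (x + \<i> *C y))^2) + \<i> * of_real ((norm (x - \<i> *C y))^2) = 4 * cinner x y"
  unfolding cinner_self[symmetric] by(simp add:cinner_add_left cinner_add_right cinner_diff_left cinner_diff_right algebra_simps)
 thus ?thesis by simp
qed

section \<open>The space of square-summable functions\<close>

text \<open>The carrier \<open>ell2\<close> as a type; \<open>fld\<close> and \<open>mk_l2\<close>
 pass between its elements and functions on the lattice.\<close>

typedef ('d::finite, 'k::finite) l2 = "ell2 :: ('d, 'k) field_config set"
 morphisms fld mk_l2 by(auto simp:ell2_def intro!:exI[where x="%_. 0"])

setup_lifting type_definition_l2

lemma norm_vector_scalar_mult [simp]: "norm (c *s (x::complex^'k)) = cmod c * norm x"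
 by(simp add:norm_vec_def norm_mult L2_set_def power_mult_distrib sum_distrib_left[symmetric]
   real_sqrt_mult)

lemma norm_add_sq_le: "(norm (x + y :: 'b::real_normed_vector))^2 <= 2 * (norm x)^2 + 2 * (norm y)^2"
proof -
 have "(norm (x + y))^2 <= (norm x + norm y)^2" by(simp add:norm_triangle_ineq power_mono)
 also have "... <= 2 * (norm x)^2 + 2 * (norm y)^2" using sum_squares_bound[of "norm x" "norm y"] by(simp add:power2_sum)
 finally show ?thesis .
qed

lemma ell2_add: "phi : ell2 ==> psi : ell2 ==> (%n. phi n + psi n) : ell2"
proof -
 assume "phi : ell2" "psi : ell2"
 hence "(%n. 2 * (norm (phi n))^2 + 2 * (norm (psi n))^2) summable_on UNIV"
  by(intro summable_on_add summable_on_cmult_right) (auto simp:ell2_def)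
 thus ?thesis
  unfolding ell2_def mem_Collect_eq by(rule summable_on_comparison_test) (auto intro:norm_add_sq_le)
qed

lemma ell2_bounded_image:
 assumes "psi : ell2" "!!n. norm (f n (psi n)) <= c * norm (psi n)"
 shows "(%n. f n (psi n)) : ell2"
proof -
 have "(%n. c^2 * (norm (psi n))^2) summable_on UNIV" using assms by(intro summable_on_cmult_right) (auto simp:ell2_def)
 thus ?thesis
  unfolding ell2_def mem_Collect_eq by(rule summable_on_comparison_test)
   (auto simp:power_mult_distrib[symmetric] intro!:power_mono assms)
qed

lemma ell2_scale: "psi : ell2 ==> (%n. c *s psi n) : ell2"
 by(rule ell2_bounded_image[where c="cmod c"]) auto

lemma abs_inner_le_sq: "abs (x \<bullet> y) <= (norm x)^2 + (norm (y::'b::real_inner))^2"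
proof -
 have "abs (x \<bullet> y) <= norm x * norm y" by(rule Cauchy_Schwarz_ineq2)
 also have "... <= (norm x)^2 + (norm y)^2"
  using sum_squares_bound[of "norm x" "norm y"] mult_nonneg_nonneg[OF norm_ge_zero[of x] norm_ge_zero[of y]] by linarith
 finally show ?thesis .
qed

lemma inner_summable:
 assumes "phi : ell2" "psi : ell2"
 shows "(%n. phi n \<bullet> psi n) summable_on UNIV"
proof -
 have "(%n. (norm (phi n))^2 + (norm (psi n))^2) summable_on UNIV" using assms by(intro summable_on_add) (auto simp:ell2_def)
 hence "(%n. norm (phi n \<bullet> psi n)) summable_on UNIV" by(rule summable_on_comparison_test) (auto simp:abs_inner_le_sq)
 thus ?thesis by(rule abs_summable_summable)
qed

instantiation l2 :: (finite, finite) ab_group_add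
begin
lift_definition zero_l2 :: "('a, 'b) l2" is "%_. 0" by(simp add:ell2_def)
lift_definition plus_l2 :: "('a, 'b) l2 => ('a, 'b) l2 => ('a, 'b) l2" is "%phi psi n. phi n + psi n" by(rule ell2_add)
lift_definition uminus_l2 :: "('a, 'b) l2 => ('a, 'b) l2" is "%phi n. - phi n" by(simp add:ell2_def)
definition minus_l2 :: "('a, 'b) l2 => ('a, 'b) l2 => ('a, 'b) l2" where
 "minus_l2 phi psi = phi + - psi"
instance by standard (transfer; simp add:fun_eq_iff minus_l2_def add.assoc add.commute)+
end

instantiation l2 :: (finite, finite) real_vector
begin
lift_definition scaleR_l2 :: "real => ('a, 'b) l2 => ('a, 'b) l2" is "%r phi n. r *\<^sub>R phi n"
 by(rule ell2_bounded_image) auto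
instance by standard (transfer; simp add:fun_eq_iff scaleR_add_left scaleR_add_right)+
end

instantiation l2 :: (finite, finite) real_inner
begin
definition inner_l2 :: "('a, 'b) l2 => ('a, 'b) l2 => real" where
 "inner_l2 phi psi = (\<Sum>\<^sub>\<infinity>n. fld phi n \<bullet> fld psi n)"
definition norm_l2 :: "('a, 'b) l2 => real" where
 "norm_l2 phi = sqrt (inner phi phi)"
definition dist_l2 :: "('a, 'b) l2 => ('a, 'b) l2 => real" where
 "dist_l2 phi psi = norm (phi - psi)"
definition sgn_l2 :: "('a, 'b) l2 => ('a, 'b) l2" where
 "sgn_l2 phi = phi /\<^sub>R norm phi"
definition uniformity_l2 :: "(('a, 'b) l2 \<times> ('a, 'b) l2) filter" where
 "uniformity_l2 = (INF e\<in>{0 <..}. principal {(x, y). dist x y < e})"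
definition open_l2 :: "('a, 'b) l2 set => bool" where
 "open_l2 S \<longleftrightarrow> (\<forall>x\<in>S. \<forall>\<^sub>F (x', y) in uniformity. x' = x --> y : S)"
instance
proof
 fix x y z :: "('a, 'b) l2" and r s :: real
 show "inner x y = inner y x" by(simp add:inner_l2_def inner_commute)
 show "inner (x + y) z = inner x z + inner y z"
  unfolding inner_l2_def plus_l2.rep_eq inner_add_left by(intro infsum_add inner_summable fld)
 show "inner (r *\<^sub>R x) y = r * inner x y" unfolding inner_l2_def scaleR_l2.rep_eq by(simp add:infsum_cmult_right')
 show "0 <= inner x x" unfolding inner_l2_def by(rule infsum_nonneg) simp
 show "inner x x = 0 \<longleftrightarrow> x = 0"
 proof
  assume "inner x x = 0"
  have "fld x n = 0" for n
  proof -
   have "(\<Sum>\<^sub>\<infinity>n\<in>UNIV. fld x n \<bullet> fld x n) = 0" using `inner x x = 0` by(simp add:inner_l2_def)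
   hence "fld x n \<bullet> fld x n = 0" by(rule nonneg_infsum_le_0D[OF eq_refl]) (auto intro:inner_summable fld)
   thus ?thesis by simp
  qed
  thus "x = 0" by transfer (simp add:fun_eq_iff)
 next
  assume "x = 0"
  thus "inner x x = 0" by(simp add:inner_l2_def zero_l2.rep_eq)
 qed
qed (simp_all add: norm_l2_def dist_l2_def sgn_l2_def uniformity_l2_def open_l2_def)
end

lemma norm_l2_sq: "(norm phi)^2 = (\<Sum>\<^sub>\<infinity>n. (norm (fld phi n))^2)"
 by(simp add:power2_norm_eq_inner inner_l2_def)

lemma ell2_norm_fld: "ell2_norm (fld phi) = norm phi"
 by(simp add:ell2_norm_def norm_l2_sq[symmetric])

lemma fld_minus: "fld (phi - psi) n = fld phi n - fld psi n"
 unfolding minus_l2_def plus_l2.rep_eq uminus_l2.rep_eq by simp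

lemma fld_sum: "fld (\<Sum>i\<in>A. f i) n = (\<Sum>i\<in>A. fld (f i) n)"
 by(induction A rule: infinite_finite_induct) (auto simp:plus_l2.rep_eq zero_l2.rep_eq)

lemma sum_norm_fld_le:
 assumes "finite F"
 shows "(\<Sum>n\<in>F. (norm (fld phi n))^2) <= (norm phi)^2"
 unfolding norm_l2_sq using fld[of phi] by(intro finite_sum_le_infsum assms) (auto simp:ell2_def)

lemma norm_fld_le: "norm (fld phi n) <= norm phi"
 using sum_norm_fld_le[of "{n}" phi] by simp

lemma ell2_boundI:
 assumes "!!F. finite F ==> (\<Sum>n\<in>F. (norm (psi n))^2) <= b"
 shows "psi : ell2" "norm (mk_l2 psi) <= sqrt b"
proof -
 have s: "(%n. (norm (psi n))^2) summable_on UNIV" by(rule nonneg_bounded_partial_sums_imp_summable_on[where C=b])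
   (auto intro!:eventually_finite_subsets_at_top_weakI assms)
 thus *: "psi : ell2" by(simp add:ell2_def)
 have "(norm (mk_l2 psi))^2 <= b"
  unfolding norm_l2_sq mk_l2_inverse[OF *] by(rule infsum_le_finite_sums[OF s]) (auto intro:assms)
 thus "norm (mk_l2 psi) <= sqrt b" by(simp add:real_le_rsqrt)
qed

instance l2 :: (finite, finite) complete_space
proof
 fix X :: "nat => ('a, 'b) l2"
 assume X: "Cauchy X"
 have "Cauchy (%i. fld (X i) n)" for n
 proof (rule metric_CauchyI)
  fix e :: real assume "e > 0"
  then obtain M where "\<forall>i\<ge>M. \<forall>j\<ge>M. dist (X i) (X j) < e" using metric_CauchyD[OF X] by blast
  moreover have "dist (fld (X i) n) (fld (X j) n) <= dist (X i) (X j)" for i j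
   using norm_fld_le[of "X i - X j" n] by(simp add:dist_norm fld_minus)
  ultimately show "\<exists>M. \<forall>i\<ge>M. \<forall>j\<ge>M. dist (fld (X i) n) (fld (X j) n) < e" by(meson le_less_trans)
 qed
 then obtain L where L: "!!n. (%i. fld (X i) n) ----> L n" unfolding Cauchy_convergent_iff convergent_def by metis
 have bd: "(\<Sum>n\<in>F. (norm (fld (X i) n - L n))^2) <= e^2"
  if F: "finite F" and i: "\<forall>j\<ge>M. dist (X i) (X j) <= e" and "e >= 0" for F i M e
 proof (rule tendsto_upperbound)
  show "(%j. \<Sum>n\<in>F. (norm (fld (X i) n - fld (X j) n))^2) ----> (\<Sum>n\<in>F. (norm (fld (X i) n - L n))^2)"
   by(intro tendsto_intros L)
  have "(\<Sum>n\<in>F. (norm (fld (X i) n - fld (X j) n))^2) <= e^2" if "j >= M" for j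
  proof -
   have "(\<Sum>n\<in>F. (norm (fld (X i) n - fld (X j) n))^2) <= (norm (X i - X j))^2"
    using sum_norm_fld_le[OF F, of "X i - X j"] by(simp add:fld_minus)
   also have "... <= e^2" using i that `e >= 0` by(intro power_mono) (auto simp:dist_norm)
   finally show ?thesis .
  qed
  thus "\<forall>\<^sub>F j in sequentially. (\<Sum>n\<in>F. (norm (fld (X i) n - fld (X j) n))^2) <= e^2"
   by(auto simp:eventually_sequentially)
 qed simp
 obtain M1 where M1: "\<forall>i\<ge>M1. \<forall>j\<ge>M1. dist (X i) (X j) < 1" using metric_CauchyD[OF X, of 1] by auto
 have "(%n. fld (X M1) n - L n) : ell2"
  by(rule ell2_boundI(1)[where b="1^2"], rule bd[where M=M1]) (use M1 in \<open>auto intro:less_imp_le\<close>)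
 hence "(%n. fld (X M1) n + - 1 *s (fld (X M1) n - L n)) : ell2" by(intro ell2_add fld ell2_scale)
 hence "L : ell2" by(simp add:vector_smult_lneg)
 have "X ----> mk_l2 L"
 proof (rule metric_LIMSEQ_I)
  fix e :: real assume "e > 0"
  then obtain M where M: "\<forall>i\<ge>M. \<forall>j\<ge>M. dist (X i) (X j) < e / 2"
   using metric_CauchyD[OF X, of "e/2"] by auto
  have "dist (X i) (mk_l2 L) < e" if "i >= M" for i
  proof -
   have "(\<Sum>n\<in>F. (norm (fld (X i - mk_l2 L) n))^2) <= (e/2)^2" if "finite F" for F
    unfolding fld_minus mk_l2_inverse[OF `L : ell2`]
    by(rule bd[where M=M]) (use M `i >= M` `e > 0` that in \<open>auto intro:less_imp_le\<close>)
   from ell2_boundI(2)[OF this] have "norm (X i - mk_l2 L) <= e / 2" using `e > 0` by(simp add:fld_inverse)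
   thus ?thesis using `e > 0` by(simp add:dist_norm)
  qed
  thus "\<exists>M. \<forall>i\<ge>M. dist (X i) (mk_l2 L) < e" by blast
 qed
 thus "convergent X" by(auto simp:convergent_def)
qed

instantiation l2 :: (finite, finite) complex_hilbert
begin
lift_definition scaleC_l2 :: "complex => ('a, 'b) l2 => ('a, 'b) l2" is "%c phi n. c *s phi n" by(rule ell2_scale)
instance
proof
 fix x y :: "('a, 'b) l2" and c d :: complex and r :: real
 show "c *C (x + y) = c *C x + c *C y" by transfer (simp add:fun_eq_iff vec_eq_iff distrib_left)
 show "(c + d) *C x = c *C x + d *C x" by transfer (simp add:fun_eq_iff vec_eq_iff distrib_right)
 show "c *C d *C x = (c * d) *C x" by transfer (simp add:fun_eq_iff vec_eq_iff)
 show "r *\<^sub>R x = complex_of_real r *C x" by transfer (simp add:fun_eq_iff vec_eq_iff, simp add:scaleR_conv_of_real)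
 show "inner (\<i> *C x) (\<i> *C y) = inner x y"
  unfolding inner_l2_def scaleC_l2.rep_eq by(simp add:inner_vec_def inner_complex_def add.commute)
qed
end

lemma cinner_l2: "cinner phi psi = ell2_inner (fld phi) (fld psi)"
proof -
 have "((%n. fld phi n \<bullet> fld psi n) has_sum (phi \<bullet> psi)) UNIV"
  unfolding inner_l2_def by(intro has_sum_infsum inner_summable fld)
 moreover have "((%n. fld (\<i> *C phi) n \<bullet> fld psi n) has_sum ((\<i> *C phi) \<bullet> psi)) UNIV"
  unfolding inner_l2_def by(intro has_sum_infsum inner_summable fld)
 ultimately have "((%n. of_real (fld phi n \<bullet> fld psi n) + \<i> * of_real (fld (\<i> *C phi) n \<bullet> fld psi n))
   has_sum of_real (phi \<bullet> psi) + \<i> * of_real ((\<i> *C phi) \<bullet> psi)) UNIV"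
  by(intro has_sum_add has_sum_cmult_right has_sum_of_real)
 also have "of_real (phi \<bullet> psi) + \<i> * of_real ((\<i> *C phi) \<bullet> psi) = cinner phi psi"
  by(simp add:cinner_def complex_eq_iff)
 finally have *: "((%n. of_real (fld phi n \<bullet> fld psi n) + \<i> * of_real (fld (\<i> *C phi) n \<bullet> fld psi n))
   has_sum cinner phi psi) UNIV" .
 have "(%n. of_real (fld phi n \<bullet> fld psi n) + \<i> * of_real (fld (\<i> *C phi) n \<bullet> fld psi n)) =
   (%n. \<Sum>i\<in>UNIV. cnj (fld phi n $ i) * fld psi n $ i)"
  by(simp add:fun_eq_iff complex_eq_iff inner_vec_def inner_complex_def scaleC_l2.rep_eq algebra_simps
    sum_subtractf sum.distrib sum_negf)
 with * have "((%n. \<Sum>i\<in>UNIV. cnj (fld phi n $ i) * fld psi n $ i) has_sum cinner phi psi) UNIV" by(simp only:)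
 thus ?thesis unfolding ell2_inner_def by(rule infsumI[symmetric])
qed

text \<open>The unit vector at a site \<open>fst a\<close> in the direction \<open>snd a\<close> of
 the fibre.\<close>

definition delta :: "(int ^ 'd) \<times> 'k => ('d::finite, 'k::finite) l2" where
 "delta a = mk_l2 (%l. if l = fst a then axis (snd a) 1 else 0)"

lemma delta_in_ell2: "(%l. if l = n then x else 0) : (ell2 :: ('d::finite,'k::finite) field_config set)"
proof (rule ell2_boundI(1))
 fix F :: "(int^'d) set" assume "finite F"
 hence "(\<Sum>l\<in>F. (norm (if l = n then x else 0))^2) = (\<Sum>l\<in>F. if l = n then (norm x)^2 else 0)"
  by(intro sum.cong) auto
 also have "... <= (norm x)^2" using `finite F` by simp
 finally show "(\<Sum>l\<in>F. (norm (if l = n then x else 0))^2) <= (norm x)^2" .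
qed

lemma fld_delta: "fld (delta a) = (%l. if l = fst a then axis (snd a) 1 else 0)"
 by(simp add:delta_def mk_l2_inverse delta_in_ell2)

lemma cinner_delta: "cinner (delta a) psi = fld psi (fst a) $ snd a"
proof -
 have "ell2_inner (fld (delta a)) (fld psi) =
   (\<Sum>\<^sub>\<infinity>n\<in>{fst a}. \<Sum>i\<in>UNIV. cnj (fld (delta a) n $ i) * fld psi n $ i)"
  unfolding ell2_inner_def by(rule infsum_cong_neutral) (auto simp:fld_delta)
 also have "... = (\<Sum>i\<in>UNIV. if i = snd a then fld psi (fst a) $ i else 0)"
  by(simp add:fld_delta axis_def if_distrib[of cnj] if_distrib[of "%x. x * _"] cong: if_cong)
 finally show ?thesis by(simp add:cinner_l2)
qed

lemma norm_delta [simp]: "norm (delta a) = 1"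
proof -
 have "of_real ((norm (delta a))^2) = (1::complex)" unfolding cinner_self[symmetric] cinner_delta by(simp add:fld_delta axis_def)
 hence "(norm (delta a))^2 = 1" using of_real_eq_1_iff by blast
 thus ?thesis by(metis norm_ge_zero power2_eq_iff_nonneg one_power2 zero_le_one)
qed

section \<open>Projection-valued measures\<close>

definition clinear_map :: "('a::complex_hilbert => 'a) => bool" where
 "clinear_map T \<longleftrightarrow> (\<forall>x y. T (x + y) = T x + T y) & (\<forall>c x. T (c *C x) = c *C T x)"

lemma clinear_mapD:
 assumes "clinear_map T"
 shows "T (x + y) = T x + T y" "T (c *C x) = c *C T x" "T 0 = 0" "T (- x) = - T x"
  "T (x - y) = T x - T y" "T (r *\<^sub>R x) = r *\<^sub>R T x" "T (\<Sum>i\<in>A. f i) = (\<Sum>i\<in>A. T (f i))"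
proof -
 show *: "T (x + y) = T x + T y" "T (c *C x) = c *C T x" for x y c using assms by(auto simp:clinear_map_def)
 show z: "T 0 = 0" using *(2)[of 0 0] by simp
 show **: "T (- x) = - T x" for x using *(2)[of "-1" x] by simp
 show "T (x - y) = T x - T y" using *(1)[of x "- y"] ** by simp
 show "T (r *\<^sub>R x) = r *\<^sub>R T x" by(simp add:scaleR_scaleC *)
 show "T (\<Sum>i\<in>A. f i) = (\<Sum>i\<in>A. T (f i))" by(induction A rule: infinite_finite_induct) (auto simp:* z)
qed

text \<open>Idempotent and self-adjoint linear maps; boundedness follows.\<close>

definition orth_proj :: "('a::complex_hilbert => 'a) => bool" where
 "orth_proj P \<longleftrightarrow> clinear_map P & (\<forall>x. P (P x) = P x) & (\<forall>x y. cinner x (P y) = cinner (P x) y)"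

lemma orth_proj_cinner_self:
 assumes "orth_proj P"
 shows "cinner x (P x) = of_real ((norm (P x))^2)"
 using assms unfolding orth_proj_def by(metis cinner_self)

lemma orth_projI:
 assumes "clinear_map P" "!!x. cinner x (P x) = of_real ((norm (P x))^2)"
 shows "orth_proj P"
proof -
 note lin = clinear_mapD[OF assms(1)]
 have *: "cinner x (P y) = cinner (P x) (P y)" for x y
 proof -
  have b: "cinner u (P u) = cinner (P u) (P u)" for u by(simp add:assms(2) cinner_self)
  have 1: "cinner x (P y) + cinner y (P x) = cinner (P x) (P y) + cinner (P y) (P x)"
   using b[of "x + y"] b[of x] b[of y] by(simp add:lin cinner_add_left cinner_add_right add.commute)
  have 2: "\<i> * cinner x (P y) - \<i> * cinner y (P x) = \<i> * cinner (P x) (P y) - \<i> * cinner (P y) (P x)"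
   using b[of "x + \<i> *C y"] b[of x] b[of y] by(simp add:lin cinner_add_left cinner_add_right algebra_simps)
  hence "cinner x (P y) - cinner y (P x) = cinner (P x) (P y) - cinner (P y) (P x)" by(simp add:right_diff_distrib[symmetric])
  with 1 have "(cinner x (P y) + cinner y (P x)) + (cinner x (P y) - cinner y (P x)) =
    (cinner (P x) (P y) + cinner (P y) (P x)) + (cinner (P x) (P y) - cinner (P y) (P x))" by(simp only:)
  thus ?thesis by simp
 qed
 have sa: "cinner x (P y) = cinner (P x) y" for x y by(metis * cinner_commute)
 have "P (P x) - P x = 0" for x
 proof (rule cinner_eq_zero_imp)
  fix y
  show "cinner y (P (P x) - P x) = 0" by(metis * sa cinner_diff_right right_minus_eq)
 qed
 thus ?thesis using assms(1) sa by(auto simp:orth_proj_def)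
qed

text \<open>The scalar measure taking \<open>S\<close> to the inner product of \<open>x\<close> and
 \<open>E S x\<close>.\<close>

definition smeas :: "(real set => 'a::complex_hilbert => 'a) => 'a => real measure" where
 "smeas E x = measure_of UNIV (sets borel) (%S. ennreal ((norm (E S x))^2))"

text \<open>Strong countable additivity is required along disjoint sequences of Borel sets only;
 multiplicativity (\<open>E_Int\<close>) follows.\<close>

locale pvm =
 fixes E :: "real set => 'a::complex_hilbert => 'a"
 assumes proj: "S : sets borel ==> orth_proj (E S)"
  and E_UNIV [simp]: "E UNIV x = x"
  and sigma_additive: "range F \<subseteq> sets borel ==> disjoint_family F ==>
   (%N::nat. \<Sum>i<N. E (F i) x) ----> E (\<Union>i. F i) x"
begin

lemma lin: "S : sets borel ==> clinear_map (E S)"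
 using proj by(auto simp:orth_proj_def)

lemmas E_simps = clinear_mapD[OF lin]

lemma idem: "S : sets borel ==> E S (E S x) = E S x"
 using proj by(auto simp:orth_proj_def)

lemma selfadj: "S : sets borel ==> cinner x (E S y) = cinner (E S x) y"
 using proj by(auto simp:orth_proj_def)

lemma cinner_E_self: "S : sets borel ==> cinner x (E S x) = of_real ((norm (E S x))^2)"
 using proj orth_proj_cinner_self by blast

lemma E_empty [simp]: "E {} x = 0"
proof -
 have *: "(%N. \<Sum>i<N. E {} x) ----> E {} x" using sigma_additive[of "%_. {}" x] by(simp add:disjoint_family_on_def)
 hence "(%N. \<Sum>i<Suc N. E {} x) ----> E {} x" by(rule LIMSEQ_Suc)
 from tendsto_diff[OF this *] have "(%N. E {} x) ----> 0" by simp
 thus ?thesis by(simp add:LIMSEQ_const_iff)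
qed

lemma E_Un:
 assumes "S : sets borel" "S' : sets borel" "S \<inter> S' = {}"
 shows "E (S \<union> S') x = E S x + E S' x"
proof -
 define F where "F = (%i::nat. if i = 0 then S else if i = 1 then S' else {})"
 have F: "range F \<subseteq> sets borel" "disjoint_family F" "(\<Union>i. F i) = S \<union> S'"
  using assms by(auto simp:F_def disjoint_family_on_def split: if_splits)
 have "(%N. \<Sum>i<N. E (F i) x) ----> E S x + E S' x"
 proof (rule tendsto_eventually, rule eventually_sequentiallyI[of 2])
  fix N :: nat assume "N >= 2"
  hence "(\<Sum>i<N. E (F i) x) = (\<Sum>i\<in>{0,1}. E (F i) x)" by(intro sum.mono_neutral_right) (auto simp:F_def)
  thus "(\<Sum>i<N. E (F i) x) = E S x + E S' x" by(simp add:F_def)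
 qed
 thus ?thesis using LIMSEQ_unique[OF sigma_additive[OF F(1,2)]] F(3) by metis
qed

lemma norm_E_le: "S : sets borel ==> norm (E S x) <= norm x"
proof -
 assume S: "S : sets borel"
 have "(norm (E S x))^2 = cmod (cinner x (E S x))" unfolding cinner_E_self[OF S] by(simp add:norm_power)
 also have "... <= norm x * norm (E S x)" by(rule cmod_cinner_le)
 finally show ?thesis by(cases "norm (E S x) = 0") (auto simp:power2_eq_square)
qed

lemma E_disjoint:
 assumes "S : sets borel" "S' : sets borel" "S \<inter> S' = {}"
 shows "E S' (E S x) = 0"
proof -
 let ?y = "E S x"
 have "cinner ?y (E (S \<union> S') ?y) = cinner ?y (E S ?y) + cinner ?y (E S' ?y)" using assms by(simp add:E_Un cinner_add_right)
 hence "(norm (E (S \<union> S') ?y))^2 = (norm (E S ?y))^2 + (norm (E S' ?y))^2"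
  using assms by(simp only: cinner_E_self sets.Un of_real_add[symmetric] of_real_eq_iff)
 moreover have "(norm (E (S \<union> S') ?y))^2 <= (norm ?y)^2" using assms by(intro power_mono norm_E_le) auto
 ultimately show ?thesis using idem[OF assms(1)] by simp
qed

lemma E_Int:
 assumes [measurable]: "S : sets borel" "S' : sets borel"
 shows "E S' (E S x) = E (S \<inter> S') x"
proof -
 have "E S x = E (S \<inter> S') x + E (S - S') x" using E_Un[of "S \<inter> S'" "S - S'" x] by(auto simp:Int_Diff_Un)
 moreover have "E S' (E (S \<inter> S') x) = E (S \<inter> S') x"
 proof -
  have "E S' y = E (S \<inter> S') y + E (S' - S) y" for y
  proof -
   have "S \<inter> S' \<union> (S' - S) = S'" "S \<inter> S' \<inter> (S' - S) = {}" by auto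
   thus ?thesis using E_Un[of "S \<inter> S'" "S' - S" y] by simp
  qed
  thus ?thesis using E_disjoint[of "S \<inter> S'" "S' - S" x] idem[of "S \<inter> S'" x] by auto
 qed
 moreover have "E S' (E (S - S') x) = 0" by(rule E_disjoint) auto
 ultimately show ?thesis by(simp add:E_simps)
qed

lemma sets_smeas [simp, measurable_cong]: "sets (smeas E x) = sets borel"
 and space_smeas [simp]: "space (smeas E x) = UNIV"
 unfolding smeas_def using sets.sigma_sets_eq[of "borel :: real measure"] by auto

lemma norm_sq_Un:
 assumes "S : sets borel" "S' : sets borel" "S \<inter> S' = {}"
 shows "(norm (E (S \<union> S') x))^2 = (norm (E S x))^2 + (norm (E S' x))^2"
proof -
 have "cinner (E S x) (E S' x) = 0" using assms by(metis selfadj E_disjoint cinner_zero_left)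
 thus ?thesis by(simp add:E_Un[OF assms] norm_add_sq)
qed

lemma norm_sq_finite_Un:
 assumes "finite A" "!!i. i : A ==> F i : sets borel" "disjoint_family_on F A"
 shows "(norm (E (\<Union>i\<in>A. F i) x))^2 = (\<Sum>i\<in>A. (norm (E (F i) x))^2)"
  and "E (\<Union>i\<in>A. F i) x = (\<Sum>i\<in>A. E (F i) x)"
proof -
 have "(norm (E (\<Union>i\<in>A. F i) x))^2 = (\<Sum>i\<in>A. (norm (E (F i) x))^2) &
   E (\<Union>i\<in>A. F i) x = (\<Sum>i\<in>A. E (F i) x)"
  using assms
 proof (induction A rule: finite_induct)
  case (insert a A)
  have d: "F a \<inter> (\<Union>i\<in>A. F i) = {}"
   using insert.prems(2) insert.hyps(2) by(fastforce simp: disjoint_family_on_def)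
  have m: "F a : sets borel" "(\<Union>i\<in>A. F i) : sets borel" using insert.prems insert.hyps by auto
  have "disjoint_family_on F A" using insert.prems(2) by(auto simp:disjoint_family_on_def)
  thus ?case using insert norm_sq_Un[OF m d, of x] E_Un[OF m d, of x] by auto
 qed simp
 thus "(norm (E (\<Union>i\<in>A. F i) x))^2 = (\<Sum>i\<in>A. (norm (E (F i) x))^2)"
  and "E (\<Union>i\<in>A. F i) x = (\<Sum>i\<in>A. E (F i) x)"
  by auto
qed

lemma emeasure_smeas:
 assumes "S : sets borel"
 shows "emeasure (smeas E x) S = ennreal ((norm (E S x))^2)"
proof (rule emeasure_measure_of[OF smeas_def])
 show "countably_additive (sets (smeas E x)) (%S. ennreal ((norm (E S x))^2))"
 proof (rule countably_additiveI)
  fix F :: "nat => real set"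
  assume F: "range F \<subseteq> sets (smeas E x)" "disjoint_family F"
  have "(%N. (norm (\<Sum>i<N. E (F i) x))^2) ----> (norm (E (\<Union>i. F i) x))^2"
   using F by(intro tendsto_intros sigma_additive) auto
  moreover have "(norm (\<Sum>i<N. E (F i) x))^2 = (\<Sum>i<N. (norm (E (F i) x))^2)" for N
   using norm_sq_finite_Un[of "{..<N}" F x] F by(auto simp:disjoint_family_on_def)
  ultimately have "(%i. (norm (E (F i) x))^2) sums (norm (E (\<Union>i. F i) x))^2" by(simp add:sums_def)
  thus "(\<Sum>i. ennreal ((norm (E (F i) x))^2)) = ennreal ((norm (E (\<Union> (range F)) x))^2)"
   by(intro suminf_ennreal_eq) auto
 qed
qed (use assms in \<open>auto simp:positive_def\<close>)

lemma finite_measure_smeas: "finite_measure (smeas E x)"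
 by(rule finite_measureI) (simp add:emeasure_smeas)

lemma measure_smeas: "S : sets borel ==> measure (smeas E x) S = (norm (E S x))^2"
 by(simp add:measure_def emeasure_smeas)

lemma smeas_E:
 assumes [measurable]: "S : sets borel"
 shows "smeas E (E S x) = density (smeas E x) (indicator S)"
proof (rule measure_eqI)
 fix X assume "X : sets (smeas E (E S x))"
 hence [measurable]: "X : sets borel" by simp
 show "emeasure (smeas E (E S x)) X = emeasure (density (smeas E x) (indicator S)) X"
  by(simp add:emeasure_density emeasure_smeas E_Int Int_commute
    nn_integral_indicator indicator_inter_arith[symmetric])
qed simp

lemma
 fixes f :: "real => 'b::{banach, second_countable_topology}"
 assumes [measurable]: "S : sets borel" "f : borel_measurable borel"
 shows integrable_smeas_E: "integrable (smeas E (E S x)) f \<longleftrightarrow> integrable (smeas E x) (%t. indicator S t *\<^sub>R f t)"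
  and integral_smeas_E: "integral\<^sup>L (smeas E (E S x)) f = (\<integral>t. indicator S t *\<^sub>R f t \<partial>smeas E x)"
proof -
 have d: "density (smeas E x) (indicator S) = density (smeas E x) (%t. ennreal (indicator S t))" by(simp add:ennreal_indicator)
 show "integrable (smeas E (E S x)) f \<longleftrightarrow> integrable (smeas E x) (%t. indicator S t *\<^sub>R f t)"
  unfolding smeas_E[OF assms(1)] d by(rule integrable_density) auto
 show "integral\<^sup>L (smeas E (E S x)) f = (\<integral>t. indicator S t *\<^sub>R f t \<partial>smeas E x)"
  unfolding smeas_E[OF assms(1)] d by(rule integral_density) auto
qed

lemma smeas_AE_in:
 assumes [measurable]: "S : sets borel" and "E S x = x"
 shows "AE t in smeas E x. t : S"
proof (rule AE_I)
 show "emeasure (smeas E x) (UNIV - S) = 0" using E_disjoint[of S "UNIV - S" x] assms by(simp add:emeasure_smeas)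
qed (use assms in auto)

lemma bounded_linear_E: "S : sets borel ==> bounded_linear (E S)"
 by(rule bounded_linear_intro[where K=1]) (auto simp:E_simps norm_E_le)

lemma norm_E_Union_tendsto:
 assumes "!!n::nat. F n : sets borel" "incseq F"
 shows "(%n. norm (E (F n) x)) ----> norm (E (\<Union>n. F n) x)"
proof -
 interpret finite_measure "smeas E x" by(rule finite_measure_smeas)
 have "(%n. sqrt (measure (smeas E x) (F n))) ----> sqrt (measure (smeas E x) (\<Union>n. F n))"
  using assms by(intro tendsto_real_sqrt finite_Lim_measure_incseq) auto
 thus ?thesis using assms by(simp add:measure_smeas)
qed

lemma E_tendsto_id: "(%n. E {- real n..real n} x) ----> x"
proof -
 let ?S = "%n. {- real n..real n}"
 have "t : ?S (nat \<lceil>\<bar>t\<bar>\<rceil>)" for t :: real by(simp add:abs_le_iff) linarith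
 hence "(\<Union>n. ?S n) = UNIV" by blast
 hence "(%n. norm (E (?S n) x)) ----> norm x" using norm_E_Union_tendsto[of ?S x] by(simp add:incseq_def)
 from tendsto_diff[OF tendsto_const tendsto_power[OF this, of 2]]
 have "(%n. (norm x)^2 - (norm (E (?S n) x))^2) ----> (norm x)^2 - (norm x)^2" .
 moreover have "(norm (x - E (?S n) x))^2 = (norm x)^2 - (norm (E (?S n) x))^2" for n
 proof -
  have "E (UNIV - ?S n) x = x - E (?S n) x" using E_Un[of "?S n" "UNIV - ?S n" x] by(simp add:algebra_simps)
  thus ?thesis using norm_sq_Un[of "?S n" "UNIV - ?S n" x] by simp
 qed
 ultimately have "(%n. sqrt ((norm (x - E (?S n) x))^2)) ----> sqrt 0" by(intro tendsto_real_sqrt) simp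
 thus ?thesis by(simp add:tendsto_norm_zero_iff LIM_zero_iff norm_minus_commute[of x])
qed

end

section \<open>Spectral measures\<close>

text \<open>
 \<open>T\<close> with domain \<open>D\<close> is the integral of the identity against \<open>E\<close>, in the sense of quadratic forms.
\<close>

locale spectral = pvm E for E :: "real set => 'a::complex_hilbert => 'a" +
 fixes D :: "'a set" and T :: "'a => 'a"
 assumes dom: "D = {x. integrable (smeas E x) (%t. t^2)}"
  and form: "x : D ==> cinner x (T x) = of_real (\<integral>t. t \<partial>smeas E x)"
  and D_add: "x : D ==> y : D ==> x + y : D"
  and D_scale: "x : D ==> c *C x : D"
  and T_add: "x : D ==> y : D ==> T (x + y) = T x + T y"
  and T_scale: "x : D ==> T (c *C x) = c *C T x"
begin

lemma D_minus: "x : D ==> - x : D" and T_minus: "x : D ==> T (- x) = - T x"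
 using D_scale[of x "-1"] T_scale[of x "-1"] by simp_all

lemma D_diff: "x : D ==> y : D ==> x - y : D" and T_diff: "x : D ==> y : D ==> T (x - y) = T x - T y"
 using D_add[of x "- y"] T_add[of x "- y"] D_minus[of y] T_minus[of y] by simp_all

lemma D_E:
 assumes "x : D" and [measurable]: "S : sets borel"
 shows "E S x : D"
proof -
 interpret finite_measure "smeas E x" by(rule finite_measure_smeas)
 have "integrable (smeas E x) (%t. indicator S t *\<^sub>R t^2)" using assms by(intro integrable_mult_indicator) (auto simp:dom)
 thus ?thesis by(simp add:dom integrable_smeas_E)
qed

lemma D_E_bounded:
 assumes [measurable]: "S : sets borel" and "bounded S"
 shows "E S x : D"
proof -
 interpret finite_measure "smeas E x" by(rule finite_measure_smeas)
 obtain b where b: "!!t. t : S ==> \<bar>t\<bar> <= b" and "b > 0" using `bounded S` by(auto simp:bounded_pos)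
 have "integrable (smeas E x) (%t. indicator S t * t^2)" by(rule integrable_const_bound[where B="b^2"])
   (use b `b > 0` in \<open>auto simp:indicator_def abs_le_square_iff[symmetric] intro!:AE_I2\<close>)
 thus ?thesis by(simp add:dom integrable_smeas_E)
qed

lemma integrable_id:
 assumes "x : D" shows "integrable (smeas E x) (%t. t)"
proof -
 interpret finite_measure "smeas E x" by(rule finite_measure_smeas)
 have "integrable (smeas E x) (%t. 1 + t^2)" using assms by(auto simp:dom)
 thus ?thesis
 proof (rule Bochner_Integration.integrable_bound, goal_cases)
  case 2
  have "abs t <= 1 + t^2" for t :: real using sum_squares_bound[of 1 "abs t"] abs_ge_zero[of t] by(simp only: power2_abs) simp
  thus ?case by(intro AE_I2) simp
 qed simp
qed

lemma D_dense:
 assumes "!!x. x : D ==> cinner x y = 0"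
 shows "y = 0"
proof -
 define F where "F = (%n::nat. {t::real. real n <= abs t & abs t < real n + 1})"
 have F: "range F \<subseteq> sets borel" "disjoint_family F" "(\<Union>n. F n) = UNIV"
 proof -
  show "range F \<subseteq> sets borel" by(auto simp:F_def)
  show "disjoint_family F"
  proof -
   have "m = n" if "t : F m" "t : F n" for m n t
   proof -
    have "real m < real n + 1" "real n < real m + 1" using that by(auto simp:F_def)
    thus "m = n" by linarith
   qed
   thus ?thesis by(auto simp:disjoint_family_on_def)
  qed
  show "(\<Union>n. F n) = UNIV"
  proof (intro set_eqI iffI UNIV_I)
   fix t :: real
   have "t : F (nat \<lfloor>\<bar>t\<bar>\<rfloor>)" by(simp add:F_def)
   thus "t : (\<Union>n. F n)" by blast
  qed
 qed
 have "E (F n) y = 0" for n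
 proof -
  have "bounded (F n)" by(rule boundedI[where B="real n + 1"]) (auto simp:F_def)
  moreover have m: "F n : sets borel" using F(1) by auto
  ultimately have "cinner (E (F n) y) y = 0" using assms D_E_bounded by blast
  thus ?thesis using cinner_E_self[OF m, of y] selfadj[OF m] by simp
 qed
 hence "(%N. 0) ----> y" using sigma_additive[OF F(1,2), of y] F(3) by simp
 thus ?thesis by(simp add:LIMSEQ_const_iff)
qed

lemma form_real: "x : D ==> Im (cinner x (T x)) = 0"
 by(simp add:form)

lemma T_symmetric:
 assumes "x : D" "y : D"
 shows "cinner x (T y) = cinner (T x) y"
proof -
 have 1: "Im (cinner x (T y) + cinner y (T x)) = 0"
  using form_real[OF D_add[OF assms]] assms by(simp add:T_add cinner_add_left cinner_add_right form_real)
 have "Im (\<i> * cinner x (T y) - \<i> * cinner y (T x)) = 0"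
  using form_real[OF D_add[OF assms(1) D_scale[OF assms(2), of \<i>]]] assms
  by(simp add:T_add T_scale D_scale cinner_add_left cinner_add_right form_real algebra_simps
    del: Im_i_times)
 with 1 show ?thesis by(subst (2) cinner_commute) (simp add:complex_eq_iff)
qed

lemma form_orth:
 assumes "x : D" "y : D" "S : sets borel" "S' : sets borel" "S \<inter> S' = {}" "E S x = x" "E S' y = y"
 shows "cinner x (T y) = 0"
proof -
 have q: "cinner (x + z) (T (x + z)) = cinner x (T x) + cinner z (T z)"
  if "z : D" "E S' z = z" for z
 proof -
  let ?m = "smeas E (x + z)"
  have sx: "E S (x + z) = x"
  proof -
   have "E S z = 0" using assms `E S' z = z` by(metis E_disjoint Int_commute)
   thus ?thesis using assms by(simp add:E_simps)
  qed
  have sz: "E S' (x + z) = z"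
  proof -
   have "E S' x = 0" using assms by(metis E_disjoint)
   thus ?thesis using assms `E S' z = z` by(simp add:E_simps)
  qed
  have ae: "AE t in ?m. t : S \<union> S'"
   using smeas_AE_in[of "S \<union> S'" "x + z"] E_Un[OF assms(3-5), of "x + z"] sx sz assms(3,4) by simp
  have i: "integrable ?m (%t. indicator S t * t)" "integrable ?m (%t. indicator S' t * t)"
  proof -
   have "integrable (smeas E (E S (x + z))) (%t. t)" unfolding sx by(rule integrable_id[OF assms(1)])
   thus "integrable ?m (%t. indicator S t * t)"
    unfolding integrable_smeas_E[OF assms(3) measurable_ident_sets[OF refl]] real_scaleR_def .
   have "integrable (smeas E (E S' (x + z))) (%t. t)" unfolding sz by(rule integrable_id[OF that(1)])
   thus "integrable ?m (%t. indicator S' t * t)"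
    unfolding integrable_smeas_E[OF assms(4) measurable_ident_sets[OF refl]] real_scaleR_def .
  qed
  have e: "(\<integral>t. t \<partial>smeas E x) = (\<integral>t. indicator S t * t \<partial>?m)"
    "(\<integral>t. t \<partial>smeas E z) = (\<integral>t. indicator S' t * t \<partial>?m)"
   using integral_smeas_E[OF assms(3), of "%t. t" "x + z"] integral_smeas_E[OF assms(4), of "%t. t" "x + z"]
   unfolding sx sz by simp_all
  have "(\<integral>t. t \<partial>?m) = (\<integral>t. indicator S t * t + indicator S' t * t \<partial>?m)"
   by(rule integral_cong_AE) (use assms ae in \<open>auto elim!:eventually_mono simp: indicator_def\<close>)
  also have "... = (\<integral>t. t \<partial>smeas E x) + (\<integral>t. t \<partial>smeas E z)"
   unfolding e using i by(rule Bochner_Integration.integral_add)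
  finally show ?thesis
   unfolding form[OF D_add[OF assms(1) that(1)]] form[OF assms(1)] form[OF that(1)] by(simp only: of_real_add)
 qed
 have 1: "cinner x (T y) + cinner y (T x) = 0"
  using q[OF assms(2,7)] assms by(simp add:T_add cinner_add_left cinner_add_right algebra_simps)
 have "\<i> * (cinner x (T y) - cinner y (T x)) = 0"
  using q[OF D_scale[OF assms(2), of \<i>]] assms
  by(simp add:T_add T_scale D_scale E_simps cinner_add_left cinner_add_right algebra_simps)
 with 1 show ?thesis by(simp add:algebra_simps)
qed

lemma E_T:
 assumes "x : D" and [measurable]: "S : sets borel"
 shows "E S (T x) = T (E S x)"
proof -
 have *: "E S (T y) = T y" if "y : D" "E S y = y" "S : sets borel" for y S
 proof -
  have c: "UNIV - S : sets borel" using that by auto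
  have "E (UNIV - S) (T y) = 0"
  proof (rule D_dense)
   fix z assume "z : D"
   have "cinner (E (UNIV - S) z) (T y) = 0" by(rule form_orth[of _ _ "UNIV - S" S]) (use that c `z : D` D_E idem in auto)
   thus "cinner z (E (UNIV - S) (T y)) = 0" using selfadj[OF c] by simp
  qed
  thus ?thesis using E_Un[of S "UNIV - S" "T y"] that c by simp
 qed
 have "x = E S x + E (UNIV - S) x" using E_Un[of S "UNIV - S" x] by simp
 hence "T x = T (E S x) + T (E (UNIV - S) x)" using T_add D_E assms by(metis sets.compl_sets space_borel)
 moreover have "E S (T (E S x)) = T (E S x)" using assms by(intro *) (auto simp:D_E idem)
 moreover have "E S (T (E (UNIV - S) x)) = 0"
  using *[of "E (UNIV - S) x" "UNIV - S"] assms E_disjoint[of "UNIV - S" S]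
  by(metis D_E Diff_disjoint Int_commute idem sets.compl_sets space_borel)
 ultimately show ?thesis by(simp add:E_simps)
qed

lemma Re_form:
 assumes "z : D"
 shows "Re (cinner z (T z - a *\<^sub>R z)) = (\<integral>t. t - a \<partial>smeas E z)" "integrable (smeas E z) (%t. t - a)"
proof -
 interpret finite_measure "smeas E z" by(rule finite_measure_smeas)
 show "Re (cinner z (T z - a *\<^sub>R z)) = (\<integral>t. t - a \<partial>smeas E z)"
  using form[OF assms] Re_cinner[of z "T z"] integrable_id[OF assms]
  by(simp add:inner_diff_right power2_norm_eq_inner measure_smeas)
 show "integrable (smeas E z) (%t. t - a)" using integrable_id[OF assms] by simp
qed

lemma norm_T_shift_ge:
 assumes [measurable]: "S : sets borel" and S: "!!t. t : S ==> a + m <= t" and z: "E S z = z" "z : D"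
 shows "m * norm z <= norm (T z - a *\<^sub>R z)"
proof -
 interpret finite_measure "smeas E z" by(rule finite_measure_smeas)
 have "m * (norm z)^2 = (\<integral>t. m \<partial>smeas E z)" by(simp add:measure_smeas)
 also have "... <= Re (cinner z (T z - a *\<^sub>R z))"
  unfolding Re_form[OF z(2)] using smeas_AE_in[OF assms(1) z(1)] S Re_form(2)[OF z(2)]
  by(intro integral_mono_AE) (auto elim!:eventually_mono simp: algebra_simps)
 also have "... <= norm z * norm (T z - a *\<^sub>R z)" using cmod_cinner_le complex_Re_le_cmod order_trans by blast
 finally show ?thesis by(cases "z = 0") (auto simp:power2_eq_square)
qed

lemma norm_T_shift_le:
 assumes [measurable]: "S : sets borel" and S: "S \<subseteq> {a - dl..a + dl}" and y: "E S y = y" and "dl >= 0"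
 shows "norm (T y - a *\<^sub>R y) <= dl * norm y"
proof -
 have "bounded S" using S bounded_subset bounded_closed_interval by blast
 hence D: "z : D" if "E S z = z" for z using D_E_bounded[of S z] that by simp
 have q: "abs (Re (cinner z (T z - a *\<^sub>R z))) <= dl * (norm z)^2" if z: "E S z = z" for z
 proof -
  interpret finite_measure "smeas E z" by(rule finite_measure_smeas)
  have "abs (Re (cinner z (T z - a *\<^sub>R z))) <= (\<integral>t. abs (t - a) \<partial>smeas E z)"
   unfolding Re_form[OF D[OF z]] by(rule integral_abs_bound)
  also have "... <= (\<integral>t. dl \<partial>smeas E z)"
   using Re_form(2)[OF D[OF z]] smeas_AE_in[OF assms(1) z] S by(intro integral_mono_AE) (auto elim!:eventually_mono dest!:subsetD)
  finally show ?thesis by(simp add:measure_smeas mult.commute)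
 qed
 let ?B = "%z. T z - a *\<^sub>R z"
 define w where "w = ?B y"
 have w: "E S w = w" using E_T[OF D[OF y], of S] y by(simp add:w_def E_simps)
 show ?thesis
 proof (cases "w = 0")
  case True
  thus ?thesis using `dl >= 0` by(simp add:w_def)
 next
  case False
  define u where "u = (norm y / norm w) *\<^sub>R w"
  have u: "E S u = u" "norm u = norm y" using w False by(simp_all add: u_def E_simps)
  have sym: "(u \<bullet> ?B y) = (y \<bullet> ?B u)"
   using arg_cong[OF T_symmetric[OF D[OF u(1)] D[OF y]], of Re] by(simp add:inner_diff_right inner_commute)
  have lin: "?B (u + y) = ?B u + ?B y" "?B (u - y) = ?B u - ?B y"
   using D[OF u(1)] D[OF y] by(simp_all add: T_add T_diff algebra_simps)
  have "4 * (u \<bullet> ?B y) = ((u + y) \<bullet> ?B (u + y)) - ((u - y) \<bullet> ?B (u - y))"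
  proof -
   have "4 * (u \<bullet> b) = ((u + y) \<bullet> (b' + b)) - ((u - y) \<bullet> (b' - b))" if "u \<bullet> b = y \<bullet> b'" for b b'
    using that by(simp add:inner_add_left inner_add_right inner_diff_left inner_diff_right)
   from this[OF sym] show ?thesis by(simp only: lin)
  qed
  also have "... <= dl * (norm (u + y))^2 + dl * (norm (u - y))^2" using q[of "u + y"] q[of "u - y"] u y by(simp add:E_simps)
  also have "... = dl * (4 * (norm y)^2)"
  proof -
   have "(norm (u + y))^2 + (norm (u - y))^2 = 2 * (norm u)^2 + 2 * (norm y)^2"
    by(simp add:power2_norm_eq_inner inner_add_left inner_add_right inner_diff_left inner_diff_right inner_commute)
   thus ?thesis unfolding distrib_left[symmetric] using u(2) by simp
  qed
  finally have "u \<bullet> w <= dl * (norm y)^2" by(simp add:w_def)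
  moreover have "u \<bullet> w = norm y * norm w" using False by(simp add:u_def power2_norm_eq_inner[symmetric] power2_eq_square)
  ultimately show ?thesis
   by(cases "y = 0") (auto simp:power2_eq_square w_def[symmetric], use w_def T_scale[of y 0] D[OF y] False in auto)
 qed
qed

end

text \<open>
 The spectral measure is unique.  On the range of \<open>E {a..b}\<close> the powers of \<open>T\<close>, shifted to the centre
 of the interval, grow no faster than its half-length, which rules out a component in \<open>F {t..}\<close>
 for \<open>b < t\<close>.
\<close>

lemma spectral_separation:
 assumes "spectral E D T" "spectral F D T" "b < t"
 shows "F {t..} (E {a..b} x) = 0"
proof (cases "a <= b")
 case True
 interpret E: spectral E D T by fact
 interpret F: spectral F D T by fact
 define c L m where "c = (a + b) / 2" and "L = (b - a) / 2" and "m = t - c"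
 have L: "0 <= L" "L < m" and J: "{a..b} = {c - L..c + L}" using True assms(3) by(auto simp:c_def L_def m_def field_simps)
 define w where "w = (%n. ((%y. T y - c *\<^sub>R y) ^^ n) (E {a..b} x))"
 have w: "E {a..b} (w n) = w n & norm (w n) <= L ^ n * norm (w 0) & w n : D" for n
 proof (induction n)
  case 0
  show ?case using E.D_E_bounded[of "{a..b}"] by(simp add:w_def E.idem)
 next
  case (Suc n)
  have "E {a..b} (w (Suc n)) = w (Suc n)" using Suc E.E_T[of "w n" "{a..b}"] by(simp add:w_def E.E_simps)
  moreover have "norm (w (Suc n)) <= L * norm (w n)" using Suc E.norm_T_shift_le[of "{a..b}" c L "w n"] L J by(simp add:w_def)
  hence "norm (w (Suc n)) <= L ^ Suc n * norm (w 0)" using Suc mult_left_mono[of "norm (w n)" "L ^ n * norm (w 0)" L] L by simp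
  ultimately show ?case using E.D_E_bounded[of "{a..b}" "w (Suc n)"] by simp
 qed
 have F: "m ^ n * norm (F {t..} (w 0)) <= norm (F {t..} (w n))" for n
 proof (induction n)
  case (Suc n)
  have "F {t..} (w n) : D" using w F.D_E by simp
  hence "m * norm (F {t..} (w n)) <= norm (T (F {t..} (w n)) - c *\<^sub>R F {t..} (w n))"
   by(intro F.norm_T_shift_ge[of "{t..}"]) (auto simp:m_def F.idem)
  also have "... = norm (F {t..} (w (Suc n)))" using w[of n] F.E_T[of "w n" "{t..}"] by(simp add:w_def F.E_simps)
  finally show ?case using order_trans[OF mult_left_mono[OF Suc, of m]] L by(simp add:mult.assoc)
 qed simp
 have "norm (F {t..} (w 0)) <= (L / m) ^ n * norm (w 0)" for n
 proof -
  have "m ^ n * norm (F {t..} (w 0)) <= L ^ n * norm (w 0)" using F[of n] F.norm_E_le[of "{t..}" "w n"] w[of n] by simp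
  thus ?thesis using L by(simp add:power_divide field_simps)
 qed
 moreover have "(%n. (L / m) ^ n * norm (w 0)) ----> 0 * norm (w 0)"
  using L by(intro tendsto_mult tendsto_const LIMSEQ_realpow_zero) auto
 ultimately have "norm (F {t..} (w 0)) <= 0 * norm (w 0)" by(intro LIMSEQ_le_const) auto
 thus ?thesis by(simp add:w_def)
qed (use assms in \<open>simp add:spectral_def pvm.E_empty pvm.E_simps\<close>)

lemma spectral_halfline:
 assumes sp: "spectral E D T" "spectral F D T"
 shows "F {..b} (E {..b} x) = E {..b} x"
proof -
 interpret E: spectral E D T by fact
 interpret F: spectral F D T by fact
 have 1: "F {t..} (E {..b} x) = 0" if "b < t" for t
 proof -
  have "(%n. F {t..} (E {- real n..real n} (E {..b} x))) ----> F {t..} (E {..b} x)"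
   by(intro bounded_linear.tendsto[OF F.bounded_linear_E] E.E_tendsto_id) simp
  moreover have "F {t..} (E {- real n..real n} (E {..b} x)) = 0" for n
  proof -
   have "{..b} \<inter> {- real n..real n} = {- real n..min b (real n)}" by auto
   thus ?thesis using spectral_separation[OF sp, of "min b (real n)" t] that by(simp add:E.E_Int)
  qed
  ultimately show ?thesis by(simp add:LIMSEQ_const_iff)
 qed
 have "(%n. norm (F {b + 1 / real (Suc n)..} (E {..b} x))) ----> norm (F (\<Union>n. {b + 1 / real (Suc n)..}) (E {..b} x))"
  by(rule F.norm_E_Union_tendsto) (auto simp:incseq_def frac_le intro:order_trans[rotated])
 moreover have "(\<Union>n. {b + 1 / real (Suc n)..}) = {b<..}"
 proof (intro set_eqI iffI)
  fix t assume "t : {b<..}"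
  then obtain n where "inverse (real (Suc n)) < t - b" using reals_Archimedean[of "t - b"] by auto
  thus "t : (\<Union>n. {b + 1 / real (Suc n)..})" by(auto intro!:exI[of _ n] simp: inverse_eq_divide)
 qed (auto intro:less_le_trans[rotated])
 ultimately have "F {b<..} (E {..b} x) = 0" by(simp add:1 LIMSEQ_const_iff)
 moreover have "{..b} \<union> {b<..} = UNIV" by auto
 ultimately show ?thesis using F.E_Un[of "{..b}" "{b<..}" "E {..b} x"] by(simp add:disjoint_iff)
qed

lemma spectral_unique:
 assumes sp: "spectral E D T" "spectral F D T"
 shows "smeas E x = smeas F x"
proof -
 interpret E: spectral E D T by fact
 interpret F: spectral F D T by fact
 interpret mE: finite_measure "smeas E x" by(rule E.finite_measure_smeas)
 interpret mF: finite_measure "smeas F x" by(rule F.finite_measure_smeas)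
 have "E {..b} x = F {..b} x" for b
 proof -
  have "cinner z (E {..b} x - F {..b} x) = 0" for z
  proof -
   have "cinner z (E {..b} x) = cinner z (F {..b} (E {..b} x))" by(simp add:spectral_halfline[OF sp])
   also have "... = cinner (E {..b} (F {..b} z)) x" by(simp add:F.selfadj E.selfadj)
   also have "... = cinner z (F {..b} x)" by(simp add:spectral_halfline[OF sp(2,1)] F.selfadj)
   finally show ?thesis by(simp add:cinner_diff_right)
  qed
  thus ?thesis using cinner_eq_zero_imp by(metis right_minus_eq)
 qed
 hence "cdf (smeas E x) = cdf (smeas F x)" by(simp add:fun_eq_iff cdf_def E.measure_smeas F.measure_smeas)
 thus ?thesis
  by(intro cdf_unique' finite_borel_measure.intro finite_borel_measure_axioms.intro mE.finite_measure_axioms mF.finite_measure_axioms) auto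
qed

section \<open>Approximate eigenvectors and atomic projections\<close>

lemma partition_grid:
 fixes S :: "real set"
 assumes [measurable]: "S : sets borel" and b: "!!t. t : S ==> \<bar>t\<bar> <= b" and "dl > 0"
 obtains N :: int and J where "real_of_int N * dl <= b + 2 * dl"
  "!!i. J i : sets borel" "!!i. J i \<subseteq> S" "S = (\<Union>i\<in>{-N..N}. J i)" "disjoint_family_on J {-N..N}"
  "!!i s t. s : J i ==> t : J i ==> \<bar>s - t\<bar> <= dl"
proof -
 define N where "N = \<lceil>b / dl\<rceil> + 1"
 define J where "J = (%i. {t : S. \<lfloor>t / dl\<rfloor> = i})"
 have 1: "S = (\<Union>i\<in>{-N..N}. J i)"
 proof -
  have "\<lfloor>t / dl\<rfloor> : {-N..N}" if "t : S" for t
  proof -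
   have "abs (t / dl) <= b / dl" using b[OF that] `dl > 0` by(simp add:divide_right_mono)
   thus ?thesis unfolding N_def abs_le_iff by simp linarith
  qed
  thus ?thesis by(auto simp:J_def)
 qed
 have 2: "abs (x - y) <= dl" if "x : J i" "y : J i" for i x y
 proof -
  have "abs (x / dl - y / dl) <= 1" using that unfolding J_def by simp linarith
  thus ?thesis using `dl > 0` by(simp add:diff_divide_distrib[symmetric])
 qed
 have "real_of_int N <= b / dl + 2" unfolding N_def by linarith
 hence "real_of_int N * dl <= b + 2 * dl" using `dl > 0` by(simp add:field_simps)
 thus thesis by(rule that[OF _ _ _ 1 _ 2]) (auto simp:J_def disjoint_family_on_def)
qed

text \<open>
 If every approximate eigenvector with approximate eigenvalue in \<open>S\<close> is small in direction \<open>e\<close>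
 (up to its size in the directions \<open>g i\<close>), then the spectral projection of \<open>S\<close> nearly kills \<open>e\<close>.
\<close>

lemma (in spectral) norm_E_approx_eigen:
 assumes S[measurable]: "S : sets borel" and b: "!!t. t : S ==> \<bar>t\<bar> <= b"
  and U: "finite U" "!!i. i : U ==> norm (g i) <= 1" and "L >= 0" "c >= 0"
  and est: "!!kp phi. kp : S ==> phi : D ==>
   cmod (cinner e phi) <= L * norm (T phi - kp *\<^sub>R phi) + c * (\<Sum>i\<in>U. cmod (cinner (g i) phi))"
 shows "(norm (E S e))^2 <= 2 * c^2 * (real (card U))^2"
proof -
 define u where "u = real (card U)"
 define B where "B = max b 0"
 have b: "!!t. t : S ==> \<bar>t\<bar> <= B" using b by(force simp: B_def)
 have *: "(norm (E S e))^2 <= 2 * c^2 * u^2 + 2 * L^2 * (2 * B + 5) * dl" if "dl > 0" "dl <= 1" for dl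
 proof -
  obtain N :: int and J where N: "real_of_int N * dl <= B + 2 * dl" and J[measurable]: "!!i. J i : sets borel" and JS: "!!i. J i \<subseteq> S"
   and SJ: "S = (\<Union>i\<in>{-N..N}. J i)" and disj: "disjoint_family_on J {-N..N}"
   and small: "!!i s t. s : J i ==> t : J i ==> \<bar>s - t\<bar> <= dl"
   by(rule partition_grid[OF S b `dl > 0`]) blast+
  have e: "(norm (E (J i) e))^2 <= 2 * (L * dl)^2 + 2 * (c^2 * (u * (\<Sum>k\<in>U. (norm (E (J i) (g k)))^2)))" for i
  proof (cases "J i = {}")
   case True
   thus ?thesis by(simp add:u_def sum_nonneg)
  next
   case False
   then obtain kp where kp: "kp : J i" by blast
   let ?y = "E (J i) e"
   have "bounded (J i)" using JS[of i] b by(intro boundedI[where B=B]) auto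
   hence "?y : D" by(intro D_E_bounded) auto
   have t: "norm (T ?y - kp *\<^sub>R ?y) <= dl * norm ?y" by(rule norm_T_shift_le[of "J i"])
     (use small[OF _ kp] `dl > 0` idem in \<open>auto simp:abs_le_iff algebra_simps\<close>)
   have "(norm ?y)^2 = cmod (cinner e ?y)" unfolding cinner_E_self[OF J] by(simp add:norm_power)
   also have "... <= L * norm (T ?y - kp *\<^sub>R ?y) + c * (\<Sum>k\<in>U. cmod (cinner (g k) ?y))"
    using est kp JS `?y : D` by blast
   also have "... <= L * (dl * norm ?y) + c * (\<Sum>k\<in>U. norm (E (J i) (g k)) * norm ?y)"
   proof (intro add_mono mult_left_mono t sum_mono `L >= 0` `c >= 0`)
    fix k
    have "cinner (g k) ?y = cinner (E (J i) (g k)) ?y" using selfadj[OF J, of "g k" i ?y] idem[OF J] by simp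
    thus "cmod (cinner (g k) ?y) <= norm (E (J i) (g k)) * norm ?y" by(simp add:cmod_cinner_le)
   qed
   also have "... = (L * dl + c * (\<Sum>k\<in>U. norm (E (J i) (g k)))) * norm ?y"
    by(simp add:algebra_simps sum_distrib_left sum_distrib_right)
   finally have "norm ?y <= L * dl + c * (\<Sum>k\<in>U. norm (E (J i) (g k)))"
    using `L >= 0` `c >= 0` `dl > 0` by(cases "norm ?y = 0") (auto simp:power2_eq_square sum_nonneg)
   hence "(norm ?y)^2 <= (L * dl + c * (\<Sum>k\<in>U. norm (E (J i) (g k))))^2" by(rule power_mono) simp
   also have "... <= 2 * (L * dl)^2 + 2 * (c * (\<Sum>k\<in>U. norm (E (J i) (g k))))^2"
    using norm_add_sq_le[of "L * dl" "c * (\<Sum>k\<in>U. norm (E (J i) (g k)))"] by simp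
   also have "(c * (\<Sum>k\<in>U. norm (E (J i) (g k))))^2 <= c^2 * (u * (\<Sum>k\<in>U. (norm (E (J i) (g k)))^2))"
   proof -
    have "(\<Sum>k\<in>U. norm (E (J i) (g k)) * 1)^2 <= (\<Sum>k\<in>U. (norm (E (J i) (g k)))^2) * (\<Sum>k\<in>U. 1^2)"
     by(rule Cauchy_Schwarz_ineq_sum)
    thus ?thesis by(simp add:power_mult_distrib u_def mult.commute mult_left_mono)
   qed
   finally show ?thesis by simp
  qed
  have "(norm (E S e))^2 = (\<Sum>i\<in>{-N..N}. (norm (E (J i) e))^2)" by(subst SJ, rule norm_sq_finite_Un) (use disj in auto)
  also have "... <= (\<Sum>i\<in>{-N..N}. 2 * (L * dl)^2 + 2 * (c^2 * (u * (\<Sum>k\<in>U. (norm (E (J i) (g k)))^2))))"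
   by(intro sum_mono e)
  also have "... = 2 * (L * dl)^2 * real (card {-N..N}) + 2 * (c^2 * (u * (\<Sum>k\<in>U. \<Sum>i\<in>{-N..N}. (norm (E (J i) (g k)))^2)))"
   by(simp add:sum.distrib sum_distrib_left[symmetric] sum.swap[of _ U])
  finally have m: "(norm (E S e))^2 <= ..." .
  have P: "(\<Sum>k\<in>U. \<Sum>i\<in>{-N..N}. (norm (E (J i) (g k)))^2) <= u"
  proof -
   have "(\<Sum>i\<in>{-N..N}. (norm (E (J i) (g k)))^2) <= 1" if "k : U" for k
   proof -
    have "(\<Sum>i\<in>{-N..N}. (norm (E (J i) (g k)))^2) = (norm (E S (g k)))^2"
     using norm_sq_finite_Un(1)[OF finite_atLeastAtMost_int J disj, of "g k"] unfolding SJ[symmetric] by simp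
    also have "... <= 1^2" using norm_E_le[OF S, of "g k"] U(2)[OF that] by(intro power_mono) auto
    finally show ?thesis by simp
   qed
   hence "(\<Sum>k\<in>U. \<Sum>i\<in>{-N..N}. (norm (E (J i) (g k)))^2) <= (\<Sum>k\<in>U. 1)" by(rule sum_mono)
   thus ?thesis by(simp add:u_def)
  qed
  have Q: "2 * (L * dl)^2 * real (card {-N..N}) <= 2 * L^2 * (2 * B + 5) * dl"
  proof -
   have "B >= 0" by(simp add:B_def)
   have "real (card {-N..N}) * dl <= 2 * B + 5"
   proof (cases "N >= 0")
    case True
    hence "real (card {-N..N}) * dl = 2 * (real_of_int N * dl) + dl" by(simp add:algebra_simps)
    thus ?thesis using N `dl <= 1` by linarith
   next
    case False
    thus ?thesis using `B >= 0` by simp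
   qed
   hence "(2 * L^2 * dl) * (real (card {-N..N}) * dl) <= (2 * L^2 * dl) * (2 * B + 5)"
    using `dl > 0` by(intro mult_left_mono) auto
   thus ?thesis by(simp add:power2_eq_square algebra_simps)
  qed
  have "c^2 * (u * (\<Sum>k\<in>U. \<Sum>i\<in>{-N..N}. (norm (E (J i) (g k)))^2)) <= c^2 * (u * u)"
   using P by(intro mult_left_mono) (auto simp:u_def)
  also have "... = c^2 * u^2" by(simp add:power2_eq_square)
  finally show ?thesis using m Q by linarith
 qed
 show ?thesis
 proof (rule field_le_epsilon)
  fix r :: real assume "r > 0"
  define K where "K = 2 * L^2 * (2 * B + 5) + 1"
  have "K > 0" by(simp add:K_def B_def add_nonneg_pos)
  define dl where "dl = min 1 (r / K)"
  have "dl > 0" "dl <= 1" using `r > 0` `K > 0` by(auto simp:dl_def)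
  have "2 * L^2 * (2 * B + 5) * dl <= K * dl" using `dl > 0` by(intro mult_right_mono) (auto simp:K_def)
  also have "... <= K * (r / K)" using `K > 0` by(intro mult_left_mono) (auto simp:dl_def)
  also have "... = r" using `K > 0` by simp
  finally show "(norm (E S e))^2 <= 2 * c^2 * (real (card U))^2 + r" using *[OF `dl > 0` `dl <= 1`] by(simp add:u_def)
 qed
qed

text \<open>A spectral projection of finite trace has finite rank, so it is carried by
 eigenvalues.\<close>

lemma (in pvm) finite_trace_atomic:
 fixes g :: "'i::countable => 'a"
 assumes Z[measurable]: "Z : sets borel"
  and parseval: "!!x. (\<integral>\<^sup>+i. ennreal ((cmod (cinner (g i) x))^2) \<partial>count_space UNIV) = ennreal ((norm x)^2)"
  and trace: "(\<integral>\<^sup>+i. ennreal ((norm (E Z (g i)))^2) \<partial>count_space UNIV) < \<infinity>"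
 shows "\<exists>X. countable X & (\<forall>x. E (Z - X) x = 0)"
proof -
 define X where "X = (\<Union>i. {s. measure (smeas E (g i)) {s} ~= 0})"
 have "countable X" unfolding X_def by(intro countable_UN finite_measure.countable_support finite_measure_smeas) auto
 have [measurable]: "X : sets borel" using `countable X` by(rule sets.countable[rotated]) auto
 define Z' where "Z' = Z - X"
 have [measurable]: "Z' : sets borel" by(simp add:Z'_def)
 have tot: "x = 0" if "!!i. cinner (g i) x = 0" for x using parseval[of x] that by(simp add:ennreal_eq_0_iff)
 define tt where "tt = (%S. \<integral>\<^sup>+i. emeasure (smeas E (g i)) S \<partial>count_space UNIV)"
 have ge1: "tt S >= 1" if [measurable]: "S : sets borel" and "E S x ~= 0" for S x
 proof -
  define y where "y = E S x /\<^sub>R norm (E S x)"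
  have y: "norm y = 1" "E S y = y" using that by(simp_all add: y_def E_simps idem)
  have "1 = (\<integral>\<^sup>+i. ennreal ((cmod (cinner (g i) y))^2) \<partial>count_space UNIV)" using y by(simp add:parseval)
  also have "... <= tt S"
   unfolding tt_def
  proof (rule nn_integral_mono)
   fix i
   have "cinner (g i) y = cinner (E S (g i)) y" using selfadj[of S "g i" y] y by simp
   hence "cmod (cinner (g i) y) <= norm (E S (g i))" using cmod_cinner_le[of "E S (g i)" y] y by simp
   thus "ennreal ((cmod (cinner (g i) y))^2) <= emeasure (smeas E (g i)) S" by(simp add:emeasure_smeas ennreal_leI power_mono)
  qed
  finally show ?thesis .
 qed
 have tau_mono: "tt S <= tt S'" if "S \<subseteq> S'" "S' : sets borel" for S S'
  unfolding tt_def using that by(intro nn_integral_mono emeasure_mono) auto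
 define nn where "nn = measure_of UNIV (sets borel) (%S. tt (Z' \<inter> S))"
 have sets_nu[simp]: "sets nn = sets borel" "space nn = UNIV"
  unfolding nn_def using sets.sigma_sets_eq[of "borel :: real measure"] by auto
 have em: "emeasure nn S = tt (Z' \<inter> S)" if "S : sets borel" for S
 proof (rule emeasure_measure_of[OF nn_def])
  show "countably_additive (sets nn) (%S. tt (Z' \<inter> S))"
  proof (rule countably_additiveI)
   fix F :: "nat => real set" assume F: "range F \<subseteq> sets nn" "disjoint_family F"
   have "(\<Sum>n. emeasure (smeas E (g i)) (Z' \<inter> F n)) = emeasure (smeas E (g i)) (\<Union>n. Z' \<inter> F n)" for i
    by(rule suminf_emeasure) (use F in \<open>auto simp:disjoint_family_on_def\<close>)
   thus "(\<Sum>n. tt (Z' \<inter> F n)) = tt (Z' \<inter> \<Union> (range F))"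
    unfolding tt_def by(subst nn_integral_suminf[symmetric]) auto
  qed
 qed (use that in \<open>auto simp:positive_def tt_def\<close>)
 have fin: "tt Z' < \<infinity>" using tau_mono[of Z' Z] trace by(auto simp:tt_def Z'_def emeasure_smeas intro:le_less_trans)
 have "finite_measure nn" by(rule finite_measureI) (use fin in \<open>simp add:em\<close>)
 then interpret finite_borel_measure nn by(simp add:finite_borel_measure_def finite_borel_measure_axioms_def)
 have "isCont (cdf nn) t" for t
 proof -
  have "emeasure (smeas E (g i)) (Z' \<inter> {t}) = 0" for i
   using finite_measure.emeasure_eq_measure[OF finite_measure_smeas, of "g i" "{t}"] by(cases "t : Z'") (auto simp:Z'_def X_def)
  thus ?thesis by(simp add:isCont_cdf measure_def em tt_def)
 qed
 \<comment> \<open>The values of \<open>nn\<close> avoid the interval between zero and one.\<close>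
 have gap: "tt S = 0 \<or> tt S >= 1" if "S : sets borel" for S
  using ge1[OF that] that by(cases "\<exists>x. E S x ~= 0") (auto simp:tt_def emeasure_smeas)
 have "E Z' x = 0" for x
 proof (rule ccontr)
  assume "E Z' x ~= 0"
  hence "1 <= ennreal (measure nn UNIV)" using ge1[of Z' x] by(simp add:emeasure_eq_measure[symmetric] em)
  hence "1 <= measure nn UNIV" by simp
  hence "\<forall>\<^sub>F t in at_bot. cdf nn t < 1/2" "\<forall>\<^sub>F t in at_top. cdf nn t > 1/2"
   using order_tendstoD(2)[OF cdf_lim_at_bot, of "1/2"] order_tendstoD(1)[OF cdf_lim_at_top, of "1/2"] by simp_all
  then obtain t1 t2 where t: "!!t. t <= t1 ==> cdf nn t < 1/2" "!!t. t >= t2 ==> 1/2 < cdf nn t"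
   by(auto simp:eventually_at_bot_linorder eventually_at_top_linorder)
  have "\<exists>t\<ge>t1. t <= max t1 t2 & cdf nn t = 1/2"
   by(rule IVT) (use t(1)[of t1] t(2)[of "max t1 t2"] `!!t. isCont _ t` in \<open>auto intro:less_imp_le\<close>)
  then obtain t where "measure nn {..t} = 1/2" by(auto simp:cdf_def)
  hence "tt (Z' \<inter> {..t}) = ennreal (1/2)" using em[of "{..t}"] by(metis atMost_borel emeasure_eq_measure)
  hence "ennreal (1/2) = 0 \<or> ennreal 1 <= ennreal (1/2)" using gap[of "Z' \<inter> {..t}"] by simp
  thus False by(subst (asm) ennreal_le_iff) auto
 qed
 thus ?thesis using `countable X` unfolding Z'_def by blast
qed

section \<open>The exponential on a spectral subspace\<close>

text \<open>The compression of \<open>T\<close> to a spectral subspace is a bounded operator.\<close>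

definition (in spectral) compress :: "real set => 'a => 'a" where
 "compress I x = E I (T (E I x))"

context spectral
begin

context
 fixes I :: "real set" and c :: real
 assumes I[measurable]: "I : sets borel" and Ic: "I \<subseteq> {-c..c}" and c: "c >= 0"
begin

lemma E_I_dom: "E I x : D"
 by(intro D_E_bounded I bounded_subset[OF bounded_closed_interval Ic])

lemma norm_compress_le: "norm (compress I x) <= c * norm x"
proof -
 have "norm (compress I x) <= norm (T (E I x) - 0 *\<^sub>R E I x)" using norm_E_le by(simp add:compress_def)
 also have "... <= c * norm (E I x)" by(rule norm_T_shift_le[of I]) (use Ic c in \<open>auto simp:idem\<close>)
 also have "... <= c * norm x" using c by(simp add:mult_left_mono norm_E_le)
 finally show ?thesis .
qed

lemma norm_compress_pow_le: "norm ((compress I ^^ j) x) <= c ^ j * norm x"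
proof (induction j)
 case (Suc j)
 have "norm ((compress I ^^ Suc j) x) <= c * norm ((compress I ^^ j) x)" by(simp add:norm_compress_le)
 also have "... <= c * (c ^ j * norm x)" using Suc c by(intro mult_left_mono) auto
 finally show ?case by simp
qed simp

lemma compress_commute:
 assumes [measurable]: "S : sets borel"
 shows "E S (compress I x) = compress I (E S x)"
proof -
 have "E S (compress I x) = E I (E S (T (E I x)))" by(simp add:compress_def E_Int Int_commute)
 also have "... = E I (T (E S (E I x)))" by(simp add:E_T E_I_dom)
 also have "E S (E I x) = E I (E S x)" by(simp add:E_Int Int_commute)
 finally show ?thesis by(simp add:compress_def)
qed

lemma compress_pow_commute:
 assumes "S : sets borel"
 shows "E S ((compress I ^^ j) x) = (compress I ^^ j) (E S x)"
 by(induction j) (simp_all add: compress_commute assms)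

lemma compress_pow_range: "E I ((compress I ^^ Suc j) x) = (compress I ^^ Suc j) x"
 by(simp add:compress_def idem)

lemma compress_pow_symmetric: "cinner ((compress I ^^ i) x) ((compress I ^^ j) y) = cinner x ((compress I ^^ (i + j)) y)"
proof (induction i arbitrary: j)
 case (Suc i)
 have "cinner (compress I x) y = cinner x (compress I y)" for x y
  using T_symmetric[OF E_I_dom E_I_dom] by(simp add:compress_def selfadj[OF I])
 thus ?case using Suc[of "Suc j"] by simp
qed simp

text \<open>The off-diagonal part of the exponential of the compression, as a sesquilinear form.\<close>

definition expform :: "complex => 'a => 'a => complex" where
 "expform z x y = (\<Sum>j. (z ^ Suc j / fact (Suc j)) * cinner x ((compress I ^^ Suc j) y))"

lemma expform_summable:
 "summable (%j. (z ^ j / fact j) * cinner x ((compress I ^^ j) y))"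
proof (rule summable_comparison_test')
 show "summable (%j. norm x * norm y * ((cmod z * c) ^ j / fact j))"
  using summable_exp[of "cmod z * c"] by(intro summable_mult) (simp add:field_simps)
 fix j
 have "cmod (cinner x ((compress I ^^ j) y)) <= norm x * (c ^ j * norm y)"
  using cmod_cinner_le norm_compress_pow_le by(meson mult_left_mono norm_ge_zero order_trans)
 hence "cmod (z ^ j / fact j) * cmod (cinner x ((compress I ^^ j) y)) <= cmod (z ^ j / fact j) * (norm x * (c ^ j * norm y))"
  by(rule mult_left_mono) simp
 thus "norm ((z ^ j / fact j) * cinner x ((compress I ^^ j) y)) <= norm x * norm y * ((cmod z * c) ^ j / fact j)"
  by(simp add:norm_mult norm_divide norm_power power_mult_distrib algebra_simps)
qed

lemma expform_eq: "(\<Sum>j. (z ^ j / fact j) * cinner x ((compress I ^^ j) y)) = cinner x y + expform z x y"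
 using suminf_split_head[OF expform_summable[of z x y]] by(simp add:expform_def algebra_simps)

lemma expform_summable_Suc:
 "summable (%j. (z ^ Suc j / fact (Suc j)) * cinner x ((compress I ^^ Suc j) y))"
 using expform_summable[of z x y] by(subst summable_Suc_iff)

lemma expform_add_left: "expform z (x + x') y = expform z x y + expform z x' y"
 unfolding expform_def
 by(subst suminf_add[OF expform_summable_Suc expform_summable_Suc]) (simp only: cinner_add_left distrib_left)

text \<open>
 The exponential of \<open>\<i>\<close> times the compression is isometric: the squared norms of the partial sums of
 its series are Cauchy products up to a remainder that vanishes as it does for the scalar exponential.
\<close>

lemma expsum_norm_tendsto:
 fixes t :: real
 defines "P \<equiv> %N y. \<Sum>j<N. ((\<i> * of_real t) ^ j / fact j) *C (compress I ^^ j) y"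
 shows "(%N. (norm (P N y))^2) ----> (norm y)^2"
proof -
 define a where "a = (%j. (\<i> * of_real t) ^ j /\<^sub>R fact j :: complex)"
 define m where "m = (%j. cinner y ((compress I ^^ j) y))"
 define f where "f = (%(i, j). cnj (a i) * a j * m (i + j))"
 define G where "G = (%x n. x ^ n /\<^sub>R fact n :: real)"
 define A where "A = abs t * c"
 define Q R where "Q = (%N::nat. {..<N} \<times> {..<N})" and "R = (%N::nat. {(i::nat, j). i + j < N})"
 have sub: "R N \<subseteq> Q N" "finite (Q N)" for N by(auto simp:R_def Q_def)
 have QP: "of_real ((norm (P N y))^2) = sum f (Q N)" for N
 proof -
  have "of_real ((norm (P N y))^2) = cinner (P N y) (P N y)" by(simp add:cinner_self)
  also have "... = (\<Sum>i<N. \<Sum>j<N. f (i, j))"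
  proof -
   have "(\<i> * of_real t) ^ j / fact j = a j" for j by(simp add:a_def scaleR_conv_of_real divide_inverse mult.commute)
   thus ?thesis
    unfolding P_def cinner_sum_left
    unfolding cinner_sum_right cinner_scaleC_left cinner_scaleC_right compress_pow_symmetric by(simp add:f_def m_def mult_ac)
  qed
  finally show ?thesis by(simp add:Q_def sum.cartesian_product)
 qed
 have tri: "sum f (R N) = of_real ((norm y)^2)" if "N > 0" for N
 proof -
  have "sum f (R N) = (\<Sum>k<N. \<Sum>i\<le>k. f (i, k - i))"
   using sum.triangle_reindex[of "%i j. f (i, j)" N] by(simp add:R_def)
  also have "... = (\<Sum>k<N. m k * (\<Sum>i\<le>k. ((- (\<i> * of_real t)) ^ i /\<^sub>R fact i) * a (k - i)))"
   by(simp add:f_def a_def sum_distrib_left mult_ac)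
  also have "... = (\<Sum>k<N. m k * (0 ^ k /\<^sub>R fact k))"
   unfolding a_def exp_series_add_commuting[of "- (\<i> * of_real t)" "\<i> * of_real t", symmetric, OF mult.commute] by simp
  also have "... = m 0" using that by(subst sum.remove[of _ 0]) (auto intro!:sum.neutral simp: power_0_left)
  finally show ?thesis by(simp add:m_def cinner_self)
 qed
 have triG: "sum (%(i, j). G A i * G A j) (R N) = (\<Sum>k<N. G (A + A) k)" for N
  unfolding G_def R_def sum.triangle_reindex by(intro sum.cong refl exp_series_add_commuting[symmetric])
 have fG: "cmod (f p) <= (case p of (i, j) => G A i * G A j) * (norm y)^2" for p
 proof (cases p)
  case (Pair i j)
  have "cmod (m (i + j)) <= norm y * (c ^ (i + j) * norm y)"
   unfolding m_def by(intro order_trans[OF cmod_cinner_le] mult_left_mono norm_compress_pow_le) simp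
  hence "cmod (a i) * cmod (a j) * cmod (m (i + j)) <= cmod (a i) * cmod (a j) * (norm y * (c ^ (i + j) * norm y))"
   by(intro mult_left_mono) auto
  also have "... = G A i * G A j * (norm y)^2"
   by(simp add:a_def G_def A_def norm_mult norm_power power_add power_mult_distrib power2_eq_square mult_ac)
  finally show ?thesis by(simp add:Pair f_def norm_mult)
 qed
 have "cmod (of_real ((norm (P N y))^2) - of_real ((norm y)^2)) <= ((\<Sum>i<N. G A i)^2 - (\<Sum>k<N. G (A + A) k)) * (norm y)^2" if "N > 0" for N
 proof -
  have "cmod (sum f (Q N) - sum f (R N)) = cmod (sum f (Q N - R N))" using sub by(simp add:sum_diff)
  also have "... <= (\<Sum>(i, j)\<in>Q N - R N. G A i * G A j) * (norm y)^2" unfolding sum_distrib_right by(intro sum_norm_le fG)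
  also have "(\<Sum>(i, j)\<in>Q N - R N. G A i * G A j) = (\<Sum>i<N. G A i)^2 - (\<Sum>k<N. G (A + A) k)"
   using sub triG[of N] by(simp add:sum_diff Q_def power2_eq_square sum_product sum.cartesian_product)
  finally show ?thesis using QP tri[OF that] by simp
 qed
 hence "\<forall>\<^sub>F N in sequentially. norm ((norm (P N y))^2 - (norm y)^2) <= ((\<Sum>i<N. G A i)^2 - (\<Sum>k<N. G (A + A) k)) * (norm y)^2"
  by(intro eventually_sequentiallyI[of 1]) (metis norm_of_real of_real_diff real_norm_def less_eq_Suc_le One_nat_def)
 moreover have "(%N. ((\<Sum>i<N. G A i)^2 - (\<Sum>k<N. G (A + A) k)) * (norm y)^2) ----> ((exp A)^2 - exp (A + A)) * (norm y)^2"
  using exp_converges[of A] exp_converges[of "A + A"] unfolding sums_def G_def by(intro tendsto_intros)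
 hence "(%N. ((\<Sum>i<N. G A i)^2 - (\<Sum>k<N. G (A + A) k)) * (norm y)^2) ----> 0"
  unfolding power2_eq_square[of "exp A"] exp_add[symmetric] by simp
 ultimately have "(%N. (norm (P N y))^2 - (norm y)^2) ----> 0" by(rule Lim_null_comparison)
 thus ?thesis by(simp add:LIM_zero_iff)
qed

lemma expform_bound: "cmod (expform (\<i> * of_real t) x y) <= 2 * norm x * norm y"
proof -
 define P where "P = (%N. \<Sum>j<N. ((\<i> * of_real t) ^ j / fact j) *C (compress I ^^ j) y)"
 have "(%N. cmod (cinner x (P N))) ----> cmod (cinner x y + expform (\<i> * of_real t) x y)"
  using summable_LIMSEQ[OF expform_summable[of "\<i> * of_real t" x y]] unfolding expform_eq P_def
  by(intro tendsto_norm) (simp add:cinner_sum_right)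
 moreover have "(%N. sqrt ((norm (P N))^2)) ----> sqrt ((norm y)^2)"
  unfolding P_def by(rule tendsto_real_sqrt[OF expsum_norm_tendsto])
 hence "(%N. norm x * norm (P N)) ----> norm x * norm y" by(intro tendsto_mult) auto
 ultimately have "cmod (cinner x y + expform (\<i> * of_real t) x y) <= norm x * norm y"
  by(rule LIMSEQ_le) (auto intro:cmod_cinner_le)
 thus ?thesis
  using cmod_cinner_le[of x y] norm_triangle_ineq4[of "cinner x y + expform (\<i> * of_real t) x y" "cinner x y"] by simp
qed

lemma expform_split_bound:
 assumes [measurable]: "S : sets borel" "S' : sets borel" and "S \<inter> S' = {}" "I = S \<union> S'"
 shows "cmod (expform (\<i> * of_real t) x y) <= 2 * norm (E S x) * norm y + 2 * norm x * norm (E S' y)"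
proof -
 let ?F = "expform (\<i> * of_real t)"
 have mv: "?F (E X x) y = ?F x (E X y)" if "X : sets borel" for X x y
  unfolding expform_def by(simp only: selfadj[OF that, symmetric] compress_pow_commute[OF that])
 have "?F x y = ?F (E I x) y" unfolding expform_def by(simp only: selfadj[OF I, symmetric] compress_pow_range)
 also have "... = ?F (E S x) y + ?F (E S' x) y"
 proof -
  have "E I x = E S x + E S' x" using E_Un[OF assms(1-3)] assms(4) by simp
  thus ?thesis by(simp only: expform_add_left)
 qed
 also have "... = ?F (E S x) y + ?F x (E S' y)" by(simp add:mv)
 also have "cmod ... <= 2 * norm (E S x) * norm y + 2 * norm x * norm (E S' y)" by(intro norm_triangle_le add_mono expform_bound)
 finally show ?thesis .
qed

end

end

section \<open>Moments of a unitary operator\<close>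

text \<open>A unitary operator \<open>U\<close> with inverse \<open>U'\<close>.\<close>

locale unitary =
 fixes U U' :: "'a::complex_hilbert => 'a"
 assumes lin_U: "clinear_map U" and norm_U: "norm (U x) = norm x"
  and U'_U [simp]: "U' (U x) = x" and U_U' [simp]: "U (U' x) = x"
begin

lemma lin_U': "clinear_map U'"
 unfolding clinear_map_def
proof (intro conjI allI)
 fix x y c
 have "U' (x + y) = U' (U (U' x + U' y))" by(simp add:clinear_mapD(1)[OF lin_U])
 thus "U' (x + y) = U' x + U' y" by simp
 have "U' (c *C x) = U' (U (c *C U' x))" by(simp add:clinear_mapD(2)[OF lin_U])
 thus "U' (c *C x) = c *C U' x" by simp
qed

text \<open>Integer powers of \<open>U\<close>.\<close>

definition upow :: "int => 'a => 'a" where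
 "upow n x = (if n >= 0 then (U ^^ nat n) x else (U' ^^ nat (- n)) x)"

lemma upow_0 [simp]: "upow 0 x = x"
 by(simp add:upow_def)

lemma upow_plus1: "U (upow n x) = upow (n + 1) x"
proof (cases "n >= 0")
 case True
 thus ?thesis by(simp add:upow_def nat_add_distrib)
next
 case False
 then obtain k where n: "n = - int (Suc k)"
  by(metis int_zle_neg not_le zle_iff_zadd zero_less_imp_eq_int add.inverse_inverse neg_0_less_iff_less gr0_implies_Suc)
 thus ?thesis by(cases k) (simp_all add: upow_def nat_add_distrib)
qed

lemma upow_minus1: "U' (upow n x) = upow (n - 1) x"
 using upow_plus1[of "n - 1" x] by(metis U'_U diff_add_cancel)

lemma upow_add: "upow m (upow n x) = upow (m + n) x"
proof (induction m rule: int_induct[where k=0])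
 case (step1 i)
 thus ?case using upow_plus1[of i "upow n x"] upow_plus1[of "i + n" x] by(simp add:algebra_simps)
next
 case (step2 i)
 thus ?case using upow_minus1[of i "upow n x"] upow_minus1[of "i + n" x] by(simp add:algebra_simps)
qed simp

lemma upow_1 [simp]: "upow 1 x = U x"
 using upow_plus1[of 0 x] by simp

lemma lin_upow: "clinear_map (upow n)"
proof (induction n rule: int_induct[where k=0])
 case base
 thus ?case by(simp add:clinear_map_def)
next
 case (step1 i)
 thus ?case by(simp add:clinear_map_def upow_plus1[symmetric] clinear_mapD[OF lin_U])
next
 case (step2 i)
 thus ?case by(simp add:clinear_map_def upow_minus1[symmetric] clinear_mapD[OF lin_U'])
qed

lemma cinner_U: "cinner (U x) (U y) = cinner x y"
proof -
 have "4 * cinner (U x) (U y) = 4 * cinner x y"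
  unfolding polarization by(simp only: clinear_mapD[OF lin_U, symmetric] norm_U)
 thus ?thesis by simp
qed

lemma cinner_upow_same: "cinner (upow m x) (upow m y) = cinner x y"
proof (induction m rule: int_induct[where k=0])
 case (step1 i)
 thus ?case by(simp add:upow_plus1[symmetric] cinner_U)
next
 case (step2 i)
 thus ?case using cinner_U[of "upow (i - 1) x" "upow (i - 1) y"] by(simp add:upow_plus1)
qed simp

lemma cinner_upow: "cinner (upow m x) (upow n y) = cinner x (upow (n - m) y)"
 using cinner_upow_same[of m x "upow (n - m) y"] by(simp add:upow_add)

text \<open>The Fejer means of the sequence of moments are the densities of probability
 measures.\<close>

definition fejer :: "'a => nat => real => real" where
 "fejer x N th = (norm (\<Sum>j<N. cis (- (real j * th)) *C upow (int j) x))^2 / (2 * pi * real N)"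

lemma continuous_scaleC_left: "continuous_on S f ==> continuous_on S (%t. f t *C (y::'a))"
proof -
 assume f: "continuous_on S f"
 have "bounded_linear (%c. c *C y)" by(rule bounded_linear_intro[where K="norm y"])
   (auto simp:scaleC_add_left scaleR_scaleC scaleR_conv_of_real mult.commute)
 from bounded_linear.continuous_on[OF this f] show ?thesis .
qed

lemma continuous_fejer: "continuous_on S (fejer x N)"
 unfolding fejer_def divide_inverse by(intro continuous_intros continuous_scaleC_left)

lemma fejer_nonneg: "fejer x N th >= 0"
 by(simp add:fejer_def)

lemma integral_cis:
 "has_bochner_integral lborel (%th. indicator {-pi..pi} th *\<^sub>R cis (real_of_int m * th)) (if m = 0 then of_real (2 * pi) else 0)"
proof (cases "m = 0")
 case True
 have "has_bochner_integral lborel (%th. indicator {-pi..pi} th *\<^sub>R (1::complex)) (of_real pi - of_real (- pi))"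
  by(rule has_bochner_integral_FTC_Icc)
   (auto intro!:derivative_eq_intros simp: has_vector_derivative_def scaleR_conv_of_real)
 thus ?thesis using True by simp
next
 case False
 let ?F = "%th. cis (real_of_int m * th) / (\<i> * of_int m)"
 have "has_bochner_integral lborel (%th. indicator {-pi..pi} th *\<^sub>R cis (real_of_int m * th)) (?F pi - ?F (- pi))"
 proof (rule has_bochner_integral_FTC_Icc)
  fix th
  have "((%z. exp (\<i> * of_int m * z) / (\<i> * of_int m)) has_field_derivative exp (\<i> * of_int m * of_real th)) (at (of_real th))"
   using False by(auto intro!:derivative_eq_intros)
  from has_vector_derivative_real_field[OF this]
  have "((%t. exp (\<i> * of_int m * of_real t) / (\<i> * of_int m)) has_vector_derivative exp (\<i> * of_int m * of_real th)) (at th within {-pi..pi})"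
   by simp
  thus "(?F has_vector_derivative cis (real_of_int m * th)) (at th within {-pi..pi})" by(simp add:cis_conv_exp mult_ac)
 qed (auto intro!:continuous_intros)
 moreover have "cis (real_of_int m * pi) = cis (real_of_int m * (- pi))"
  by(simp add:complex_eq_iff mult.commute[of "real_of_int m"])
 hence "?F pi = ?F (- pi)" by simp
 ultimately show ?thesis using False by simp
qed

lemma fejer_moment:
 assumes "N > 0"
 shows "has_bochner_integral lborel (%th. indicator {-pi..pi} th *\<^sub>R (of_real (fejer x N th) * cis (real_of_int n * th)))
   (of_nat (card {j\<in>{..<N}. 0 <= n + int j & n + int j < int N}) / of_nat N * cinner x (upow n x))"
proof -
 let ?C = "%m::int. if m = 0 then complex_of_real (2 * pi) else 0"
 let ?k = "1 / (2 * pi * real N)"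
 have e: "indicator {-pi..pi} th *\<^sub>R (of_real (fejer x N th) * cis (real_of_int n * th)) =
   of_real ?k * (\<Sum>j<N. \<Sum>l<N. cinner x (upow (int l - int j) x) * (indicator {-pi..pi} th *\<^sub>R cis (real_of_int (n + int j - int l) * th)))" for th
 proof -
  have "of_real ((norm (\<Sum>j<N. cis (- (real j * th)) *C upow (int j) x))^2) =
    (\<Sum>j<N. \<Sum>l<N. cis (real j * th) * (cis (- (real l * th)) * cinner x (upow (int l - int j) x)))"
   unfolding cinner_self[symmetric] by(simp add:cinner_sum_left cinner_sum_right cinner_upow cis_cnj sum_distrib_left mult.assoc)
    (subst sum.swap, simp add:mult.left_commute)
  hence "of_real (fejer x N th) * cis (real_of_int n * th) = of_real ?k *
    (\<Sum>j<N. \<Sum>l<N. cis (real j * th) * (cis (- (real l * th)) * cinner x (upow (int l - int j) x))) * cis (real_of_int n * th)"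
   unfolding fejer_def by(simp add:field_simps del: of_real_power)
  also have "... = of_real ?k * (\<Sum>j<N. \<Sum>l<N. cinner x (upow (int l - int j) x) * (cis (real j * th) * cis (- (real l * th)) * cis (real_of_int n * th)))"
   by(simp only: mult.assoc sum_distrib_right) (simp only: mult_ac)
  also have "... = of_real ?k * (\<Sum>j<N. \<Sum>l<N. cinner x (upow (int l - int j) x) * cis (real_of_int (n + int j - int l) * th))"
   by(simp add:cis_mult algebra_simps)
  finally show ?thesis by(simp only: scaleR_conv_of_real) (simp add:indicator_def)
 qed
 have "has_bochner_integral lborel (%th. of_real ?k * (\<Sum>j<N. \<Sum>l<N. cinner x (upow (int l - int j) x) * (indicator {-pi..pi} th *\<^sub>R cis (real_of_int (n + int j - int l) * th))))
   (of_real ?k * (\<Sum>j<N. \<Sum>l<N. cinner x (upow (int l - int j) x) * ?C (n + int j - int l)))"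
  by(intro has_bochner_integral_mult_right has_bochner_integral_sum integral_cis)
 moreover have "of_real ?k * (\<Sum>j<N. \<Sum>l<N. cinner x (upow (int l - int j) x) * ?C (n + int j - int l)) =
   of_nat (card {j\<in>{..<N}. 0 <= n + int j & n + int j < int N}) / of_nat N * cinner x (upow n x)"
 proof -
  have "(\<Sum>l<N. cinner x (upow (int l - int j) x) * ?C (n + int j - int l)) =
    (if 0 <= n + int j & n + int j < int N then cinner x (upow n x) * of_real (2 * pi) else 0)" for j
  proof -
   have "(\<Sum>l<N. cinner x (upow (int l - int j) x) * ?C (n + int j - int l)) =
     (\<Sum>l<N. if l = nat (n + int j) then (if 0 <= n + int j then cinner x (upow n x) * of_real (2 * pi) else 0) else 0)"
    by(intro sum.cong) auto
   also have "... = (if 0 <= n + int j & n + int j < int N then cinner x (upow n x) * of_real (2 * pi) else 0)"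
    by(auto simp:nat_less_iff)
   finally show ?thesis .
  qed
  hence "of_real ?k * (\<Sum>j<N. \<Sum>l<N. cinner x (upow (int l - int j) x) * ?C (n + int j - int l)) =
   of_real ?k * (\<Sum>j<N. if 0 <= n + int j & n + int j < int N then cinner x (upow n x) * of_real (2 * pi) else 0)" by simp
  also have "... = of_real ?k * (of_nat (card {j\<in>{..<N}. 0 <= n + int j & n + int j < int N}) * (cinner x (upow n x) * of_real (2 * pi)))"
   by(subst sum.inter_filter[symmetric]) auto
  finally show ?thesis using `N > 0` by(simp add:field_simps)
 qed
 ultimately show ?thesis unfolding e by simp
qed

lemma card_ratio_tendsto: "(%N. real (card {j\<in>{..<Suc N}. 0 <= n + int j & n + int j < int (Suc N)}) / real (Suc N)) ----> 1"
proof (rule real_tendsto_sandwich)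
 show "\<forall>\<^sub>F N in sequentially. 1 - real_of_int \<bar>n\<bar> / real (Suc N) <= real (card {j\<in>{..<Suc N}. 0 <= n + int j & n + int j < int (Suc N)}) / real (Suc N)"
 proof (rule always_eventually, rule allI)
  fix N
  let ?A = "{j\<in>{..<Suc N}. 0 <= n + int j & n + int j < int (Suc N)}"
  have "{nat (- n)..<Suc N - nat n} \<subseteq> ?A" by auto
  hence "card {nat (- n)..<Suc N - nat n} <= card ?A" by(intro card_mono) auto
  hence "real (Suc N) - real_of_int \<bar>n\<bar> <= real (card ?A)" by simp
  hence "(real (Suc N) - real_of_int \<bar>n\<bar>) / real (Suc N) <= real (card ?A) / real (Suc N)"
   by(rule divide_right_mono) simp
  thus "1 - real_of_int \<bar>n\<bar> / real (Suc N) <= real (card ?A) / real (Suc N)"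
   by(simp add:diff_divide_distrib del: of_nat_Suc)
 qed
 show "\<forall>\<^sub>F N in sequentially. real (card {j\<in>{..<Suc N}. 0 <= n + int j & n + int j < int (Suc N)}) / real (Suc N) <= 1"
 proof (rule always_eventually, rule allI)
  fix N
  have "card {j\<in>{..<Suc N}. 0 <= n + int j & n + int j < int (Suc N)} <= card {..<Suc N}" by(intro card_mono) auto
  thus "real (card {j\<in>{..<Suc N}. 0 <= n + int j & n + int j < int (Suc N)}) / real (Suc N) <= 1" by(simp del:of_nat_Suc)
 qed
 have "(%N. real_of_int \<bar>n\<bar> / real (Suc N)) ----> 0" by(rule LIMSEQ_Suc) (rule lim_const_over_n)
 from tendsto_diff[OF tendsto_const this] show "(%N. 1 - real_of_int \<bar>n\<bar> / real (Suc N)) ----> 1" by simp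
qed simp

text \<open>The Fejer densities live on a bounded interval, so they are tight and a subsequence
 converges weakly.\<close>

lemma herglotz_unit:
 assumes "norm x = 1"
 shows "\<exists>M. real_distribution M & (\<forall>n. (\<integral>th. cis (real_of_int n * th) \<partial>M) = cinner x (upow n x))"
proof -
 define M where "M = (%N. density lborel (%th. ennreal (indicator {-pi..pi} th * fejer x (Suc N) th)))"
 have [measurable]: "fejer x N : borel_measurable borel" for N using continuous_fejer by(rule borel_measurable_continuous_onI)
 have [measurable]: "(%th. cis (real_of_int n * th)) : borel_measurable borel" for n
  by(intro borel_measurable_continuous_onI continuous_intros)
 have mom: "(\<integral>th. cis (real_of_int n * th) \<partial>M N) =
   of_nat (card {j\<in>{..<Suc N}. 0 <= n + int j & n + int j < int (Suc N)}) / of_nat (Suc N) * cinner x (upow n x)" for n N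
 proof -
  have "(\<integral>th. cis (real_of_int n * th) \<partial>M N) = (\<integral>th. (indicator {-pi..pi} th * fejer x (Suc N) th) *\<^sub>R cis (real_of_int n * th) \<partial>lborel)"
   unfolding M_def by(rule integral_density) (auto simp:fejer_nonneg)
  also have "... = (\<integral>th. indicator {-pi..pi} th *\<^sub>R (of_real (fejer x (Suc N) th) * cis (real_of_int n * th)) \<partial>lborel)"
   by(simp add:scaleR_conv_of_real mult.assoc)
  also have "... = of_nat (card {j\<in>{..<Suc N}. 0 <= n + int j & n + int j < int (Suc N)}) / of_nat (Suc N) * cinner x (upow n x)"
   by(rule has_bochner_integral_integral_eq[OF fejer_moment]) simp
  finally show ?thesis .
 qed
 have prob: "emeasure (M N) UNIV = 1" for N
 proof -
  have i: "has_bochner_integral lborel (%th. indicator {-pi..pi} th *\<^sub>R (of_real (fejer x (Suc N) th) :: complex)) 1"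
  proof -
   have "{j\<in>{..<Suc N}. 0 <= (0::int) + int j & 0 + int j < int (Suc N)} = {..<Suc N}" by auto
   hence "card {j\<in>{..<Suc N}. 0 <= (0::int) + int j & 0 + int j < int (Suc N)} = Suc N" by(simp only: card_lessThan)
   moreover have "cinner x x = 1" using assms by(simp add:cinner_self)
   ultimately show ?thesis using fejer_moment[of "Suc N" x 0] by(simp del:of_nat_Suc)
  qed
  have "has_bochner_integral lborel (%th. Re (indicator {-pi..pi} th *\<^sub>R (of_real (fejer x (Suc N) th) :: complex))) (Re 1)"
   using i by(rule has_bochner_integral_Re)
  hence j: "has_bochner_integral lborel (%th. indicator {-pi..pi} th * fejer x (Suc N) th) 1" by simp
  have "emeasure (M N) UNIV = (\<integral>\<^sup>+th. ennreal (indicator {-pi..pi} th * fejer x (Suc N) th) \<partial>lborel)"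
   unfolding M_def by(subst emeasure_density) auto
  also have "... = ennreal 1"
   using nn_integral_eq_integral[OF integrable.intros[OF j]] has_bochner_integral_integral_eq[OF j] by(simp add:fejer_nonneg)
  finally show ?thesis by simp
 qed
 have rd: "real_distribution (M N)" for N
 proof -
  interpret prob_space "M N"
  proof (rule prob_spaceI)
   have "space (M N) = UNIV" by(simp add:M_def)
   thus "emeasure (M N) (space (M N)) = 1" by(simp add:prob)
  qed
  show ?thesis by standard (auto simp:M_def)
 qed
 have "measure (M N) {-4<..4} = 1" for N
 proof -
  have "emeasure (M N) {-4<..4} = (\<integral>\<^sup>+th. ennreal (indicator {-pi..pi} th * fejer x (Suc N) th) * indicator {-4<..4} th \<partial>lborel)"
   unfolding M_def by(subst emeasure_density) auto
  also have "... = (\<integral>\<^sup>+th. ennreal (indicator {-pi..pi} th * fejer x (Suc N) th) * indicator UNIV th \<partial>lborel)"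
   using pi_less_4 by(intro nn_integral_cong) (auto simp:indicator_def)
  also have "... = 1" using prob[of N] unfolding M_def by(subst (asm) emeasure_density) auto
  finally show ?thesis by(simp add:measure_def)
 qed
 hence "tight M"
  unfolding tight_def using rd by(intro conjI allI impI exI[of _ "-4::real"] exI[of _ "4::real"]) auto
 from tight_imp_convergent_subsubsequence[OF this strict_mono_id]
 obtain r M' where r: "strict_mono r" and M': "real_distribution M'" and w: "weak_conv_m (M \<circ> r) M'" by(auto simp:o_def)
 have "(\<integral>th. cis (real_of_int n * th) \<partial>M') = cinner x (upow n x)" for n
 proof (rule LIMSEQ_unique)
  show "(%N. \<integral>th. cis (real_of_int n * th) \<partial>(M \<circ> r) N) ----> (\<integral>th. cis (real_of_int n * th) \<partial>M')"
   by(rule weak_conv_imp_integral_bdd_continuous_conv[where B=1])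
    (use rd M' w continuous_on_cis[OF continuous_on_mult[OF continuous_on_const continuous_on_id], of UNIV "real_of_int n"]
     in \<open>auto simp:o_def continuous_on_eq_continuous_at\<close>)
  have "(%N. complex_of_real (real (card {j\<in>{..<Suc N}. 0 <= n + int j & n + int j < int (Suc N)}) / real (Suc N)) * cinner x (upow n x)) ----> of_real 1 * cinner x (upow n x)"
   by(intro tendsto_mult tendsto_of_real card_ratio_tendsto tendsto_const)
  hence "(%N. \<integral>th. cis (real_of_int n * th) \<partial>M N) ----> cinner x (upow n x)"
   unfolding mom by(simp del:of_nat_Suc)
  from LIMSEQ_subseq_LIMSEQ[OF this r]
  show "(%N. \<integral>th. cis (real_of_int n * th) \<partial>(M \<circ> r) N) ----> cinner x (upow n x)" by(simp add:o_def)
 qed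
 with M' show ?thesis by blast
qed

lemma powi_measurable [measurable]: "(%z::complex. z powi n) : borel_measurable borel"
 unfolding power_int_def by(cases "n >= 0") auto

lemma herglotz:
 "\<exists>nn::complex measure. sets nn = sets borel & finite_measure nn & (AE z in nn. cmod z = 1) &
   (\<forall>n. (\<integral>z. z powi n \<partial>nn) = cinner x (upow n x))"
proof (cases "x = 0")
 case True
 show ?thesis by(rule exI[where x="null_measure borel"])
   (auto simp:True AE_iff_null null_sets_def intro!:finite_measureI)
next
 case False
 define y where "y = x /\<^sub>R norm x"
 have "norm y = 1" using False by(simp add:y_def)
 have x: "x = of_real (norm x) *C y" using False by(simp add:y_def scaleR_scaleC[symmetric])
 obtain M where M: "real_distribution M" and mom: "!!n. (\<integral>th. cis (real_of_int n * th) \<partial>M) = cinner y (upow n y)"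
  using herglotz_unit[OF `norm y = 1`] by blast
 interpret real_distribution M by fact
 let ?r = "ennreal ((norm x)^2)"
 define nn where "nn = density (distr M borel cis) (%_. ennreal ((norm x)^2))"
 have [measurable]: "cis : borel_measurable M"
  using borel_measurable_continuous_onI[of cis] continuous_on_cis[OF continuous_on_id] by(simp add:id_def)
 show ?thesis
 proof (rule exI[where x=nn], intro conjI allI)
  show "sets nn = sets borel" by(simp add:nn_def)
  show "finite_measure nn"
  proof (rule finite_measureI)
   have "emeasure nn (space nn) = ?r * emeasure (distr M borel cis) UNIV"
    unfolding nn_def by(subst emeasure_density) (auto simp:nn_integral_cmult_indicator)
   also have "emeasure (distr M borel cis) UNIV = 1" by(subst emeasure_distr) (auto simp:emeasure_space_1[simplified])
   finally show "emeasure nn (space nn) ~= \<infinity>" by simp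
  qed
  show "AE z in nn. cmod z = 1" unfolding nn_def by(simp add:AE_density AE_distr_iff)
  fix n
  have "(\<integral>z. z powi n \<partial>nn) = (\<integral>z. (norm x)^2 *\<^sub>R z powi n \<partial>distr M borel cis)"
   unfolding nn_def by(rule integral_density) auto
  also have "... = (\<integral>th. (norm x)^2 *\<^sub>R cis th powi n \<partial>M)" by(rule integral_distr) auto
  also have "... = (\<integral>th. of_real ((norm x)^2) * cis (real_of_int n * th) \<partial>M)"
   by(simp add:cis_power_int scaleR_conv_of_real)
  also have "... = of_real ((norm x)^2) * cinner y (upow n y)" by(simp add:mom del: of_real_power)
  also have "... = cinner x (upow n x)" by(subst (2 3) x) (simp add:clinear_mapD(2)[OF lin_upow] power2_eq_square)
  finally show "(\<integral>z. z powi n \<partial>nn) = cinner x (upow n x)" .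
 qed
qed

end

lemma cnj_measurable [measurable]: "cnj : borel_measurable borel"
 by(intro borel_measurable_continuous_onI continuous_intros)

section \<open>Functional calculus of a unitary operator\<close>

context unitary
begin

text \<open>The spectral measure of \<open>U\<close> at \<open>x\<close>: the measure on the unit
 circle whose moments are the inner products of \<open>x\<close> and \<open>U^n x\<close>. It exists
 as a weak limit of Fejer means.\<close>

definition nu :: "'a => complex measure" where
 "nu x = (SOME nn. sets nn = sets borel & finite_measure nn & (AE z in nn. cmod z = 1) &
   (\<forall>n. (\<integral>z. z powi n \<partial>nn) = cinner x (upow n x)))"

lemma nu: "sets (nu x) = sets borel" "finite_measure (nu x)" "AE z in nu x. cmod z = 1"
  "(\<integral>z. z powi n \<partial>nu x) = cinner x (upow n x)" using someI_ex[OF herglotz[of x], folded nu_def] by auto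

lemmas [measurable_cong] = nu(1)

lemma space_nu [simp]: "space (nu x) = UNIV"
 using sets_eq_imp_space_eq[OF nu(1)] by simp

text \<open>Functions that are bounded on the unit circle: all integrands below are of this
 kind.\<close>

definition cbm :: "(complex => 'b::{banach, second_countable_topology}) => bool" where
 "cbm f \<longleftrightarrow> f : borel_measurable borel & (\<exists>b. \<forall>z. cmod z = 1 --> norm (f z) <= b)"

lemma cbm_measurable: "cbm f ==> f : borel_measurable borel"
 by(simp add:cbm_def)

lemma cbm_integrable: "cbm f ==> integrable (nu x) f"
proof -
 assume f: "cbm f"
 interpret finite_measure "nu x" by(rule nu)
 obtain b where b: "!!z. cmod z = 1 ==> norm (f z) <= b" and [measurable]: "f : borel_measurable borel"
  using f by(auto simp:cbm_def)
 show ?thesis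
 proof (rule integrable_const_bound[where B=b])
  show "AE z in nu x. norm (f z) <= b" using nu(3) by eventually_elim (rule b)
 qed simp
qed

lemma cbm_const: "cbm (%_. c)"
 by(auto simp:cbm_def)

lemma cbm_add: assumes "cbm f" "cbm g" shows "cbm (%z. f z + g z)"
proof -
 obtain a b where "!!z. cmod z = 1 ==> norm (f z) <= a" "!!z. cmod z = 1 ==> norm (g z) <= b" using assms by(auto simp:cbm_def)
 hence "\<forall>z. cmod z = 1 --> norm (f z + g z) <= a + b" using norm_triangle_mono by blast
 thus ?thesis using assms by(auto simp:cbm_def)
qed

lemma cbm_mult:
 fixes f g :: "complex => 'b::{banach, second_countable_topology, real_normed_algebra}"
 assumes "cbm f" "cbm g" shows "cbm (%z. f z * g z)"
proof -
 obtain a b where a: "!!z. cmod z = 1 ==> norm (f z) <= a" and b: "!!z. cmod z = 1 ==> norm (g z) <= b"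
  using assms by(auto simp:cbm_def)
 have "norm (f z * g z) <= a * b" if "cmod z = 1" for z
 proof -
  have "norm (f z * g z) <= norm (f z) * norm (g z)" by(rule norm_mult_ineq)
  also have "... <= a * b" using a[OF that] b[OF that] order_trans[OF norm_ge_zero a[OF that]] by(intro mult_mono) auto
  finally show ?thesis .
 qed
 thus ?thesis using assms by(auto simp:cbm_def)
qed

lemma cbm_uminus: "cbm f ==> cbm (%z. - f z)"
 by(auto simp:cbm_def)

lemma cbm_diff: "cbm f ==> cbm g ==> cbm (%z. f z - g z)"
 using cbm_add[OF _ cbm_uminus, of f g] by simp

lemma cbm_norm_sq: "cbm f ==> cbm (%z. (norm (f z))^2)"
 by(auto simp:cbm_def intro!:exI power_mono)

lemma cbm_sum: "(!!i. i : A ==> cbm (f i)) ==> cbm (%z. \<Sum>i\<in>A. f i z)"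
 by(induction A rule: infinite_finite_induct) (auto intro:cbm_add cbm_const)

lemma cbm_cnj: "cbm f ==> cbm (%z. cnj (f z))"
 using measurable_compose[OF _ borel_measurable_continuous_onI[OF continuous_on_cnj[OF continuous_on_id]], of f borel]
 by(auto simp:cbm_def)

lemma cbm_indicator: "S : sets borel ==> cbm (%z. indicator S z :: complex)"
 by(auto simp:cbm_def indicator_def intro!:exI[where x=1])

lemma cbm_of_real: "cbm f ==> cbm (%z. complex_of_real (f z))"
 by(auto simp:cbm_def)

lemmas cbm_intros = cbm_const cbm_add cbm_mult cbm_uminus cbm_diff cbm_norm_sq cbm_sum cbm_cnj cbm_of_real

text \<open>Trigonometric polynomials on the circle, paired with the operators they define.\<close>

definition trig :: "(complex => complex) => ('a => 'a) => bool" where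
 "trig p P \<longleftrightarrow> p : borel_measurable borel & (\<exists>F a. finite F &
   (\<forall>z. cmod z = 1 --> p z = (\<Sum>n\<in>F. a n * z powi n)) & (\<forall>x. P x = (\<Sum>n\<in>F. a n *C upow n x)))"

lemma trig_cbm: assumes "trig p P" shows "cbm p"
proof -
 obtain F a where F: "finite F" "!!z. cmod z = 1 ==> p z = (\<Sum>n\<in>F. a n * z powi n)" using assms by(auto simp:trig_def)
 have "norm (p z) <= (\<Sum>n\<in>F. cmod (a n))" if "cmod z = 1" for z
  unfolding F(2)[OF that] by(rule order_trans[OF norm_sum]) (simp add:norm_mult norm_power_int that)
 thus ?thesis using assms by(auto simp:cbm_def trig_def)
qed

lemma trig_monom: "trig (%z. c * z powi n) (%x. c *C upow n x)"
 unfolding trig_def by(auto intro!:exI[where x="{n}"] exI[where x="%_. c"])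

lemma trig_const: "trig (%_. c) (%x. c *C x)"
 using trig_monom[of c 0] by simp

lemma trig_add: assumes "trig p P" "trig q Q" shows "trig (%z. p z + q z) (%x. P x + Q x)"
proof -
 obtain F a where F: "finite F" "!!z. cmod z = 1 ==> p z = (\<Sum>n\<in>F. a n * z powi n)"
  "!!x. P x = (\<Sum>n\<in>F. a n *C upow n x)" "p : borel_measurable borel" using assms(1) by(auto simp:trig_def)
 obtain G b where G: "finite G" "!!z. cmod z = 1 ==> q z = (\<Sum>n\<in>G. b n * z powi n)"
  "!!x. Q x = (\<Sum>n\<in>G. b n *C upow n x)" "q : borel_measurable borel" using assms(2) by(auto simp:trig_def)
 let ?a = "%n. if n : F then a n else 0" and ?b = "%n. if n : G then b n else 0"
 have "(\<Sum>n\<in>F. a n * z powi n) = (\<Sum>n\<in>F \<union> G. ?a n * z powi n)"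
    "(\<Sum>n\<in>G. b n * z powi n) = (\<Sum>n\<in>F \<union> G. ?b n * z powi n)"
    "(\<Sum>n\<in>F. a n *C upow n x) = (\<Sum>n\<in>F \<union> G. ?a n *C upow n x)"
    "(\<Sum>n\<in>G. b n *C upow n x) = (\<Sum>n\<in>F \<union> G. ?b n *C upow n x)" for z x
  using F(1) G(1) by(auto intro!:sum.mono_neutral_cong_left)
 thus ?thesis
  unfolding trig_def using F G by(intro conjI exI[where x="F \<union> G"] exI[where x="%n. ?a n + ?b n"])
   (simp_all add: sum.distrib distrib_right scaleC_add_left)
qed

lemma trig_scale: assumes "trig p P" shows "trig (%z. c * p z) (%x. c *C P x)"
proof -
 obtain F a where F: "finite F" "!!z. cmod z = 1 ==> p z = (\<Sum>n\<in>F. a n * z powi n)"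
  "!!x. P x = (\<Sum>n\<in>F. a n *C upow n x)" "p : borel_measurable borel" using assms(1) by(auto simp:trig_def)
 thus ?thesis
  unfolding trig_def by(intro conjI exI[where x="F"] exI[where x="%n. c * a n"])
   (simp_all add: sum_distrib_left scaleC_sum_right mult.assoc)
qed

lemma trig_diff: "trig p P ==> trig q Q ==> trig (%z. p z - q z) (%x. P x - Q x)"
 using trig_add[OF _ trig_scale, of p P q Q "-1"] by simp

lemma trig_sum: "(!!i. i : A ==> trig (p i) (P i)) ==> trig (%z. \<Sum>i\<in>A. p i z) (%x. \<Sum>i\<in>A. P i x)"
proof (induction A rule: infinite_finite_induct)
 case (insert a A)
 thus ?case by(simp add:trig_add)
qed (use trig_const[of 0] in simp_all)

lemma trig_cong:
 assumes "trig p P" "!!z. cmod z = 1 ==> p z = q z" "!!x. P x = Q x" "q : borel_measurable borel"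
 shows "trig q Q"
 using assms unfolding trig_def by metis

lemma trig_lin: "trig p P ==> clinear_map P"
 unfolding trig_def clinear_map_def
 by(auto simp:clinear_mapD[OF lin_upow] scaleC_add_right sum.distrib scaleC_sum_right mult.commute)

lemma trig_mult: assumes "trig p P" "trig q Q" shows "trig (%z. p z * q z) (%x. P (Q x))"
proof -
 obtain F a where F: "finite F" "!!z. cmod z = 1 ==> p z = (\<Sum>n\<in>F. a n * z powi n)"
  "!!x. P x = (\<Sum>n\<in>F. a n *C upow n x)" "p : borel_measurable borel" using assms(1) by(auto simp:trig_def)
 obtain G b where G: "finite G" "!!z. cmod z = 1 ==> q z = (\<Sum>n\<in>G. b n * z powi n)"
  "!!x. Q x = (\<Sum>n\<in>G. b n *C upow n x)" "q : borel_measurable borel" using assms(2) by(auto simp:trig_def)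
 have "trig (%z. \<Sum>n\<in>F. \<Sum>m\<in>G. (a n * b m) * z powi (n + m)) (%x. \<Sum>n\<in>F. \<Sum>m\<in>G. (a n * b m) *C upow (n + m) x)"
  by(intro trig_sum trig_monom)
 thus ?thesis
 proof (rule trig_cong)
  fix z :: complex assume "cmod z = 1"
  hence "z ~= 0" by auto
  thus "(\<Sum>n\<in>F. \<Sum>m\<in>G. (a n * b m) * z powi (n + m)) = p z * q z"
   using F(2) G(2) `cmod z = 1` by(simp add:sum_product power_int_add mult_ac)
 next
  fix x
  show "(\<Sum>n\<in>F. \<Sum>m\<in>G. (a n * b m) *C upow (n + m) x) = P (Q x)"
   unfolding F(3) G(3) by(simp add:clinear_mapD[OF lin_upow] upow_add scaleC_sum_right)
 qed (use F G in simp)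
qed

lemma trig_commute: assumes "trig p P" shows "P (upow m x) = upow m (P x)"
proof -
 obtain F a where "!!x. P x = (\<Sum>n\<in>F. a n *C upow n x)" using assms(1) by(auto simp:trig_def)
 thus ?thesis by(simp add:clinear_mapD[OF lin_upow] upow_add add.commute)
qed

lemma trig_cinner: assumes "trig p P" "trig q Q"
 shows "cinner (P x) (Q x) = (\<integral>z. cnj (p z) * q z \<partial>nu x)"
proof -
 obtain F a where F: "finite F" "!!z. cmod z = 1 ==> p z = (\<Sum>n\<in>F. a n * z powi n)"
  "!!x. P x = (\<Sum>n\<in>F. a n *C upow n x)" and [measurable]: "p : borel_measurable borel"
  using assms(1) by(auto simp:trig_def)
 obtain G b where G: "finite G" "!!z. cmod z = 1 ==> q z = (\<Sum>n\<in>G. b n * z powi n)"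
  "!!x. Q x = (\<Sum>n\<in>G. b n *C upow n x)" and [measurable]: "q : borel_measurable borel"
  using assms(2) by(auto simp:trig_def)
 have mono: "cbm (%z. c * z powi n)" for c :: complex and n
  using trig_cbm[OF trig_monom] .
 have "(\<integral>z. cnj (p z) * q z \<partial>nu x) = (\<integral>z. (\<Sum>n\<in>F. \<Sum>m\<in>G. (cnj (a n) * b m) * z powi (m - n)) \<partial>nu x)"
 proof (rule integral_cong_AE)
  show "AE z in nu x. cnj (p z) * q z = (\<Sum>n\<in>F. \<Sum>m\<in>G. (cnj (a n) * b m) * z powi (m - n))"
   using nu(3)
  proof eventually_elim
   case (elim z)
   hence "z ~= 0" "cnj z = inverse z" by(auto simp:inverse_complex_def complex_eq_iff cmod_def)
   hence h: "cnj (z powi n) * z powi m = z powi (m - n)" for n m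
    by(simp add:power_int_diff power_int_inverse divide_inverse mult.commute
      complex_cnj_power_int power_int_minus)
   have "cnj (p z) * q z = (\<Sum>n\<in>F. \<Sum>m\<in>G. (cnj (a n) * b m) * (cnj (z powi n) * z powi m))"
    unfolding F(2)[OF elim] G(2)[OF elim] cnj_sum complex_cnj_mult sum_product by(intro sum.cong refl) (simp only: mult_ac)
   thus ?case by(simp only: h)
  qed
 qed measurable
 also have "... = (\<Sum>n\<in>F. \<Sum>m\<in>G. (cnj (a n) * b m) * cinner x (upow (m - n) x))"
  using mono by(subst Bochner_Integration.integral_sum; (intro cbm_integrable cbm_sum)?; simp?)
   (simp add:Bochner_Integration.integral_sum cbm_integrable nu(4))
 also have "... = cinner (P x) (Q x)"
  unfolding F(3) G(3) by(simp add:cinner_sum_left cinner_sum_right cinner_upow sum_distrib_left mult.assoc)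
   (subst sum.swap, simp add:mult.left_commute)
 finally show ?thesis ..
qed

lemma trig_norm: "trig p P ==> (norm (P x))^2 = (\<integral>z. (cmod (p z))^2 \<partial>nu x)"
proof -
 assume p: "trig p P"
 have "complex_of_real ((norm (P x))^2) = (\<integral>z. complex_of_real ((cmod (p z))^2) \<partial>nu x)"
  unfolding cinner_self[symmetric] trig_cinner[OF p p] by(simp only: complex_norm_square mult.commute)
 also have "... = complex_of_real (\<integral>z. (cmod (p z))^2 \<partial>nu x)" by(rule integral_complex_of_real)
 finally show ?thesis using of_real_eq_iff by blast
qed

lemma measure_nu_UNIV: "measure (nu x) UNIV = (norm x)^2"
 using trig_norm[OF trig_const[of 1], of x] by simp

text \<open>On the circle the real and imaginary parts are trigonometric polynomials; hence, by the
 Stone-Weierstrass theorem, trigonometric polynomials are uniformly dense in the continuous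
 functions.\<close>

lemma trig_real_polynomial:
 assumes "real_polynomial_function g"
 shows "\<exists>p P. trig p P & (\<forall>z. cmod z = 1 --> p z = complex_of_real (g z))"
 using assms
proof (induction rule: real_polynomial_function.induct)
 case (linear f)
 interpret bounded_linear f by fact
 let ?p = "%z. of_real (f 1) * ((1/2) * z powi 1 + (1/2) * z powi (-1)) + of_real (f \<i>) * ((-\<i>/2) * z powi 1 + (\<i>/2) * z powi (-1))"
 have "\<exists>P. trig ?p P"
  using trig_add[OF trig_scale[OF trig_add[OF trig_monom trig_monom]] trig_scale[OF trig_add[OF trig_monom trig_monom]]] by blast
 moreover have "?p z = complex_of_real (f z)" if "cmod z = 1" for z
 proof -
  have i: "inverse z = cnj z" using that by(auto simp:inverse_complex_def complex_eq_iff cmod_def)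
  have "z = Re z *\<^sub>R 1 + Im z *\<^sub>R \<i>" by(simp add:complex_eq_iff)
  hence "f z = Re z * f 1 + Im z * f \<i>" by(metis add scaleR real_scaleR_def)
  moreover have "?p z = of_real (f 1) * of_real (Re z) + of_real (f \<i>) * of_real (Im z)"
   by(simp add:power_int_minus i complex_eq_iff)
  ultimately show ?thesis by(simp add:mult.commute)
 qed
 ultimately show ?case by blast
next
 case (const c)
 thus ?case using trig_const by blast
next
 case (add f g)
 then obtain p P q Q where "trig p P" "trig q Q" "\<forall>z. cmod z = 1 --> p z = complex_of_real (f z)" "\<forall>z. cmod z = 1 --> q z = complex_of_real (g z)"
  by blast
 thus ?case by(intro exI[where x="%z. p z + q z"] exI[where x="%x. P x + Q x"] conjI trig_add) auto
next
 case (mult f g)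
 then obtain p P q Q where "trig p P" "trig q Q" "\<forall>z. cmod z = 1 --> p z = complex_of_real (f z)" "\<forall>z. cmod z = 1 --> q z = complex_of_real (g z)"
  by blast
 thus ?case by(intro exI[where x="%z. p z * q z"] exI[where x="%x. P (Q x)"] conjI trig_mult) auto
qed

lemma trig_uniform:
 assumes "continuous_on UNIV f" "e > 0"
 obtains p P where "trig p P" "!!z. cmod z = 1 ==> cmod (p z - complex_of_real (f z)) < e"
proof -
 have "compact (sphere (0::complex) 1)" by simp
 moreover have "continuous_on (sphere (0::complex) 1) f" using assms(1) continuous_on_subset by blast
 ultimately obtain g where g: "real_polynomial_function g" "!!z. z : sphere 0 1 ==> \<bar>f z - g z\<bar> < e"
  using Stone_Weierstrass_real_polynomial_function[OF _ _ assms(2)] by blast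
 obtain p P where "trig p P" "!!z. cmod z = 1 ==> p z = complex_of_real (g z)" using trig_real_polynomial[OF g(1)] by blast
 thus thesis using g(2) by(intro that[of p P]) (auto simp:of_real_diff[symmetric] abs_minus_commute simp del:of_real_diff)
qed

text \<open>The squared distance between the vectors that \<open>f\<close> and \<open>g\<close>
 should produce from \<open>x\<close>.\<close>

definition err :: "(complex => complex) => (complex => complex) => 'a => real" where
 "err f g x = (\<integral>z. (cmod (f z - g z))^2 \<partial>nu x)"

lemma err_commute: "err f g x = err g f x"
 by(simp add:err_def norm_minus_commute)

lemma err_nonneg: "err f g x >= 0"
 by(simp add:err_def)

lemma err_triangle:
 assumes "cbm f" "cbm g" "cbm h" "dl > 0"
 shows "err f h x <= (1 + dl) * err f g x + (1 + 1 / dl) * err g h x"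
proof -
 have e: "(cmod (a + b))^2 <= (1 + dl) * (cmod a)^2 + (1 + 1 / dl) * (cmod b)^2" for a b
 proof -
  have "(cmod (a + b))^2 <= (cmod a + cmod b)^2" by(simp add:norm_triangle_ineq power_mono)
  also have "... = (cmod a)^2 + 2 * (cmod a * cmod b) + (cmod b)^2" by(simp add:power2_sum)
  also have "2 * (cmod a * cmod b) <= dl * (cmod a)^2 + (1 / dl) * (cmod b)^2"
  proof -
   have "0 <= (sqrt dl * cmod a - cmod b / sqrt dl)^2" by simp
   also have "... = dl * (cmod a)^2 + (1 / dl) * (cmod b)^2 - 2 * (cmod a * cmod b)"
    using `dl > 0` by(simp add:power2_diff power_mult_distrib power_divide)
   finally show ?thesis by simp
  qed
  finally show ?thesis by(simp add:algebra_simps)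
 qed
 have "err f h x <= (\<integral>z. (1 + dl) * (cmod (f z - g z))^2 + (1 + 1 / dl) * (cmod (g z - h z))^2 \<partial>nu x)"
  unfolding err_def
 proof (rule integral_mono)
  fix z
  show "(cmod (f z - h z))^2 <= (1 + dl) * (cmod (f z - g z))^2 + (1 + 1 / dl) * (cmod (g z - h z))^2"
   using e[of "f z - g z" "g z - h z"] by simp
 qed (intro cbm_integrable cbm_intros assms)+
 also have "... = (1 + dl) * err f g x + (1 + 1 / dl) * err g h x"
  unfolding err_def by(subst Bochner_Integration.integral_add) (auto intro!:cbm_integrable cbm_intros assms)
 finally show ?thesis .
qed

lemma err_triangle2: "cbm f ==> cbm g ==> cbm h ==> err f h x <= 2 * err f g x + 2 * err g h x"
 using err_triangle[of f g h 1] by simp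

lemma err_uniform:
 assumes "cbm f" "cbm g" "!!z. cmod z = 1 ==> cmod (f z - g z) <= e"
 shows "err f g x <= e^2 * (norm x)^2"
proof -
 interpret finite_measure "nu x" by(rule nu)
 have "err f g x <= (\<integral>z. e^2 \<partial>nu x)"
  unfolding err_def
 proof (rule integral_mono_AE)
  show "AE z in nu x. (cmod (f z - g z))^2 <= e^2" using nu(3) by eventually_elim (auto intro:power_mono assms)
 qed (auto intro!:cbm_integrable cbm_intros assms)
 thus ?thesis by(simp add:measure_nu_UNIV mult.commute)
qed

lemma trig_dist: "trig p P ==> trig q Q ==> (norm (P x - Q x))^2 = err p q x"
 using trig_norm[OF trig_diff] by(simp add:err_def)

text \<open>Simultaneous mean-square approximation by trigonometric polynomials.\<close>

definition l2app :: "'a set => (complex => complex) => bool" where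
 "l2app X f \<longleftrightarrow> (\<forall>e>0. \<exists>p P. trig p P & (\<forall>x\<in>X. err p f x < e))"

lemma l2app_limit:
 assumes "cbm f" "!!e. e > 0 ==> \<exists>g. cbm g & l2app X g & (\<forall>x\<in>X. err g f x < e)"
 shows "l2app X f"
 unfolding l2app_def
proof (intro allI impI)
 fix e :: real assume "e > 0"
 then obtain g where g: "cbm g" "l2app X g" "\<forall>x\<in>X. err g f x < e / 4" using assms(2)[of "e/4"] by auto
 obtain p P where p: "trig p P" "\<forall>x\<in>X. err p g x < e / 4"
  using g(2) `e > 0` unfolding l2app_def by(meson zero_less_divide_iff zero_less_numeral)
 have "err p f x < e" if "x : X" for x using err_triangle2[OF trig_cbm[OF p(1)] g(1) assms(1), of x] g(3) p(2) that by force
 thus "\<exists>p P. trig p P & (\<forall>x\<in>X. err p f x < e)" using p(1) by blast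
qed

lemma l2app_trig: "trig p P ==> l2app X p"
 unfolding l2app_def by(auto simp:err_def)

lemma err_scale: "err (%z. c * f z) (%z. c * g z) x = (cmod c)^2 * err f g x"
proof -
 have "(cmod (c * f z - c * g z))^2 = (cmod c)^2 * (cmod (f z - g z))^2" for z
  by(simp add:right_diff_distrib[symmetric] norm_mult power_mult_distrib)
 thus ?thesis by(simp add:err_def)
qed

lemma err_add:
 assumes "cbm f" "cbm g" "cbm f'" "cbm g'"
 shows "err (%z. f z + g z) (%z. f' z + g' z) x <= 2 * err f f' x + 2 * err g g' x"
proof -
 have "err (%z. f z + g z) (%z. f' z + g' z) x <= (\<integral>z. 2 * (cmod (f z - f' z))^2 + 2 * (cmod (g z - g' z))^2 \<partial>nu x)"
  unfolding err_def
 proof (rule integral_mono)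
  fix z
  show "(cmod (f z + g z - (f' z + g' z)))^2 <= 2 * (cmod (f z - f' z))^2 + 2 * (cmod (g z - g' z))^2"
   using norm_add_sq_le[of "f z - f' z" "g z - g' z"] by(simp add:algebra_simps)
 qed (intro cbm_integrable cbm_intros assms)+
 also have "... = 2 * err f f' x + 2 * err g g' x"
  unfolding err_def by(subst Bochner_Integration.integral_add) (auto intro!:cbm_integrable cbm_intros assms)
 finally show ?thesis .
qed

lemma l2app_add:
 assumes "cbm f" "cbm g" "l2app X f" "l2app X g"
 shows "l2app X (%z. f z + g z)"
 unfolding l2app_def
proof (intro allI impI)
 fix e :: real assume "e > 0"
 hence "e / 4 > 0" by simp
 then obtain p P q Q where p: "trig p P" "\<forall>x\<in>X. err p f x < e / 4" and q: "trig q Q" "\<forall>x\<in>X. err q g x < e / 4"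
  using assms(3,4) unfolding l2app_def by meson
 have "err (%z. p z + q z) (%z. f z + g z) x < e" if "x : X" for x
  using err_add[OF trig_cbm[OF p(1)] trig_cbm[OF q(1)] assms(1,2), of x] p(2) q(2) that by force
 thus "\<exists>p P. trig p P & (\<forall>x\<in>X. err p (%z. f z + g z) x < e)" using trig_add[OF p(1) q(1)] by blast
qed

lemma l2app_scale:
 assumes "cbm f" "l2app X f"
 shows "l2app X (%z. c * f z)"
 unfolding l2app_def
proof (intro allI impI)
 fix e :: real assume "e > 0"
 have c: "(cmod c)^2 + 1 > 0" by(simp add:add_nonneg_pos)
 hence "e / ((cmod c)^2 + 1) > 0" using `e > 0` by simp
 then obtain p P where p: "trig p P" "\<forall>x\<in>X. err p f x < e / ((cmod c)^2 + 1)"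
  using assms(2) unfolding l2app_def by meson
 have "err (%z. c * p z) (%z. c * f z) x < e" if "x : X" for x
 proof -
  have "(cmod c)^2 * err p f x <= ((cmod c)^2 + 1) * err p f x" by(intro mult_right_mono) (auto simp:err_nonneg)
  also have "... < ((cmod c)^2 + 1) * (e / ((cmod c)^2 + 1))" using p(2) that c by(intro mult_strict_left_mono) auto
  also have "... = e" using c by simp
  finally show ?thesis by(simp add:err_scale)
 qed
 thus "\<exists>p P. trig p P & (\<forall>x\<in>X. err p (%z. c * f z) x < e)" using trig_scale[OF p(1)] by blast
qed

lemma l2app_sum:
 assumes "finite A" "!!i. i : A ==> cbm (f i)" "!!i. i : A ==> l2app X (f i)"
 shows "l2app X (%z. \<Sum>i\<in>A. f i z)"
 using assms
proof (induction A rule: finite_induct)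
 case empty
 thus ?case using l2app_trig[OF trig_const[of 0]] by simp
next
 case (insert a A)
 thus ?case by(simp add:l2app_add cbm_sum)
qed

lemma l2app_continuous:
 assumes "continuous_on UNIV f" "cbm f" "finite X"
 shows "l2app X (%z. complex_of_real (f z))"
 unfolding l2app_def
proof (intro allI impI)
 fix e :: real assume "e > 0"
 define s where "s = (\<Sum>x\<in>X. (norm x)^2) + 1"
 have "s > 0" by(simp add:s_def add_nonneg_pos sum_nonneg)
 define d where "d = sqrt (e / s)"
 have "d > 0" using `e > 0` `s > 0` by(simp add:d_def)
 obtain p P where p: "trig p P" "!!z. cmod z = 1 ==> cmod (p z - complex_of_real (f z)) < d"
  by(rule trig_uniform[OF assms(1) `d > 0`]) blast
 have "err p (%z. complex_of_real (f z)) x < e" if "x : X" for x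
 proof -
  have "err p (%z. complex_of_real (f z)) x <= d^2 * (norm x)^2"
   by(rule err_uniform) (auto intro:trig_cbm p cbm_of_real assms less_imp_le)
  also have "(norm x)^2 < s" using member_le_sum[OF that, of "%x. (norm x)^2"] `finite X` by(simp add:s_def)
  hence "d^2 * (norm x)^2 < d^2 * s" using `d > 0` by simp
  also have "d^2 * s = e" using `e > 0` `s > 0` by(simp add:d_def)
  finally show ?thesis .
 qed
 thus "\<exists>p P. trig p P & (\<forall>x\<in>X. err p (%z. complex_of_real (f z)) x < e)" using p(1) by blast
qed

end

text \<open>Continuous functions decreasing to the indicator of a closed set.\<close>

definition ramp :: "complex set => nat => complex => real" where
 "ramp S n z = max 0 (1 - real n * infdist z S)"

lemma ramp: "continuous_on UNIV (ramp S n)" "0 <= ramp S n z" "ramp S n z <= 1"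
 by(auto simp:ramp_def[abs_def] infdist_nonneg intro!:continuous_intros)

lemma ramp_tendsto:
 assumes "closed S" "S ~= {}"
 shows "(%n. ramp S n z) ----> indicator S z"
proof (cases "z : S")
 case False
 hence "infdist z S > 0" using assms by(metis in_closed_iff_infdist_zero infdist_nonneg less_eq_real_def)
 then obtain N where N: "1 < real N * infdist z S" using reals_Archimedean3 by blast
 have "ramp S n z = 0" if "N <= n" for n
 proof -
  have "real N * infdist z S <= real n * infdist z S" using that by(intro mult_right_mono) (auto simp:infdist_nonneg)
  thus ?thesis using N by(simp add:ramp_def)
 qed
 thus ?thesis using False by(intro tendsto_eventually eventually_sequentiallyI[of N]) simp
qed (simp add:ramp_def)

context unitary
begin

lemma err_indicator:
 assumes "S : sets borel" "S' : sets borel" "S' \<subseteq> S"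
 shows "err (indicator S') (indicator S) x = measure (nu x) (S - S')"
proof -
 have "(cmod (indicator S' z - indicator S z))^2 = indicator (S - S') z" for z using assms(3) by(auto simp:indicator_def)
 thus ?thesis using assms by(simp add:err_def)
qed

lemma l2app_indicator_closed:
 assumes "closed S" "finite X"
 shows "l2app X (indicator S)"
proof (cases "S = {}")
 case True
 moreover have "(indicator {} :: complex => complex) = (%_. 0)" by auto
 ultimately show ?thesis using l2app_trig[OF trig_const[of 0]] by simp
next
 case False
 have [measurable]: "S : sets borel" using assms by simp
 let ?c = "ramp S"
 have cb: "cbm (?c n)" for n
  using ramp(2,3)[of S n] borel_measurable_continuous_onI[OF ramp(1)] by(auto simp:cbm_def intro!:exI[where x=1])
 have lim: "(%n. err (%z. complex_of_real (?c n z)) (indicator S) x) ----> 0" for x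
 proof -
  interpret finite_measure "nu x" by(rule nu)
  have e: "(cmod (complex_of_real (?c n z) - indicator S z))^2 = (?c n z - indicator S z)^2" for n z
   by(metis norm_of_real of_real_diff of_real_indicator power2_abs)
  have [measurable]: "?c n : borel_measurable borel" for n by(rule borel_measurable_continuous_onI[OF ramp(1)])
  have "(%n. \<integral>z. (?c n z - indicator S z)^2 \<partial>nu x) ----> (\<integral>z. 0 \<partial>nu x)"
  proof (rule integral_dominated_convergence[where w="%_. 1"])
   have "(%n. (?c n z - indicator S z)^2) ----> (indicator S z - indicator S z)^2" for z
    by(intro tendsto_intros ramp_tendsto assms False)
   thus "AE z in nu x. (%n. (?c n z - indicator S z)^2) ----> 0" by simp
   have "abs (?c n z - indicator S z) <= 1" for n z using ramp(2)[of S n z] ramp(3)[of S n z] by(auto simp:indicator_def)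
   thus "AE z in nu x. norm ((?c n z - indicator S z)^2) <= 1" for n by(simp add:abs_square_le_1)
  qed (auto simp:nu(1))
  thus ?thesis by(simp add:err_def e)
 qed
 show ?thesis
 proof (rule l2app_limit)
  fix e :: real assume "e > 0"
  hence "\<forall>\<^sub>F n in sequentially. \<forall>x\<in>X. err (%z. complex_of_real (?c n z)) (indicator S) x < e"
   using `finite X` order_tendstoD(2)[OF lim `e > 0`] by(intro eventually_ball_finite) auto
  then obtain n where n: "\<forall>x\<in>X. err (%z. complex_of_real (?c n z)) (indicator S) x < e"
   by(auto simp:eventually_sequentially)
  thus "\<exists>g. cbm g & l2app X g & (\<forall>x\<in>X. err g (indicator S) x < e)"
   using cbm_of_real[OF cb[of n]] l2app_continuous[OF ramp(1) cb `finite X`, of n] by blast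
 qed (rule cbm_indicator, simp)
qed

text \<open>From closed sets to Borel sets by Dynkin's lemma.\<close>

lemma l2app_indicator:
 assumes "S : sets borel" "finite X"
 shows "l2app X (indicator S)"
proof -
 let ?G = "{S::complex set. closed S}"
 have b: "sets (borel :: complex measure) = sigma_sets UNIV ?G" by(simp add:borel_eq_closed)
 have "Int_stable ?G" by(auto simp:Int_stable_def)
 moreover have "?G \<subseteq> Pow UNIV" by auto
 moreover have "S : sigma_sets UNIV ?G" using assms(1) b by simp
 ultimately show ?thesis
 proof (induction rule: sigma_sets_induct_disjoint)
  case (basic A)
  thus ?case using l2app_indicator_closed assms(2) by simp
 next
  case empty
  show ?case by(rule l2app_indicator_closed[OF closed_empty assms(2)])
 next
  case (compl A)
  hence A: "A : sets borel" using b by simp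
  have "l2app X (%z. 1 * 1 + (-1) * indicator A z)"
   by(intro l2app_add l2app_scale cbm_intros cbm_indicator A compl l2app_trig[OF trig_const])
  moreover have "(%z. 1 * 1 + (-1) * indicator A z) = (indicator (UNIV - A) :: complex => complex)"
   by(auto simp:fun_eq_iff indicator_def)
  ultimately show ?case by simp
 next
  case (union A)
  hence A: "A i : sets borel" for i using b by auto
  show ?case
  proof (rule l2app_limit)
   show "cbm (indicator (\<Union> (range A)) :: complex => complex)" by(rule cbm_indicator) (use A in auto)
   fix e :: real assume "e > 0"
   have lim: "(%n. err (indicator (\<Union>i<n. A i)) (indicator (\<Union>i. A i)) x) ----> 0" for x
   proof -
    interpret finite_measure "nu x" by(rule nu)
    have "(%n. measure (nu x) ((\<Union>i. A i) - (\<Union>i<n. A i))) ----> measure (nu x) (\<Inter>n. (\<Union>i. A i) - (\<Union>i<n. A i))"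
     by(rule finite_Lim_measure_decseq) (use A in \<open>auto simp:decseq_def nu(1)\<close>)
    moreover have "(\<Inter>n. (\<Union>i. A i) - (\<Union>i<n. A i)) = {}" by(auto simp:lessThan_iff)
    ultimately have "(%n. measure (nu x) ((\<Union>i. A i) - (\<Union>i<n. A i))) ----> 0" by(simp only: measure_empty)
    moreover have "err (indicator (\<Union>i<n. A i)) (indicator (\<Union>i. A i)) x = measure (nu x) ((\<Union>i. A i) - (\<Union>i<n. A i))" for n
     by(rule err_indicator) (use A in auto)
    ultimately show ?thesis by simp
   qed
   have "\<forall>\<^sub>F n in sequentially. \<forall>x\<in>X. err (indicator (\<Union>i<n. A i)) (indicator (\<Union>i. A i)) x < e"
    using `finite X` order_tendstoD(2)[OF lim `e > 0`] by(intro eventually_ball_finite) auto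
   then obtain n where n: "\<forall>x\<in>X. err (indicator (\<Union>i<n. A i)) (indicator (\<Union>i. A i)) x < e"
    by(auto simp:eventually_sequentially)
   have "(indicator (\<Union>i<n. A i) :: complex => complex) = (%z. \<Sum>i<n. indicator (A i) z)"
    using union(1) by(intro ext indicator_UN_disjoint) (auto simp:disjoint_family_on_def)
   hence "l2app X (indicator (\<Union>i<n. A i))" by(auto intro!:l2app_sum cbm_indicator A union)
   moreover have "cbm (indicator (\<Union>i<n. A i) :: complex => complex)" by(rule cbm_indicator) (use A in auto)
   ultimately show "\<exists>g. cbm g & l2app X g & (\<forall>x\<in>X. err g (indicator (\<Union> (range A))) x < e)"
    using n by blast
  qed
 qed
qed

lemma l2app_real:
 assumes [measurable]: "f : borel_measurable borel" and b: "!!z. abs (f z) <= b" and "finite X"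
 shows "l2app X (%z. complex_of_real (f z))"
proof (rule l2app_limit)
 show cf: "cbm (%z. complex_of_real (f z))" using b by(intro cbm_of_real) (auto simp:cbm_def)
 fix e :: real assume "e > 0"
 define s where "s = (\<Sum>x\<in>X. (norm x)^2) + 1"
 have "s > 0" by(simp add:s_def add_nonneg_pos sum_nonneg)
 define d where "d = sqrt (e / s)"
 have "d > 0" using `e > 0` `s > 0` by(simp add:d_def)
 obtain N :: int and J where N: "!!i. J i : sets borel" "{-b..b} = (\<Union>i\<in>{-N..N}. J i)" "disjoint_family_on J {-N..N}"
   "!!i s t. s : J i ==> t : J i ==> \<bar>s - t\<bar> <= d"
  by(rule partition_grid[of "{-b..b}" b d]) (use `d > 0` in \<open>auto simp:abs_le_iff\<close>)
 define t where "t = (%i. SOME s. s : J i)"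
 define g where "g = (%z. \<Sum>i\<in>{-N..N}. complex_of_real (t i) * indicator (f -` J i) z)"
 have m: "f -` J i : sets borel" for i using measurable_sets[OF assms(1) N(1)[of i]] by simp
 have cg: "cbm g" unfolding g_def by(intro cbm_intros cbm_indicator m)
 have "l2app X g" unfolding g_def by(intro l2app_sum l2app_scale cbm_intros cbm_indicator l2app_indicator m `finite X`) auto
 moreover have close: "cmod (g z - complex_of_real (f z)) <= d" for z
 proof -
  have "f z : {-b..b}" using b[of z] by(auto simp:abs_le_iff)
  then obtain i where i: "i : {-N..N}" "f z : J i" using N(2) by auto
  have "indicator (f -` J k) z = (if k = i then 1 else 0 :: complex)" if "k : {-N..N}" for k
  proof (cases "k = i")
   case False
   hence "J k \<inter> J i = {}" using disjoint_family_onD[OF N(3) that i(1)] by blast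
   thus ?thesis using i(2) False by(auto simp:indicator_def)
  qed (use i in simp)
  hence "g z = (\<Sum>k\<in>{-N..N}. if k = i then complex_of_real (t k) else 0)" unfolding g_def by(intro sum.cong) auto
  also have "... = complex_of_real (t i)" using i by simp
  finally have "g z = complex_of_real (t i)" .
  moreover have "t i : J i" unfolding t_def using i(2) by(rule someI)
  ultimately show ?thesis using N(4)[OF _ i(2)] by(simp add:of_real_diff[symmetric] del: of_real_diff)
 qed
 moreover have "err g (%z. complex_of_real (f z)) x < e" if "x : X" for x
 proof -
  have "err g (%z. complex_of_real (f z)) x <= d^2 * (norm x)^2" by(rule err_uniform[OF cg cf close])
  also have "(norm x)^2 < s" using member_le_sum[OF that, of "%x. (norm x)^2"] `finite X` by(simp add:s_def)
  hence "d^2 * (norm x)^2 < d^2 * s" using `d > 0` by simp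
  also have "d^2 * s = e" using `e > 0` `s > 0` by(simp add:d_def)
  finally show ?thesis .
 qed
 ultimately show "\<exists>g. cbm g & l2app X g & (\<forall>x\<in>X. err g (%z. complex_of_real (f z)) x < e)" using cg by blast
qed

text \<open>The bounded functional calculus: \<open>calc f x\<close> is the mean-square limit of
 \<open>P x\<close> as \<open>p\<close> tends to \<open>f\<close>.\<close>

definition calc :: "(complex => complex) => 'a => 'a" where
 "calc f x = (THE y. \<forall>p P. trig p P --> (norm (P x - y))^2 = err p f x)"

text \<open>The functions in the calculus: bounded on the circle and, for finitely many vectors
 simultaneously, mean-square limits of trigonometric polynomials.\<close>

definition app :: "(complex => complex) => bool" where
 "app f \<longleftrightarrow> cbm f & (\<forall>X. finite X --> l2app X f)"

lemma app_cbm: "app f ==> cbm f" by(simp add:app_def)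

lemma app_indicator: "S : sets borel ==> app (indicator S)"
 by(simp add:app_def cbm_indicator l2app_indicator)

lemma app_real: "f : borel_measurable borel ==> (!!z. abs (f z) <= b) ==> app (%z. complex_of_real (f z))"
 using l2app_real[of f b] by(auto simp:app_def cbm_def intro!:exI[where x=b])

lemma app_add: "app f ==> app g ==> app (%z. f z + g z)"
 by(simp add:app_def cbm_add l2app_add)

lemma app_scale: "app f ==> app (%z. c * f z)"
 by(simp add:app_def cbm_mult cbm_const l2app_scale)

lemma app_trig: "trig p P ==> app p"
 by(simp add:app_def trig_cbm l2app_trig)

lemma appD:
 assumes "app f" "finite X" "e > 0"
 obtains p P where "trig p P" "!!x. x : X ==> err p f x < e" using assms unfolding app_def l2app_def by meson

lemma le_all_factor: "(!!dl. dl > 0 ==> a <= (1 + dl) * b) ==> b >= 0 ==> a <= (b::real)"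
proof (rule field_le_epsilon)
 fix e :: real assume *: "!!dl. dl > 0 ==> a <= (1 + dl) * b" and "b >= 0" "e > 0"
 have "a <= (1 + e / (b + 1)) * b" using `e > 0` `b >= 0` by(intro *) auto
 also have "... = b + e * (b / (b + 1))" by(simp add:algebra_simps)
 also have "e * (b / (b + 1)) <= e * 1" using `e > 0` `b >= 0` by(intro mult_left_mono) auto
 finally show "a <= b + e" by simp
qed

lemma calc_exists:
 assumes "app f"
 shows "\<exists>!y. \<forall>p P. trig p P --> (norm (P x - y))^2 = err p f x"
proof -
 have f: "cbm f" using assms by(rule app_cbm)
 have "\<exists>p P. trig p P & err p f x < (1 / (real n + 1))^2" for n :: nat
  by(rule appD[OF assms, of "{x}" "(1 / (real n + 1))^2"]) auto
 then obtain p P where p: "!!n::nat. trig (p n) (P n)" and e: "!!n. err (p n) f x < (1 / (real n + 1))^2" by metis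
 have bound: "norm (P i x - P j x) <= 2 / (real N + 1)" if "i >= N" "j >= N" for i j N
 proof -
  have mono: "(1 / (real k + 1))^2 <= (1 / (real N + 1))^2" if "k >= N" for k
   using that by(intro power_mono divide_left_mono) auto
  have "(norm (P i x - P j x))^2 <= 2 * err (p i) f x + 2 * err f (p j) x"
   unfolding trig_dist[OF p p] by(intro err_triangle2 trig_cbm[OF p] f)
  also have "... <= 4 * (1 / (real N + 1))^2"
   using e[of i] e[of j] mono[OF that(1)] mono[OF that(2)] unfolding err_commute[of f] by linarith
  also have "... = (2 / (real N + 1))^2" by(simp add:power_divide)
  finally show ?thesis by(rule power2_le_imp_le) simp
 qed
 have "Cauchy (%n. P n x)"
 proof (rule metric_CauchyI)
  fix r :: real assume "r > 0"
  obtain N where "inverse (real (Suc N)) < r / 2" using reals_Archimedean[of "r/2"] `r > 0` by auto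
  hence N: "2 / (real N + 1) < r" by(simp add:field_simps)
  show "\<exists>N. \<forall>i\<ge>N. \<forall>j\<ge>N. dist (P i x) (P j x) < r"
   using bound N by(intro exI[of _ N]) (force simp: dist_norm)
 qed
 then obtain y where y: "(%n. P n x) ----> y" using Cauchy_convergent_iff convergent_def by blast
 have e0: "(%n. err (p n) f x) ----> 0"
 proof (rule real_tendsto_sandwich[where f="%_. 0" and h="%n. (1 / (real n + 1))^2"])
  have "(%n. inverse (real (Suc n))) ----> 0" by(rule LIMSEQ_inverse_real_of_nat)
  from tendsto_power[OF this, of 2] show "(%n. (1 / (real n + 1))^2) ----> 0" by(simp add:inverse_eq_divide add.commute)
 qed (use e in \<open>auto simp:err_nonneg intro:always_eventually less_imp_le\<close>)
 have main: "(norm (Q x - y))^2 = err q f x" if q: "trig q Q" for q Q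
 proof -
  have lim: "(%n. err q (p n) x) ----> (norm (Q x - y))^2" unfolding trig_dist[OF q p, symmetric] by(intro tendsto_intros y)
  have 1: "(norm (Q x - y))^2 <= (1 + dl) * err q f x" if "dl > 0" for dl
  proof (rule tendsto_le[OF _ _ lim])
   have "(%n. (1 + dl) * err q f x + (1 + 1/dl) * err (p n) f x) ----> (1 + dl) * err q f x + (1 + 1/dl) * 0"
    by(intro tendsto_intros e0)
   thus "(%n. (1 + dl) * err q f x + (1 + 1/dl) * err f (p n) x) ----> (1 + dl) * err q f x" by(simp add:err_commute[of f])
   show "\<forall>\<^sub>F n in sequentially. err q (p n) x <= (1 + dl) * err q f x + (1 + 1/dl) * err f (p n) x"
    using that by(intro always_eventually allI err_triangle trig_cbm[OF p] trig_cbm[OF q] f)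
  qed simp
  have 2: "err q f x <= (1 + dl) * (norm (Q x - y))^2" if "dl > 0" for dl
  proof (rule tendsto_lowerbound)
   have "(%n. (1 + dl) * err q (p n) x + (1 + 1/dl) * err (p n) f x) ----> (1 + dl) * (norm (Q x - y))^2 + (1 + 1/dl) * 0"
    by(intro tendsto_intros e0 lim)
   thus "(%n. (1 + dl) * err q (p n) x + (1 + 1/dl) * err (p n) f x) ----> (1 + dl) * (norm (Q x - y))^2" by simp
   show "\<forall>\<^sub>F n in sequentially. err q f x <= (1 + dl) * err q (p n) x + (1 + 1/dl) * err (p n) f x"
    using that by(intro always_eventually allI err_triangle trig_cbm[OF p] trig_cbm[OF q] f)
  qed simp
  show ?thesis using le_all_factor[OF 1 err_nonneg] le_all_factor[OF 2] by(simp add:order_antisym)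
 qed
 have uniq: "y' = y" if "\<forall>p P. trig p P --> (norm (P x - y'))^2 = err p f x" for y'
 proof (rule LIMSEQ_unique[OF _ y])
  have ee: "err (p n) f x = (norm (P n x - y'))^2" for n using that p[of n] by metis
  have "(%n. (norm (P n x - y'))^2) ----> 0"
   using e0 unfolding ee .
  hence "(%n. sqrt ((norm (P n x - y'))^2)) ----> sqrt 0" by(rule tendsto_real_sqrt)
  hence "(%n. norm (P n x - y')) ----> 0" by simp
  thus "(%n. P n x) ----> y'" by(simp only: tendsto_norm_zero_iff LIM_zero_iff)
 qed
 show ?thesis using main uniq by blast
qed

lemma calc_dist: "app f ==> trig p P ==> (norm (P x - calc f x))^2 = err p f x"
 using theI'[OF calc_exists, of f x] unfolding calc_def by blast

lemma calcI:
 assumes "app f" "!!e. e > 0 ==> \<exists>p P. trig p P & err p f x < e & (norm (P x - y))^2 < e"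
 shows "calc f x = y"
proof (rule ccontr)
 assume "calc f x ~= y"
 hence d: "(norm (calc f x - y))^2 / 4 > 0" (is "?d > 0") by simp
 then obtain p P where p: "trig p P" "err p f x < ?d" "(norm (P x - y))^2 < ?d" using assms(2) by blast
 have "(norm (calc f x - y))^2 = (norm ((P x - y) + (calc f x - P x)))^2" by simp
 also have "... <= 2 * (norm (P x - y))^2 + 2 * (norm (calc f x - P x))^2" by(rule norm_add_sq_le)
 also have "(norm (calc f x - P x))^2 = err p f x" using calc_dist[OF assms(1) p(1)] by(simp add:norm_minus_commute)
 finally show False using p by simp
qed

lemma calc_norm: "app f ==> (norm (calc f x))^2 = (\<integral>z. (cmod (f z))^2 \<partial>nu x)"
 using calc_dist[OF _ trig_const[of 0], of f x] by(simp add:err_def)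

lemma calc_trig: "trig p P ==> calc p x = P x"
 by(rule calcI, erule app_trig, intro exI[of _ p] exI[of _ P]) (simp add:err_def)

lemma calc_add:
 assumes "app f" "app g" shows "calc (%z. f z + g z) x = calc f x + calc g x"
proof (rule calcI)
 fix e :: real assume "e > 0"
 hence "e / 5 > 0" by simp
 obtain p P where p: "trig p P" "err p f x < e / 5" using appD[OF assms(1) _ `e / 5 > 0`, of "{x}"] by auto
 obtain q Q where q: "trig q Q" "err q g x < e / 5" using appD[OF assms(2) _ `e / 5 > 0`, of "{x}"] by auto
 have "err (%z. p z + q z) (%z. f z + g z) x < e"
  using err_add[OF trig_cbm[OF p(1)] trig_cbm[OF q(1)] app_cbm[OF assms(1)] app_cbm[OF assms(2)], of x] p q `e > 0` by simp
 moreover have "(norm ((P x + Q x) - (calc f x + calc g x)))^2 < e"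
 proof -
  have "(norm ((P x - calc f x) + (Q x - calc g x)))^2 <= 2 * err p f x + 2 * err q g x"
   unfolding calc_dist[OF assms(1) p(1), symmetric] calc_dist[OF assms(2) q(1), symmetric] by(rule norm_add_sq_le)
  thus ?thesis using p q `e > 0` by(simp add:algebra_simps)
 qed
 ultimately show "\<exists>r R. trig r R & err r (%z. f z + g z) x < e & (norm (R x - (calc f x + calc g x)))^2 < e"
  using trig_add[OF p(1) q(1)] by blast
qed (use assms in \<open>rule app_add\<close>)

lemma calc_add_arg:
 assumes "app f" shows "calc f (x + y) = calc f x + calc f y"
proof (rule calcI)
 fix e :: real assume "e > 0"
 hence "e / 5 > 0" by simp
 obtain p P where p: "trig p P" "!!u. u : {x, y, x + y} ==> err p f u < e / 5"
  by(rule appD[OF assms _ `e / 5 > 0`, of "{x, y, x + y}"]) auto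
 have "(norm ((P x - calc f x) + (P y - calc f y)))^2 <= 2 * err p f x + 2 * err p f y"
  unfolding calc_dist[OF assms p(1), symmetric] by(rule norm_add_sq_le)
 hence "(norm (P (x + y) - (calc f x + calc f y)))^2 < e"
  using p(2)[of x] p(2)[of y] `e > 0` by(simp add:clinear_mapD[OF trig_lin[OF p(1)]] algebra_simps)
 moreover have "err p f (x + y) < e" using p(2)[of "x + y"] `e > 0` by simp
 ultimately show "\<exists>p P. trig p P & err p f (x + y) < e & (norm (P (x + y) - (calc f x + calc f y)))^2 < e"
  using p(1) by blast
qed (rule assms)

lemma nu_trig_bounded:
 assumes "trig r R"
 obtains b where "b > 0" "!!x. (norm (R x))^2 <= b * (norm x)^2" "!!z. cmod z = 1 ==> (cmod (r z))^2 <= b"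
proof -
 obtain b where b: "!!z. cmod z = 1 ==> cmod (r z) <= b" using trig_cbm[OF assms] by(auto simp:cbm_def)
 have 1: "(cmod (r z))^2 <= b^2 + 1" if "cmod z = 1" for z using power_mono[OF b[OF that], of 2] by simp
 have 2: "(norm (R x))^2 <= (b^2 + 1) * (norm x)^2" for x
 proof -
  interpret finite_measure "nu x" by(rule nu)
  have "(norm (R x))^2 <= (\<integral>z. b^2 + 1 \<partial>nu x)"
   unfolding trig_norm[OF assms]
  proof (rule integral_mono_AE)
   show "AE z in nu x. (cmod (r z))^2 <= b^2 + 1" using nu(3) by eventually_elim (rule 1)
  qed (auto intro!:cbm_integrable cbm_intros trig_cbm[OF assms])
  thus ?thesis by(simp add:measure_nu_UNIV mult.commute)
 qed
 show thesis by(rule that[OF _ 2 1]) (simp_all add: add_nonneg_pos)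
qed

lemma calc_trig_mult:
 assumes "app f" "trig r R" shows "app (%z. r z * f z)" "calc (%z. r z * f z) x = R (calc f x)"
proof -
 obtain b where b: "b > 0" "!!x. (norm (R x))^2 <= b * (norm x)^2" "!!z. cmod z = 1 ==> (cmod (r z))^2 <= b"
  by(rule nu_trig_bounded[OF assms(2)]) blast
 have e: "err (%z. r z * p z) (%z. r z * f z) x <= b * err p f x" if "trig p P" for p P x
 proof -
  have "err (%z. r z * p z) (%z. r z * f z) x <= (\<integral>z. b * (cmod (p z - f z))^2 \<partial>nu x)"
   unfolding err_def
  proof (rule integral_mono_AE)
   show "AE z in nu x. (cmod (r z * p z - r z * f z))^2 <= b * (cmod (p z - f z))^2"
    using nu(3)
   proof eventually_elim
    case (elim z)
    have "(cmod (r z * p z - r z * f z))^2 = (cmod (r z))^2 * (cmod (p z - f z))^2"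
     by(simp add:right_diff_distrib[symmetric] norm_mult power_mult_distrib)
    thus ?case using b(3)[OF elim] by(simp add:mult_right_mono)
   qed
  qed (auto intro!:cbm_integrable cbm_intros trig_cbm[OF that] trig_cbm[OF assms(2)] app_cbm[OF assms(1)])
  thus ?thesis by(simp add:err_def)
 qed
 have approx: "\<exists>p P. trig p P & (\<forall>x\<in>X. err (%z. r z * p z) (%z. r z * f z) x < e & err p f x < e & b * err p f x < e)"
  if X: "finite X" "e > 0" for X e
 proof -
  have "min e (e / b) > 0" using X b by simp
  then obtain p P where p: "trig p P" "!!x. x : X ==> err p f x < min e (e / b)" using appD[OF assms(1) X(1)] by metis
  have "b * err p f x < e" if "x : X" for x using p(2)[OF that] b(1) by(simp add:field_simps)
  thus ?thesis using p e[OF p(1)] by(meson le_less_trans min_less_iff_conj)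
 qed
 show app: "app (%z. r z * f z)"
  unfolding app_def l2app_def
 proof (intro conjI allI impI)
  show "cbm (%z. r z * f z)" by(intro cbm_mult trig_cbm[OF assms(2)] app_cbm[OF assms(1)])
  fix X :: "'a set" and e :: real assume X: "finite X" "e > 0"
  obtain p P where p: "trig p P" "\<forall>x\<in>X. err (%z. r z * p z) (%z. r z * f z) x < e" using approx[OF X] by blast
  show "\<exists>p P. trig p P & (\<forall>x\<in>X. err p (%z. r z * f z) x < e)"
   by(intro exI[of _ "%z. r z * p z"] exI[of _ "%x. R (P x)"] conjI trig_mult assms p)
 qed
 show "calc (%z. r z * f z) x = R (calc f x)"
 proof (rule calcI[OF app])
  fix e :: real assume "e > 0"
  obtain p P where p: "trig p P" "err (%z. r z * p z) (%z. r z * f z) x < e" "b * err p f x < e"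
   using approx[of "{x}" e] `e > 0` by auto
  have "(norm (R (P x) - R (calc f x)))^2 <= b * (norm (P x - calc f x))^2"
   using b(2)[of "P x - calc f x"] by(simp add:clinear_mapD[OF trig_lin[OF assms(2)]])
  also have "... < e" using p(3) calc_dist[OF assms(1) p(1)] by simp
  finally show "\<exists>q Q. trig q Q & err q (%z. r z * f z) x < e & (norm (Q x - R (calc f x)))^2 < e"
   by(intro exI[of _ "%z. r z * p z"] exI[of _ "%x. R (P x)"] conjI trig_mult assms p)
 qed
qed

lemma trig_swap: assumes "trig p P" "trig r R" shows "P (R x) = R (P x)"
proof -
 obtain F a where "!!x. R x = (\<Sum>n\<in>F. a n *C upow n x)" using assms(2) by(auto simp:trig_def)
 thus ?thesis by(simp add:clinear_mapD[OF trig_lin[OF assms(1)]] trig_commute[OF assms(1)])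
qed

lemma calc_trig_arg:
 assumes "app f" "trig r R" shows "calc f (R x) = R (calc f x)"
proof (rule calcI[OF assms(1)])
 obtain b where b: "b > 0" "!!x. (norm (R x))^2 <= b * (norm x)^2" by(rule nu_trig_bounded[OF assms(2)]) blast
 fix e :: real assume "e > 0"
 hence "min e (e / b) > 0" using b by simp
 then obtain p P where p: "trig p P" "!!u. u : {x, R x} ==> err p f u < min e (e / b)"
  using appD[OF assms(1), of "{x, R x}" "min e (e / b)"] by auto
 have "(norm (P (R x) - R (calc f x)))^2 = (norm (R (P x - calc f x)))^2"
  by(simp add:clinear_mapD[OF trig_lin[OF assms(2)]] trig_swap[OF p(1) assms(2)])
 also have "... <= b * (norm (P x - calc f x))^2" by(rule b)
 also have "... = b * err p f x" by(simp add:calc_dist[OF assms(1) p(1)])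
 also have "... < e" using p(2)[of x] b(1) by(simp add:field_simps)
 finally show "\<exists>p P. trig p P & err p f (R x) < e & (norm (P (R x) - R (calc f x)))^2 < e"
  using p(1) p(2)[of "R x"] by(intro exI[of _ p] exI[of _ P]) simp
qed

lemma calc_lin: "app f ==> clinear_map (calc f)"
 unfolding clinear_map_def using calc_add_arg calc_trig_arg[OF _ trig_const] by auto

end

context unitary
begin

lemma calc_scale: "app f ==> calc (%z. c * f z) x = c *C calc f x"
 using calc_trig_mult(2)[OF _ trig_const[of c], of f x] by simp

lemma calc_diff:
 assumes "app f" "app g" shows "calc f x - calc g x = calc (%z. f z - g z) x"
 using calc_add[OF assms(1) app_scale[OF assms(2), of "-1"], of x] calc_scale[OF assms(2), of "-1" x] by simp

lemma calc_err: "app f ==> app g ==> (norm (calc f x - calc g x))^2 = err f g x"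
 using calc_norm[OF app_add[OF _ app_scale, of f g "-1"], of x] by(simp add:calc_diff err_def)

lemma norm_calc_indicator: "S : sets borel ==> (norm (calc (indicator S) x))^2 = measure (nu x) S"
proof -
 assume S: "S : sets borel"
 have "(cmod (indicator S z))^2 = indicator S z" for z by(simp add:indicator_def)
 thus ?thesis using S by(simp add:calc_norm[OF app_indicator] )
qed

lemma cinner_calc_indicator:
 assumes S[measurable]: "S : sets borel"
 shows "cinner x (calc (indicator S) x) = of_real (measure (nu x) S)"
proof -
 interpret finite_measure "nu x" by(rule nu)
 let ?y = "calc (indicator S) x"
 have d: "(norm (c *C x - ?y))^2 = (\<integral>z. (cmod (c - indicator S z))^2 \<partial>nu x)" for c
  using calc_dist[OF app_indicator[OF S] trig_const[of c]] by(simp add:err_def)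
 have "(cmod (1 - indicator S z))^2 = 1 - indicator S z" "(cmod (\<i> - indicator S z))^2 = 1 + indicator S z" for z
  by(auto simp:indicator_def cmod_power2)
 with d[of 1] d[of \<i>] have "(norm (1 *C x - ?y))^2 = (norm x)^2 - measure (nu x) S" "(norm (\<i> *C x - ?y))^2 = (norm x)^2 + measure (nu x) S"
  using integrable_real_indicator[of S "nu x"] by(simp_all add: measure_nu_UNIV nu(1) less_top[symmetric])
 hence "Re (cinner x ?y) = measure (nu x) S" "Re (cinner (\<i> *C x) ?y) = 0"
  using norm_add_sq[of x "- ?y"] norm_add_sq[of "\<i> *C x" "- ?y"] by(simp_all add: norm_calc_indicator[OF S])
 thus ?thesis by(simp add:complex_eq_iff cinner_scaleC_left)
qed

lemma calc_indicator_Un: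
 assumes "S : sets borel" "S' : sets borel" "S \<inter> S' = {}"
 shows "calc (indicator (S \<union> S')) x = calc (indicator S) x + calc (indicator S') x"
proof -
 have "(indicator (S \<union> S') :: complex => complex) = (%z. indicator S z + indicator S' z)"
  using assms(3) by(auto simp:fun_eq_iff indicator_def)
 thus ?thesis using calc_add[OF app_indicator app_indicator] assms by simp
qed

lemma calc_indicator_empty: "calc (indicator {}) x = 0"
 using norm_calc_indicator[of "{}" x] by simp

lemma pvm_calc:
 assumes k[measurable]: "kp : borel_measurable borel"
 shows "pvm (%S. calc (indicator (kp -` S)))"
proof
 have m: "kp -` S : sets borel" if "S : sets borel" for S :: "real set" using measurable_sets[OF k that] by simp
 fix S :: "real set" and x assume S: "S : sets borel"
 show "orth_proj (calc (indicator (kp -` S)))"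
 proof (rule orth_projI)
  show "clinear_map (calc (indicator (kp -` S)))" by(intro calc_lin app_indicator m S)
  fix x
  show "cinner x (calc (indicator (kp -` S)) x) = of_real ((norm (calc (indicator (kp -` S)) x))^2)"
   by(simp add:norm_calc_indicator cinner_calc_indicator m S)
 qed
next
 fix x
 show "calc (indicator (kp -` UNIV)) x = x" using calc_trig[OF trig_const[of 1], of x] by(simp add:indicator_def)
next
 have m: "kp -` S : sets borel" if "S : sets borel" for S :: "real set" using measurable_sets[OF k that] by simp
 fix F :: "nat => real set" and x assume F: "range F \<subseteq> sets borel" "disjoint_family F"
 let ?E = "%S. calc (indicator (kp -` S)) x"
 have mF: "F i : sets borel" for i using F by auto
 have fin: "(\<Sum>i<N. ?E (F i)) = ?E (\<Union>i<N. F i)" for N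
 proof (induction N)
  case 0
  thus ?case using calc_trig[OF trig_const[of 0], of x] by simp
 next
  case (Suc N)
  have "kp -` (\<Union>i<Suc N. F i) = kp -` (\<Union>i<N. F i) \<union> kp -` F N" by(auto simp:lessThan_Suc)
  moreover have "F N \<inter> F i = {}" if "i < N" for i using F(2) that by(auto simp:disjoint_family_on_def)
  hence "kp -` (\<Union>i<N. F i) \<inter> kp -` F N = {}" by blast
  ultimately show ?case
   using Suc calc_indicator_Un[of "kp -` (\<Union>i<N. F i)" "kp -` F N" x] m[of "\<Union>i<N. F i"] m[OF mF, of N] mF by simp
 qed
 have tail: "?E (\<Union>i. F i) - ?E (\<Union>i<N. F i) = ?E ((\<Union>i. F i) - (\<Union>i<N. F i))" for N
 proof -
  have "kp -` (\<Union>i. F i) = kp -` (\<Union>i<N. F i) \<union> kp -` ((\<Union>i. F i) - (\<Union>i<N. F i))" by auto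
  moreover have "kp -` (\<Union>i<N. F i) \<inter> kp -` ((\<Union>i. F i) - (\<Union>i<N. F i)) = {}" by auto
  moreover have "kp -` (\<Union>i<N. F i) : sets borel" "kp -` ((\<Union>i. F i) - (\<Union>i<N. F i)) : sets borel"
   by(intro m; use mF in auto)+
  ultimately show ?thesis using calc_indicator_Un[of "kp -` (\<Union>i<N. F i)" "kp -` ((\<Union>i. F i) - (\<Union>i<N. F i))" x] by simp
 qed
 interpret finite_measure "nu x" by(rule nu)
 let ?A = "%N. kp -` ((\<Union>i. F i) - (\<Union>i<N. F i))"
 have mA: "?A N : sets borel" for N by(intro m) (use mF in auto)
 have "(%N. measure (nu x) (?A N)) ----> measure (nu x) (\<Inter>N. ?A N)"
  by(rule finite_Lim_measure_decseq) (use mA in \<open>auto simp:decseq_def nu(1)\<close>)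
 moreover have "(\<Inter>N. ?A N) = {}" by(auto simp:lessThan_iff)
 ultimately have "(%N. measure (nu x) (?A N)) ----> 0" by(simp only: measure_empty)
 hence "(%N. sqrt ((norm (?E (\<Union>i. F i) - ?E (\<Union>i<N. F i)))^2)) ----> sqrt 0"
  unfolding tail norm_calc_indicator[OF mA] by(rule tendsto_real_sqrt)
 hence "(%N. norm (?E (\<Union>i<N. F i) - ?E (\<Union>i. F i))) ----> 0" by(simp add:norm_minus_commute)
 thus "(%N. \<Sum>i<N. ?E (F i)) ----> ?E (\<Union>i. F i)" unfolding fin by(simp only: tendsto_norm_zero_iff LIM_zero_iff)
qed

end

section \<open>The spectral theorem for self-adjoint operators\<close>

text \<open>A symmetric operator \<open>T\<close> with domain \<open>D\<close> such that \<open>T -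
 i eta\<close> and \<open>T + i eta\<close> are onto.\<close>

locale self_adjoint =
 fixes D :: "'a::complex_hilbert set" and T :: "'a => 'a" and eta :: real and R R' :: "'a => 'a"
 assumes eta: "eta > 0"
  and D_add: "x : D ==> y : D ==> x + y : D"
  and D_scale: "x : D ==> c *C x : D"
  and T_add: "x : D ==> y : D ==> T (x + y) = T x + T y"
  and T_scale: "x : D ==> T (c *C x) = c *C T x"
  and sym: "x : D ==> y : D ==> cinner x (T y) = cinner (T x) y"
  and R: "R x : D" "T (R x) - (\<i> * of_real eta) *C R x = x"
  and R': "R' x : D" "T (R' x) + (\<i> * of_real eta) *C R' x = x"
begin

abbreviation "ie \<equiv> \<i> * of_real eta"

lemma D_diff: "x : D ==> y : D ==> x - y : D" and T_diff: "x : D ==> y : D ==> T (x - y) = T x - T y"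
 using D_add[of x "-1 *C y"] T_add[of x "-1 *C y"] D_scale[of y "-1"] T_scale[of y "-1"] by simp_all

lemma norm_shift:
 assumes "x : D" shows "(norm (T x - ie *C x))^2 = (norm (T x))^2 + eta^2 * (norm x)^2"
  "(norm (T x + ie *C x))^2 = (norm (T x))^2 + eta^2 * (norm x)^2"
proof -
 have "Im (cinner (T x) x) = 0" using sym[OF assms assms] cinner_commute[of "T x" x] by(simp add:complex_eq_iff)
 hence z: "Re (cinner (T x) (ie *C x)) = 0" by(simp del:Re_cinner)
 show "(norm (T x + ie *C x))^2 = (norm (T x))^2 + eta^2 * (norm x)^2"
  using z by(simp add:norm_add_sq norm_mult power_mult_distrib del: Re_cinner)
 show "(norm (T x - ie *C x))^2 = (norm (T x))^2 + eta^2 * (norm x)^2"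
  using z norm_add_sq[of "T x" "- (ie *C x)"] by(simp add:norm_mult power_mult_distrib del: Re_cinner)
qed

lemma R_left: "x : D ==> R (T x - ie *C x) = x"
 and R'_left: "x : D ==> R' (T x + ie *C x) = x"
proof -
 assume x: "x : D"
 let ?w = "R (T x - ie *C x) - x"
 have D: "?w : D" using D_diff R x by blast
 have "T ?w - ie *C ?w = 0" using R(2)[of "T x - ie *C x"] x R(1) by(simp add:T_diff scaleC_diff_right algebra_simps)
 hence "eta^2 * (norm ?w)^2 <= 0"
  using norm_shift(1)[OF D] by(metis add_increasing norm_zero order_refl power_zero_numeral zero_le_power2)
 hence "eta^2 * (norm ?w)^2 = 0" by(meson antisym mult_nonneg_nonneg zero_le_power2)
 thus "R (T x - ie *C x) = x" using eta by simp
next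
 assume x: "x : D"
 let ?w = "R' (T x + ie *C x) - x"
 have D: "?w : D" using D_diff R' x by blast
 have "T ?w + ie *C ?w = 0" using R'(2)[of "T x + ie *C x"] x R'(1) by(simp add:T_diff scaleC_diff_right algebra_simps)
 hence "eta^2 * (norm ?w)^2 <= 0"
  using norm_shift(2)[OF D] by(metis add_increasing norm_zero order_refl power_zero_numeral zero_le_power2)
 hence "eta^2 * (norm ?w)^2 = 0" by(meson antisym mult_nonneg_nonneg zero_le_power2)
 thus "R' (T x + ie *C x) = x" using eta by simp
qed

lemma R_lin: "clinear_map R"
 unfolding clinear_map_def
proof (intro conjI allI)
 fix x y c
 have "x + y = T (R x + R y) - ie *C (R x + R y)"
  using R(2)[of x] R(2)[of y] R(1) by(simp add:T_add scaleC_add_right algebra_simps)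
 thus "R (x + y) = R x + R y" using R_left[OF D_add[OF R(1) R(1)]] by metis
 have "c *C x = T (c *C R x) - ie *C (c *C R x)"
  using arg_cong[OF R(2)[of x], of "%v. c *C v"] R(1) by(simp add:T_scale scaleC_diff_right mult.commute)
 thus "R (c *C x) = c *C R x" using R_left[OF D_scale[OF R(1)]] by metis
qed

lemma norm_R_le: "norm (R x) <= norm x / eta"
proof -
 have "(eta * norm (R x))^2 <= (norm x)^2" using norm_shift(1)[OF R(1), of x] R(2)[of x] by(simp add:power_mult_distrib)
 hence "eta * norm (R x) <= norm x" by(rule power2_le_imp_le) simp
 thus ?thesis using eta by(simp add:field_simps)
qed

lemma bounded_linear_R: "bounded_linear R"
 by(rule bounded_linear_intro[where K="1/eta"])
  (use norm_R_le in \<open>auto simp:clinear_mapD[OF R_lin]\<close>)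

text \<open>The Cayley transform, written by means of the resolvents \<open>R\<close> and
 \<open>R'\<close> at \<open>\<i> * eta\<close> and \<open>- \<i> * eta\<close>, and its
 inverse.\<close>

definition cay :: "'a => 'a" where "cay x = x + (2 * \<i> * of_real eta) *C R x"
definition cay' :: "'a => 'a" where "cay' x = x - (2 * \<i> * of_real eta) *C R' x"

lemma cay_eq: "cay x = T (R x) + ie *C R x"
proof -
 have "cay x = (T (R x) - ie *C R x) + (2 * ie) *C R x" by(simp only: cay_def R(2) mult.assoc)
 thus ?thesis by(simp only: mult_2 scaleC_add_left) simp
qed

lemma cay'_eq: "cay' x = T (R' x) - ie *C R' x"
proof -
 have "cay' x = (T (R' x) + ie *C R' x) - (2 * ie) *C R' x" by(simp only: cay'_def R'(2) mult.assoc)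
 thus ?thesis by(simp only: mult_2 scaleC_add_left) simp
qed

sublocale unitary cay cay'
proof
 show "clinear_map cay" using R_lin by(simp add:clinear_map_def cay_def scaleC_add_right algebra_simps)
 fix x
 have "(norm (cay x))^2 = (norm x)^2"
  unfolding cay_eq norm_shift(2)[OF R(1)] using norm_shift(1)[OF R(1), of x] R(2)[of x] by simp
 thus "norm (cay x) = norm x" by(simp add:power2_eq_iff_nonneg)
 have "R' (cay x) = R x" by(simp add:cay_eq R'_left R(1))
 hence "cay' (cay x) = cay x - (2 * \<i> * of_real eta) *C R x" by(simp only: cay'_def)
 thus "cay' (cay x) = x" unfolding cay_def by(simp only: add_diff_cancel)
 have "R (cay' x) = R' x" by(simp add:cay'_eq R_left R'(1))
 hence "cay (cay' x) = cay' x + (2 * \<i> * of_real eta) *C R' x" by(simp only: cay_def)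
 thus "cay (cay' x) = x" unfolding cay'_def by(simp only: diff_add_cancel)
qed

text \<open>The map \<open>kap\<close> takes a point of the circle to the corresponding point of the
 spectrum of \<open>T\<close>; the default value at \<open>z = 1\<close> is harmless, as that point
 has measure zero. On the circle the resolvent is the function \<open>res\<close>.\<close>

definition kap :: "complex => real" where
 "kap z = Re (ie * (z + 1) / (z - 1))"

definition res :: "complex => complex" where
 "res z = (z - 1) / (2 * \<i> * of_real eta)"

lemma kap_measurable [measurable]: "kap : borel_measurable borel"
 unfolding kap_def by measurable

lemma res_measurable [measurable]: "res : borel_measurable borel"
 unfolding res_def by measurable

lemma trig_res: "trig res R"
proof (rule trig_cong)
 show "trig (%z. (1 / (2 * \<i> * of_real eta)) * z powi 1 + (- 1 / (2 * \<i> * of_real eta)) * z powi 0)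
   (%x. (1 / (2 * \<i> * of_real eta)) *C upow 1 x + (- 1 / (2 * \<i> * of_real eta)) *C upow 0 x)" by(intro trig_add trig_monom)
 fix x
 show "(1 / (2 * \<i> * of_real eta)) *C upow 1 x + (- 1 / (2 * \<i> * of_real eta)) *C upow 0 x = R x"
  using eta by(simp add:cay_def scaleC_add_right)
qed (simp_all add: res_def diff_divide_distrib)

lemma kap_res:
 assumes "cmod z = 1"
 shows "cnj (res z) + ie * of_real ((cmod (res z))^2) = of_real (kap z * (cmod (res z))^2)"
  and "z ~= 1 ==> res z * (of_real (kap z) - ie) = 1"
  and "(kap z)^2 * (cmod (res z))^2 <= 1"
proof -
 have main: "res z * (of_real (kap z) - ie) = 1" if "z ~= 1"
 proof -
  let ?w = "ie * (z + 1) / (z - 1)"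
  have zz: "z * cnj z = 1" using assms by(simp add:complex_norm_square[symmetric])
  have "cnj z ~= 1" using that by(metis complex_cnj_cnj complex_cnj_one)
  have "cnj ?w = - ie * (cnj z + 1) / (cnj z - 1)" by simp
  also have "... = - ie * (z * (cnj z + 1)) / (z * (cnj z - 1))"
  proof -
   have "z ~= 0" using assms by auto
   hence "(cnj z + 1) / (cnj z - 1) = (z * (cnj z + 1)) / (z * (cnj z - 1))" by(rule mult_divide_mult_cancel_left[symmetric])
   thus ?thesis by(simp only: times_divide_eq_right[symmetric])
  qed
  also have "... = - ie * (1 + z) / (1 - z)" by(simp only: distrib_left right_diff_distrib zz mult_1_right)
  also have "... = ?w" using that by(simp add:field_simps)
  finally have "of_real (kap z) = ?w" unfolding kap_def by(metis Reals_cnj_iff of_real_Re)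
  hence "of_real (kap z) - ie = ie * ((z + 1) / (z - 1) - 1)" by(simp add:algebra_simps)
  also have "(z + 1) / (z - 1) - 1 = 2 / (z - 1)" using that by(simp add:field_simps)
  finally show ?thesis using that eta by(simp add:res_def field_simps)
 qed
 thus "z ~= 1 ==> res z * (of_real (kap z) - ie) = 1" .
 have n: "(cmod (res z))^2 * ((kap z)^2 + eta^2) = 1" if "z ~= 1"
 proof -
  have "cmod (res z) * cmod (of_real (kap z) - ie) = 1" using main[OF that] by(metis norm_mult norm_one)
  hence "(cmod (res z))^2 * (cmod (of_real (kap z) - ie))^2 = 1" by(metis power_mult_distrib one_power2)
  thus ?thesis by(simp add:cmod_power2)
 qed
 show "(kap z)^2 * (cmod (res z))^2 <= 1"
 proof (cases "z = 1")
  case False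
  have "(kap z)^2 * (cmod (res z))^2 <= (cmod (res z))^2 * ((kap z)^2 + eta^2)" by(simp add:algebra_simps)
  thus ?thesis using n[OF False] by simp
 qed (simp add:res_def)
 show "cnj (res z) + ie * of_real ((cmod (res z))^2) = of_real (kap z * (cmod (res z))^2)"
 proof (cases "z = 1")
  case False
  have "cnj (res z) = cnj (res z) * (res z * (of_real (kap z) - ie))" using main[OF False] by simp
  also have "... = of_real ((cmod (res z))^2) * (of_real (kap z) - ie)" by(simp only: complex_norm_square mult_ac)
  finally have c: "cnj (res z) = of_real ((cmod (res z))^2) * (of_real (kap z) - ie)" .
  show ?thesis by(subst c) (simp add:algebra_simps del: of_real_power)
 qed (simp add:res_def)
qed

lemma calc_one: "calc (indicator {1}) x = 0"
proof -
 let ?y = "calc (indicator {1}) x"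
 have "R ?y = calc (%z. res z * indicator {1} z) x" by(rule calc_trig_mult(2)[symmetric, OF app_indicator trig_res]) simp
 also have "(%z. res z * indicator {1} z) = (%z. 0)" by(auto simp:fun_eq_iff res_def indicator_def)
 also have "calc (%z. 0) x = 0" using calc_trig[OF trig_const[of 0], of x] by simp
 finally have "R ?y = 0" .
 hence "?y = T 0" using R(2)[of ?y] by simp
 also have "T 0 = 0" using T_scale[OF R(1), of 0] by simp
 finally show ?thesis .
qed

text \<open>The spectral measure of \<open>T\<close> is the image of that of its Cayley
 transform.\<close>

definition specE :: "real set => 'a => 'a" where
 "specE S = calc (indicator (kap -` S))"

sublocale E: pvm specE using pvm_calc[OF kap_measurable] by(simp add:specE_def[abs_def])

lemma smeas_specE: "smeas specE x = distr (nu x) borel kap"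
proof (rule measure_eqI)
 interpret finite_measure "nu x" by(rule nu)
 fix S assume "S : sets (smeas specE x)"
 hence S: "S : sets borel" by simp
 have m: "kap -` S : sets borel" using measurable_sets[OF kap_measurable S] by simp
 have "emeasure (smeas specE x) S = ennreal (measure (nu x) (kap -` S))"
  using S m by(simp add:E.emeasure_smeas specE_def norm_calc_indicator)
 also have "... = emeasure (distr (nu x) borel kap) S" using S by(subst emeasure_distr) (auto simp:emeasure_eq_measure)
 finally show "emeasure (smeas specE x) S = emeasure (distr (nu x) borel kap) S" .
qed simp

lemma nu_R: "nu (R w) = density (nu w) (%z. ennreal ((cmod (res z))^2))"
proof (rule measure_eqI)
 have [measurable]: "res : borel_measurable borel" using trig_res by(simp add:trig_def)
 interpret Rw: finite_measure "nu (R w)" by(rule nu)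
 show "sets (nu (R w)) = sets (density (nu w) (%z. ennreal ((cmod (res z))^2)))" by(simp add:nu)
 fix A assume "A : sets (nu (R w))"
 hence A[measurable]: "A : sets borel" by(simp add:nu)
 have "measure (nu (R w)) A = (norm (R (calc (indicator A) w)))^2"
  by(simp add:norm_calc_indicator[symmetric] calc_trig_arg[OF app_indicator trig_res])
 also have "... = (norm (calc (%z. res z * indicator A z) w))^2" by(simp add:calc_trig_mult(2)[OF app_indicator trig_res])
 also have "... = (\<integral>z. (cmod (res z * indicator A z))^2 \<partial>nu w)"
  by(rule calc_norm[OF calc_trig_mult(1)[OF app_indicator[OF A] trig_res]])
 also have "... = (\<integral>z. (cmod (res z))^2 * indicator A z \<partial>nu w)"
  by(intro Bochner_Integration.integral_cong) (auto simp:indicator_def)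
 finally have m: "measure (nu (R w)) A = (\<integral>z. (cmod (res z))^2 * indicator A z \<partial>nu w)" .
 have "integrable (nu w) (%z. (cmod (res z))^2 * indicator A z)"
  by(intro integrable_real_mult_indicator cbm_integrable cbm_norm_sq trig_cbm[OF trig_res]) (simp add:nu)
 hence "(\<integral>\<^sup>+z. ennreal ((cmod (res z))^2 * indicator A z) \<partial>nu w) = ennreal (measure (nu (R w)) A)"
  unfolding m by(rule nn_integral_eq_integral) auto
 thus "emeasure (nu (R w)) A = emeasure (density (nu w) (%z. ennreal ((cmod (res z))^2))) A"
  by(simp add:emeasure_density Rw.emeasure_eq_measure ennreal_mult' ennreal_indicator)
qed

lemma cbm_kap_res: "cbm (%z. (cmod (res z))^2 * (kap z)^2)"
 using kap_res(3) trig_res by(auto simp:cbm_def trig_def mult.commute intro!:exI[where x=1])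

lemma dom_iff: "x : D \<longleftrightarrow> integrable (smeas specE x) (%t. t^2)"
proof
 have [measurable]: "res : borel_measurable borel" using trig_res by(simp add:trig_def)
 assume x: "x : D"
 define w where "w = T x - ie *C x"
 have xw: "x = R w" using R_left[OF x] by(simp add:w_def)
 have "integrable (nu w) (%z. (cmod (res z))^2 *\<^sub>R (kap z)^2)" using cbm_integrable[OF cbm_kap_res, of w] by simp
 hence "integrable (nu x) (%z. (kap z)^2)" unfolding xw nu_R by(subst integrable_density) auto
 thus "integrable (smeas specE x) (%t. t^2)" unfolding smeas_specE by(subst integrable_distr_eq) auto
next
 assume "integrable (smeas specE x) (%t. t^2)"
 hence ik: "integrable (nu x) (%z. (kap z)^2)" unfolding smeas_specE by(subst (asm) integrable_distr_eq) auto
 interpret finite_measure "nu x" by(rule nu)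
 let ?S = "%n::nat. kap -` {- real n..real n}"
 have S[measurable]: "?S n : sets borel" for n using measurable_sets[OF kap_measurable, of "{- real n..real n}"] by simp
 have in_S: "z : ?S n \<longleftrightarrow> \<bar>kap z\<bar> <= real n" for z n by(auto simp:abs_le_iff)
 define f where "f = (%n z. complex_of_real (kap z * indicator (?S n) z) + (- ie) * indicator (?S n) z)"
 have appf: "app (f n)" for n
  unfolding f_def
 proof (intro app_add app_scale app_indicator S)
  show "app (%z. complex_of_real (kap z * indicator (?S n) z))" by(rule app_real[where b="real n"]) (auto simp:in_S indicator_def)
 qed
 define y where "y = (%n. calc (f n) x)"
 have Ry: "R (y n) = specE {- real n..real n} x" for n
 proof -
  have "specE {- real n..real n} x = calc (indicator ((?S n - {1}) \<union> (?S n \<inter> {1}))) x"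
   by(simp add:specE_def Un_Diff_Int)
  also have "... = calc (indicator (?S n - {1})) x + calc (indicator (?S n \<inter> {1})) x" by(rule calc_indicator_Un) auto
  also have "calc (indicator (?S n \<inter> {1})) x = 0"
   using calc_one calc_indicator_empty by(cases "1 : ?S n") (simp_all add: Int_insert_right)
  finally have e: "specE {- real n..real n} x = calc (indicator (?S n - {1})) x" by simp
  have "(norm (calc (%z. res z * f n z) x - calc (indicator (?S n - {1})) x))^2 = err (%z. res z * f n z) (indicator (?S n - {1})) x"
   by(rule calc_err[OF calc_trig_mult(1)[OF appf trig_res] app_indicator]) auto
  also have "... = (\<integral>z. 0 \<partial>nu x)"
   unfolding err_def
  proof (rule integral_cong_AE)
   show "AE z in nu x. (cmod (res z * f n z - indicator (?S n - {1}) z))^2 = 0"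
    using nu(3)
   proof eventually_elim
    case (elim z)
    show ?case
    proof (cases "z = 1")
     case False
     thus ?thesis using kap_res(2)[OF elim] by(cases "z : ?S n") (simp_all add: f_def)
    qed (simp add:res_def)
   qed
   show "(%z. (cmod (res z * f n z - indicator (?S n - {1}) z))^2) : borel_measurable (nu x)"
    using cbm_measurable[OF app_cbm[OF appf]] cbm_measurable[OF trig_cbm[OF trig_res]] by measurable
  qed simp
  finally have "calc (%z. res z * f n z) x = calc (indicator (?S n - {1})) x" by simp
  thus ?thesis using e calc_trig_mult(2)[OF appf trig_res, of n x] by(simp add:y_def)
 qed
 define h where "h = (%n z. ((kap z)^2 + eta^2) * indicator (- ?S n) z)"
 have ih: "integrable (nu x) (h n)" for n
  unfolding h_def using ik by(intro integrable_real_mult_indicator Bochner_Integration.integrable_add) (auto simp:nu)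
 have lim: "(%n. \<integral>z. h n z \<partial>nu x) ----> (\<integral>z. 0 \<partial>nu x)"
 proof (rule integral_dominated_convergence[where w="%z. (kap z)^2 + eta^2"])
  show "AE z in nu x. (%n. h n z) ----> 0"
  proof (rule AE_I2, rule tendsto_eventually)
   fix z
   obtain N where "abs (kap z) <= real N" using real_arch_simple by blast
   thus "\<forall>\<^sub>F n in sequentially. h n z = 0"
    by(intro eventually_sequentiallyI[of N]) (auto simp:h_def in_S simp del:vimage_eq)
  qed
  show "AE z in nu x. norm (h n z) <= (kap z)^2 + eta^2" for n by(auto simp:h_def indicator_def)
  show "integrable (nu x) (%z. (kap z)^2 + eta^2)" using ik by simp
  show "h n : borel_measurable (nu x)" for n using ih by(rule borel_measurable_integrable)
 qed simp
 have bound: "(norm (y i - y j))^2 <= (\<integral>z. h N z \<partial>nu x)" if "i >= N" "j >= N" for i j N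
 proof -
  have "(norm (y i - y j))^2 = err (f i) (f j) x" unfolding y_def by(rule calc_err[OF appf appf])
  also have "... <= (\<integral>z. h N z \<partial>nu x)"
   unfolding err_def
  proof (rule integral_mono)
   fix z
   have e: "f n z = (of_real (kap z) - ie) * indicator (?S n) z" for n by(simp add:f_def indicator_def)
   have "f i z - f j z = (of_real (kap z) - ie) * (indicator (?S i) z - indicator (?S j) z)"
    unfolding e by(simp only: right_diff_distrib)
   hence "(cmod (f i z - f j z))^2 = ((kap z)^2 + eta^2) * (cmod (indicator (?S i) z - indicator (?S j) z))^2"
    by(simp add:norm_mult power_mult_distrib cmod_power2)
   also have "... <= ((kap z)^2 + eta^2) * indicator (- ?S N) z"
   proof (rule mult_left_mono)
    have "z : ?S N ==> z : ?S i & z : ?S j" using that unfolding in_S by force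
    thus "(cmod (indicator (?S i) z - indicator (?S j) z))^2 <= indicator (- ?S N) z"
     by(auto simp:indicator_def simp del:vimage_eq)
   qed simp
   finally show "(cmod (f i z - f j z))^2 <= h N z" by(simp add:h_def)
  qed (auto intro!:ih cbm_integrable cbm_intros app_cbm[OF appf])
  finally show ?thesis .
 qed
 have "Cauchy y"
 proof (rule metric_CauchyI)
  fix r :: real assume "r > 0"
  have "\<forall>\<^sub>F n in sequentially. (\<integral>z. h n z \<partial>nu x) < r^2"
   using order_tendstoD(2)[OF lim, of "r^2"] `r > 0` by simp
  then obtain N where "(\<integral>z. h N z \<partial>nu x) < r^2" by(auto simp:eventually_sequentially)
  hence "norm (y i - y j) < r" if "i >= N" "j >= N" for i j
   using bound[OF that] `r > 0` by(meson le_less_trans power_less_imp_less_base less_imp_le)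
  thus "\<exists>M. \<forall>i\<ge>M. \<forall>j\<ge>M. dist (y i) (y j) < r" by(auto simp:dist_norm)
 qed
 then obtain w where w: "y ----> w" using Cauchy_convergent_iff convergent_def by blast
 have "(%n. R (y n)) ----> R w" by(rule bounded_linear.tendsto[OF bounded_linear_R w])
 moreover have "(%n. R (y n)) ----> x" unfolding Ry by(rule E.E_tendsto_id)
 ultimately have "x = R w" using LIMSEQ_unique by blast
 thus "x : D" using R(1) by simp
qed

lemma form_eq:
 assumes x: "x : D"
 shows "cinner x (T x) = of_real (\<integral>t. t \<partial>smeas specE x)"
proof -
 have [measurable]: "res : borel_measurable borel" using trig_res by(simp add:trig_def)
 define w where "w = T x - ie *C x"
 have xw: "x = R w" using R_left[OF x] by(simp add:w_def)
 have "T x = w + ie *C R w" using xw by(simp add:w_def)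
 hence "cinner x (T x) = cinner (R w) w + ie * cinner (R w) (R w)" by(simp add:xw[symmetric] cinner_add_right)
 also have "... = (\<integral>z. cnj (res z) * 1 \<partial>nu w) + ie * (\<integral>z. cnj (res z) * res z \<partial>nu w)"
  using trig_cinner[OF trig_res trig_const[of 1], of w] trig_cinner[OF trig_res trig_res, of w] by simp
 also have "... = (\<integral>z. cnj (res z) + ie * (cnj (res z) * res z) \<partial>nu w)"
  by(subst Bochner_Integration.integral_add)
   (auto intro!:cbm_integrable cbm_intros trig_cbm[OF trig_res])
 also have "... = (\<integral>z. complex_of_real ((cmod (res z))^2 *\<^sub>R kap z) \<partial>nu w)"
 proof (rule integral_cong_AE)
  show "AE z in nu w. cnj (res z) + ie * (cnj (res z) * res z) = complex_of_real ((cmod (res z))^2 *\<^sub>R kap z)"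
   using nu(3)
  proof eventually_elim
   case (elim z)
   have "cnj (res z) * res z = of_real ((cmod (res z))^2)" by(simp only: complex_norm_square mult.commute)
   thus ?case using kap_res(1)[OF elim] by(simp only: real_scaleR_def mult.commute)
  qed
 qed measurable
 also have "... = of_real (\<integral>z. (cmod (res z))^2 *\<^sub>R kap z \<partial>nu w)" by(rule integral_complex_of_real)
 also have "(\<integral>z. (cmod (res z))^2 *\<^sub>R kap z \<partial>nu w) = (\<integral>z. kap z \<partial>nu x)"
  unfolding xw nu_R by(subst integral_density) auto
 also have "... = (\<integral>t. t \<partial>smeas specE x)" unfolding smeas_specE by(subst integral_distr) auto
 finally show ?thesis .
qed

theorem spectral_theorem: "spectral specE D T" by unfold_locales
  (use dom_iff form_eq D_add D_scale T_add T_scale in auto)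

end

section \<open>Measurable dependence on moments\<close>

text \<open>A family of measures on the circle depends measurably on a parameter as soon as its
 moments do.\<close>

lemma measurable_from_moments:
 fixes m :: "'w => complex measure" and c :: "int => 'w => complex"
 assumes m: "!!w. sets (m w) = sets borel" "!!w. finite_measure (m w)" "!!w. AE z in m w. cmod z = 1"
  and c[measurable]: "!!n. c n : borel_measurable M"
  and mc: "!!n w. (\<integral>z. z powi n \<partial>m w) = c n w"
  and "S : sets borel"
  and triv: "unitary (%x::'h::complex_hilbert. x) (%x. x)"
 shows "(%w. measure (m w) S) : borel_measurable M"
proof -
 interpret u: unitary "%x::'h::complex_hilbert. x" "%x. x" by(rule triv)
 note [measurable_cong] = m(1)
 have sp: "space (m w) = UNIV" for w using sets_eq_imp_space_eq[OF m(1)] by simp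
 have fin: "finite_measure (m w)" for w by(rule m)
 have ib: "integrable (m w) f" if "f : borel_measurable borel" "!!z. cmod z = 1 ==> norm (f z) <= b"
  for w and b :: real and f :: "complex => complex"
 proof (rule finite_measure.integrable_const_bound[OF fin, where B=b])
  show "AE z in m w. norm (f z) <= b" using m(3)[of w] by eventually_elim (rule that)
 qed (use that in simp)
 have tot: "(%w. measure (m w) UNIV) : borel_measurable M"
 proof -
  have "measure (m w) UNIV = Re (c 0 w)" for w using mc[of w 0] sp[of w] by(simp add:sp complex_eq_iff)
  thus ?thesis by simp
 qed
 have cont: "(%w. \<integral>z. f z \<partial>m w) : borel_measurable M"
  if f: "continuous_on UNIV f" and b: "!!z. abs (f z) <= b" for f :: "complex => real" and b
 proof -
  have "\<exists>F a. finite F & (\<forall>z. cmod z = 1 --> cmod ((\<Sum>n\<in>F. a n * z powi n) - of_real (f z)) < 1 / (real N + 1))" for N :: nat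
  proof -
   obtain p P where p: "u.trig p P" "!!z. cmod z = 1 ==> cmod (p z - complex_of_real (f z)) < 1 / (real N + 1)"
    by(rule u.trig_uniform[OF f, of "1 / (real N + 1)"]) auto
   thus ?thesis unfolding u.trig_def by metis
  qed
  then obtain F a where F: "!!N. finite (F N)"
   and a: "!!N z. cmod z = 1 ==> cmod ((\<Sum>n\<in>F N. a N n * z powi n) - of_real (f z)) < 1 / (real N + 1)"
   by metis
  have [measurable]: "f : borel_measurable borel" using f by(rule borel_measurable_continuous_onI)
  have if_: "integrable (m w) (%z. complex_of_real (f z))" for w by(rule ib[where b=b]) (use b in auto)
  have iz: "integrable (m w) (%z. k * z powi n)" for w n and k :: complex
   by(rule ib[where b="cmod k"]) (auto simp:norm_mult norm_power_int)
  have conv: "(%N. \<Sum>n\<in>F N. a N n * c n w) ----> complex_of_real (\<integral>z. f z \<partial>m w)" for w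
  proof (rule LIMSEQ_I)
   interpret finite_measure "m w" by(rule m)
   fix r :: real assume "r > 0"
   define K where "K = measure (m w) UNIV + 1"
   have "K > 0" by(simp add:K_def add_nonneg_pos)
   obtain N0 where N0: "inverse (real (Suc N0)) < r / K" using reals_Archimedean[of "r / K"] `r > 0` `K > 0` by auto
   have "norm ((\<Sum>n\<in>F N. a N n * c n w) - complex_of_real (\<integral>z. f z \<partial>m w)) < r" if "N >= N0" for N
   proof -
    have "(\<Sum>n\<in>F N. a N n * c n w) = (\<integral>z. (\<Sum>n\<in>F N. a N n * z powi n) \<partial>m w)"
     using iz by(simp add:Bochner_Integration.integral_sum mc)
    hence "(\<Sum>n\<in>F N. a N n * c n w) - complex_of_real (\<integral>z. f z \<partial>m w) = (\<integral>z. (\<Sum>n\<in>F N. a N n * z powi n) - complex_of_real (f z) \<partial>m w)"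
     using iz if_ by(simp add:Bochner_Integration.integral_diff integral_complex_of_real)
    also have "norm ... <= (\<integral>z. 1 / (real N + 1) \<partial>m w)"
    proof (rule order_trans[OF integral_norm_bound integral_mono_AE])
     show "integrable (m w) (%z. norm ((\<Sum>n\<in>F N. a N n * z powi n) - complex_of_real (f z)))"
      by(intro integrable_norm Bochner_Integration.integrable_diff Bochner_Integration.integrable_sum iz if_)
     show "AE z in m w. norm ((\<Sum>n\<in>F N. a N n * z powi n) - complex_of_real (f z)) <= 1 / (real N + 1)"
      using m(3)[of w] by eventually_elim (rule less_imp_le[OF a])
    qed simp
    also have "... <= K * (1 / (real N + 1))" by(simp add:sp K_def divide_right_mono)
    also have "... <= K * inverse (real (Suc N0))"
     using `K > 0` that by(intro mult_left_mono) (auto simp:inverse_eq_divide intro!:divide_left_mono)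
    also have "... < K * (r / K)" using N0 `K > 0` by(rule mult_strict_left_mono)
    also have "... = r" using `K > 0` by simp
    finally show ?thesis .
   qed
   thus "\<exists>N0. \<forall>N\<ge>N0. norm ((\<Sum>n\<in>F N. a N n * c n w) - complex_of_real (\<integral>z. f z \<partial>m w)) < r" by blast
  qed
  have "(%w. complex_of_real (\<integral>z. f z \<partial>m w)) : borel_measurable M"
   by(rule borel_measurable_LIMSEQ_metric[OF _ conv]) measurable
  hence "(%w. Re (complex_of_real (\<integral>z. f z \<partial>m w))) : borel_measurable M" by measurable
  thus ?thesis by simp
 qed
 have closed: "(%w. measure (m w) C) : borel_measurable M" if "closed C" for C
 proof (cases "C = {}")
  case False
  have [measurable]: "C : sets borel" using that by simp
  have [measurable]: "ramp C n : borel_measurable borel" for n by(rule borel_measurable_continuous_onI[OF ramp(1)])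
  have conv: "(%n. \<integral>z. ramp C n z \<partial>m w) ----> measure (m w) C" for w
  proof -
   interpret finite_measure "m w" by(rule m)
   have "(%n. \<integral>z. ramp C n z \<partial>m w) ----> (\<integral>z. indicator C z \<partial>m w)"
    by(rule integral_dominated_convergence[where w="%_. 1"]) (use ramp(2,3) ramp_tendsto[OF that False] in auto)
   thus ?thesis by(simp add:sp)
  qed
  show ?thesis by(rule borel_measurable_LIMSEQ_metric[OF _ conv], rule cont[OF ramp(1), where b=1]) (use ramp(2,3) in simp)
 qed simp
 have b: "sets (borel :: complex measure) = sigma_sets UNIV {S. closed S}" by(simp add:borel_eq_closed)
 have "Int_stable {S::complex set. closed S}" by(auto simp:Int_stable_def)
 moreover have "{S::complex set. closed S} \<subseteq> Pow UNIV" by auto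
 moreover have "S : sigma_sets UNIV {S. closed S}" using `S : sets borel` b by simp
 ultimately show ?thesis
 proof (induction rule: sigma_sets_induct_disjoint)
  case (compl A)
  hence A: "A : sets borel" using b by simp
  have "measure (m w) (UNIV - A) = measure (m w) UNIV - measure (m w) A" for w
   using finite_measure.finite_measure_compl[OF m(2), of A w] A by(simp add:sp m(1))
  thus ?case using compl(2) tot by simp
 next
  case (union A)
  hence A: "A i : sets borel" for i using b by auto
  have "(%i. measure (m w) (A i)) sums measure (m w) (\<Union>i. A i)" for w
   by(rule finite_measure.finite_measure_UNION[OF m(2)]) (use union A m(1) in auto)
  hence "measure (m w) (\<Union>i. A i) = (\<Sum>i. measure (m w) (A i))" for w by(simp add:sums_unique)
  thus ?case using union(3) by simp
 qed (use closed in auto)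
qed

section \<open>The Hamiltonian as a self-adjoint operator\<close>

text \<open>The inner product on the fibre.\<close>

definition vdot :: "complex ^ 'k => complex ^ 'k => complex" where
 "vdot x y = (\<Sum>i\<in>UNIV. cnj (x $ i) * y $ i)"

lemma vdot_self: "vdot x x = of_real ((norm x)^2)"
 unfolding vdot_def norm_vec_def L2_set_def
 by(simp add:sum_nonneg del: of_real_power) (simp only: complex_norm_square mult.commute)

lemma vdot_adjoint: "vdot x (M *v y) = vdot (conj_transpose M *v x) y"
proof -
 have "vdot x (M *v y) = (\<Sum>i\<in>UNIV. \<Sum>j\<in>UNIV. cnj (x $ i) * (M $ i $ j * y $ j))"
  by(simp add:vdot_def matrix_vector_mult_def sum_distrib_left)
 also have "... = (\<Sum>j\<in>UNIV. \<Sum>i\<in>UNIV. cnj (x $ i) * (M $ i $ j * y $ j))" by(rule sum.swap)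
 also have "... = vdot (conj_transpose M *v x) y"
  by(simp add:vdot_def matrix_vector_mult_def conj_transpose_def sum_distrib_left sum_distrib_right mult_ac)
 finally show ?thesis .
qed

lemma vdot_commute: "vdot y x = cnj (vdot x y)"
 by(simp add:vdot_def mult.commute)

lemma vdot_add_right: "vdot x (y + z) = vdot x y + vdot x z"
 and vdot_scale_right: "vdot x (c *s y) = c * vdot x y"
 and vdot_diff_right: "vdot x (y - z) = vdot x y - vdot x z"
 by(simp_all add: vdot_def distrib_left right_diff_distrib sum.distrib sum_subtractf sum_distrib_left mult_ac)

lemma cmod_vdot_le: "cmod (vdot x y) <= norm x * norm y"
proof -
 have "cmod (vdot x y) <= (\<Sum>i\<in>UNIV. norm (x $ i) * norm (y $ i))"
  unfolding vdot_def by(rule order_trans[OF norm_sum]) (simp add:norm_mult)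
 also have "... <= L2_set (%i. norm (x $ i)) UNIV * L2_set (%i. norm (y $ i)) UNIV"
  by(rule order_trans[OF _ L2_set_mult_ineq]) simp
 finally show ?thesis by(simp add:norm_vec_def)
qed

lemma norm_matrix_vector_le: "norm (M *v x) <= mat_norm M * norm (x :: complex ^ 'k)"
 unfolding mat_norm_def by(rule onorm[OF matrix_vector_mul_bounded_linear])

lemma mat_norm_nonneg: "mat_norm M >= 0"
 unfolding mat_norm_def by(rule onorm_pos_le[OF matrix_vector_mul_bounded_linear])

lemma mat_norm_leI: "(!!x. norm (M *v x) <= b * norm x) ==> mat_norm M <= b"
 unfolding mat_norm_def by(rule onorm_le)

lemma hermitian_shift_lower:
 assumes "hermitian M"
 shows "abs (Im z) * norm x <= norm (M *v x - z *s x)"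
proof -
 have "vdot x (M *v x) = cnj (vdot x (M *v x))" using vdot_adjoint[of x M x] assms vdot_commute by(metis hermitian_def)
 hence im: "Im (vdot x (M *v x)) = 0" by(simp add:complex_eq_iff)
 have "vdot x (M *v x - z *s x) = vdot x (M *v x) - z * of_real ((norm x)^2)"
  by(simp add:vdot_diff_right vdot_scale_right vdot_self del: of_real_power)
 hence "abs (Im z) * (norm x)^2 = abs (Im (vdot x (M *v x - z *s x)))" using im by(simp add:abs_mult del: of_real_power)
 also have "... <= norm x * norm (M *v x - z *s x)" by(rule order_trans[OF abs_Im_le_cmod cmod_vdot_le])
 finally show ?thesis by(cases "norm x = 0") (auto simp:power2_eq_square mult.commute)
qed

text \<open>The inverse of \<open>M - z\<close>; used for nonreal \<open>z\<close> and Hermitian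
 \<open>M\<close>, where it exists.\<close>

definition shift_inv :: "complex ^ 'k ^ 'k => complex => complex ^ 'k ^ 'k" where
 "shift_inv M z = matrix_inv (M - mat z)"

lemma mat_mult_vec: "mat z *v x = z *s (x :: complex ^ 'k)"
 by(simp add:vec_eq_iff matrix_vector_mult_def mat_def if_distrib[of "%c. c * _"] cong: if_cong)

lemma shift_inv:
 assumes "hermitian M" "Im z ~= 0"
 shows "M *v (shift_inv M z *v x) - z *s (shift_inv M z *v x) = x"
  and "shift_inv M z *v (M *v x - z *s x) = x"
  and "norm (shift_inv M z *v x) <= norm x / abs (Im z)"
proof -
 have e: "(M - mat z) *v x = M *v x - z *s x" for x by(simp add:matrix_vector_mult_diff_rdistrib mat_mult_vec)
 have "x = 0" if "(M - mat z) *v x = 0" for x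
  using hermitian_shift_lower[OF assms(1), of z x] that assms(2) by(simp add:e mult_le_0_iff)
 hence "invertible (M - mat z)" unfolding invertible_left_inverse matrix_left_invertible_ker by blast
 hence i: "(M - mat z) ** shift_inv M z = mat 1" "shift_inv M z ** (M - mat z) = mat 1"
  unfolding shift_inv_def matrix_inv_def invertible_def by(metis (mono_tags, lifting) someI_ex)+
 show 1: "M *v (shift_inv M z *v x) - z *s (shift_inv M z *v x) = x" for x
  using arg_cong[OF i(1), of "%N. N *v x"] by(simp add:e matrix_vector_mul_assoc[symmetric])
 show "shift_inv M z *v (M *v x - z *s x) = x"
  using arg_cong[OF i(2), of "%N. N *v x"] by(simp add:e matrix_vector_mul_assoc[symmetric])
 show "norm (shift_inv M z *v x) <= norm x / abs (Im z)"
  using hermitian_shift_lower[OF assms(1), of z "shift_inv M z *v x"] assms(2) by(simp add:1 field_simps)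
qed

lemma adjacent_iff_shift: "adjacent n m \<longleftrightarrow> adjacent 0 (m - n)"
 by(simp add:adjacent_def l1_dist_def abs_minus_commute)

lemma adjacent_sym: "adjacent m n \<longleftrightarrow> adjacent n m"
 by(simp add:adjacent_def l1_dist_def abs_minus_commute)

lemma adjacent_0_minus: "adjacent 0 (- e) \<longleftrightarrow> adjacent 0 e"
 by(simp add:adjacent_def l1_dist_def)

lemma sum_adjacent_shift: "(\<Sum>m\<in>{m. adjacent n m}. f m) = (\<Sum>e\<in>{e. adjacent 0 e}. f (n + e))"
 by(rule sum.reindex_bij_witness[where j="%m. m - n" and i="%e. n + e"])
  (auto simp:adjacent_iff_shift[of n])

lemma mult_scale: "M *v (c *s x) = c *s (M *v (x :: complex ^ 'k))"
 by(simp add:vec_eq_iff matrix_vector_mult_def sum_distrib_left mult_ac)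

text \<open>The data of the Hamiltonian. The constant \<open>CK\<close> bounds the hopping
 matrices.\<close>

locale hamil =
 fixes A B :: "complex ^ 'k::finite ^ 'k" and K :: "int ^ 'd::finite => complex ^ 'k ^ 'k" and g CK :: real
 assumes hA: "hermitian A" and hB: "hermitian B"
  and K_adj: "adjacent m n ==> K (n - m) = conj_transpose (K (m - n))"
  and K_bd: "adjacent m n ==> mat_norm (K (m - n)) <= CK"
  and g: "g > 0"
begin

text \<open>The block of the Hamiltonian at a site where the field has the value
 \<open>r\<close>.\<close>

definition pot :: "real => complex ^ 'k ^ 'k" where
 "pot r = r *\<^sub>R A + B"

lemma hermitian_pot: "hermitian (pot r)"
 using hA hB by(simp add:pot_def hermitian_def conj_transpose_def vec_eq_iff)

lemma K_minus: "adjacent 0 e ==> K (- e) = conj_transpose (K e)"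
 using K_adj[of 0 "- e"] K_adj[of e 0] by(simp add:adjacent_sym)

lemma K_bd': "adjacent 0 e ==> mat_norm (K e) <= max CK 0"
 using K_bd[of e 0] by(simp add:adjacent_sym)

lemma K_norm: "adjacent 0 e ==> norm (K e *v x) <= max CK 0 * norm x"
 using norm_matrix_vector_le[of "K e" x] K_bd' by(meson mult_right_mono norm_ge_zero order_trans)

text \<open>The contribution of one lattice direction to the hopping term.\<close>

lemma shift_in_ell2:
 assumes "adjacent 0 e"
 shows "(%n. K (- e) *v fld phi (n + e)) : ell2"
  and "norm (mk_l2 (%n. K (- e) *v fld phi (n + e))) <= max CK 0 * norm phi"
proof -
 let ?c = "max CK 0"
 have b: "(\<Sum>n\<in>F. (norm (K (- e) *v fld phi (n + e)))^2) <= (?c * norm phi)^2" if "finite F" for F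
 proof -
  have "(\<Sum>n\<in>F. (norm (K (- e) *v fld phi (n + e)))^2) <= (\<Sum>n\<in>F. (?c * norm (fld phi (n + e)))^2)"
   using K_norm[of "- e"] assms by(intro sum_mono power_mono) (auto simp:adjacent_0_minus)
  also have "... = ?c^2 * (\<Sum>n\<in>F. (norm (fld phi (n + e)))^2)" by(simp add:power_mult_distrib sum_distrib_left)
  also have "(\<Sum>n\<in>F. (norm (fld phi (n + e)))^2) = (\<Sum>n\<in>(%n. n + e) ` F. (norm (fld phi n))^2)"
   by(subst sum.reindex) (auto simp:inj_on_def)
  also have "... <= (norm phi)^2" by(rule sum_norm_fld_le) (use that in simp)
  finally show ?thesis by(simp add:power_mult_distrib mult_left_mono)
 qed
 show "(%n. K (- e) *v fld phi (n + e)) : ell2" by(rule ell2_boundI(1)[OF b])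
 show "norm (mk_l2 (%n. K (- e) *v fld phi (n + e))) <= ?c * norm phi" using ell2_boundI(2)[OF b] by simp
qed

definition hopdir :: "int ^ 'd => ('d, 'k) l2 => ('d, 'k) l2" where
 "hopdir e phi = mk_l2 (%n. K (- e) *v fld phi (n + e))"

lemma fld_hopdir: "adjacent 0 e ==> fld (hopdir e phi) = (%n. K (- e) *v fld phi (n + e))"
 unfolding hopdir_def by(rule mk_l2_inverse[OF shift_in_ell2(1)])

text \<open>The hopping term.\<close>

definition hop :: "('d, 'k) l2 => ('d, 'k) l2" where
 "hop phi = inverse g *\<^sub>R (\<Sum>e\<in>{e. adjacent 0 e}. hopdir e phi)"

text \<open>A bound for the norm of the hopping term.\<close>

definition tau :: real where
 "tau = inverse g * (real (card {e :: int ^ 'd. adjacent 0 e}) * max CK 0)"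

lemma fld_hop: "fld (hop phi) n = inverse g *\<^sub>R (\<Sum>m\<in>{m. adjacent n m}. K (n - m) *v fld phi m)"
 unfolding sum_adjacent_shift[of _ n] by(simp add:hop_def scaleR_l2.rep_eq fld_sum fld_hopdir)

lemma norm_hop: "norm (hop phi) <= tau * norm phi"
proof -
 have "norm (\<Sum>e\<in>{e. adjacent 0 e}. hopdir e phi) <= (\<Sum>e\<in>{e :: int^'d. adjacent 0 e}. max CK 0 * norm phi)"
  by(rule order_trans[OF norm_sum sum_mono]) (simp add:hopdir_def shift_in_ell2)
 hence "inverse g * norm (\<Sum>e\<in>{e. adjacent 0 e}. hopdir e phi) <= inverse g * (\<Sum>e\<in>{e :: int^'d. adjacent 0 e}. max CK 0 * norm phi)"
  using g by(intro mult_left_mono) auto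
 thus ?thesis using g by(simp add:hop_def tau_def mult.assoc)
qed

lemma tau_nonneg: "tau >= 0"
 using g by(simp add:tau_def)

lemma fld_eqI: "(!!n. fld phi n = fld psi n) ==> phi = psi"
 using fld_inject by blast

lemma lin_hop: "clinear_map hop"
 unfolding clinear_map_def
proof (intro conjI allI fld_eqI)
 fix phi psi :: "('d, 'k) l2" and c n
 show "fld (hop (phi + psi)) n = fld (hop phi + hop psi) n"
  by(simp add:fld_hop plus_l2.rep_eq matrix_vector_right_distrib sum.distrib scaleR_add_right)
 show "fld (hop (c *C phi)) n = fld (c *C hop phi) n"
  unfolding fld_hop scaleC_l2.rep_eq mult_scale by(simp add:vec_eq_iff sum_distrib_left mult.left_commute scaleR_conv_of_real)
qed

lemma cinner_hop: "cinner phi (hop psi) = cinner (hop phi) psi"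
proof -
 have dir: "cinner phi (hopdir e psi) = cinner (hopdir (- e) phi) psi" if e: "adjacent 0 e" for e
 proof -
  have e': "adjacent 0 (- e)" using e by(simp add:adjacent_0_minus)
  have "cinner phi (hopdir e psi) = (\<Sum>\<^sub>\<infinity>n. vdot (fld phi n) (K (- e) *v fld psi (n + e)))"
   unfolding cinner_l2 ell2_inner_def fld_hopdir[OF e] vdot_def ..
  also have "... = (\<Sum>\<^sub>\<infinity>n. (%m. vdot (K e *v fld phi (m - e)) (fld psi m)) (n + e))"
   by(simp add:vdot_adjoint K_minus[OF e', simplified])
  also have "... = (\<Sum>\<^sub>\<infinity>m. vdot (K e *v fld phi (m - e)) (fld psi m))"
   by(rule infsum_reindex_bij_betw) (rule bij_betwI[where g="%m. m - e"], auto)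
  also have "... = cinner (hopdir (- e) phi) psi" unfolding cinner_l2 ell2_inner_def fld_hopdir[OF e'] vdot_def by simp
  finally show ?thesis .
 qed
 have "cinner phi (hop psi) = inverse g * (\<Sum>e\<in>{e. adjacent 0 e}. cinner (hopdir (- e) phi) psi)"
  by(simp add:hop_def scaleR_scaleC cinner_sum_right dir)
 also have "(\<Sum>e\<in>{e. adjacent 0 e}. cinner (hopdir (- e) phi) psi) = (\<Sum>e\<in>{e. adjacent 0 e}. cinner (hopdir e phi) psi)"
  by(rule sum.reindex_bij_witness[where i=uminus and j=uminus]) (auto simp:adjacent_0_minus)
 also have "inverse g * ... = cinner (hop phi) psi" by(simp add:hop_def scaleR_scaleC cinner_sum_left)
 finally show ?thesis .
qed

context
 fixes u :: "int ^ 'd => real"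
begin

abbreviation ham :: "('d, 'k) field_config => ('d, 'k) field_config" where
 "ham \<equiv> hamiltonian A B K g u"

text \<open>The Hamiltonian and its maximal domain, on the type of square-summable functions.\<close>

definition domH :: "('d, 'k) l2 set" where
 "domH = {phi. ham (fld phi) : ell2}"

definition opH :: "('d, 'k) l2 => ('d, 'k) l2" where
 "opH phi = mk_l2 (ham (fld phi))"

lemma ham_eq: "ham (fld phi) n = pot (u n) *v fld phi n + fld (hop phi) n"
 by(simp add:hamiltonian_def pot_def fld_hop)

lemma fld_opH: "phi : domH ==> fld (opH phi) n = pot (u n) *v fld phi n + fld (hop phi) n"
 by(simp add:opH_def domH_def mk_l2_inverse ham_eq)

lemma opHI:
 assumes "!!n. pot (u n) *v fld phi n + fld (hop phi) n = fld psi n"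
 shows "phi : domH" "opH phi = psi"
proof -
 have "ham (fld phi) = fld psi" using assms by(simp add:fun_eq_iff ham_eq)
 thus "phi : domH" "opH phi = psi" by(simp_all add: domH_def opH_def fld fld_inverse)
qed

lemma opH_add: assumes "phi : domH" "psi : domH" shows "phi + psi : domH" "opH (phi + psi) = opH phi + opH psi"
proof -
 have "pot (u n) *v fld (phi + psi) n + fld (hop (phi + psi)) n = fld (opH phi + opH psi) n" for n
  using assms by(simp add:plus_l2.rep_eq fld_opH clinear_mapD[OF lin_hop] matrix_vector_right_distrib)
 from opHI[OF this] show "phi + psi : domH" "opH (phi + psi) = opH phi + opH psi" .
qed

lemma opH_scale: assumes "phi : domH" shows "c *C phi : domH" "opH (c *C phi) = c *C opH phi"
proof -
 have "pot (u n) *v fld (c *C phi) n + fld (hop (c *C phi)) n = fld (c *C opH phi) n" for n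
  using assms by(simp add:scaleC_l2.rep_eq fld_opH clinear_mapD[OF lin_hop] mult_scale vector_add_ldistrib)
 from opHI[OF this] show "c *C phi : domH" "opH (c *C phi) = c *C opH phi" .
qed

lemma opH_sym:
 assumes "phi : domH" "psi : domH"
 shows "cinner phi (opH psi) = cinner (opH phi) psi"
proof -
 have 1: "fld (opH zt - hop zt) n = pot (u n) *v fld zt n" if "zt : domH" for zt n using that by(simp add:fld_minus fld_opH)
 have "cinner phi (opH psi - hop psi) = (\<Sum>\<^sub>\<infinity>n. vdot (fld phi n) (pot (u n) *v fld psi n))"
  unfolding cinner_l2 ell2_inner_def 1[OF assms(2)] vdot_def ..
 also have "... = (\<Sum>\<^sub>\<infinity>n. vdot (pot (u n) *v fld phi n) (fld psi n))"
  using hermitian_pot by(simp add:vdot_adjoint hermitian_def)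
 also have "... = cinner (opH phi - hop phi) psi"
  unfolding cinner_l2 ell2_inner_def 1[OF assms(1)] vdot_def ..
 finally show ?thesis by(simp add:cinner_diff_left cinner_diff_right cinner_hop)
qed

text \<open>The resolvent far from the real axis, by a Neumann series around the potential term.\<close>

definition potres :: "complex => ('d, 'k) l2 => ('d, 'k) l2" where
 "potres z phi = mk_l2 (%n. shift_inv (pot (u n)) z *v fld phi n)"

lemma fld_potres: "Im z ~= 0 ==> fld (potres z phi) n = shift_inv (pot (u n)) z *v fld phi n"
proof -
 assume z: "Im z ~= 0"
 have "(%n. shift_inv (pot (u n)) z *v fld phi n) : ell2" by(rule ell2_bounded_image[OF fld, where c="1 / abs (Im z)"])
   (use shift_inv(3)[OF hermitian_pot z] in simp)
 thus ?thesis by(simp add:potres_def mk_l2_inverse)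
qed

lemma norm_potres: "Im z ~= 0 ==> norm (potres z phi) <= norm phi / abs (Im z)"
proof -
 assume z: "Im z ~= 0"
 have "(\<Sum>n\<in>F. (norm (fld (potres z phi) n))^2) <= (norm phi / abs (Im z))^2" if "finite F" for F
 proof -
  have "(\<Sum>n\<in>F. (norm (fld (potres z phi) n))^2) <= (\<Sum>n\<in>F. (norm (fld phi n) / abs (Im z))^2)"
   unfolding fld_potres[OF z] by(intro sum_mono power_mono shift_inv(3) hermitian_pot z) simp
  also have "... = (\<Sum>n\<in>F. (norm (fld phi n))^2) / abs (Im z)^2" by(simp add:power_divide sum_divide_distrib)
  also have "... <= (norm phi)^2 / abs (Im z)^2" by(intro divide_right_mono sum_norm_fld_le that) simp
  finally show ?thesis by(simp add:power_divide)
 qed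
 from ell2_boundI(2)[OF this] show ?thesis by(simp add:fld_inverse)
qed

lemma lin_potres: "Im z ~= 0 ==> clinear_map (potres z)"
 unfolding clinear_map_def
 by(auto intro!:fld_eqI simp: fld_potres plus_l2.rep_eq scaleC_l2.rep_eq matrix_vector_right_distrib mult_scale)

text \<open>With \<open>potres z\<close> the resolvent of the potential term, the resolvent of the
 Hamiltonian is \<open>potres z\<close> composed with the sum of the powers of \<open>neu z\<close>,
 which converges for \<open>tau < \<bar>Im z\<bar>\<close>.\<close>

definition neu :: "complex => ('d, 'k) l2 => ('d, 'k) l2" where
 "neu z phi = - hop (potres z phi)"

definition resH :: "complex => ('d, 'k) l2 => ('d, 'k) l2" where
 "resH z phi = potres z (\<Sum>j. (neu z ^^ j) phi)"

context
 fixes z :: complex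
 assumes z: "tau < abs (Im z)"
begin

lemma Im_nz: "Im z ~= 0" using z tau_nonneg by auto

lemma norm_neu_pow: "norm ((neu z ^^ j) phi) <= (tau / abs (Im z)) ^ j * norm phi"
proof (induction j)
 case (Suc j)
 have "norm (neu z ((neu z ^^ j) phi)) <= tau * (norm ((neu z ^^ j) phi) / abs (Im z))"
  unfolding neu_def norm_minus_cancel using norm_hop norm_potres[OF Im_nz] tau_nonneg by(meson mult_left_mono order_trans)
 also have "... <= tau * ((tau / abs (Im z)) ^ j * norm phi / abs (Im z))"
  using Suc tau_nonneg by(intro mult_left_mono divide_right_mono) auto
 finally show ?case by(simp add:mult_ac)
qed simp

lemma neu_summable: "summable (%j. (neu z ^^ j) phi)"
proof (rule summable_comparison_test')
 show "summable (%j. (tau / abs (Im z)) ^ j * norm phi)" by(intro summable_mult2 summable_geometric) (use z tau_nonneg in simp)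
 show "norm ((neu z ^^ j) phi) <= (tau / abs (Im z)) ^ j * norm phi" for j by(rule norm_neu_pow)
qed

lemma lin_neu: "clinear_map (neu z)"
 using lin_hop lin_potres[OF Im_nz] by(simp add:clinear_map_def neu_def)

lemma bl_neu: "bounded_linear (neu z)"
 by(rule bounded_linear_intro[where K="tau / abs (Im z)"])
  (use norm_neu_pow[of 1] in \<open>auto simp:clinear_mapD[OF lin_neu] mult.commute\<close>)

lemma resH: "resH z phi : domH" "opH (resH z phi) - z *C resH z phi = phi"
proof -
 let ?s = "\<Sum>j. (neu z ^^ j) phi"
 have "?s = phi + (\<Sum>j. (neu z ^^ Suc j) phi)" using suminf_split_head[OF neu_summable] by(simp add:algebra_simps)
 also have "(\<Sum>j. (neu z ^^ Suc j) phi) = neu z ?s" using bounded_linear.suminf[OF bl_neu neu_summable] by simp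
 also have "neu z ?s = - hop (potres z ?s)" by(rule neu_def)
 finally have s: "?s = phi + - hop (potres z ?s)" .
 have "pot (u n) *v fld (resH z phi) n + fld (hop (resH z phi)) n = fld (phi + z *C resH z phi) n" for n
 proof -
  have "pot (u n) *v fld (resH z phi) n - z *s fld (resH z phi) n = fld ?s n"
   unfolding resH_def fld_potres[OF Im_nz] by(rule shift_inv(1)[OF hermitian_pot Im_nz])
  also have "... = fld phi n - fld (hop (resH z phi)) n" unfolding resH_def by(subst s) (simp add:fld_minus)
  finally show ?thesis by(simp add:plus_l2.rep_eq scaleC_l2.rep_eq algebra_simps)
 qed
 from opHI[OF this] show "resH z phi : domH" "opH (resH z phi) - z *C resH z phi = phi" by simp_all
qed

end

lemma self_adjoint_opH:
 assumes "eta > tau"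
 shows "self_adjoint domH opH eta (resH (\<i> * of_real eta)) (resH (- (\<i> * of_real eta)))"
proof
 show "eta > 0" using assms tau_nonneg by simp
 have a: "tau < abs (Im (\<i> * of_real eta))" "tau < abs (Im (- (\<i> * of_real eta)))" using assms tau_nonneg by auto
 fix x
 show "resH (\<i> * of_real eta) x : domH" "opH (resH (\<i> * of_real eta) x) - (\<i> * of_real eta) *C resH (\<i> * of_real eta) x = x"
  by(rule resH[OF a(1)])+
 show "resH (- (\<i> * of_real eta)) x : domH" "opH (resH (- (\<i> * of_real eta)) x) + (\<i> * of_real eta) *C resH (- (\<i> * of_real eta)) x = x"
  using resH[OF a(2), of x] by simp_all
qed (auto simp:opH_add opH_scale opH_sym)

end

end

section \<open>Spectral projections of the Hamiltonian\<close>

lemma mk_l2_add: "phi : ell2 ==> psi : ell2 ==> mk_l2 (%n. phi n + psi n) = mk_l2 phi + mk_l2 psi"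
 by(rule fld_inject[THEN iffD1]) (simp add:mk_l2_inverse plus_l2.rep_eq ell2_add)

lemma mk_l2_scale: "psi : ell2 ==> mk_l2 (%n. c *s psi n) = c *C mk_l2 psi"
 by(rule fld_inject[THEN iffD1]) (simp add:mk_l2_inverse scaleC_l2.rep_eq ell2_scale)

lemma ell2_inner_mk: "phi : ell2 ==> psi : ell2 ==> ell2_inner phi psi = cinner (mk_l2 phi) (mk_l2 psi)"
 by(simp add:cinner_l2 mk_l2_inverse)

context hamil
begin

abbreviation hdom :: "(int ^ 'd => real) => ('d, 'k) field_config set" where
 "hdom u \<equiv> hamiltonian_domain A B K g u"

abbreviation hproj :: "(int ^ 'd => real) => real set => ('d, 'k) operator" where
 "hproj u \<equiv> hamiltonian_projection A B K g u"

lemma hdom_eq: "hdom u = fld ` domH u"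
proof -
 have "psi : fld ` domH u" if "psi : ell2" "hamiltonian A B K g u psi : ell2" for psi
  using that by(intro image_eqI[where x="mk_l2 psi"]) (simp_all add: domH_def mk_l2_inverse)
 thus ?thesis by(auto simp:hamiltonian_domain_def domH_def fld)
qed

lemma spectral_measure_exists: "is_spectral_measure (hdom u) (hamiltonian A B K g u) (hproj u)"
proof -
 define eta where "eta = tau + 1"
 have "eta > tau" by(simp add:eta_def)
 interpret sa: self_adjoint "domH u" "opH u" eta "resH u (\<i> * of_real eta)" "resH u (- (\<i> * of_real eta))"
  by(rule self_adjoint_opH[OF `eta > tau`])
 interpret spectral sa.specE "domH u" "opH u" by(rule sa.spectral_theorem)
 define E where "E = (%S psi. fld (sa.specE S (mk_l2 psi)))"
 have sm: "scalar_spectral_measure E psi = smeas sa.specE (mk_l2 psi)" for psi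
  by(simp add:scalar_spectral_measure_def smeas_def E_def ell2_norm_fld)
 have "orthogonal_projection (E S)" if S: "S : sets borel" for S
  unfolding orthogonal_projection_def E_def
 proof (intro conjI ballI allI)
  fix phi psi :: "('d, 'k) field_config" and c assume a: "phi : ell2" "psi : ell2"
  show "fld (sa.specE S (mk_l2 psi)) : ell2" by(rule fld)
  show "fld (sa.specE S (mk_l2 (%n. phi n + psi n))) = (%n. fld (sa.specE S (mk_l2 phi)) n + fld (sa.specE S (mk_l2 psi)) n)"
   by(simp add:mk_l2_add a sa.E.E_simps[OF S] plus_l2.rep_eq)
  show "fld (sa.specE S (mk_l2 (%n. c *s psi n))) = (%n. c *s fld (sa.specE S (mk_l2 psi)) n)"
   by(simp add:mk_l2_scale a sa.E.E_simps[OF S] scaleC_l2.rep_eq)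
  show "fld (sa.specE S (mk_l2 (fld (sa.specE S (mk_l2 psi))))) = fld (sa.specE S (mk_l2 psi))"
   by(simp add:fld_inverse sa.E.idem[OF S])
  show "ell2_inner phi (fld (sa.specE S (mk_l2 psi))) = ell2_inner (fld (sa.specE S (mk_l2 phi))) psi"
   by(simp add:ell2_inner_mk a fld fld_inverse sa.E.selfadj[OF S])
 qed
 moreover have "E UNIV psi = psi" if "psi : ell2" for psi using that by(simp add:E_def mk_l2_inverse)
 moreover have "(%N. ell2_norm (%n. (\<Sum>i<N. E (F i) psi n) - E (\<Union>i. F i) psi n)) ----> 0"
  if F: "range F \<subseteq> sets borel" "disjoint_family F" for F :: "nat => real set" and psi
 proof -
  let ?x = "mk_l2 psi"
  have "(%N. norm ((\<Sum>i<N. sa.specE (F i) ?x) - sa.specE (\<Union>i. F i) ?x)) ----> 0"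
   using sa.E.sigma_additive[OF F, of ?x] by(simp add:tendsto_norm_zero_iff LIM_zero_iff)
  moreover have "(%n. (\<Sum>i<N. E (F i) psi n) - E (\<Union>i. F i) psi n) = fld ((\<Sum>i<N. sa.specE (F i) ?x) - sa.specE (\<Union>i. F i) ?x)" for N
   by(simp add:fun_eq_iff E_def fld_minus fld_sum)
  ultimately show ?thesis by(simp add:ell2_norm_fld)
 qed
 ultimately have pvm: "projection_valued_measure E" by(simp add:projection_valued_measure_def)
 have D: "hdom u = {psi : ell2. integrable (scalar_spectral_measure E psi) (%x. x^2)}"
 proof (intro set_eqI iffI)
  fix psi assume "psi : hdom u"
  then obtain phi where "phi : domH u" "psi = fld phi" by(auto simp:hdom_eq)
  thus "psi : {psi : ell2. integrable (scalar_spectral_measure E psi) (%x. x^2)}" using dom by(auto simp:fld sm fld_inverse)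
 next
  fix psi assume "psi : {psi : ell2. integrable (scalar_spectral_measure E psi) (%x. x^2)}"
  hence "mk_l2 psi : domH u" "psi = fld (mk_l2 psi)" using dom by(auto simp:sm mk_l2_inverse)
  thus "psi : hdom u" unfolding hdom_eq by blast
 qed
 have "is_spectral_measure (hdom u) (hamiltonian A B K g u) E"
  unfolding is_spectral_measure_def
 proof (intro conjI pvm D ballI)
  fix psi assume "psi : hdom u"
  then obtain phi where phi: "phi : domH u" "psi = fld phi" by(auto simp:hdom_eq)
  hence "hamiltonian A B K g u psi = fld (opH u phi)" by(simp add:opH_def domH_def mk_l2_inverse)
  thus "ell2_inner psi (hamiltonian A B K g u psi) = complex_of_real (\<integral>x. x \<partial>scalar_spectral_measure E psi)"
   using form[OF phi(1)] phi(2) by(simp add:cinner_l2[symmetric] sm fld_inverse)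
 qed
 thus ?thesis
  unfolding hamiltonian_projection_def spectral_projection_def
  by(rule someI[where P="is_spectral_measure (hdom u) (hamiltonian A B K g u)"])
qed

text \<open>The spectral projections of the Hamiltonian, as operators on the type of square-summable
 functions.\<close>

definition PE :: "(int ^ 'd => real) => real set => ('d, 'k) l2 => ('d, 'k) l2" where
 "PE u S phi = mk_l2 (hproj u S (fld phi))"

lemma hproj_orth: "S : sets borel ==> orthogonal_projection (hproj u S)"
 using spectral_measure_exists by(auto simp:is_spectral_measure_def projection_valued_measure_def)

lemma fld_PE: "S : sets borel ==> fld (PE u S phi) = hproj u S (fld phi)"
 using hproj_orth[of S u] fld[of phi] by(simp add:PE_def orthogonal_projection_def mk_l2_inverse)

lemma smeas_PE: "smeas (PE u) phi = scalar_spectral_measure (hproj u) (fld phi)"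
 unfolding smeas_def scalar_spectral_measure_def
proof (rule measure_of_eq)
 fix S :: "real set" assume "S : sigma_sets UNIV (sets borel)"
 hence "S : sets borel" using sets.sigma_sets_eq[of "borel :: real measure"] by simp
 thus "ennreal ((norm (PE u S phi))^2) = ennreal ((ell2_norm (hproj u S (fld phi)))^2)"
  by(simp add:fld_PE[symmetric] ell2_norm_fld)
qed auto

lemma pvm_PE: "pvm (PE u)"
proof
 fix S :: "real set" and phi assume S: "S : sets borel"
 note o = hproj_orth[OF S, of u, unfolded orthogonal_projection_def]
 show "orth_proj (PE u S)"
  unfolding orth_proj_def clinear_map_def
 proof (intro conjI allI)
  fix x y :: "('d, 'k) l2" and c
  show "PE u S (x + y) = PE u S x + PE u S y"
  proof (rule fld_eqI)
   fix n
   show "fld (PE u S (x + y)) n = fld (PE u S x + PE u S y) n"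
    using o fld[of x] fld[of y] by(simp add:fld_PE[OF S] plus_l2.rep_eq)
  qed
  show "PE u S (c *C x) = c *C PE u S x"
  proof (rule fld_eqI)
   fix n
   show "fld (PE u S (c *C x)) n = fld (c *C PE u S x) n" using o fld[of x] by(simp add:fld_PE[OF S] scaleC_l2.rep_eq)
  qed
  show "PE u S (PE u S x) = PE u S x"
  proof (rule fld_eqI)
   fix n
   show "fld (PE u S (PE u S x)) n = fld (PE u S x) n" using o fld[of x] by(simp add:fld_PE[OF S])
  qed
  show "cinner x (PE u S y) = cinner (PE u S x) y" using o fld[of x] fld[of y] by(simp add:cinner_l2 fld_PE[OF S])
 qed
next
 fix phi :: "('d, 'k) l2"
 have "hproj u UNIV (fld phi) = fld phi"
  using spectral_measure_exists[of u] fld[of phi] by(auto simp:is_spectral_measure_def projection_valued_measure_def)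
 thus "PE u UNIV phi = phi" by(simp add:PE_def fld_inverse)
next
 fix F :: "nat => real set" and phi :: "('d, 'k) l2"
 assume F: "range F \<subseteq> sets borel" "disjoint_family F"
 hence m: "F i : sets borel" "(\<Union>i. F i) : sets borel" for i by auto
 have "(%N. ell2_norm (%n. (\<Sum>i<N. hproj u (F i) (fld phi) n) - hproj u (\<Union>i. F i) (fld phi) n)) ----> 0"
  using spectral_measure_exists[of u] F fld[of phi] unfolding is_spectral_measure_def projection_valued_measure_def by blast
 moreover have "(%n. (\<Sum>i<N. hproj u (F i) (fld phi) n) - hproj u (\<Union>i. F i) (fld phi) n) = fld ((\<Sum>i<N. PE u (F i) phi) - PE u (\<Union>i. F i) phi)" for N
  by(simp add:fun_eq_iff fld_minus fld_sum fld_PE m)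
 ultimately have "(%N. norm ((\<Sum>i<N. PE u (F i) phi) - PE u (\<Union>i. F i) phi)) ----> 0" by(simp add:ell2_norm_fld)
 thus "(%N. \<Sum>i<N. PE u (F i) phi) ----> PE u (\<Union>i. F i) phi" by(simp only: tendsto_norm_zero_iff LIM_zero_iff)
qed

lemma spectral_PE: "spectral (PE u) (domH u) (opH u)"
proof -
 interpret pvm "PE u" by(rule pvm_PE)
 show ?thesis
 proof
  show "domH u = {x. integrable (smeas (PE u) x) (%t. t^2)}"
  proof (intro set_eqI)
   fix x
   have "x : domH u \<longleftrightarrow> fld x : hdom u" by(auto simp:hdom_eq fld_inject)
   also have "... \<longleftrightarrow> integrable (smeas (PE u) x) (%t. t^2)"
    using spectral_measure_exists[of u] fld[of x] unfolding is_spectral_measure_def smeas_PE by auto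
   finally show "x : domH u \<longleftrightarrow> x : {x. integrable (smeas (PE u) x) (%t. t^2)}" by simp
  qed
  fix x assume x: "x : domH u"
  hence "fld x : hdom u" by(auto simp:hdom_eq)
  moreover have "hamiltonian A B K g u (fld x) = fld (opH u x)" using x by(simp add:opH_def domH_def mk_l2_inverse)
  ultimately show "cinner x (opH u x) = complex_of_real (\<integral>t. t \<partial>smeas (PE u) x)"
   using spectral_measure_exists[of u] unfolding is_spectral_measure_def smeas_PE cinner_l2 by metis
 qed (auto simp:opH_add opH_scale)
qed

text \<open>By uniqueness, the norms of spectral projections are those of the measure constructed
 from the Cayley transform, whose dependence on the disorder is explicit.\<close>

lemma norm_PE:
 assumes "eta > tau" "S : sets borel"
 shows "(norm (PE u S x))^2 = measure (unitary.nu (self_adjoint.cay eta (resH u (\<i> * of_real eta)))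
  (self_adjoint.cay' eta (resH u (- (\<i> * of_real eta)))) x) (self_adjoint.kap eta -` S)"
proof -
 interpret self_adjoint "domH u" "opH u" eta "resH u (\<i> * of_real eta)" "resH u (- (\<i> * of_real eta))"
  by(rule self_adjoint_opH[OF assms(1)])
 have "(norm (PE u S x))^2 = measure (smeas specE x) S"
  using pvm.measure_smeas[OF pvm_PE assms(2), of u x] spectral_unique[OF spectral_PE spectral_theorem] by simp
 thus ?thesis using assms(2) by(simp add:smeas_specE measure_distr nu(1))
qed

lemma block_entry:
 assumes I: "I : sets borel" "I \<subseteq> {-c..c}" "c >= 0"
 shows "block (op_exp z (hamiltonian_on A B K g u I)) m n $ i $ j =
   cinner (delta (m, i)) (delta (n, j)) + spectral.expform (PE u) (opH u) I z (delta (m, i)) (delta (n, j))"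
proof -
 interpret spectral "PE u" "domH u" "opH u" by(rule spectral_PE)
 let ?H = "hamiltonian_on A B K g u I"
 have on: "?H (fld x) = fld (compress I x)" for x
 proof -
  have "PE u I x : domH u" by(rule E_I_dom[OF I])
  hence "fld (opH u (PE u I x)) = hamiltonian A B K g u (fld (PE u I x))" by(simp add:opH_def domH_def mk_l2_inverse)
  thus ?thesis by(simp add:hamiltonian_on_def compress_def fld_PE I)
 qed
 have pow: "(?H ^^ l) (fld x) = fld ((compress I ^^ l) x)" for l x by(induction l) (simp_all add: on)
 let ?x = "delta (n, j) :: ('d, 'k) l2"
 let ?v = "%l. (z ^ l / fact l) *s fld ((compress I ^^ l) ?x) m"
 have summ: "summable ?v"
 proof (rule summable_comparison_test')
  show "summable (%l. (cmod z * c) ^ l / fact l)" using summable_exp[of "cmod z * c"] by(simp add:field_simps)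
  fix l
  have "norm (fld ((compress I ^^ l) ?x) m) <= norm ((compress I ^^ l) ?x)" by(rule norm_fld_le)
  also have "... <= c ^ l * norm ?x" by(rule norm_compress_pow_le[OF I])
  finally have "cmod (z ^ l / fact l) * norm (fld ((compress I ^^ l) ?x) m) <= cmod (z ^ l / fact l) * c ^ l"
   by(intro mult_left_mono) simp_all
  thus "norm (?v l) <= (cmod z * c) ^ l / fact l" by(simp add:norm_divide norm_power power_mult_distrib)
 qed
 have "block (op_exp z ?H) m n $ i $ j = op_exp z ?H (fld ?x) m $ i" by(simp add:block_def fld_delta cong: if_cong)
 also have "... = (\<Sum>l. ?v l) $ i" by(simp add:op_exp_def pow)
 also have "... = (\<Sum>l. ?v l $ i)" by(rule bounded_linear.suminf[OF bounded_linear_vec_nth summ])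
 also have "... = (\<Sum>l. (z ^ l / fact l) * cinner (delta (m, i)) ((compress I ^^ l) ?x))" by(simp add:cinner_delta)
 also have "... = cinner (delta (m, i)) ?x + expform I z (delta (m, i)) ?x" by(rule expform_eq[OF I])
 finally show ?thesis .
qed

lemma cinner_delta_delta: "m ~= n ==> cinner (delta (m, i)) (delta (n, j)) = 0"
 by(simp add:cinner_delta fld_delta)

end

lemma mat_norm_le_sum: "mat_norm M <= (\<Sum>i\<in>UNIV. \<Sum>j\<in>UNIV. cmod (M $ i $ j))"
proof (rule mat_norm_leI)
 fix x
 have "norm (M *v x) <= (\<Sum>i\<in>UNIV. norm ((M *v x) $ i))" unfolding norm_vec_def by(rule L2_set_le_sum) simp
 also have "... <= (\<Sum>i\<in>UNIV. (\<Sum>j\<in>UNIV. cmod (M $ i $ j)) * norm x)"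
 proof (rule sum_mono)
  fix i
  have "norm ((M *v x) $ i) <= (\<Sum>j\<in>UNIV. cmod (M $ i $ j) * cmod (x $ j))"
   unfolding matrix_vector_mult_def by(simp add:norm_mult[symmetric] norm_sum)
  also have "... <= (\<Sum>j\<in>UNIV. cmod (M $ i $ j) * norm x)"
   by(intro sum_mono mult_left_mono Finite_Cartesian_Product.norm_nth_le) simp
  finally show "norm ((M *v x) $ i) <= (\<Sum>j\<in>UNIV. cmod (M $ i $ j)) * norm x" by(simp add:sum_distrib_right)
 qed
 also have "... = (\<Sum>i\<in>UNIV. \<Sum>j\<in>UNIV. cmod (M $ i $ j)) * norm x" by(simp add:sum_distrib_right)
 finally show "norm (M *v x) <= (\<Sum>i\<in>UNIV. \<Sum>j\<in>UNIV. cmod (M $ i $ j)) * norm x" .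
qed

section \<open>Measurability in the disorder\<close>

lemma measurable_infsum_countable:
 fixes f :: "'a::countable => 'w => complex"
 assumes [measurable]: "!!a. f a : borel_measurable M"
  and summ: "!!w. (%a. f a w) summable_on UNIV"
 shows "(%w. \<Sum>\<^sub>\<infinity>a. f a w) : borel_measurable M"
proof -
 define X where "X = (%n. {a::'a. to_nat a <= n})"
 have fX: "finite (X n)" for n
  by(rule finite_imageD[of to_nat]) (auto simp:X_def intro:finite_subset[of _ "{..n}"] inj_on_subset[OF inj_to_nat])
 have lim: "filterlim X (finite_subsets_at_top UNIV) sequentially"
  unfolding filterlim_def le_filter_def eventually_filtermap eventually_finite_subsets_at_top
 proof (intro allI impI)
  fix P :: "'a set => bool"
  assume "\<exists>Z. finite Z & Z \<subseteq> UNIV & (\<forall>Y. finite Y & Z \<subseteq> Y & Y \<subseteq> UNIV --> P Y)"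
  then obtain Z where Z: "finite Z" "!!Y. finite Y ==> Z \<subseteq> Y ==> P Y" by auto
  have "Z \<subseteq> X n" if "n >= Max (insert 0 (to_nat ` Z))" for n
  proof
   fix a assume "a : Z"
   hence "to_nat a <= Max (insert 0 (to_nat ` Z))" using Z(1) by(intro Max_ge) auto
   thus "a : X n" using that by(simp add:X_def)
  qed
  thus "\<forall>\<^sub>F n in sequentially. P (X n)" using Z(2) fX by(intro eventually_sequentiallyI) blast
 qed
 have "(%n. \<Sum>a\<in>X n. f a w) ----> (\<Sum>\<^sub>\<infinity>a. f a w)" for w
  using filterlim_compose[OF has_sum_infsum[OF summ[of w], unfolded has_sum_def] lim] by(simp add:o_def)
 thus ?thesis by(rule borel_measurable_LIMSEQ_metric[rotated]) measurable
qed

lemma measurable_suminf_complex: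
 fixes f :: "nat => 'w => complex"
 assumes [measurable]: "!!n. f n : borel_measurable M" and "!!w. summable (%n. f n w)"
 shows "(%w. \<Sum>n. f n w) : borel_measurable M"
 by(rule borel_measurable_LIMSEQ_metric[OF _ summable_LIMSEQ[OF assms(2)]]) measurable

text \<open>Random vectors: measurability of all components.\<close>

definition rvec :: "'w measure => ('w => ('d::finite, 'k::finite) l2) => bool" where
 "rvec M phi \<longleftrightarrow> (\<forall>n i. (%w. fld (phi w) n $ i) : borel_measurable M)"

lemma rvecD [measurable_dest]: "rvec M phi ==> (%w. fld (phi w) n $ i) : borel_measurable M"
 by(simp add:rvec_def)

lemma rvec_const: "rvec M (%_. phi)"
 by(simp add:rvec_def)

lemma rvec_cinner:
 assumes "rvec M phi" "rvec M psi"
 shows "(%w. cinner (phi w) (psi w)) : borel_measurable M"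
 unfolding cinner_l2 ell2_inner_def
proof (rule measurable_infsum_countable)
 fix n
 have [measurable]: "(%w. fld (phi w) n $ i) : borel_measurable M" "(%w. fld (psi w) n $ i) : borel_measurable M" for i
  using assms by(auto simp:rvec_def)
 show "(%w. \<Sum>i\<in>UNIV. cnj (fld (phi w) n $ i) * fld (psi w) n $ i) : borel_measurable M" by measurable
next
 fix w
 show "(%n. \<Sum>i\<in>UNIV. cnj (fld (phi w) n $ i) * fld (psi w) n $ i) summable_on UNIV"
 proof (rule abs_summable_summable, rule summable_on_comparison_test)
  show "(%n. (norm (fld (phi w) n))^2 + (norm (fld (psi w) n))^2) summable_on UNIV"
   using fld[of "phi w"] fld[of "psi w"] by(intro summable_on_add) (auto simp:ell2_def)
  fix n
  have "norm (\<Sum>i\<in>UNIV. cnj (fld (phi w) n $ i) * fld (psi w) n $ i) <= norm (fld (phi w) n) * norm (fld (psi w) n)"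
   using cmod_vdot_le[of "fld (phi w) n" "fld (psi w) n"] by(simp add:vdot_def)
  also have "... <= (norm (fld (phi w) n))^2 + (norm (fld (psi w) n))^2"
   using sum_squares_bound[of "norm (fld (phi w) n)" "norm (fld (psi w) n)"]
    mult_nonneg_nonneg[OF norm_ge_zero[of "fld (phi w) n"] norm_ge_zero[of "fld (psi w) n"]] by linarith
  finally show "norm (\<Sum>i\<in>UNIV. cnj (fld (phi w) n $ i) * fld (psi w) n $ i) <= (norm (fld (phi w) n))^2 + (norm (fld (psi w) n))^2" .
 qed auto
qed

lemma rvec_iff: "rvec M phi \<longleftrightarrow> (\<forall>a. (%w. cinner (delta a) (phi w)) : borel_measurable M)"
 by(auto simp:rvec_def cinner_delta)

lemma rvec_add: "rvec M phi ==> rvec M psi ==> rvec M (%w. phi w + psi w)"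
 unfolding rvec_def plus_l2.rep_eq vector_add_component by(auto intro:borel_measurable_add)

lemma rvec_scale: "rvec M phi ==> rvec M (%w. c *C phi w)"
 unfolding rvec_def scaleC_l2.rep_eq vector_smult_component by(auto intro:borel_measurable_times)

lemma rvec_diff: "rvec M phi ==> rvec M psi ==> rvec M (%w. phi w - psi w)"
 using rvec_add[OF _ rvec_scale, of M phi psi "-1"] by simp

lemma rvec_suminf:
 assumes "!!j. rvec M (phi j)" "!!w. summable (%j. phi j w)"
 shows "rvec M (%w. \<Sum>j. phi j w)"
 unfolding rvec_iff
proof
 fix a
 have "cinner (delta a) (\<Sum>j. phi j w) = (\<Sum>j. cinner (delta a) (phi j w))" for w
  by(rule bounded_linear.suminf[OF bounded_linear_cinner_right assms(2)])
 moreover have "summable (%j. cinner (delta a) (phi j w))" for w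
  by(rule bounded_linear.summable[OF bounded_linear_cinner_right assms(2)])
 ultimately show "(%w. cinner (delta a) (\<Sum>j. phi j w)) : borel_measurable M"
  using measurable_suminf_complex[of "%j w. cinner (delta a) (phi j w)" M] assms(1)[unfolded rvec_iff] by presburger
qed

context hamil
begin

lemma shift_inv_pot_entry_measurable:
 assumes z: "Im z ~= 0"
 shows "(%r. shift_inv (pot r) z $ i $ j) : borel_measurable borel"
proof (rule borel_measurable_continuous_onI)
 let ?G = "%r. shift_inv (pot r) z"
 have lip: "norm (?G r *v x - ?G s *v x) <= (mat_norm A / abs (Im z)^2 * norm x) * abs (r - s)" for r s x
 proof -
  let ?y = "?G r *v x"
  have 1: "pot r *v ?y - z *s ?y = x" by(rule shift_inv(1)[OF hermitian_pot z])
  have "pot s *v ?y = pot r *v ?y - (r - s) *\<^sub>R (A *v ?y)"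
   by(simp add:pot_def vec_eq_iff matrix_vector_mult_def scaleR_sum_right sum.distrib sum_subtractf algebra_simps)
  hence "pot s *v ?y - z *s ?y = x - (r - s) *\<^sub>R (A *v ?y)" using 1 by(simp add:algebra_simps)
  hence "?y = ?G s *v (x - (r - s) *\<^sub>R (A *v ?y))" using shift_inv(2)[OF hermitian_pot z, of s ?y] by simp
  hence "?y - ?G s *v x = - (?G s *v ((r - s) *\<^sub>R (A *v ?y)))"
   by(metis (no_types, lifting) add_diff_cancel_left' diff_diff_eq2 matrix_vector_mult_diff_distrib minus_diff_eq)
  hence "norm (?y - ?G s *v x) = norm (?G s *v ((r - s) *\<^sub>R (A *v ?y)))" by simp
  also have "... <= norm ((r - s) *\<^sub>R (A *v ?y)) / abs (Im z)" by(rule shift_inv(3)[OF hermitian_pot z])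
  also have "... = abs (r - s) * norm (A *v ?y) / abs (Im z)" by simp
  also have "norm (A *v ?y) <= mat_norm A * (norm x / abs (Im z))"
   using norm_matrix_vector_le[of A ?y] shift_inv(3)[OF hermitian_pot z, of r x] mat_norm_nonneg[of A]
   by(meson mult_left_mono order_trans)
  hence "abs (r - s) * norm (A *v ?y) / abs (Im z) <= abs (r - s) * (mat_norm A * (norm x / abs (Im z))) / abs (Im z)"
   by(intro divide_right_mono mult_left_mono) auto
  finally show ?thesis by(simp add:power2_eq_square mult_ac)
 qed
 have e: "?G r $ i $ j = (?G r *v axis j 1) $ i" for r
  by(simp add:matrix_vector_mult_def axis_def if_distrib[of "%c. _ * c"] cong: if_cong)
 have "lipschitz_on (mat_norm A / abs (Im z)^2) UNIV (%r. ?G r $ i $ j)"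
 proof (rule lipschitz_onI)
  fix r s :: real
  have "dist (?G r $ i $ j) (?G s $ i $ j) = norm ((?G r *v axis j 1 - ?G s *v axis j 1) $ i)" by(simp add:e dist_norm)
  also have "... <= norm (?G r *v axis j 1 - ?G s *v axis j 1)" by(rule Finite_Cartesian_Product.norm_nth_le)
  also have "... <= (mat_norm A / abs (Im z)^2 * norm (axis j (1::complex))) * abs (r - s)" by(rule lip)
  finally show "dist (?G r $ i $ j) (?G s $ i $ j) <= mat_norm A / abs (Im z)^2 * dist r s" by(simp add:norm_axis_1 dist_real_def)
 qed (simp add:mat_norm_nonneg)
 thus "continuous_on UNIV (%r. ?G r $ i $ j)" by(rule lipschitz_on_continuous_on)
qed

context
 fixes M :: "'w measure" and v :: "int ^ 'd => 'w => real"
 assumes v[measurable]: "!!n. v n : borel_measurable M"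
begin

abbreviation "uw w \<equiv> (%l. v l w)"

lemma rvec_hop: "rvec M phi ==> rvec M (%w. hop (phi w))"
 unfolding rvec_def fld_hop
proof (intro allI)
 fix n i assume [rule_format, measurable]: "\<forall>n i. (%w. fld (phi w) n $ i) : borel_measurable M"
 show "(%w. (inverse g *\<^sub>R (\<Sum>m\<in>{m. adjacent n m}. K (n - m) *v fld (phi w) m)) $ i) : borel_measurable M"
  unfolding vector_scaleR_component sum_component matrix_vector_mult_def vec_lambda_beta by measurable
qed

lemma rvec_potres:
 assumes z: "Im z ~= 0" and "rvec M phi"
 shows "rvec M (%w. potres (uw w) z (phi w))"
 unfolding rvec_def fld_potres[OF z]
proof (intro allI)
 fix n i
 have [measurable]: "(%w. shift_inv (pot (v n w)) z $ i $ j) : borel_measurable M" for j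
  by(rule measurable_compose[OF v shift_inv_pot_entry_measurable[OF z]])
 have [measurable]: "(%w. fld (phi w) n $ j) : borel_measurable M" for j using assms(2) by(simp add:rvec_def)
 show "(%w. (shift_inv (pot (v n w)) z *v fld (phi w) n) $ i) : borel_measurable M" unfolding matrix_vector_mult_def by simp
qed

lemma rvec_resH:
 assumes z: "tau < abs (Im z)" and "rvec M phi"
 shows "rvec M (%w. resH (uw w) z (phi w))"
proof -
 have nz: "Im z ~= 0" by(rule Im_nz[OF z])
 have "rvec M (%w. (neu (uw w) z ^^ j) (phi w))" for j
 proof (induction j)
  case (Suc j)
  have "rvec M (%w. (-1) *C hop (potres (uw w) z ((neu (uw w) z ^^ j) (phi w))))" by(intro rvec_scale rvec_hop rvec_potres nz Suc)
  moreover have "(-1) *C hop (potres u z x) = neu u z x" for u x by(simp add:neu_def)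
  ultimately show ?case by(simp only: funpow.simps o_apply)
 qed (use assms in simp)
 thus ?thesis unfolding resH_def by(intro rvec_potres nz rvec_suminf neu_summable[OF z])
qed

lemma PE_norm_measurable:
 assumes S: "S : sets borel"
 shows "(%w. (norm (PE (uw w) S x))^2) : borel_measurable M"
proof -
 define eta where "eta = tau + 1"
 have eta: "eta > tau" by(simp add:eta_def)
 hence z: "tau < abs (Im (\<i> * of_real eta))" "tau < abs (Im (- (\<i> * of_real eta)))" using tau_nonneg by auto
 have sa: "self_adjoint (domH (uw w)) (opH (uw w)) eta (resH (uw w) (\<i> * of_real eta)) (resH (uw w) (- (\<i> * of_real eta)))" for w
  by(rule self_adjoint_opH[OF eta])
 define c c' where "c = (%w. self_adjoint.cay eta (resH (uw w) (\<i> * of_real eta)))"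
  and "c' = (%w. self_adjoint.cay' eta (resH (uw w) (- (\<i> * of_real eta))))"
 have un: "unitary (c w) (c' w)" for w
 proof -
  interpret self_adjoint "domH (uw w)" "opH (uw w)" eta "resH (uw w) (\<i> * of_real eta)" "resH (uw w) (- (\<i> * of_real eta))" by(rule sa)
  show ?thesis unfolding c_def c'_def by(rule unitary_axioms)
 qed
 have rv: "rvec M (%w. c w (phi w))" "rvec M (%w. c' w (phi w))" if "rvec M phi" for phi
  unfolding c_def c'_def self_adjoint.cay_def[OF sa] self_adjoint.cay'_def[OF sa]
  by(intro rvec_add rvec_diff rvec_scale rvec_resH z that)+
 have rv_pow: "rvec M (%w. unitary.upow (c w) (c' w) n x)" for n
 proof -
  have "rvec M (%w. (c w ^^ k) x)" "rvec M (%w. (c' w ^^ k) x)" for k by(induction k) (simp_all add: rvec_const rv)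
  thus ?thesis unfolding unitary.upow_def[OF un] by(cases "n >= 0") simp_all
 qed
 have kap: "self_adjoint.kap eta : borel_measurable borel" by(rule self_adjoint.kap_measurable[OF sa])
 have "(%w. measure (unitary.nu (c w) (c' w) x) (self_adjoint.kap eta -` S)) : borel_measurable M"
 proof (rule measurable_from_moments[OF unitary.nu(1)[OF un] unitary.nu(2)[OF un] unitary.nu(3)[OF un] _ unitary.nu(4)[OF un]])
  show "unitary (%x::('d, 'k) l2. x) (%x. x)" by standard (auto simp:clinear_map_def)
  show "self_adjoint.kap eta -` S : sets borel" using measurable_sets[OF kap S] by simp
  show "(%w. cinner x (unitary.upow (c w) (c' w) n x)) : borel_measurable M" for n by(intro rvec_cinner rvec_const rv_pow)
 qed
 thus ?thesis by(simp add:norm_PE[OF eta S] c_def c'_def)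
qed

lemma PE_cinner_measurable:
 assumes S: "S : sets borel"
 shows "(%w. cinner x (PE (uw w) S y)) : borel_measurable M"
proof -
 let ?E = "%w. PE (uw w) S"
 have e: "cinner x (?E w y) = (of_real ((norm (?E w (x + y)))^2) - of_real ((norm (?E w (x - y)))^2)
   - \<i> * of_real ((norm (?E w (x + \<i> *C y)))^2) + \<i> * of_real ((norm (?E w (x - \<i> *C y)))^2)) / 4" for w
 proof -
  interpret pvm "PE (uw w)" by(rule pvm_PE)
  have "4 * cinner x (?E w y) = 4 * cinner (?E w x) (?E w y)"
   using selfadj[OF S, of "?E w x" y] selfadj[OF S, of x y] idem[OF S] by simp
  thus ?thesis unfolding polarization[of "?E w x" "?E w y"] by(simp add:E_simps[OF S] mult.commute)
 qed
 have [measurable]: "(%w. (norm (?E w x))^2) : borel_measurable M" for x by(rule PE_norm_measurable[OF S])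
 show ?thesis unfolding e by measurable
qed

lemma rvec_PE:
 assumes S: "S : sets borel" and "rvec M phi"
 shows "rvec M (%w. PE (uw w) S (phi w))"
 unfolding rvec_iff
proof
 fix a
 have "rvec M (%w. PE (uw w) S (delta a))" unfolding rvec_iff using PE_cinner_measurable[OF S] by blast
 moreover have "cinner (delta a) (PE (uw w) S (phi w)) = cinner (PE (uw w) S (delta a)) (phi w)" for w
  using pvm.selfadj[OF pvm_PE S] .
 ultimately show "(%w. cinner (delta a) (PE (uw w) S (phi w))) : borel_measurable M" using rvec_cinner[OF _ assms(2)] by simp
qed

context
 fixes I :: "real set" and c :: real
 assumes I: "I : sets borel" "I \<subseteq> {-c..c}" "c >= 0"
begin

lemma rvec_compress:
 assumes "rvec M phi"
 shows "rvec M (%w. spectral.compress (PE (uw w)) (opH (uw w)) I (phi w))"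
proof -
 have sp: "spectral (PE (uw w)) (domH (uw w)) (opH (uw w))" for w by(rule spectral_PE)
 have r: "rvec M (%w. PE (uw w) I (phi w))" by(rule rvec_PE[OF I(1) assms])
 have "rvec M (%w. opH (uw w) (PE (uw w) I (phi w)))"
  unfolding rvec_def
 proof (intro allI)
  fix n i
  have "fld (opH (uw w) (PE (uw w) I (phi w))) n $ i = (\<Sum>j\<in>UNIV. (v n w *\<^sub>R (A $ i $ j) + B $ i $ j) * fld (PE (uw w) I (phi w)) n $ j) + fld (hop (PE (uw w) I (phi w))) n $ i" for w
   using fld_opH[OF spectral.E_I_dom[OF sp I]] by(simp add:pot_def matrix_vector_mult_def)
  moreover have [measurable]: "(%w. fld (PE (uw w) I (phi w)) n $ j) : borel_measurable M"
    "(%w. fld (hop (PE (uw w) I (phi w))) n $ j) : borel_measurable M" for j using r rvec_hop[OF r] by(auto simp:rvec_def)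
  ultimately show "(%w. fld (opH (uw w) (PE (uw w) I (phi w))) n $ i) : borel_measurable M" by simp
 qed
 from rvec_PE[OF I(1) this] show ?thesis by(simp add:spectral.compress_def[OF sp])
qed

lemma expform_measurable:
 "(%w. spectral.expform (PE (uw w)) (opH (uw w)) I z x y) : borel_measurable M"
proof -
 have sp: "spectral (PE (uw w)) (domH (uw w)) (opH (uw w))" for w by(rule spectral_PE)
 have r: "rvec M (%w. (spectral.compress (PE (uw w)) (opH (uw w)) I ^^ j) y)" for j
  by(induction j) (simp_all add: rvec_const rvec_compress)
 show ?thesis
  unfolding spectral.expform_def[OF sp I]
 proof (rule measurable_suminf_complex)
  fix j
  have [measurable]: "(%w. cinner x ((spectral.compress (PE (uw w)) (opH (uw w)) I ^^ Suc j) y)) : borel_measurable M"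
   by(intro rvec_cinner rvec_const r)
  show "(%w. z ^ Suc j / fact (Suc j) * cinner x ((spectral.compress (PE (uw w)) (opH (uw w)) I ^^ Suc j) y)) : borel_measurable M"
   by measurable
 qed (rule spectral.expform_summable_Suc[OF sp I])
qed

end

end

end

lemma mat_norm_continuous: "continuous_on UNIV (mat_norm :: complex ^ 'k ^ 'k => real)"
proof -
 have "mat_norm X <= mat_norm Y + norm (X - Y) * real CARD('k) * real CARD('k)" for X Y :: "complex ^ 'k ^ 'k"
 proof (rule mat_norm_leI)
  fix x
  have "mat_norm (X - Y) <= (\<Sum>i\<in>(UNIV::'k set). \<Sum>j\<in>(UNIV::'k set). norm (X - Y))"
   by(intro order_trans[OF mat_norm_le_sum] sum_mono order_trans[OF Finite_Cartesian_Product.norm_nth_le[of "(X - Y) $ _"]]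
     Finite_Cartesian_Product.norm_nth_le)
  hence 1: "mat_norm (X - Y) <= norm (X - Y) * real CARD('k) * real CARD('k)" by(simp add:mult_ac)
  have "norm (X *v x) <= norm (Y *v x) + norm ((X - Y) *v x)"
   using norm_triangle_ineq[of "Y *v x" "(X - Y) *v x"] by(simp add:matrix_vector_mult_diff_rdistrib)
  also have "... <= mat_norm Y * norm x + (norm (X - Y) * real CARD('k) * real CARD('k)) * norm x"
   by(intro add_mono norm_matrix_vector_le order_trans[OF norm_matrix_vector_le mult_right_mono[OF 1]]) simp
  finally show "norm (X *v x) <= (mat_norm Y + norm (X - Y) * real CARD('k) * real CARD('k)) * norm x" by(simp add:algebra_simps)
 qed
 hence "lipschitz_on (real CARD('k) * real CARD('k)) UNIV (mat_norm :: complex ^ 'k ^ 'k => real)"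
  by(intro lipschitz_onI) (force simp: dist_norm abs_le_iff algebra_simps norm_minus_commute)+
 thus ?thesis by(rule lipschitz_on_continuous_on)
qed

lemma mat_norm_measurable:
 assumes "!!i j. (%w. X w $ i $ j) : borel_measurable M"
 shows "(%w. mat_norm (X w :: complex ^ 'k ^ 'k)) : borel_measurable M"
proof -
 have "mat_norm : borel_measurable (borel :: (complex ^ 'k ^ 'k) measure)"
  by(rule borel_measurable_continuous_onI[OF mat_norm_continuous])
 moreover have "X : borel_measurable M"
 proof (subst borel_measurable_euclidean_space, intro ballI)
  fix b :: "complex ^ 'k ^ 'k" assume "b : Basis"
  have "X w \<bullet> b = (\<Sum>i\<in>UNIV. \<Sum>j\<in>UNIV. X w $ i $ j \<bullet> b $ i $ j)" for w by(simp add:inner_vec_def)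
  thus "(%w. X w \<bullet> b) : borel_measurable M" using assms by simp
 qed
 ultimately show ?thesis by measurable
qed

text \<open>A supremum over continuous time may be taken over rational times.\<close>

lemma SUP_rational:
 fixes f :: "real => real"
 assumes "continuous_on UNIV f"
 shows "(SUP t\<in>{0..}. ennreal (f t)) = (SUP t\<in>{0..} \<inter> \<rat>. ennreal (f t))"
proof (rule antisym)
 show "(SUP t\<in>{0..}. ennreal (f t)) <= (SUP t\<in>{0..} \<inter> \<rat>. ennreal (f t))"
 proof (rule SUP_least)
  fix t :: real assume "t : {0..}"
  have "\<exists>r. r : \<rat> & t < r & r < t + 1 / real (Suc n)" for n
   using Rats_dense_in_real[of t "t + 1 / real (Suc n)"] by auto
  then obtain r where r: "r n : \<rat>" "t < r n" "r n < t + 1 / real (Suc n)" for n by metis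
  have "(%n. t + 1 / real (Suc n)) ----> t" using LIMSEQ_inverse_real_of_nat_add[of t] by(simp add:inverse_eq_divide)
  from tendsto_sandwich[OF _ _ tendsto_const this, of r] have "r ----> t" using r by(auto intro!:always_eventually less_imp_le)
  hence "(%n. ennreal (f (r n))) ----> ennreal (f t)"
   using assms by(intro tendsto_ennrealI continuous_on_tendsto_compose[OF assms]) auto
  moreover have "ennreal (f (r n)) <= (SUP t\<in>{0..} \<inter> \<rat>. ennreal (f t))" for n
   using r(1,2)[of n] `t : {0..}` by(intro SUP_upper) simp
  ultimately show "ennreal (f t) <= (SUP t\<in>{0..} \<inter> \<rat>. ennreal (f t))" by(intro LIMSEQ_le_const2) blast+
 qed
qed (auto intro:SUP_subset_mono)

lemma (in spectral) expform_continuous: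
 assumes I: "I : sets borel" "I \<subseteq> {-c..c}" "c >= 0"
 shows "continuous_on UNIV (%t. expform I (\<i> * of_real t) x y)"
proof -
 let ?a = "%j. cinner x ((compress I ^^ j) y) / fact j"
 have s: "summable (%j. ?a j * z ^ j)" for z using expform_summable[OF I, of z x y] by(simp add:mult.commute)
 have e: "expform I z x y = (\<Sum>j. ?a j * z ^ j) - cinner x y" for z
  using expform_eq[OF I, of z x y] by(simp add:mult.commute algebra_simps)
 have "isCont (%z. \<Sum>j. ?a j * z ^ j) z" for z by(rule isCont_powser_converges_everywhere[OF s])
 hence "continuous_on UNIV (%z. \<Sum>j. ?a j * z ^ j)" by(simp add:continuous_on_eq_continuous_at)
 hence "continuous_on UNIV (%t::real. \<Sum>j. ?a j * (\<i> * of_real t) ^ j)"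
  by(rule continuous_on_compose2) (auto intro!:continuous_intros)
 thus ?thesis unfolding e by(intro continuous_intros)
qed

lemma (in hamil) sup_measurable:
 fixes v :: "int ^ 'd => 'w => real"
 assumes v: "!!n. v n : borel_measurable M"
  and I: "I : sets borel" "I \<subseteq> {-c..c}" "c >= 0"
 shows "(%w. SUP t\<in>{0::real..}. ennreal (mat_norm
      (block (op_exp (\<i> * of_real t) (hamiltonian_on A B K g (%l. v l w) I)) m n))) : borel_measurable M"
proof -
 let ?B = "%t w. block (op_exp (\<i> * of_real t) (hamiltonian_on A B K g (%l. v l w) I)) m n"
 have e: "?B t w = (\<chi> i j. cinner (delta (m, i)) (delta (n, j)) + spectral.expform (PE (%l. v l w)) (opH (%l. v l w)) I (\<i> * of_real t) (delta (m, i)) (delta (n, j)))" for t w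
  by(simp add:vec_eq_iff block_entry[OF I])
 have "continuous_on UNIV (%t. mat_norm (?B t w))" for w
  unfolding e by(rule continuous_on_compose2[OF mat_norm_continuous])
   (intro continuous_on_vec_lambda continuous_on_add continuous_on_const spectral.expform_continuous[OF spectral_PE I], simp)
 hence "(SUP t\<in>{0..}. ennreal (mat_norm (?B t w))) = (SUP t\<in>{0..} \<inter> \<rat>. ennreal (mat_norm (?B t w)))" for w
  by(rule SUP_rational)
 moreover have "(%w. ennreal (mat_norm (?B t w))) : borel_measurable M" for t
  by(intro measurable_compose[OF mat_norm_measurable measurable_ennreal])
   (simp add:e, intro borel_measurable_add borel_measurable_const expform_measurable[OF v I])
 ultimately show ?thesis by(simp, intro borel_measurable_SUP countable_Int2 countable_rat)
qed

section \<open>Determinants and Green functions\<close>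

text \<open>
 Determinants and cofactors of matrices indexed by a finite set.  The cofactor for \<open>a\<close> and \<open>b\<close>
 is the determinant with column \<open>a\<close> replaced by the unit vector at \<open>b\<close>.
\<close>

definition sdet :: "'a set => ('a => 'a => 'b) => 'b::comm_ring_1" where
 "sdet S M = (\<Sum>p | p permutes S. of_int (sign p) * (\<Prod>i\<in>S. M (p i) i))"

definition sadj :: "'a set => ('a => 'a => 'b) => 'a => 'a => 'b::comm_ring_1" where
 "sadj S M a b = sdet S (%i j. if j = a then (if i = b then 1 else 0) else M i j)"

lemma sdet_cong:
 "(!!i j. i : S ==> j : S ==> M i j = M' i j) ==> sdet S M = sdet S M'"
 unfolding sdet_def by(intro sum.cong refl arg_cong2[where f="(*)"] prod.cong) (auto simp:permutes_in_image)

lemma sdet_column_sum: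
 assumes "finite S" "a : S"
 shows "sdet S (%i j. if j = a then \<Sum>b\<in>B. f b i * c b else M i j) =
  (\<Sum>b\<in>B. sdet S (%i j. if j = a then f b i else M i j) * c b)"
proof -
 have 1: "(\<Prod>i\<in>S. if i = a then h (p i) else M (p i) i) = h (p a) * (\<Prod>i\<in>S - {a}. M (p i) i)" for p and h :: "'a => 'b"
  by(subst prod.remove[OF assms]) (auto intro!:arg_cong2[where f="(*)"] prod.cong)
 show ?thesis
  unfolding sdet_def 1[of "%x. \<Sum>b\<in>B. f b x * c b"] 1[of "f _"]
  by(subst sum_distrib_right, subst sum.swap) (simp add:sum_distrib_left sum_distrib_right mult_ac)
qed

lemma sdet_eq_columns:
 fixes M :: "'a => 'a => complex"
 assumes "finite S" "a : S" "c : S" "a ~= c" "!!i. M i a = M i c"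
 shows "sdet S M = 0"
proof -
 let ?t = "Transposition.transpose a c"
 have t: "?t permutes S" by(rule permutes_swap_id) (use assms in auto)
 have M: "M i (?t j) = M i j" for i j using assms(5)[of i] by(simp add:Transposition.transpose_def)
 have "sdet S M = (\<Sum>p | p permutes S. of_int (sign (p \<circ> ?t)) * (\<Prod>i\<in>S. M ((p \<circ> ?t) i) i))"
  unfolding sdet_def by(rule sum_permutations_compose_right[OF t])
 also have "... = (\<Sum>p | p permutes S. - (of_int (sign p) * (\<Prod>i\<in>S. M (p i) i)))"
 proof (rule sum.cong[OF refl])
  fix p assume p: "p : {p. p permutes S}"
  have "(\<Prod>i\<in>S. M (p i) i) = (\<Prod>i\<in>S. M ((p \<circ> ?t) i) i)" by(subst prod.permute[OF t]) (simp add:o_def M)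
  moreover have "sign (p \<circ> ?t) = - sign p"
   using sign_compose[of p ?t] p t assms permutation_permutes by(auto simp:sign_swap_id)
  ultimately show "of_int (sign (p \<circ> ?t)) * (\<Prod>i\<in>S. M ((p \<circ> ?t) i) i) = - (of_int (sign p) * (\<Prod>i\<in>S. M (p i) i))" by simp
 qed
 also have "... = - sdet S M" by(simp add:sdet_def sum_negf)
 finally show ?thesis by simp
qed

lemma sadj_mult:
 fixes M :: "'a => 'a => complex"
 assumes "finite S" "a : S" "c : S"
 shows "(\<Sum>b\<in>S. sadj S M a b * M b c) = (if a = c then sdet S M else 0)"
proof -
 have "(\<Sum>b\<in>S. sadj S M a b * M b c) = sdet S (%i j. if j = a then \<Sum>b\<in>S. (if i = b then 1 else 0) * M b c else M i j)"
  unfolding sadj_def by(rule sdet_column_sum[symmetric]) (use assms in auto)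
 also have "... = sdet S (%i j. if j = a then M i c else M i j)"
  by(rule sdet_cong) (use assms in \<open>simp add:if_distrib[of "%x. x * _"] cong: if_cong\<close>)
 finally show ?thesis using sdet_eq_columns[OF assms, of "%i j. if j = a then M i c else M i j"] by(auto intro:sdet_cong)
qed

lemma sadj_diag:
 assumes "finite S" "a : S"
 shows "sadj S M a a = sdet (S - {a}) M"
proof -
 have "sadj S M a a = (\<Sum>p | p permutes S. if p a = a then of_int (sign p) * (\<Prod>i\<in>S - {a}. M (p i) i) else 0)"
  unfolding sadj_def sdet_def by(subst prod.remove[OF assms]) (auto intro!:sum.cong arg_cong2[where f="(*)"] prod.cong)
 also have "... = (\<Sum>p | p permutes S & p a = a. of_int (sign p) * (\<Prod>i\<in>S - {a}. M (p i) i))"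
  using assms by(subst sum.inter_filter[symmetric]) (auto simp:finite_permutations)
 also have "{p. p permutes S & p a = a} = {p. p permutes (S - {a})}"
  by(auto intro:permutes_superset permutes_subset simp: permutes_not_in)
 finally show ?thesis by(simp add:sdet_def)
qed

lemma poly_sdet: "poly (sdet S P) x = sdet S (%i j. poly (P i j) x)"
 by(simp add:sdet_def poly_sum poly_prod)

lemma poly_sadj: "poly (sadj S P a b) x = sadj S (%i j. poly (P i j) x) a b"
 unfolding sadj_def poly_sdet by(intro arg_cong2[where f=sdet] refl ext) auto

lemma degree_sdet:
 assumes "finite S" "!!i j. j : S ==> degree (P i j) <= w j"
 shows "degree (sdet S P) <= (\<Sum>j\<in>S. w j)"
 unfolding sdet_def
proof (rule degree_sum_le)
 fix p
 have "degree (of_int (sign p) * (\<Prod>i\<in>S. P (p i) i)) <= degree (of_int (sign p) :: 'b poly) + degree (\<Prod>i\<in>S. P (p i) i)"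
  by(rule degree_mult_le)
 also have "... <= (\<Sum>i\<in>S. degree (P (p i) i))"
  using degree_prod_sum_le[OF assms(1), of "%i. P (p i) i"] by(simp add:o_def)
 also have "... <= (\<Sum>j\<in>S. w j)" by(rule sum_mono) (rule assms(2))
 finally show "degree (of_int (sign p) * (\<Prod>i\<in>S. P (p i) i)) <= (\<Sum>j\<in>S. w j)" .
qed (use assms in \<open>simp add:finite_permutations\<close>)

lemma degree_sadj:
 assumes "finite S" "!!i j. j : S ==> degree (P i j) <= w j"
 shows "degree (sadj S P a b) <= (\<Sum>j\<in>S. w j)"
 unfolding sadj_def by(rule degree_sdet) (use assms in auto)

lemma coeff_sdet_linear:
 assumes "finite S"
 shows "coeff (sdet S (%i j. [:N i j, L i j:])) (card S) = sdet S L"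
proof -
 have "degree (\<Prod>i\<in>S. [:n i, l i:]) <= card S & coeff (\<Prod>i\<in>S. [:n i, l i:]) (card S) = (\<Prod>i\<in>S. l i)" for n l :: "'a => 'b"
  using assms
 proof (induction S)
  case (insert a S)
  let ?q = "\<Prod>i\<in>S. [:n i, l i:]"
  have "degree ([:n a, l a:] * ?q) <= 1 + card S"
   using degree_mult_le[of "[:n a, l a:]" ?q] degree_pCons_le[of "n a" "[:l a:]"] insert.IH by(simp split: if_splits)
  moreover have "coeff ?q (Suc (card S)) = 0" by(rule coeff_eq_0) (use insert.IH in simp)
  ultimately show ?case using insert by(simp add:coeff_pCons)
 qed simp
 thus ?thesis by(simp add:sdet_def coeff_sum of_int_poly)
qed

text \<open>Hermitian matrices shifted by a spectral parameter.\<close>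

definition shifted :: "('a => 'a => complex) => complex => 'a => 'a => complex" where
 "shifted h z a b = h a b - (if a = b then z else 0)"

text \<open>The entries of the inverse of \<open>h - z\<close>, by Cramer's rule.\<close>

definition green :: "'a set => ('a => 'a => complex) => complex => 'a => 'a => complex" where
 "green S h z a b = sadj S (shifted h z) a b / sdet S (shifted h z)"

lemma green_mult:
 assumes "finite S" "a : S" "c : S" "sdet S (shifted h z) ~= 0"
 shows "(\<Sum>b\<in>S. green S h z a b * shifted h z b c) = (if a = c then 1 else 0)"
 using sadj_mult[OF assms(1-3), of "shifted h z"] assms(4) by(simp add:green_def sum_divide_distrib[symmetric])

lemma hermitian_row_bound:
 assumes "finite S" "!!a b. h b a = cnj (h a b)" "a : S"
  and y: "!!c. c : S ==> (\<Sum>b\<in>S. y b * shifted h z b c) = (if a = c then t else 0)"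
 shows "abs (Im z) * (\<Sum>b\<in>S. (cmod (y b))^2) <= cmod t * cmod (y a)"
proof -
 let ?W = "\<Sum>c\<in>S. \<Sum>b\<in>S. y b * h b c * cnj (y c)"
 have "cnj ?W = (\<Sum>c\<in>S. \<Sum>b\<in>S. y c * h c b * cnj (y b))" by(simp add:assms(2)[of _ _, symmetric] mult_ac)
 also have "... = ?W" by(rule sum.swap)
 finally have "- Im ?W = Im ?W" using cnj.sel(2)[of ?W] by simp
 hence W: "Im ?W = 0" by simp
 have "(\<Sum>c\<in>S. (\<Sum>b\<in>S. y b * shifted h z b c) * cnj (y c)) = ?W - (\<Sum>c\<in>S. z * (y c * cnj (y c)))"
 proof -
  have "(\<Sum>b\<in>S. y b * shifted h z b c) * cnj (y c) = (\<Sum>b\<in>S. y b * h b c * cnj (y c)) - z * (y c * cnj (y c))" if "c : S" for c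
   using assms(1) that
   by(simp add:shifted_def right_diff_distrib sum_subtractf left_diff_distrib sum_distrib_right sum_distrib_left mult_ac if_distrib[of "%x. x * _"] if_distrib[of "%x. _ * x"] cong: if_cong)
  thus ?thesis by(simp add:sum_subtractf)
 qed
 also have "(\<Sum>c\<in>S. z * (y c * cnj (y c))) = z * of_real (\<Sum>b\<in>S. (cmod (y b))^2)"
  by(simp add:sum_distrib_left complex_norm_square[symmetric] del: of_real_power)
 also have "(\<Sum>c\<in>S. (\<Sum>b\<in>S. y b * shifted h z b c) * cnj (y c)) = t * cnj (y a)"
  using assms(1,3) by(simp add:y if_distrib[of "%x. x * _"] cong: if_cong)
 finally have "Im z * (\<Sum>b\<in>S. (cmod (y b))^2) = - Im (t * cnj (y a))" using W by simp
 hence "abs (Im z * (\<Sum>b\<in>S. (cmod (y b))^2)) <= cmod (t * cnj (y a))" using abs_Im_le_cmod[of "t * cnj (y a)"] by simp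
 thus ?thesis by(simp add:abs_mult norm_mult sum_nonneg)
qed

text \<open>
 If the determinant vanished, a row of cofactors would be in the kernel; its diagonal entry is
 the determinant of a smaller matrix of the same kind, which is nonzero by induction.
\<close>

lemma sdet_shifted_nonzero:
 assumes "finite S" and h: "!!a b. h b a = cnj (h a b)" and z: "Im z ~= 0"
 shows "sdet S (shifted h z) ~= 0"
 using `finite S`
proof (induction S)
 case (insert a S)
 let ?S = "insert a S" and ?y = "sadj (insert a S) (shifted h z) a"
 have ya: "?y a ~= 0" using sadj_diag[of ?S a "shifted h z"] insert by simp
 show ?case
 proof
  assume "sdet ?S (shifted h z) = 0"
  hence "(\<Sum>b\<in>?S. ?y b * shifted h z b c) = (if a = c then 0 else 0)" if "c : ?S" for c
   using sadj_mult[of ?S a c "shifted h z"] insert.hyps that by(simp only: if_cancel finite_insert insertI1)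
  from hermitian_row_bound[OF _ h _ this] have "abs (Im z) * (\<Sum>b\<in>?S. (cmod (?y b))^2) <= 0" using insert by simp
  hence "(\<Sum>b\<in>?S. (cmod (?y b))^2) <= 0" using z by(simp add:mult_le_0_iff)
  moreover have "(cmod (?y a))^2 <= (\<Sum>b\<in>?S. (cmod (?y b))^2)" by(rule member_le_sum) (use insert in auto)
  moreover have "(cmod (?y a))^2 > 0" using ya by simp
  ultimately show False by linarith
 qed
qed (simp add:sdet_def)

lemma green_bound:
 assumes "finite S" and h: "!!a b. h b a = cnj (h a b)" and z: "Im z ~= 0" and ab: "a : S" "b : S"
 shows "cmod (green S h z a b) <= 1 / abs (Im z)"
proof -
 let ?y = "green S h z a"
 have le: "(cmod (?y b))^2 <= (\<Sum>b\<in>S. (cmod (?y b))^2)" if "b : S" for b by(rule member_le_sum) (use assms that in auto)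
 have 1: "abs (Im z) * (\<Sum>b\<in>S. (cmod (?y b))^2) <= cmod (?y a)"
  using hermitian_row_bound[where h=h and y="?y" and z=z and t=1, OF assms(1) h ab(1)] green_mult[OF assms(1) ab(1) _ sdet_shifted_nonzero[where h=h, OF assms(1) h z]] by simp
 have 2: "abs (Im z) * (cmod (?y b))^2 <= cmod (?y a)" if "b : S" for b
  using mult_left_mono[OF le[OF that], of "abs (Im z)"] 1 by linarith
 have "abs (Im z) * cmod (?y a) <= 1" using 2[OF ab(1)] z by(cases "?y a = 0") (simp_all add: power2_eq_square)
 moreover have "(abs (Im z) * cmod (?y b))^2 <= abs (Im z) * cmod (?y a)"
  using mult_left_mono[OF 2[OF ab(2)], of "abs (Im z)"] by(simp add:power2_eq_square mult_ac)
 ultimately have "(abs (Im z) * cmod (?y b))^2 <= 1^2" by simp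
 hence "abs (Im z) * cmod (?y b) <= 1" by(rule power2_le_imp_le) simp
 thus ?thesis using z by(simp add:field_simps)
qed

lemma log_deriv_pole:
 fixes D :: "complex poly"
 assumes "D ~= 0" "poly D z0 = 0"
 shows "filterlim (%z. poly (pderiv D) z / poly D z) at_infinity (at z0)"
proof -
 obtain q where q: "D = [:- z0, 1:] ^ order z0 D * q" "~ [:- z0, 1:] dvd q" using order_decomp[OF assms(1)] by blast
 obtain m where m: "order z0 D = Suc m" using assms order_root by(metis not0_implies_Suc)
 define N where "N = smult (of_nat (Suc m)) q + [:- z0, 1:] * pderiv q"
 have q0: "poly q z0 ~= 0" using q(2) by(simp add:dvd_iff_poly_eq_0)
 have "pderiv (X ^ Suc m * q) = X ^ m * (smult (of_nat (Suc m)) q + X * pderiv q)" if "pderiv X = 1" for X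
  unfolding pderiv_mult pderiv_power_Suc that by(simp add:algebra_simps)
 from this[of "[:- z0, 1:]"] have "pderiv D = [:- z0, 1:] ^ m * N" using q(1) unfolding m N_def by(simp add:pderiv_pCons)
 hence e: "poly (pderiv D) z / poly D z = poly N z / poly ([:- z0, 1:] * q) z" if "z ~= z0" for z
 proof -
  have "poly D z = (z - z0) ^ Suc m * poly q z" by(subst q(1)) (simp add:m algebra_simps)
  thus ?thesis using that `pderiv D = _` by(simp add:left_diff_distrib[symmetric])
 qed
 have "filterlim (%z. poly N z / poly ([:- z0, 1:] * q) z) at_infinity (at z0)"
 proof (rule filterlim_divide_at_infinity)
  show "(poly N \<longlongrightarrow> poly N z0) (at z0)" by(rule isContD[OF poly_isCont])
  show "poly N z0 ~= 0" using q0 by(simp add:N_def del: of_nat_Suc)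
  have "\<forall>\<^sub>F z in at z0. poly q z ~= 0" by(rule tendsto_imp_eventually_ne[OF isContD[OF poly_isCont] q0])
  hence ne: "\<forall>\<^sub>F z in at z0. poly ([:- z0, 1:] * q) z ~= 0"
   by(auto simp:eventually_at_filter left_diff_distrib[symmetric] elim:eventually_mono)
  thus "filterlim (poly ([:- z0, 1:] * q)) (at 0) (at z0)"
  proof -
   have "poly ([:- z0, 1:] * q) z0 = 0" by simp
   with isContD[OF poly_isCont[of z0 "[:- z0, 1:] * q"]] have "(poly ([:- z0, 1:] * q) \<longlongrightarrow> 0) (at z0)" by metis
   with ne show ?thesis unfolding filterlim_at by(simp only: UNIV_I simp_thms)
  qed
 qed
 thus ?thesis by(rule filterlim_mono_eventually) (use e in \<open>auto simp:eventually_at_filter\<close>)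
qed

definition shifted_poly :: "('a => 'a => complex) => 'a => 'a => complex poly" where
 "shifted_poly h a b = [:h a b, if a = b then - 1 else 0:]"

lemma poly_shifted: "poly (shifted_poly h a b) z = shifted h z a b"
 by(simp add:shifted_poly_def shifted_def)

lemma pderiv_sum: "pderiv (sum f S) = (\<Sum>i\<in>S. pderiv (f i))"
 by(induction S rule: infinite_finite_induct) (simp_all add: pderiv_add)

lemma pderiv_sdet_shifted:
 assumes "finite S"
 shows "pderiv (sdet S (shifted_poly h)) = - (\<Sum>a\<in>S. sadj S (shifted_poly h) a a)"
proof -
 have 1: "pderiv (\<Prod>i\<in>S. shifted_poly h (p i) i) = (\<Sum>a\<in>S. - (\<Prod>i\<in>S. if i = a then (if p i = a then 1 else 0) else shifted_poly h (p i) i))" for p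
 proof -
  have "pderiv (\<Prod>i\<in>S. shifted_poly h (p i) i) = (\<Sum>a\<in>S. (\<Prod>i\<in>S - {a}. shifted_poly h (p i) i) * pderiv (shifted_poly h (p a) a))"
   by(rule pderiv_prod)
  also have "... = (\<Sum>a\<in>S. - (\<Prod>i\<in>S. if i = a then (if p i = a then 1 else 0) else shifted_poly h (p i) i))"
  proof (rule sum.cong[OF refl])
   fix a assume "a : S"
   have "(\<Prod>i\<in>S - {a}. if i = a then (if p i = a then 1 else 0) else shifted_poly h (p i) i) = (\<Prod>i\<in>S - {a}. shifted_poly h (p i) i)"
    by(rule prod.cong) auto
   thus "(\<Prod>i\<in>S - {a}. shifted_poly h (p i) i) * pderiv (shifted_poly h (p a) a) = - (\<Prod>i\<in>S. if i = a then (if p i = a then 1 else 0) else shifted_poly h (p i) i)"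
    using assms `a : S` by(subst prod.remove) (auto simp:shifted_poly_def pderiv_pCons)
  qed
  finally show ?thesis .
 qed
 have c: "pderiv (of_int k * X) = of_int k * pderiv X" for k :: int and X :: "complex poly" by(simp add:of_int_poly pderiv_smult)
 show ?thesis
  unfolding sdet_def sadj_def pderiv_sum c 1 sum_negf mult_minus_right sum_distrib_left by(subst sum.swap) (simp cong: if_cong)
qed

text \<open>At an eigenvalue, the trace of the Green function blows up.\<close>

lemma green_trace_blowup:
 assumes "finite S" and h: "!!a b. h b a = cnj (h a b)" and "sdet S (shifted h z0) = 0"
 shows "filterlim (%z. \<Sum>a\<in>S. green S h z a a) at_infinity (at z0)"
proof -
 let ?D = "sdet S (shifted_poly h)"
 have D: "poly ?D z = sdet S (shifted h z)" for z by(simp add:poly_sdet poly_shifted)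
 have "poly ?D \<i> ~= 0" unfolding D by(rule sdet_shifted_nonzero[where h=h, OF assms(1) h]) simp
 hence "filterlim (%z. poly (pderiv ?D) z / poly ?D z) at_infinity (at z0)" by(intro log_deriv_pole) (use assms D in auto)
 hence "filterlim (%z. - (poly (pderiv ?D) z / poly ?D z)) at_infinity (at z0)"
  by(simp add:filterlim_at_infinity_conv_norm_at_top)
 moreover have "- (poly (pderiv ?D) z / poly ?D z) = (\<Sum>a\<in>S. green S h z a a)" for z
  by(simp add:D pderiv_sdet_shifted[OF assms(1)] poly_sum poly_sadj poly_shifted green_def sum_divide_distrib)
 ultimately show ?thesis by simp
qed

section \<open>Hoelder continuous distributions\<close>

lemma powr_add_le:
 fixes a b :: real
 assumes "0 <= a" "0 <= b" "0 < p" "p <= 1"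
 shows "(a + b) powr p <= a powr p + b powr p"
proof (cases "a + b = 0")
 case False
 define c where "c = a + b"
 have c: "c > 0" using assms False by(simp add:c_def)
 have *: "x / c <= x powr p / c powr p" if "0 <= x" "x <= c" for x
  using powr_mono'[of p 1 "x / c"] that assms c by(simp add:powr_divide)
 have "1 = a / c + b / c" using c by(simp add:c_def add_divide_distrib[symmetric])
 also have "... <= a powr p / c powr p + b powr p / c powr p" using assms by(intro add_mono *) (simp_all add: c_def)
 finally have "1 * c powr p <= (a powr p / c powr p + b powr p / c powr p) * c powr p" by(rule mult_right_mono) simp
 thus ?thesis using c by(simp add:distrib_right c_def[symmetric])
qed (use assms in auto)

lemma powr_sum_le:
 fixes f :: "'a => real"
 assumes "0 < p" "p <= 1" "!!i. 0 <= f i"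
 shows "(\<Sum>i\<in>S. f i) powr p <= (\<Sum>i\<in>S. f i powr p)"
proof (induction S rule: infinite_finite_induct)
 case (insert i S)
 thus ?case using powr_add_le[of "f i" "\<Sum>i\<in>S. f i" p] assms by(auto simp:sum_nonneg intro:order_trans)
qed auto

text \<open>A probability measure on the line that is Hoelder continuous and has a finite
 moment.\<close>

locale holder_measure = prob_space mu for mu :: "real measure" +
 fixes al q CA CQ :: real
 assumes sets_mu[measurable_cong, simp]: "sets mu = sets borel"
  and al: "al > 0" and q: "q > 0"
  and holder: "!!eps t. eps > 0 ==> measure mu {t - eps..t + eps} <= CA * eps powr al"
  and moment: "(\<integral>\<^sup>+x. ennreal (abs x powr q) \<partial>mu) <= ennreal CQ"
begin

lemma CA_nonneg: "CA >= 0"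
 using holder[of 1 0] by(simp add:order_trans[OF measure_nonneg])

lemma space_mu[simp]: "space mu = UNIV"
 using sets_eq_imp_space_eq[OF sets_mu] by simp

lemma disc_small:
 assumes "eps > 0"
 shows "measure mu {x. cmod (of_real x - b) <= eps} <= CA * eps powr al"
proof (rule order_trans[OF finite_measure_mono holder[OF assms, of "Re b"]])
 show "{x. cmod (of_real x - b) <= eps} \<subseteq> {Re b - eps..Re b + eps}"
 proof
  fix x assume "x : {x. cmod (of_real x - b) <= eps}"
  thus "x : {Re b - eps..Re b + eps}" using abs_Re_le_cmod[of "of_real x - b"] by(auto simp:abs_le_iff)
 qed
qed simp

lemma disc_uniformly_small: "kp > 0 ==> \<exists>eps>0. \<forall>b. measure mu {x. cmod (of_real x - b) <= eps} <= kp"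
proof -
 assume kp: "kp > 0"
 define eps where "eps = (kp / (CA + 1)) powr (1 / al)"
 have "CA * eps powr al = CA / (CA + 1) * kp" using kp al CA_nonneg by(simp add:eps_def powr_powr)
 also have "... <= 1 * kp" using kp CA_nonneg by(intro mult_right_mono) auto
 finally show ?thesis using kp CA_nonneg disc_small[of eps] by(intro exI[of _ eps]) (auto simp:eps_def intro:order_trans)
qed

text \<open>A Hoelder exponent above one would make the measure vanish.\<close>

lemma alpha_le_1: "al <= 1"
proof (rule ccontr)
 assume a: "~ al <= 1"
 have split: "measure mu {t - eps..t + eps} <= 2 ^ n * (CA * (eps / 2 ^ n) powr al)" if "eps > 0" for t eps n
  using that
 proof (induction n arbitrary: t eps)
  case (Suc n)
  have "measure mu {t - eps..t + eps} <= measure mu ({t - eps/2 - eps/2..t - eps/2 + eps/2} \<union> {t + eps/2 - eps/2..t + eps/2 + eps/2})"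
   by(intro finite_measure_mono) (auto simp:field_simps)
  also have "... <= measure mu {t - eps/2 - eps/2..t - eps/2 + eps/2} + measure mu {t + eps/2 - eps/2..t + eps/2 + eps/2}"
   by(rule measure_Un_le) auto
  also have "... <= 2 * (2 ^ n * (CA * (eps / 2 / 2 ^ n) powr al))"
   using Suc.IH[of "eps/2" "t - eps/2"] Suc.IH[of "eps/2" "t + eps/2"] Suc.prems by simp
  finally show ?case by simp
 qed (use holder in simp)
 have null: "measure mu {t - 1..t + 1} = 0" for t
 proof -
  have "measure mu {t - 1..t + 1} <= CA * (2 powr (1 - al)) ^ n" for n
  proof -
   have "2 ^ n * (1 / 2 ^ n) powr al = (2 powr (1 - al)) ^ n"
    by(simp add:powr_divide powr_diff powr_realpow[symmetric] powr_powr powr_power mult.commute)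
   thus ?thesis using split[of 1 t n] by(simp add:mult.left_commute[of "2 ^ n" CA])
  qed
  moreover have "(%n. CA * (2 powr (1 - al)) ^ n) ----> CA * 0"
   by(intro tendsto_mult tendsto_const LIMSEQ_realpow_zero) (use a powr_less_mono[of "1 - al" 0 2] in auto)
  ultimately have "measure mu {t - 1..t + 1} <= CA * 0" by(intro LIMSEQ_le_const) auto
  thus ?thesis using measure_nonneg[of mu "{t - 1..t + 1}"] by simp
 qed
 have "(\<Union>z::int. {of_int z - 1..of_int z + 1}) : null_sets mu"
  by(rule null_sets_UN) (simp add:null_sets_def emeasure_eq_measure null)
 moreover have "x : {of_int \<lfloor>x\<rfloor> - 1..of_int \<lfloor>x\<rfloor> + 1}" for x :: real by simp linarith
 hence "(\<Union>z::int. {of_int z - 1..of_int z + 1}) = (UNIV :: real set)" by blast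
 ultimately show False using emeasure_space_1 by(auto simp:null_sets_def)
qed

lemma inverse_moment:
 assumes "0 < p" "p < al"
 shows "\<exists>C\<ge>0. \<forall>b. (\<integral>\<^sup>+x. ennreal (inverse (cmod (of_real x - b)) powr p) \<partial>mu) <= ennreal C"
proof -
 let ?r = "2 powr (p - al)"
 have sm: "summable (%j. 2 powr p * CA * ?r ^ j)"
  using assms powr_less_mono[of "p - al" 0 2] by(intro summable_mult summable_geometric) auto
 define C where "C = 1 + (\<Sum>j. 2 powr p * CA * ?r ^ j)"
 let ?B = "%b j. {x. cmod (of_real x - b) <= (1/2) ^ j}"
 have le_suminf: "f j <= suminf f" for f :: "nat => ennreal" and j using sum_le_suminf[of f "{j}"] by simp
 have pw: "ennreal (inverse (cmod (of_real x - b)) powr p) <= 1 + (\<Sum>j. ennreal ((2 ^ Suc j) powr p) * indicator (?B b j) x)" for x b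
 proof (cases "inverse (cmod (of_real x - b)) <= 1")
  case True
  hence "inverse (cmod (of_real x - b)) powr p <= 1" using powr_mono2[of p "inverse (cmod (of_real x - b))" 1] assms by simp
  thus ?thesis by(simp add:add_increasing2 flip: ennreal_1)
 next
  case False
  let ?y = "cmod (of_real x - b)"
  have y: "0 < ?y" "?y <= 1" using False by(cases "?y = 0"; auto simp:inverse_eq_divide field_simps)+
  obtain n where n: "(1/2) ^ n < ?y" using real_arch_pow_inv[OF y(1), of "1/2"] by auto
  have n0: "~ (1/2) ^ 0 < ?y" using y by simp
  obtain j where j: "~ (1/2) ^ j < ?y" "(1/2) ^ Suc j < ?y" using ex_least_nat_less[of "%n. (1/2) ^ n < ?y" n] n n0 by blast
  have "inverse ?y <= inverse ((1/2) ^ Suc j)" using j(2) y by(intro le_imp_inverse_le) auto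
  hence "inverse ?y powr p <= (2 ^ Suc j) powr p" using assms by(intro powr_mono2) (auto simp:power_one_over inverse_eq_divide)
  hence "ennreal (inverse ?y powr p) <= ennreal ((2 ^ Suc j) powr p) * indicator (?B b j) x" using j(1) by(auto intro:ennreal_leI)
  also have "... <= (\<Sum>j. ennreal ((2 ^ Suc j) powr p) * indicator (?B b j) x)" by(rule le_suminf)
  finally show ?thesis by(simp add:add_increasing)
 qed
 have "(\<integral>\<^sup>+x. ennreal (inverse (cmod (of_real x - b)) powr p) \<partial>mu) <= ennreal C" for b
 proof -
  have "(\<integral>\<^sup>+x. ennreal (inverse (cmod (of_real x - b)) powr p) \<partial>mu)
    <= (\<integral>\<^sup>+x. 1 + (\<Sum>j. ennreal ((2 ^ Suc j) powr p) * indicator (?B b j) x) \<partial>mu)"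
   by(rule nn_integral_mono) (rule pw)
  also have "... = 1 + (\<Sum>j. ennreal ((2 ^ Suc j) powr p) * emeasure mu (?B b j))"
   by(simp add:nn_integral_add nn_integral_suminf nn_integral_cmult emeasure_space_1[simplified])
  also have "... <= 1 + (\<Sum>j. ennreal (2 powr p * CA * ?r ^ j))"
  proof (intro add_left_mono suminf_le summableI allI)
   fix j
   have "emeasure mu (?B b j) <= ennreal (CA * ((1/2) ^ j) powr al)"
    unfolding emeasure_eq_measure by(intro ennreal_leI disc_small) simp
   hence "ennreal ((2 ^ Suc j) powr p) * emeasure mu (?B b j) <= ennreal ((2 ^ Suc j) powr p) * ennreal (CA * ((1/2) ^ j) powr al)"
    by(rule mult_left_mono) simp
   also have "... = ennreal (2 powr p * CA * ?r ^ j)"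
   proof -
    have "(2 ^ j) powr p * ((1/2) ^ j) powr al = ?r ^ j"
     by(simp add:power_one_over powr_divide powr_diff powr_realpow[symmetric] powr_powr powr_power mult.commute)
    thus ?thesis using CA_nonneg by(simp add:ennreal_mult[symmetric] powr_mult mult_ac)
   qed
   finally show "ennreal ((2 ^ Suc j) powr p) * emeasure mu (?B b j) <= ennreal (2 powr p * CA * ?r ^ j)" .
  qed
  also have "... = ennreal C" using CA_nonneg sm by(simp add:C_def suminf_ennreal2 suminf_nonneg ennreal_plus)
  finally show ?thesis .
 qed
 moreover have "C >= 0" using CA_nonneg sm by(simp add:C_def suminf_nonneg add_nonneg_nonneg)
 ultimately show ?thesis by blast
qed

end

section \<open>The decoupling inequality\<close>

context holder_measure
begin

lemma tail_small:
 assumes "kp > 0"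
 shows "\<exists>m\<ge>0. measure mu {x. m < abs x} <= kp"
proof -
 have "(%n. measure mu {x. real n < abs x}) ----> measure mu (\<Inter>n. {x. real n < abs x})"
  by(intro finite_Lim_measure_decseq) (auto simp:decseq_def intro:le_less_trans)
 also have "(\<Inter>n. {x::real. real n < abs x}) = {}" by(auto simp:not_less) (metis reals_Archimedean2 less_asym)
 finally have "\<forall>\<^sub>F n in sequentially. measure mu {x. real n < abs x} < kp" using assms by(intro order_tendstoD(2)) auto
 then obtain n where "measure mu {x. real n < abs x} < kp" using eventually_happens' sequentially_bot by blast
 thus ?thesis by(intro exI[of _ "real n"]) auto
qed

lemma poly_powr_measurable[measurable]:
 "(%x. cmod (poly P (of_real x) / poly Q (of_real x)) powr p) : borel_measurable borel"
proof -
 have [measurable]: "(%x::real. poly P (of_real x :: complex)) : borel_measurable borel" for P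
  by(intro borel_measurable_continuous_onI continuous_intros)
 show ?thesis by measurable
qed

text \<open>
 The decoupling inequality for rational functions of bounded degree: sets of small measure
 carry at most half of the fractional moment.  After dividing out the scale of the roots,
 \<open>\<bar>P / Q\<bar>\<close> is bounded below on a set of measure one half, and bounded above by a function
 with a uniformly bounded moment of higher order.
\<close>

lemma decoupling:
 assumes s: "0 < s" "2 * real k * s <= q" "real k * s < al" and k: "k >= 1"
 shows "\<exists>kp>0. \<forall>P Q T. degree P <= k & degree Q <= k & Q ~= 0 & T : sets borel & measure mu T <= kp -->
   (\<integral>\<^sup>+x. ennreal (cmod (poly P (of_real x) / poly Q (of_real x)) powr (s / 3)) \<partial>mu) \<le>
   2 * (\<integral>\<^sup>+x. ennreal (cmod (poly P (of_real x) / poly Q (of_real x)) powr (s / 3)) * indicator (- T) x \<partial>mu)"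
proof -
 define p where "p = real k * s"
 have p: "0 < p" "p < al" "p <= 1" "2 * p <= q" using s k alpha_le_1 by(auto simp:p_def)
 obtain C0 where C0: "C0 >= 0" "!!b. (\<integral>\<^sup>+x. ennreal (inverse (cmod (of_real x - b)) powr p) \<partial>mu) <= ennreal C0"
  using inverse_moment[OF p(1,2)] by blast
 \<comment> \<open>A majorant for the rational function, in terms of its poles.\<close>
 define W where "W = (%b (l::nat) x. (1 + abs x) ^ (2 * k) * (1 + (\<Sum>j<l. inverse (cmod (of_real x - b j)))) ^ k)"
 have W1: "W b l x >= 1" for b l x unfolding W_def by(intro mult_ge1_I one_le_power) (auto simp:sum_nonneg)
 have Wm[measurable]: "W b l : borel_measurable borel" for b l unfolding W_def by measurable
 define C1 where "C1 = 1 + max 0 CQ * 2 powr q + 2 powr q + 1 + real k * C0"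
 have C1: "(\<integral>\<^sup>+x. ennreal (W b l x powr (s / 2)) \<partial>mu) <= ennreal C1" if l: "l <= k" for b l
 proof -
  have pw: "W b l x powr (s / 2) <= 2 powr q + 2 powr q * abs x powr q + (1 + (\<Sum>j<l. inverse (cmod (of_real x - b j)) powr p))" for x
  proof -
   let ?X = "1 + abs x" and ?Y = "1 + (\<Sum>j<l. inverse (cmod (of_real x - b j)))"
   have Y: "?Y > 0" by(intro add_pos_nonneg sum_nonneg) auto
   have "W b l x powr (s / 2) = ?X powr p * ?Y powr (p / 2)"
    unfolding W_def using Y by(simp add:powr_mult p_def powr_realpow[symmetric] powr_powr sum_nonneg)
   also have "... <= (?X powr p)^2 + (?Y powr (p / 2))^2"
    using sum_squares_bound[of "?X powr p" "?Y powr (p / 2)"] mult_nonneg_nonneg[OF powr_ge_zero powr_ge_zero, of ?X p ?Y "p / 2"] by linarith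
   also have "(?X powr p)^2 = ?X powr (2 * p)" by(simp add:power2_eq_square powr_add[symmetric])
   also have "(?Y powr (p / 2))^2 = ?Y powr p" by(simp add:power2_eq_square powr_add[symmetric])
   also have "?X powr (2 * p) <= ?X powr q" using p by(intro powr_mono) auto
   also have "?X powr q <= 2 powr q + 2 powr q * abs x powr q"
   proof (cases "abs x <= 1")
    case True
    hence "?X powr q <= 2 powr q" using q by(intro powr_mono2) auto
    thus ?thesis by(simp add:add_increasing2)
   next
    case False
    hence "?X powr q <= (2 * abs x) powr q" using q by(intro powr_mono2) auto
    thus ?thesis by(simp add:powr_mult add_increasing)
   qed
   also have "?Y powr p <= 1 powr p + (\<Sum>j<l. inverse (cmod (of_real x - b j))) powr p"
    using p by(intro powr_add_le) (auto simp:sum_nonneg)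
   also have "... <= 1 + (\<Sum>j<l. inverse (cmod (of_real x - b j)) powr p)"
    using powr_sum_le[OF p(1,3), of "%j. inverse (cmod (of_real x - b j))" "{..<l}"] by simp
   finally show ?thesis by simp
  qed
  have "(\<integral>\<^sup>+x. ennreal (W b l x powr (s / 2)) \<partial>mu) <= (\<integral>\<^sup>+x. ennreal (2 powr q + 2 powr q * abs x powr q + (1 + (\<Sum>j<l. inverse (cmod (of_real x - b j)) powr p))) \<partial>mu)"
   by(intro nn_integral_mono ennreal_leI pw)
  also have "... = (\<integral>\<^sup>+x. (ennreal (2 powr q) + ennreal (2 powr q) * ennreal (abs x powr q)) + (1 + (\<Sum>j<l. ennreal (inverse (cmod (of_real x - b j)) powr p))) \<partial>mu)"
   by(intro nn_integral_cong) (simp add:ennreal_mult sum_nonneg add_nonneg_nonneg sum_ennreal)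
  also have "... = (ennreal (2 powr q) + ennreal (2 powr q) * (\<integral>\<^sup>+x. ennreal (abs x powr q) \<partial>mu)) + (1 + (\<Sum>j<l. \<integral>\<^sup>+x. ennreal (inverse (cmod (of_real x - b j)) powr p) \<partial>mu))"
   by(simp add:nn_integral_add nn_integral_cmult nn_integral_sum emeasure_space_1[simplified] del: sum_ennreal)
  also have "... <= (ennreal (2 powr q) + ennreal (2 powr q) * ennreal (max 0 CQ)) + (1 + (\<Sum>j<l. ennreal C0))"
   using moment by(intro add_mono mult_left_mono sum_mono order_refl C0) (auto simp:ennreal_max_0)
  also have "... <= ennreal (2 powr q) + ennreal (2 powr q) * ennreal (max 0 CQ) + (1 + ennreal (real k * C0))"
   using l C0(1) by(intro add_left_mono) (simp add:ennreal_of_nat_eq_real_of_nat ennreal_mult[symmetric] mult_right_mono ennreal_leI)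
  also have "... = ennreal (2 powr q + 2 powr q * max 0 CQ + (1 + real k * C0))"
   using C0(1) by(simp add:ennreal_plus ennreal_mult flip: ennreal_1)
  also have "... <= ennreal C1" by(intro ennreal_leI) (simp add:C1_def mult.commute)
  finally show ?thesis .
 qed
 have C1_pos: "C1 > 0" using C0(1) by(simp add:C1_def add_pos_nonneg)
 \<comment> \<open>A set of measure at least one half on which all factors are of their typical size.\<close>
 obtain t0 where t0: "t0 > 0" "!!b. measure mu {x. cmod (of_real x - b) <= t0} <= 1 / (8 * real k)"
  using disc_uniformly_small[of "1 / (8 * real k)"] k by auto
 obtain M0 :: real where M0: "M0 >= 0" "measure mu {x. M0 < abs x} <= 1 / 4" using tail_small[of "1 / 4"] by auto
 define rho where "rho = t0 / (1 + M0 + t0)"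
 define c0 where "c0 = rho ^ k / (1 + M0) ^ k"
 have rho: "0 < rho" "rho <= 1" using t0 M0 by(auto simp:rho_def)
 have c0: "c0 > 0" using rho M0 by(simp add:c0_def)
 define c where "c = (1/2) * c0 powr (s/3)"
 define L where "L = (4 * C1 / c)^2"
 define kp where "kp = c / (4 * L)"
 have c: "c > 0" using c0 by(simp add:c_def)
 have L: "L > 0" using c C1_pos by(simp add:L_def)
 have kp: "kp > 0" using c L by(simp add:kp_def)
 show ?thesis
 proof (intro exI[of _ kp] conjI kp allI impI, elim conjE)
  fix P Q :: "complex poly" and T :: "real set"
  assume deg: "degree P <= k" "degree Q <= k" and Q: "Q ~= 0" and T[measurable]: "T : sets borel" and Tk: "measure mu T <= kp"
  let ?f = "%x. cmod (poly P (of_real x) / poly Q (of_real x)) powr (s / 3)"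
  show "(\<integral>\<^sup>+x. ennreal (?f x) \<partial>mu) <= 2 * (\<integral>\<^sup>+x. ennreal (?f x) * indicator (- T) x \<partial>mu)"
  proof (cases "P = 0")
   case False
   obtain a where a: "smult (lead_coeff P) (\<Prod>i<degree P. [:- a i, 1:]) = P" by(rule complex_poly_decompose')
   obtain b where b: "smult (lead_coeff Q) (\<Prod>i<degree Q. [:- b i, 1:]) = Q" by(rule complex_poly_decompose')
   define u where "u = (%x i. cmod (of_real x - a i) / (1 + cmod (a i)))"
   define w where "w = (%x i. cmod (of_real x - b i) / (1 + cmod (b i)))"
   define N where "N = cmod (lead_coeff P) * (\<Prod>i<degree P. 1 + cmod (a i)) / (cmod (lead_coeff Q) * (\<Prod>i<degree Q. 1 + cmod (b i)))"
   have pos: "(\<Prod>i<n. 1 + cmod (r i)) > 0" for n :: nat and r by(intro prod_pos) (auto intro:add_pos_nonneg)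
   have N: "N > 0" unfolding N_def using False Q pos by(intro divide_pos_pos mult_pos_pos) auto
   have fe: "cmod (poly P (of_real x) / poly Q (of_real x)) = N * ((\<Prod>i<degree P. u x i) * (\<Prod>i<degree Q. inverse (w x i)))" for x
   proof -
    have "cmod (poly P (of_real x)) = cmod (lead_coeff P) * (\<Prod>i<degree P. cmod (of_real x - a i))"
     by(subst a[symmetric]) (simp add:poly_prod norm_mult prod_norm[symmetric] norm_minus_commute)
    moreover have "cmod (poly Q (of_real x)) = cmod (lead_coeff Q) * (\<Prod>i<degree Q. cmod (of_real x - b i))"
     by(subst b[symmetric]) (simp add:poly_prod norm_mult prod_norm[symmetric] norm_minus_commute)
    moreover have "(\<Prod>i<n. 1 + cmod (r i)) ~= 0" for n :: nat and r using pos[of r n] by(metis less_irrefl)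
    ultimately show ?thesis by(simp add:N_def u_def w_def norm_divide prod_dividef field_simps)
   qed
   have tri: "1 + cmod r <= 1 + abs x + cmod (of_real x - r)" for x r
    using norm_triangle_ineq4[of "of_real x" "of_real x - r"] by simp
   have pr: "cmod (of_real x - r) <= (1 + m) * (1 + cmod r)" if "abs x <= m" for x m r
   proof -
    have "cmod (of_real x - r) <= m + cmod r" using norm_triangle_ineq4[of "of_real x" r] that by simp
    also have "... <= (1 + m) * (1 + cmod r)" using that by(simp add:distrib_left distrib_right)
    finally show ?thesis .
   qed
   have upper: "?f x <= N powr (s / 3) * W b (degree Q) x powr (s / 3)" for x
   proof -
    let ?U = "1 + (\<Sum>j<degree Q. inverse (cmod (of_real x - b j)))"
    have U: "?U >= 1" by(simp add:sum_nonneg)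
    have "(\<Prod>i<degree P. u x i) <= (\<Prod>i<degree P. 1 + abs x)"
    proof (rule prod_mono, safe)
     fix i
     show "0 <= u x i" by(simp add:u_def)
     have "cmod (of_real x - a i) <= (1 + abs x) * (1 + cmod (a i))" by(rule pr) simp
     thus "u x i <= 1 + abs x" by(simp add:u_def divide_le_eq add_pos_nonneg)
    qed
    also have "... <= (1 + abs x) ^ k" using deg by(simp add:power_increasing)
    finally have 1: "(\<Prod>i<degree P. u x i) <= (1 + abs x) ^ k" .
    have "(\<Prod>i<degree Q. inverse (w x i)) <= (\<Prod>i<degree Q. (1 + abs x) * ?U)"
    proof (rule prod_mono, safe)
     fix i assume i: "i < degree Q"
     show "0 <= inverse (w x i)" by(simp add:w_def)
     let ?y = "cmod (of_real x - b i)"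
     have "inverse (w x i) <= (1 + abs x) * (1 + inverse ?y)"
     proof (cases "?y = 0")
      case False
      hence "(1 + cmod (b i)) / ?y <= (1 + abs x + ?y) / ?y" by(intro divide_right_mono tri) simp
      also have "... = 1 + (1 + abs x) * inverse ?y" using False by(simp add:field_simps)
      also have "... <= (1 + abs x) * (1 + inverse ?y)" by(simp add:distrib_left)
      finally show ?thesis by(simp add:w_def inverse_eq_divide)
     qed (simp add:w_def)
     also have "... <= (1 + abs x) * ?U"
      using member_le_sum[of i "{..<degree Q}" "%j. inverse (cmod (of_real x - b j))"] i by(intro mult_left_mono) auto
     finally show "inverse (w x i) <= (1 + abs x) * ?U" .
    qed
    also have "... <= ((1 + abs x) * ?U) ^ k" using deg U by(simp add:power_increasing mult_ge1_I)
    finally have "(\<Prod>i<degree P. u x i) * (\<Prod>i<degree Q. inverse (w x i)) <= (1 + abs x) ^ k * ((1 + abs x) * ?U) ^ k"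
     using 1 by(intro mult_mono prod_nonneg) (auto simp:w_def)
    also have "... = W b (degree Q) x" by(simp add:W_def power_mult_distrib mult_2 power_add)
    finally have "cmod (poly P (of_real x) / poly Q (of_real x)) <= N * W b (degree Q) x"
     unfolding fe using N by(intro mult_left_mono) auto
    hence "?f x <= (N * W b (degree Q) x) powr (s / 3)" using s by(intro powr_mono2) auto
    thus ?thesis using N order_trans[OF zero_le_one W1[of b "degree Q" x]] by(simp add:powr_mult)
   qed
   define Gd where "Gd = {x. abs x <= M0 & (\<forall>i<degree P. cmod (of_real x - a i) > t0) & (\<forall>i<degree Q. cmod (of_real x - b i) > t0)}"
   have Gdm[measurable]: "Gd : sets borel" unfolding Gd_def by measurable
   have lower: "N * c0 <= cmod (poly P (of_real x) / poly Q (of_real x))" if x: "x : Gd" for x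
   proof -
    have ge: "rho <= y / (1 + cmod r)" if "y = cmod (of_real x - r)" "y > t0" for r y
    proof -
     have "rho <= y / (1 + M0 + y)" unfolding rho_def using that(2) t0(1) M0(1) mult_left_mono[of t0 y M0] by(simp add:field_simps)
     also have "... <= y / (1 + cmod r)" using tri[of r x] that t0 x by(intro divide_left_mono) (auto simp:Gd_def add_pos_nonneg)
     finally show ?thesis .
    qed
    have "rho ^ k <= rho ^ degree P" using rho deg by(intro power_decreasing) auto
    also have "... = (\<Prod>i<degree P. rho)" by simp
    also have "... <= (\<Prod>i<degree P. u x i)" using x rho by(intro prod_mono) (auto simp:u_def Gd_def intro!:ge)
    finally have 1: "rho ^ k <= (\<Prod>i<degree P. u x i)" .
    have "inverse (1 + M0) ^ k <= inverse (1 + M0) ^ degree Q"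
     using M0 deg by(intro power_decreasing) (auto simp:inverse_le_1_iff)
    also have "... = (\<Prod>i<degree Q. inverse (1 + M0))" by simp
    also have "... <= (\<Prod>i<degree Q. inverse (w x i))"
    proof (rule prod_mono, safe)
     fix i assume i: "i < degree Q"
     have "cmod (of_real x - b i) <= (1 + M0) * (1 + cmod (b i))" by(rule pr) (use x in \<open>simp add:Gd_def\<close>)
     hence "w x i <= 1 + M0" by(simp add:w_def divide_le_eq add_pos_nonneg)
     moreover have "0 < cmod (of_real x - b i)" using x i less_trans[OF t0(1)] unfolding Gd_def by blast
     hence "w x i > 0" unfolding w_def by(intro divide_pos_pos add_pos_nonneg) simp_all
     ultimately show "inverse (1 + M0) <= inverse (w x i)" by(rule le_imp_inverse_le)
    qed (use M0 in simp)
    finally have "rho ^ k * inverse (1 + M0) ^ k <= (\<Prod>i<degree P. u x i) * (\<Prod>i<degree Q. inverse (w x i))"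
     using 1 rho M0 by(intro mult_mono prod_nonneg) (auto simp:u_def)
    thus ?thesis unfolding fe c0_def using N by(intro mult_left_mono) (auto simp:divide_inverse power_inverse)
   qed
   have "measure mu (- Gd) <= measure mu ({x. M0 < abs x} \<union> ((\<Union>i<degree P. {x. cmod (of_real x - a i) <= t0}) \<union> (\<Union>i<degree Q. {x. cmod (of_real x - b i) <= t0})))"
    by(intro finite_measure_mono) (auto simp:Gd_def not_le not_less)
   also have "... <= measure mu {x. M0 < abs x} + ((\<Sum>i<degree P. measure mu {x. cmod (of_real x - a i) <= t0}) + (\<Sum>i<degree Q. measure mu {x. cmod (of_real x - b i) <= t0}))"
    by(intro order_trans[OF measure_Un_le] add_mono finite_measure_subadditive_finite order_refl) auto
   also have "... <= 1 / 4 + ((\<Sum>i<degree P. 1 / (8 * real k)) + (\<Sum>i<degree Q. 1 / (8 * real k)))"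
    by(intro add_mono M0 sum_mono t0)
   also have "... <= 1 / 4 + (1 / 8 + 1 / 8)" using deg k by(intro add_left_mono add_mono) (auto simp:field_simps)
   finally have "measure mu (- Gd) <= 1 / 2" by simp
   hence Gd: "measure mu Gd >= 1 / 2" using prob_compl[of Gd] by(simp add:Compl_eq_Diff_UNIV)
   let ?N = "N powr (s / 3)"
   have total: "ennreal (?N * c) <= (\<integral>\<^sup>+x. ennreal (?f x) \<partial>mu)"
   proof -
    have "ennreal (?N * c) <= ennreal ((N * c0) powr (s / 3)) * emeasure mu Gd"
     using Gd N c0 by(simp add:c_def powr_mult emeasure_eq_measure ennreal_mult[symmetric] mult_left_mono ennreal_leI mult_ac)
    also have "... = (\<integral>\<^sup>+x. ennreal ((N * c0) powr (s / 3)) * indicator Gd x \<partial>mu)"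
     by(rule nn_integral_cmult_indicator[symmetric]) simp
    also have "... <= (\<integral>\<^sup>+x. ennreal (?f x) \<partial>mu)"
     using lower N c0 s by(intro nn_integral_mono) (auto simp:indicator_def intro!:ennreal_leI powr_mono2)
    finally show ?thesis .
   qed
   have onT: "(\<integral>\<^sup>+x. ennreal (?f x) * indicator T x \<partial>mu) <= ennreal (?N * c / 2)"
   proof -
    let ?W = "W b (degree Q)"
    have pw: "ennreal (?f x) * indicator T x <= ennreal (?N * L) * indicator T x + ennreal (?N / sqrt L) * ennreal (?W x powr (s / 2))" for x
    proof (cases "x : T & ?W x powr (s / 3) > L")
     case True
     have "?W x powr (s / 3) * sqrt L <= ?W x powr (s / 3) * ?W x powr (s / 6)"
     proof (rule mult_left_mono)
      have "sqrt L <= sqrt (?W x powr (s / 3))" using True by simp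
      also have "... = ?W x powr (s / 6)" using W1[of b "degree Q" x] by(simp add:powr_half_sqrt[symmetric] powr_powr)
      finally show "sqrt L <= ?W x powr (s / 6)" .
     qed simp
     also have "... = ?W x powr (s / 2)" by(simp add:powr_add[symmetric])
     finally have "?W x powr (s / 3) <= ?W x powr (s / 2) / sqrt L" using L by(simp add:field_simps)
     hence "?f x <= ?N * (?W x powr (s / 2) / sqrt L)" using upper[of x] N by(meson mult_left_mono order_trans powr_ge_zero)
     thus ?thesis using True by(simp add:ennreal_mult[symmetric] add_increasing ennreal_leI L less_imp_le)
    next
     case False
     hence "?f x <= ?N * L" if "x : T" using upper[of x] that mult_left_mono[of "?W x powr (s / 3)" L ?N] by simp
     thus ?thesis by(auto simp:indicator_def intro!:add_increasing2 ennreal_leI)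
    qed
    have "(\<integral>\<^sup>+x. ennreal (?f x) * indicator T x \<partial>mu) <= (\<integral>\<^sup>+x. ennreal (?N * L) * indicator T x + ennreal (?N / sqrt L) * ennreal (?W x powr (s / 2)) \<partial>mu)"
     by(rule nn_integral_mono) (rule pw)
    also have "... = ennreal (?N * L) * emeasure mu T + ennreal (?N / sqrt L) * (\<integral>\<^sup>+x. ennreal (?W x powr (s / 2)) \<partial>mu)"
     by(simp add:nn_integral_add nn_integral_cmult)
    also have "... <= ennreal (?N * L) * ennreal kp + ennreal (?N / sqrt L) * ennreal C1"
     using Tk C1[OF deg(2)] by(intro add_mono mult_left_mono) (auto simp:emeasure_eq_measure intro:ennreal_leI)
    also have "... = ennreal (?N * L * kp + ?N / sqrt L * C1)"
     using L kp C1_pos by(simp add:ennreal_mult[symmetric] ennreal_plus[symmetric] del: ennreal_plus)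
    also have "?N * L * kp + ?N / sqrt L * C1 = ?N * c / 2"
    proof -
     have "sqrt L = 4 * C1 / c" using c C1_pos by(simp add:L_def)
     hence "C1 / sqrt L = c / 4" using c C1_pos by simp
     moreover have "L * kp = c / 4" using L by(simp add:kp_def)
     moreover have "?N * L * kp + ?N / sqrt L * C1 = ?N * (L * kp) + ?N * (C1 / sqrt L)" by simp
     ultimately have "?N * L * kp + ?N / sqrt L * C1 = ?N * (c / 4) + ?N * (c / 4)" by metis
     thus ?thesis by simp
    qed
    finally show ?thesis .
   qed
   let ?X = "\<integral>\<^sup>+x. ennreal (?f x) * indicator T x \<partial>mu" and ?Y = "\<integral>\<^sup>+x. ennreal (?f x) * indicator (- T) x \<partial>mu"
   have XY: "(\<integral>\<^sup>+x. ennreal (?f x) \<partial>mu) = ?X + ?Y"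
    by(subst nn_integral_add[symmetric]) (auto intro!:nn_integral_cong simp: indicator_def)
   have "2 * ?X <= 2 * ennreal (?N * c / 2)" by(rule mult_left_mono[OF onT]) simp
   also have "... = ennreal (?N * c)" using c by(subst ennreal_numeral[symmetric], subst ennreal_mult[symmetric]) auto
   finally have le: "2 * ?X <= ennreal (?N * c)" .
   have gen: "X + Y <= 2 * Y" if "2 * X <= n" "n <= X + Y" "X < \<top>" for X Y n :: ennreal
   proof -
    have "X + X <= X + Y" using order_trans[OF that(1,2)] unfolding mult_2 .
    hence "X <= Y" using that(3) ennreal_add_left_cancel_le by auto
    thus ?thesis by(simp add:mult_2 add_right_mono)
   qed
   have "?X < \<top>" using onT by(auto intro:le_less_trans)
   thus ?thesis unfolding XY by(rule gen[OF le total[unfolded XY]])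
  qed simp
 qed
qed

end

section \<open>Inverting the block at one site\<close>

lemma cmod_sdet_le:
 assumes "finite S" "!!i j. i : S ==> j : S ==> cmod (M i j) <= c"
 shows "cmod (sdet S M) <= fact (card S) * c ^ card S"
proof -
 have "cmod (sdet S M) <= (\<Sum>p | p permutes S. c ^ card S)"
  unfolding sdet_def
 proof (rule sum_norm_le)
  fix p assume "p : {p. p permutes S}"
  hence "cmod (\<Prod>i\<in>S. M (p i) i) <= (\<Prod>i\<in>S. c)"
   unfolding prod_norm[symmetric] by(intro prod_mono) (auto intro!:assms simp: permutes_in_image)
  thus "cmod (of_int (sign p) * (\<Prod>i\<in>S. M (p i) i)) <= c ^ card S" by(simp add:norm_mult sign_def)
 qed
 thus ?thesis by(simp add:card_permutations[OF refl assms(1)])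
qed

lemma cmod_sadj_le:
 assumes "finite S" "!!i j. i : S ==> j : S ==> cmod (M i j) <= c" "c >= 1"
 shows "cmod (sadj S M a b) <= fact (card S) * c ^ card S"
 unfolding sadj_def by(rule cmod_sdet_le) (use assms in auto)

lemma norm_entry_le: "cmod (M $ i $ j) <= norm (M :: complex ^ 'k ^ 'k)"
 by(meson Finite_Cartesian_Product.norm_nth_le order_trans)

context holder_measure
begin

text \<open>Outside a set of small measure, the blocks \<open>x A + B - z\<close> are invertible
 with a uniform bound.\<close>

lemma single_site:
 fixes A B :: "complex ^ 'k::finite ^ 'k"
 assumes A: "invertible A" and kp: "kp > 0"
 shows "\<exists>C\<ge>0. \<forall>z. abs (Re z) <= c & abs (Im z) <= 1 --> (\<exists>T\<in>sets borel. measure mu T <= kp &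
  (\<forall>x y. x ~: T --> (\<Sum>j\<in>UNIV. cmod (y j)) \<le>
    C * (\<Sum>l\<in>UNIV. cmod (\<Sum>j\<in>UNIV. y j * ((x *\<^sub>R A + B) $ j $ l - (if j = l then z else 0))))))"
proof -
 let ?k = "CARD('k)"
 obtain M where M: "measure mu {x. M < abs x} <= kp / 2" "M >= 0" using tail_small[of "kp / 2"] kp by auto
 obtain t where t: "t > 0" "!!b. measure mu {x. cmod (of_real x - b) <= t} <= kp / (2 * real ?k)"
  using disc_uniformly_small[of "kp / (2 * real ?k)"] kp by auto
 define dA where "dA = cmod (det A)"
 have dA: "dA > 0" using A by(simp add:dA_def invertible_det_nz)
 define m where "m = 1 + M * norm A + norm B + (abs c + 1)"
 define C where "C = real ?k * (fact ?k * m ^ ?k / (dA * t ^ ?k))"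
 have m1: "m >= 1" using M by(simp add:m_def)
 show ?thesis
 proof (intro exI[of _ C] conjI allI impI, goal_cases)
  case (2 z)
  define N where "N = (%x::real. %l j. (x *\<^sub>R A + B) $ j $ l - (if j = l then z else 0))"
  define NP where "NP = (%l j. [:B $ j $ l - (if j = l then z else 0), A $ j $ l:])"
  define Q where "Q = sdet UNIV NP"
  have NP: "poly (NP l j) (of_real x) = N x l j" for l j x by(simp add:NP_def N_def scaleR_conv_of_real[of x "A $ j $ l"])
  have Q: "poly Q (of_real x) = sdet UNIV (N x)" for x by(simp add:Q_def poly_sdet NP)
  have cQ: "cmod (coeff Q ?k) = dA" unfolding Q_def NP_def coeff_sdet_linear[OF finite] dA_def by(simp add:sdet_def det_def)
  have "degree Q <= (\<Sum>j\<in>(UNIV::'k set). 1)" unfolding Q_def by(rule degree_sdet) (auto simp:NP_def)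
  hence dQ: "degree Q = ?k" using cQ dA le_degree[of Q ?k] by(cases "coeff Q ?k = 0") auto
  obtain b where b: "smult (lead_coeff Q) (\<Prod>i<degree Q. [:- b i, 1:]) = Q" by(rule complex_poly_decompose')
  define T where "T = {x. M < abs x} \<union> (\<Union>i<?k. {x. cmod (of_real x - b i) <= t})"
  have "T : sets borel" unfolding T_def by measurable
  moreover have "measure mu T <= kp"
  proof -
   have "measure mu T <= measure mu {x. M < abs x} + (\<Sum>i<?k. measure mu {x. cmod (of_real x - b i) <= t})"
    unfolding T_def by(intro order_trans[OF measure_Un_le] add_mono finite_measure_subadditive_finite order_refl) auto
   also have "... <= kp / 2 + (\<Sum>i<?k. kp / (2 * real ?k))" by(intro add_mono M sum_mono t)
   finally show ?thesis by simp
  qed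
  moreover have "(\<Sum>j\<in>UNIV. cmod (y j)) <= C * (\<Sum>l\<in>UNIV. cmod (\<Sum>j\<in>UNIV. y j * N x l j))" if x: "x ~: T" for x y
  proof -
   have "dA * t ^ ?k <= dA * (\<Prod>i<?k. cmod (of_real x - b i))"
   proof (rule mult_left_mono)
    have "(\<Prod>i<?k. t) <= (\<Prod>i<?k. cmod (of_real x - b i))"
     using x t(1) by(intro prod_mono) (auto simp:T_def not_le intro:less_imp_le)
    thus "t ^ ?k <= (\<Prod>i<?k. cmod (of_real x - b i))" by simp
   qed (use dA in simp)
   also have "... = cmod (poly Q (of_real x))"
    by(subst b[symmetric]) (simp add:dQ cQ poly_prod norm_mult prod_norm[symmetric] norm_minus_commute)
   finally have D: "dA * t ^ ?k <= cmod (sdet UNIV (N x))" by(simp add:Q)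
   hence D0: "cmod (sdet UNIV (N x)) > 0" using dA t by(meson less_le_trans mult_pos_pos zero_less_power)
   let ?e = "%l. \<Sum>j\<in>UNIV. y j * N x l j"
   have ent: "cmod (N x l j) <= m" for l j
   proof -
    have "cmod ((x *\<^sub>R A + B) $ j $ l) <= abs x * norm A + norm B"
     using norm_triangle_ineq[of "x *\<^sub>R A $ j $ l" "B $ j $ l"] norm_entry_le[of A j l] norm_entry_le[of B j l]
      mult_left_mono[OF norm_entry_le[of A j l] abs_ge_zero[of x]] by simp
    also have "... <= M * norm A + norm B" using x by(intro add_right_mono mult_right_mono) (auto simp:T_def)
    finally have "cmod ((x *\<^sub>R A + B) $ j $ l) <= M * norm A + norm B" .
    moreover have "cmod (if j = l then z else 0) <= abs c + 1" using 2 cmod_le[of z] by auto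
    ultimately show ?thesis
     unfolding N_def m_def using norm_triangle_ineq4[of "(x *\<^sub>R A + B) $ j $ l" "if j = l then z else 0"] by linarith
   qed
   have "cmod (y a) <= fact ?k * m ^ ?k / (dA * t ^ ?k) * (\<Sum>l\<in>UNIV. cmod (?e l))" for a
   proof -
    have "(\<Sum>l\<in>UNIV. sadj UNIV (N x) a l * ?e l) = (\<Sum>j\<in>UNIV. (\<Sum>l\<in>UNIV. sadj UNIV (N x) a l * N x l j) * y j)"
     unfolding sum_distrib_left sum_distrib_right by(subst sum.swap) (simp add:mult_ac)
    also have "... = sdet UNIV (N x) * y a" by(simp add:sadj_mult if_distrib[of "%x. x * _"] cong: if_cong)
    finally have "cmod (sdet UNIV (N x)) * cmod (y a) = cmod (\<Sum>l\<in>UNIV. sadj UNIV (N x) a l * ?e l)"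
     by(simp add:norm_mult)
    also have "... <= (\<Sum>l\<in>UNIV. fact ?k * m ^ ?k * cmod (?e l))"
     by(rule sum_norm_le) (auto simp:norm_mult intro!:mult_right_mono cmod_sadj_le ent m1)
    finally have "(dA * t ^ ?k) * cmod (y a) <= fact ?k * m ^ ?k * (\<Sum>l\<in>UNIV. cmod (?e l))"
     using mult_right_mono[OF D norm_ge_zero[of "y a"]] by(simp add:sum_distrib_left)
    thus ?thesis using dA t by(simp add:pos_le_divide_eq mult.commute)
   qed
   hence "(\<Sum>j\<in>UNIV. cmod (y j)) <= real ?k * (fact ?k * m ^ ?k / (dA * t ^ ?k) * (\<Sum>l\<in>UNIV. cmod (?e l)))"
    by(rule sum_bounded_above)
   thus ?thesis by(simp add:C_def mult.assoc)
  qed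
  ultimately show ?case by(auto simp:N_def)
 qed (use dA t m1 in \<open>simp add:C_def\<close>)
qed

end

context hamil
begin

text \<open>Matrix elements of the Hamiltonian between the unit vectors of the field space.\<close>

definition hent :: "(int ^ 'd => real) => (int ^ 'd) \<times> 'k => (int ^ 'd) \<times> 'k => complex" where
 "hent u a b = (if fst a = fst b then pot (u (fst a)) $ snd a $ snd b
   else if adjacent (fst a) (fst b) then of_real (inverse g) * K (fst a - fst b) $ snd a $ snd b else 0)"

lemma hent_hermitian: "hent u b a = cnj (hent u a b)"
proof -
 have 1: "pot r $ i $ j = cnj (pot r $ j $ i)" for r i j
  using hermitian_pot[of r] unfolding hermitian_def conj_transpose_def by(metis vec_lambda_beta)
 have 2: "K (n - m) $ i $ j = cnj (K (m - n) $ j $ i)" if "adjacent m n" for m n i j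
  by(subst K_adj[OF that]) (simp add:conj_transpose_def)
 show ?thesis
 proof (cases "fst a = fst b")
  case True
  thus ?thesis unfolding hent_def by(simp only: refl if_True) (rule 1)
 next
  case False
  thus ?thesis
   using 2[of "fst a" "fst b" "snd b" "snd a", symmetric] adjacent_sym[of "fst a" "fst b"]
   by(cases "adjacent (fst a) (fst b)") (simp_all add: hent_def)
 qed
qed

lemma hent_measurable:
 assumes "!!n. n : Lam ==> (%w. v w n) : borel_measurable M" "a : Lam \<times> UNIV"
 shows "(%w. hent (v w) a b) : borel_measurable M"
proof -
 have [measurable]: "(%w. v w (fst a)) : borel_measurable M" using assms by auto
 have "(%w. (v w (fst a) *\<^sub>R A + B) $ snd a $ snd b) : borel_measurable M" by simp
 thus ?thesis unfolding hent_def pot_def by(cases "fst a = fst b") auto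
qed

end

lemma sdet_measurable:
 fixes X :: "'w => 'a => 'a => complex"
 assumes "!!a b. a : S ==> b : S ==> (%w. X w a b) : borel_measurable M"
 shows "(%w. sdet S (X w)) : borel_measurable M"
 unfolding sdet_def
 by(intro borel_measurable_sum borel_measurable_times borel_measurable_const borel_measurable_prod assms) (auto simp:permutes_in_image)

lemma sadj_measurable:
 fixes X :: "'w => 'a => 'a => complex"
 assumes "!!a b. a : S ==> b : S ==> (%w. X w a b) : borel_measurable M"
 shows "(%w. sadj S (X w) a b) : borel_measurable M"
 unfolding sadj_def by(rule sdet_measurable) (use assms in auto)

section \<open>Fractional moments of the Green function\<close>

text \<open>The random Hamiltonian in an energy window \<open>{-c..c}\<close>. The assumption
 \<open>dec\<close> is the decoupling inequality for sets of measure at most \<open>kp\<close>; the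
 assumption \<open>site\<close> says that off such a set the block at one site, shifted by an energy
 in the window, has an inverse bounded by \<open>C1\<close>. Neither \<open>kp\<close> nor
 \<open>C1\<close> depends on \<open>g\<close>.\<close>

locale anderson = hamil A B K g CK + holder_measure mu al q CA CQ
 for A B :: "complex ^ 'k::finite ^ 'k" and K :: "int ^ 'd::finite => complex ^ 'k ^ 'k" and g CK :: real
  and mu :: "real measure" and al q CA CQ :: real +
 fixes s kp C1 c :: real
 assumes s: "0 < s" "s <= 1" and C1: "C1 >= 0" and c: "c >= 0"
  and dec: "!!P Q T. degree P <= CARD('k) ==> degree Q <= CARD('k) ==> Q ~= 0 ==> T : sets borel ==> measure mu T <= kp ==>
   (\<integral>\<^sup>+x. ennreal (cmod (poly P (of_real x) / poly Q (of_real x)) powr (s / 3)) \<partial>mu) \<le>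
   2 * (\<integral>\<^sup>+x. ennreal (cmod (poly P (of_real x) / poly Q (of_real x)) powr (s / 3)) * indicator (- T) x \<partial>mu)"
  and site: "!!z. abs (Re z) <= c ==> \<bar>Im z\<bar> <= 1 ==> \<exists>T\<in>sets borel. measure mu T <= kp &
  (\<forall>x y. x ~: T --> (\<Sum>j\<in>UNIV. cmod (y j)) \<le>
    C1 * (\<Sum>l\<in>UNIV. cmod (\<Sum>j\<in>UNIV. y j * ((x *\<^sub>R A + B) $ j $ l - (if j = l then z else 0)))))"
begin

text \<open>The exponent of the fractional moments, the distribution of the potential in a box, the
 basis indices over a box, and the Green function of a box.\<close>

abbreviation "sg \<equiv> s / 3"
abbreviation "PM Lam \<equiv> PiM Lam (%_::int ^ 'd. mu)"
abbreviation "sites Lam \<equiv> Lam \<times> (UNIV :: 'k set)"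
abbreviation "gr Lam z u \<equiv> green (sites Lam) (hent u) z"

sublocale prod: product_prob_space "%_::int ^ 'd. mu" UNIV by standard

lemma prob_PM: "prob_space (PM Lam)"
 by(rule prob_space_PiM) (rule prob_space_axioms)

lemma shifted_measurable:
 assumes "a : sites Lam"
 shows "(%u. shifted (hent u) z a b) : borel_measurable (PM Lam)"
proof -
 have "(%u. hent u a b) : borel_measurable (PM Lam)"
  by(rule hent_measurable[OF _ assms]) (simp add:measurable_cong_sets[OF refl sets_mu, symmetric])
 thus ?thesis by(simp add:shifted_def)
qed

lemma sdet_sadj_measurable[measurable]:
 "(%u. sdet (sites Lam) (shifted (hent u) z)) : borel_measurable (PM Lam)"
 "(%u. sadj (sites Lam) (shifted (hent u) z) a b) : borel_measurable (PM Lam)"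
 by(rule sdet_measurable sadj_measurable, erule shifted_measurable)+

lemma gr_measurable[measurable]: "(%u. gr Lam z u a b) : borel_measurable (PM Lam)"
 unfolding green_def by measurable

lemma gr_rational:
 assumes fin: "finite Lam" and n: "n : Lam" and z: "Im z ~= 0"
 shows "\<exists>P Q. degree P <= CARD('k) & degree Q <= CARD('k) & Q ~= 0 &
  (\<forall>x. gr Lam z (u(n := x)) a b = poly P (of_real x) / poly Q (of_real x))"
proof -
 define E where "E = (%a b :: (int ^ 'd) \<times> 'k. if fst a = n & fst b = n
  then [:B $ snd a $ snd b - (if a = b then z else 0), A $ snd a $ snd b:] else [:shifted (hent u) z a b:])"
 have e: "shifted (hent (u(n := x))) z a b = poly (E a b) (of_real x)" for x a b
  by(auto simp:E_def shifted_def hent_def pot_def scaleR_conv_of_real[of x "A $ _ $ _"])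
 define Q where "Q = sdet (sites Lam) E"
 define P where "P = sadj (sites Lam) E a b"
 have w: "(\<Sum>b\<in>sites Lam. if fst b = n then 1 else 0) = CARD('k)"
 proof -
  have "(\<Sum>b\<in>sites Lam. if fst b = n then 1 else 0) = (\<Sum>l\<in>Lam. \<Sum>j\<in>(UNIV::'k set). if l = n then 1 else (0::nat))"
   by(subst sum.cartesian_product) (auto simp:case_prod_beta)
  also have "... = (\<Sum>l\<in>Lam. if l = n then CARD('k) else 0)" by(intro sum.cong) auto
  finally show ?thesis using fin n by simp
 qed
 have d: "degree (E a b) <= (if fst b = n then 1 else 0)" for a b by(auto simp:E_def)
 have "degree P <= CARD('k)" "degree Q <= CARD('k)"
  unfolding P_def Q_def w[symmetric] by(intro degree_sadj degree_sdet d, simp add:fin)+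
 moreover have "gr Lam z (u(n := x)) a b = poly P (of_real x) / poly Q (of_real x)" for x
  unfolding green_def P_def Q_def poly_sdet poly_sadj e[abs_def] by simp
 moreover have "Q ~= 0"
 proof
  assume "Q = 0"
  hence "sdet (sites Lam) (shifted (hent (u(n := 0))) z) = 0"
   using poly_sdet[of "sites Lam" E "of_real 0"] by(simp add:e[abs_def] Q_def)
  thus False using sdet_shifted_nonzero[where h="hent (u(n := 0))", OF _ hent_hermitian z] fin by simp
 qed
 ultimately show ?thesis by blast
qed

lemma cmod_K_entry: "adjacent n m ==> cmod (K (n - m) $ i $ j) <= max CK 0"
proof -
 assume "adjacent n m"
 have "K (n - m) $ i $ j = (K (n - m) *v axis j 1) $ i"
  by(simp add:matrix_vector_mult_def axis_def if_distrib[of "%c. _ * c"] cong: if_cong)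
 also have "cmod ... <= norm (K (n - m) *v axis j 1)" by(rule Finite_Cartesian_Product.norm_nth_le)
 also have "... <= mat_norm (K (n - m)) * 1" using norm_matrix_vector_le[of "K (n - m)" "axis j 1"] by(simp add:norm_axis_1)
 finally show ?thesis using K_bd[OF `adjacent n m`] by simp
qed

text \<open>The constants in the one-step estimate; only \<open>b0\<close> depends on
 \<open>g\<close>.\<close>

definition A0 :: real where "A0 = 2 * real CARD('k) * C1 powr sg"
definition b0 :: real where "b0 = real CARD('k) * (max CK 0 / g) powr sg"

lemma A0_nonneg: "A0 >= 0" and b0_nonneg: "b0 >= 0"
 by(simp_all add: A0_def b0_def)

text \<open>
 The equation satisfied by a row of the Green function at a site, resolved for the block at
 that site, when the potential there avoids the exceptional set.
\<close>

lemma gr_site_bound: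
 assumes fin: "finite Lam" and n: "n : Lam" and z: "Im z ~= 0" and a: "a : sites Lam"
  and T: "\<forall>x y. x ~: T --> (\<Sum>j\<in>UNIV. cmod (y j)) \<le>
    C1 * (\<Sum>l\<in>UNIV. cmod (\<Sum>j\<in>UNIV. y j * ((x *\<^sub>R A + B) $ j $ l - (if j = l then z else 0))))"
  and x: "u n ~: T"
 shows "(\<Sum>j\<in>UNIV. cmod (gr Lam z u a (n, j)) powr sg) <= real CARD('k) * C1 powr sg *
  ((if fst a = n then 1 else 0) + b0 * (\<Sum>n'\<in>{n' : Lam. adjacent n n'}. \<Sum>j\<in>UNIV. cmod (gr Lam z u a (n', j)) powr sg))"
proof -
 let ?G = "gr Lam z u a" and ?N = "{n' : Lam. adjacent n n'}" and ?k = "real CARD('k)"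
 have fS: "finite (sites Lam)" using fin by simp
 have sg: "0 < sg" "sg <= 1" using s by auto
 define e where "e = (%l. (if a = (n, l) then 1 else 0) - (\<Sum>n'\<in>?N. \<Sum>j\<in>UNIV. ?G (n', j) * hent u (n', j) (n, l)))"
 have row: "(\<Sum>j\<in>UNIV. ?G (n, j) * ((u n *\<^sub>R A + B) $ j $ l - (if j = l then z else 0))) = e l" for l
 proof -
  have "(if a = (n, l) then 1 else 0) = (\<Sum>b\<in>sites Lam. ?G b * shifted (hent u) z b (n, l))"
   using green_mult[OF fS a _ sdet_shifted_nonzero[where h="hent u", OF fS hent_hermitian z]] n by simp
  also have "... = (\<Sum>n'\<in>Lam. \<Sum>j\<in>UNIV. ?G (n', j) * shifted (hent u) z (n', j) (n, l))"
   by(subst sum.cartesian_product) (simp add:case_prod_beta)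
  also have "... = (\<Sum>j\<in>UNIV. ?G (n, j) * shifted (hent u) z (n, j) (n, l)) + (\<Sum>n'\<in>Lam - {n}. \<Sum>j\<in>UNIV. ?G (n', j) * shifted (hent u) z (n', j) (n, l))"
   by(rule sum.remove[OF fin n])
  also have "(\<Sum>n'\<in>Lam - {n}. \<Sum>j\<in>UNIV. ?G (n', j) * shifted (hent u) z (n', j) (n, l)) = (\<Sum>n'\<in>?N. \<Sum>j\<in>UNIV. ?G (n', j) * hent u (n', j) (n, l))"
  proof -
   have "n' ~= n" if "adjacent n n'" for n' using that by(auto simp:adjacent_def l1_dist_def)
   moreover have "shifted (hent u) z (n', j) (n, l) = (if adjacent n n' then hent u (n', j) (n, l) else 0)" if "n' ~= n" for n' j
    using that adjacent_sym[of n n'] by(simp add:shifted_def hent_def)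
   ultimately show ?thesis by(intro sum.mono_neutral_cong_right) (use fin in auto)
  qed
  moreover have "shifted (hent u) z (n, j) (n, l) = (u n *\<^sub>R A + B) $ j $ l - (if j = l then z else 0)" for j
   by(simp add:shifted_def hent_def pot_def)
  ultimately show ?thesis unfolding e_def by simp
 qed
 have el: "cmod (e l) powr sg <= (if a = (n, l) then 1 else 0) + (max CK 0 / g) powr sg * (\<Sum>n'\<in>?N. \<Sum>j\<in>UNIV. cmod (?G (n', j)) powr sg)" for l
 proof -
  have "cmod (e l) <= (if a = (n, l) then 1 else 0) + (\<Sum>n'\<in>?N. \<Sum>j\<in>UNIV. max CK 0 / g * cmod (?G (n', j)))"
  proof -
   have "cmod (\<Sum>n'\<in>?N. \<Sum>j\<in>UNIV. ?G (n', j) * hent u (n', j) (n, l)) <= (\<Sum>n'\<in>?N. \<Sum>j\<in>UNIV. max CK 0 / g * cmod (?G (n', j)))"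
   proof (intro sum_norm_le)
    fix n' and j assume "n' : ?N"
    hence "cmod (hent u (n', j) (n, l)) <= max CK 0 / g"
     using cmod_K_entry[of n' n j l] g adjacent_sym[of n]
     by(auto simp:hent_def norm_mult norm_inverse divide_inverse mult.commute mult_left_mono adjacent_def l1_dist_def)
    thus "cmod (?G (n', j) * hent u (n', j) (n, l)) <= max CK 0 / g * cmod (?G (n', j))"
     unfolding norm_mult mult.commute[of "cmod (?G _)"] by(rule mult_right_mono) simp
   qed
   thus ?thesis unfolding e_def by(intro order_trans[OF norm_triangle_ineq4] add_mono) auto
  qed
  hence "cmod (e l) powr sg <= ((if a = (n, l) then 1 else 0) + (\<Sum>n'\<in>?N. \<Sum>j\<in>UNIV. max CK 0 / g * cmod (?G (n', j)))) powr sg"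
   using sg by(intro powr_mono2) auto
  also have "... <= (if a = (n, l) then 1 else 0) powr sg + (\<Sum>n'\<in>?N. \<Sum>j\<in>UNIV. max CK 0 / g * cmod (?G (n', j))) powr sg"
   using sg g by(intro powr_add_le sum_nonneg) auto
  also have "(\<Sum>n'\<in>?N. \<Sum>j\<in>UNIV. max CK 0 / g * cmod (?G (n', j))) powr sg <= (\<Sum>n'\<in>?N. \<Sum>j\<in>UNIV. (max CK 0 / g * cmod (?G (n', j))) powr sg)"
   using sg g by(intro order_trans[OF powr_sum_le] sum_mono powr_sum_le sum_nonneg) auto
  also have "... = (max CK 0 / g) powr sg * (\<Sum>n'\<in>?N. \<Sum>j\<in>UNIV. cmod (?G (n', j)) powr sg)"
  proof -
   have "(max CK 0 / g * cmod y) powr sg = (max CK 0 / g) powr sg * cmod y powr sg" for y by(rule powr_mult)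
   thus ?thesis by(simp only: sum_distrib_left)
  qed
  finally show ?thesis by(cases "a = (n, l)") simp_all
 qed
 let ?R = "\<Sum>n'\<in>?N. \<Sum>j\<in>UNIV. cmod (?G (n', j)) powr sg"
 have sumle: "(\<Sum>j\<in>UNIV. cmod (?G (n, j))) <= C1 * (\<Sum>l\<in>UNIV. cmod (e l))"
  using T[rule_format, OF x, of "%j. ?G (n, j)"] unfolding row .
 have "(\<Sum>j\<in>UNIV. cmod (?G (n, j)) powr sg) <= ?k * (C1 * (\<Sum>l\<in>UNIV. cmod (e l))) powr sg"
 proof (rule sum_bounded_above)
  fix j
  have "cmod (?G (n, j)) <= C1 * (\<Sum>l\<in>UNIV. cmod (e l))"
   using sumle member_le_sum[of j UNIV "%j. cmod (?G (n, j))"] by simp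
  thus "cmod (?G (n, j)) powr sg <= (C1 * (\<Sum>l\<in>UNIV. cmod (e l))) powr sg" using sg by(intro powr_mono2) auto
 qed
 also have "... = ?k * C1 powr sg * (\<Sum>l\<in>UNIV. cmod (e l)) powr sg" using C1 by(simp add:powr_mult sum_nonneg)
 also have "... <= ?k * C1 powr sg * (\<Sum>l\<in>UNIV. (if a = (n, l) then 1 else 0) + (max CK 0 / g) powr sg * ?R)"
  using sg by(intro mult_left_mono order_trans[OF powr_sum_le] sum_mono el) auto
 also have "(\<Sum>l\<in>UNIV. (if a = (n, l) then 1 else 0) + (max CK 0 / g) powr sg * ?R) = (if fst a = n then 1 else 0) + b0 * ?R"
 proof -
  have "(\<Sum>l\<in>UNIV. if a = (n, l) then 1 else 0) = (if fst a = n then 1 else (0::real))"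
   by(cases a) (auto simp:if_distrib sum.delta cong: if_cong)
  thus ?thesis by(simp add:sum.distrib b0_def)
 qed
 finally show ?thesis .
qed

text \<open>The fractional moment of a row of the Green function at the site \<open>n\<close>.\<close>

definition FM :: "(int ^ 'd) set => complex => (int ^ 'd) \<times> 'k => int ^ 'd => ennreal" where
 "FM Lam z a n = (\<integral>\<^sup>+u. ennreal (\<Sum>j\<in>UNIV. cmod (gr Lam z u a (n, j)) powr sg) \<partial>PM Lam)"

text \<open>In the integral over the potential at \<open>n\<close>, decoupling removes the
 exceptional values; off them the equation for the row at \<open>n\<close> bounds the integrand by
 the entries at the neighbours.\<close>

lemma FM_step:
 assumes fin: "finite Lam" and n: "n : Lam" and z: "0 < Im z" "Im z <= 1" "abs (Re z) <= c" and a: "a : sites Lam"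
 shows "FM Lam z a n <= ennreal A0 * ((if fst a = n then 1 else 0) + ennreal b0 * (\<Sum>n'\<in>{n' : Lam. adjacent n n'}. FM Lam z a n'))"
proof -
 obtain T where T: "T : sets borel" "measure mu T <= kp"
  and T2: "\<forall>x y. x ~: T --> (\<Sum>j\<in>UNIV. cmod (y j)) \<le>
    C1 * (\<Sum>l\<in>UNIV. cmod (\<Sum>j\<in>UNIV. y j * ((x *\<^sub>R A + B) $ j $ l - (if j = l then z else 0))))"
  using site[OF z(3)] z by auto
 let ?N = "{n' : Lam. adjacent n n'}"
 define phi where "phi = (%u n. \<Sum>j\<in>UNIV. cmod (gr Lam z u a (n, j)) powr sg)"
 have phim[measurable]: "(%u. phi u n) : borel_measurable (PM Lam)" for n unfolding phi_def by measurable
 have FM: "FM Lam z a n = (\<integral>\<^sup>+u. ennreal (phi u n) \<partial>PM Lam)" for n by(simp add:FM_def phi_def)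
 define Psi where "Psi = (%u. ennreal (real CARD('k) * C1 powr sg * ((if fst a = n then 1 else 0) + b0 * (\<Sum>n'\<in>?N. phi u n'))))"
 have Psim[measurable]: "Psi : borel_measurable (PM Lam)" unfolding Psi_def by measurable
 have phi0: "phi u n >= 0" for u n by(simp add:phi_def sum_nonneg)
 have ins: "insert n (Lam - {n}) = Lam" using n by auto
 have int: "(\<integral>\<^sup>+u. f u \<partial>PM Lam) = (\<integral>\<^sup>+u. (\<integral>\<^sup>+x. f (u(n := x)) \<partial>mu) \<partial>PM (Lam - {n}))" if "f : borel_measurable (PM Lam)" for f
  using prod.product_nn_integral_insert[of "Lam - {n}" n f, unfolded ins] that fin by simp
 have "FM Lam z a n = (\<integral>\<^sup>+u. (\<integral>\<^sup>+x. ennreal (phi (u(n := x)) n) \<partial>mu) \<partial>PM (Lam - {n}))"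
  unfolding FM by(rule int) measurable
 also have "... <= (\<integral>\<^sup>+u. (\<integral>\<^sup>+x. 2 * Psi (u(n := x)) \<partial>mu) \<partial>PM (Lam - {n}))"
 proof (rule nn_integral_mono)
  fix u assume "u : space (PM (Lam - {n}))"
  hence u[measurable]: "(%x. u(n := x)) : measurable mu (PM Lam)" using n by(intro measurable_fun_upd[where J="Lam - {n}"]) auto
  let ?f = "%j x. ennreal (cmod (gr Lam z (u(n := x)) a (n, j)) powr sg)"
  have f[measurable]: "?f j : borel_measurable mu" for j by measurable
  have d: "(\<integral>\<^sup>+x. ?f j x \<partial>mu) <= 2 * (\<integral>\<^sup>+x. ?f j x * indicator (- T) x \<partial>mu)" for j
  proof -
   obtain P Q where PQ: "degree P <= CARD('k)" "degree Q <= CARD('k)" "Q ~= 0"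
    "!!x. gr Lam z (u(n := x)) a (n, j) = poly P (of_real x) / poly Q (of_real x)"
    using gr_rational[OF fin n, of z u a "(n, j)"] z by auto
   show ?thesis unfolding PQ(4) by(rule dec[OF PQ(1-3) T])
  qed
  have "(\<integral>\<^sup>+x. ennreal (phi (u(n := x)) n) \<partial>mu) = (\<Sum>j\<in>UNIV. \<integral>\<^sup>+x. ?f j x \<partial>mu)"
   unfolding phi_def by(subst nn_integral_sum[symmetric]) (auto intro!:nn_integral_cong)
  also have "... <= (\<Sum>j\<in>UNIV. 2 * (\<integral>\<^sup>+x. ?f j x * indicator (- T) x \<partial>mu))" by(rule sum_mono) (rule d)
  also have "... = 2 * (\<integral>\<^sup>+x. (\<Sum>j\<in>UNIV. ?f j x) * indicator (- T) x \<partial>mu)"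
   unfolding sum_distrib_left[symmetric] sum_distrib_right using T(1) by(subst nn_integral_sum) simp_all
  also have "... <= 2 * (\<integral>\<^sup>+x. Psi (u(n := x)) \<partial>mu)"
  proof (intro mult_left_mono nn_integral_mono)
   fix x
   show "(\<Sum>j\<in>UNIV. ?f j x) * indicator (- T) x <= Psi (u(n := x))"
    using gr_site_bound[OF fin n _ a T2, of "u(n := x)"] z by(auto simp:indicator_def Psi_def phi_def intro!:ennreal_leI)
  qed simp
  also have "... = (\<integral>\<^sup>+x. 2 * Psi (u(n := x)) \<partial>mu)" by(rule nn_integral_cmult[symmetric]) measurable
  finally show "(\<integral>\<^sup>+x. ennreal (phi (u(n := x)) n) \<partial>mu) <= (\<integral>\<^sup>+x. 2 * Psi (u(n := x)) \<partial>mu)" .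
 qed
 also have "... = (\<integral>\<^sup>+u. 2 * Psi u \<partial>PM Lam)" by(rule int[symmetric]) measurable
 also have "... = (\<integral>\<^sup>+u. ennreal A0 * ((if fst a = n then 1 else 0) + ennreal b0 * (\<Sum>n'\<in>?N. ennreal (phi u n'))) \<partial>PM Lam)"
  by(intro nn_integral_cong)
   (simp add:Psi_def A0_def phi0 sum_nonneg ennreal_mult[symmetric] b0_nonneg flip: ennreal_plus ennreal_numeral ennreal_1)
 also have "... = ennreal A0 * ((if fst a = n then 1 else 0) + ennreal b0 * (\<Sum>n'\<in>?N. FM Lam z a n'))"
  unfolding FM
  by(simp add:nn_integral_cmult nn_integral_add nn_integral_sum phi0 prob_space.emeasure_space_1[OF prob_PM] del: sum_ennreal)
 finally show ?thesis .
qed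

end

lemma l1_dist_triangle: "l1_dist n m <= l1_dist n n' + l1_dist n' m"
 unfolding l1_dist_def sum.distrib[symmetric] by(rule sum_mono) linarith

lemma l1_dist_self[simp]: "l1_dist n n = 0"
 and l1_dist_nonneg: "l1_dist n m >= 0"
 and l1_dist_commute: "l1_dist n m = l1_dist m n"
 by(simp_all add: l1_dist_def sum_nonneg abs_minus_commute)

text \<open>The number of neighbours of a site.\<close>

definition nbr :: "'d::finite itself => nat" where
 "nbr _ = card {e :: int ^ 'd. adjacent 0 e}"

lemma card_adjacent_le:
 fixes n :: "int ^ 'd::finite"
 shows "card {n' : Lam. adjacent n n'} <= nbr TYPE('d)"
proof -
 have "card {n'. adjacent n n'} = nbr TYPE('d)" using sum_adjacent_shift[of "%_. 1 :: nat" n] by(simp add:nbr_def)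
 moreover have "card {n' : Lam. adjacent n n'} <= card {n'. adjacent n n'}" by(rule card_mono) (auto simp:finite_adjacent)
 ultimately show ?thesis by simp
qed

text \<open>Iterating the one-step estimate.  The geometric factor is gained at every step away from
 \<open>m\<close>.\<close>

lemma decay_iteration:
 fixes f :: "int ^ 'd::finite => real"
 assumes fin: "finite Lam" and nn: "a0 >= 0" "b >= 0" "!!n. f n >= 0"
  and step: "!!n. n : Lam ==> f n <= a0 * ((if m = n then 1 else 0) + b * (\<Sum>n'\<in>{n' : Lam. adjacent n n'}. f n'))"
  and th: "th = a0 * b * nbr TYPE('d)" "th <= 1 / 2"
  and n: "n : Lam" "int j <= l1_dist n m"
 shows "f n <= 2 * a0 * th ^ j"
proof -
 have sum: "(\<Sum>n'\<in>{n' : Lam. adjacent n n'}. f n') <= real (nbr TYPE('d)) * X" if "!!n'. n' : Lam ==> adjacent n n' ==> f n' <= X" "X >= 0" for n X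
 proof -
  have "(\<Sum>n'\<in>{n' : Lam. adjacent n n'}. f n') <= real (card {n' : Lam. adjacent n n'}) * X"
   by(rule sum_bounded_above) (use that in auto)
  also have "... <= real (nbr TYPE('d)) * X" using that card_adjacent_le by(intro mult_right_mono) auto
  finally show ?thesis .
 qed
 have step2: "f n <= a0 * (if m = n then 1 else 0) + th * X" if "n : Lam" "!!n'. n' : Lam ==> adjacent n n' ==> f n' <= X" "X >= 0" for n X
 proof -
  have "f n <= a0 * ((if m = n then 1 else 0) + b * (nbr TYPE('d) * X))"
   using step[OF that(1)] sum[OF that(2,3)] nn by(meson add_left_mono mult_left_mono order_trans)
  thus ?thesis by(simp add:th algebra_simps)
 qed
 show ?thesis
  using n
 proof (induction j arbitrary: n)
  case 0
  \<comment> \<open>The maximum is at most \<open>a0\<close> plus half of itself.\<close>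
  define X where "X = Max (f ` Lam)"
  have X: "f n' <= X" if "n' : Lam" for n' unfolding X_def using fin that by simp
  hence X0: "X >= 0" using nn 0 order_trans by blast
  have "X : f ` Lam" unfolding X_def using fin 0 by(intro Max_in) auto
  then obtain n0 where "n0 : Lam" "X = f n0" by auto
  hence "X <= a0 * (if m = n0 then 1 else 0) + th * X" using step2[OF `n0 : Lam` X X0] by simp
  also have "... <= a0 + 1 / 2 * X" using nn th X0 by(intro add_mono mult_right_mono) auto
  finally show ?case using X[OF 0(1)] by simp
 next
  case (Suc j)
  have ih: "f n' <= 2 * a0 * th ^ j" if "n' : Lam" "adjacent n n'" for n'
   using Suc.IH[OF that(1)] Suc.prems l1_dist_triangle[of n m n'] that(2) by(simp add:adjacent_def)
  have "f n <= a0 * (if m = n then 1 else 0) + th * (2 * a0 * th ^ j)" by(rule step2[OF Suc.prems(1) ih]) (use nn th in auto)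
  moreover have "m ~= n" using Suc.prems by auto
  ultimately show ?case by(simp add:mult.left_commute)
 qed
qed

context anderson
begin

text \<open>The factor gained in every step; it tends to zero as \<open>g\<close> grows.\<close>

definition th :: real where "th = A0 * b0 * nbr TYPE('d)"

lemma theta_nonneg: "th >= 0"
 by(simp add:th_def A0_nonneg b0_nonneg)

text \<open>
 A nonnegative value of this function at a real energy means that the entries of the Green function
 of \<open>Lam\<close> between \<open>a\<close> and the sites in \<open>W\<close> have a sum of squares of at least \<open>eps\<^sup>2\<close>, or that
 the determinant vanishes.  Without denominators this is a polynomial in the energy.
\<close>

definition reson :: "(int ^ 'd) set => (int ^ 'd) set => real => (int ^ 'd) \<times> 'k => (int ^ 'd => real) => real => real" where
 "reson Lam W eps a u x = (\<Sum>b\<in>sites W. (cmod (sadj (sites Lam) (shifted (hent u) (of_real x)) a b))^2)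
   - eps^2 * (cmod (sdet (sites Lam) (shifted (hent u) (of_real x))))^2"

lemma reson_measurable[measurable]: "(%u. reson Lam W eps a u x) : borel_measurable (PM Lam)"
 unfolding reson_def by measurable

context
 fixes Lam :: "(int ^ 'd) set"
 assumes fin: "finite Lam" and th: "th <= 1 / 2"
begin

lemma FM_decay:
 assumes z: "0 < Im z" "Im z <= 1" "abs (Re z) <= c" and a: "a : sites Lam" and n: "n : Lam" "int j <= l1_dist n (fst a)"
 shows "FM Lam z a n <= ennreal (2 * A0 * th ^ j)"
proof -
 have F: "FM Lam z a n < \<top>" if "n : Lam" for n
 proof -
  have "FM Lam z a n <= (\<integral>\<^sup>+u. ennreal (\<Sum>j\<in>(UNIV::'k set). (1 / abs (Im z)) powr sg) \<partial>PM Lam)"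
   unfolding FM_def using a that fin z s
   by(intro nn_integral_mono ennreal_leI sum_mono powr_mono2 green_bound hent_hermitian) auto
  also have "... = ennreal (\<Sum>j\<in>(UNIV::'k set). (1 / abs (Im z)) powr sg)"
   by(simp add:prob_space.emeasure_space_1[OF prob_PM])
  finally show ?thesis by(rule le_less_trans) simp
 qed
 define f where "f = (%n. enn2real (FM Lam z a n))"
 have Ff: "FM Lam z a n = ennreal (f n)" if "n : Lam" for n using F[OF that] by(simp add:f_def)
 have "f n <= 2 * A0 * th ^ j"
 proof (rule decay_iteration[OF fin A0_nonneg b0_nonneg _ _ th_def th n])
  fix n assume n: "n : Lam"
  have "ennreal (f n) <= ennreal A0 * ((if fst a = n then 1 else 0) + ennreal b0 * (\<Sum>n'\<in>{n' : Lam. adjacent n n'}. ennreal (f n')))"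
  proof -
   have "(\<Sum>n'\<in>{n' : Lam. adjacent n n'}. FM Lam z a n') = (\<Sum>n'\<in>{n' : Lam. adjacent n n'}. ennreal (f n'))"
    by(intro sum.cong Ff) auto
   thus ?thesis using FM_step[OF fin n z a] unfolding Ff[OF n] by simp
  qed
  also have "... = ennreal (A0 * ((if fst a = n then 1 else 0) + b0 * (\<Sum>n'\<in>{n' : Lam. adjacent n n'}. f n')))"
  proof -
   let ?S = "\<Sum>n'\<in>{n' : Lam. adjacent n n'}. f n'"
   have S: "(\<Sum>n'\<in>{n' : Lam. adjacent n n'}. ennreal (f n')) = ennreal ?S" "?S >= 0"
    by(auto simp:f_def sum_nonneg intro!:sum_ennreal)
   thus ?thesis unfolding S(1)
    using A0_nonneg b0_nonneg by(cases "fst a = n") (simp_all add: ennreal_mult[symmetric] flip: ennreal_plus ennreal_1)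
  qed
  finally show "f n <= A0 * ((if fst a = n then 1 else 0) + b0 * (\<Sum>n'\<in>{n' : Lam. adjacent n n'}. f n'))"
   using A0_nonneg b0_nonneg by(subst (asm) ennreal_le_iff) (auto simp:f_def intro!:mult_nonneg_nonneg add_nonneg_nonneg sum_nonneg)
 qed (simp add:f_def)
 thus ?thesis using Ff[OF n(1)] by(simp add:ennreal_leI)
qed

lemma sdet_sadj_continuous:
 "isCont (%z. sdet (sites Lam) (shifted (hent u) z)) z"
 "isCont (%z. sadj (sites Lam) (shifted (hent u) z) a b) z"
 using poly_isCont[of z "sdet (sites Lam) (shifted_poly (hent u))"] poly_isCont[of z "sadj (sites Lam) (shifted_poly (hent u)) a b"]
 by(simp_all add: poly_sdet poly_sadj poly_shifted)

text \<open>
 The bound on fractional moments passes to real energies by Fatou's lemma; at an eigenvalue the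
 diagonal entries of the Green function blow up.
\<close>

lemma reson_prob:
 assumes x: "abs x <= c" and eps: "eps > 0" and a: "a : sites Lam" and W: "W \<subseteq> Lam" "!!w. w : W ==> int r <= l1_dist w (fst a)"
 shows "emeasure (PM Lam) {u : space (PM Lam). 0 <= reson Lam W eps a u x} <= ennreal (card W * (2 * A0 * th ^ r) * eps powr (- sg))"
  (is "emeasure _ ?E <= ennreal ?X")
proof (rule ennreal_le_epsilon)
 fix e :: real assume "e > 0"
 define Y where "Y = card Lam * (real CARD('k) * (2 * A0))"
 define dl where "dl = e / (Y + 1)"
 have Y: "Y >= 0" using A0_nonneg by(simp add:Y_def)
 have dl: "dl > 0" using Y `e > 0` by(simp add:dl_def)
 have sg: "0 < sg" "sg <= 1" using s by auto
 define z where "z = (%N. Complex x (1 / real (Suc N)))"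
 have z: "0 < Im (z N)" "Im (z N) <= 1" "abs (Re (z N)) <= c" for N using x by(auto simp:z_def)
 have zlim: "z ----> of_real x"
  unfolding z_def complex_of_real_def by(intro tendsto_Complex tendsto_const) (use LIMSEQ_inverse_real_of_nat in \<open>simp add:inverse_eq_divide\<close>)
 have z_at: "filterlim z (at (of_real x)) sequentially" using zlim by(auto simp:filterlim_at z_def complex_eq_iff)
 \<comment> \<open>The diagonal entries get a small weight; they are needed only to detect eigenvalues, at which the other entries may stay bounded.\<close>
 define p where "p = (%N u. eps powr (- sg) * (\<Sum>w\<in>W. \<Sum>j\<in>UNIV. cmod (gr Lam (z N) u a (w, j)) powr sg))"
 define t where "t = (%N u. \<Sum>b\<in>sites Lam. cmod (gr Lam (z N) u b b) powr sg)"
 have [measurable]: "(%u. p N u) : borel_measurable (PM Lam)" "(%u. t N u) : borel_measurable (PM Lam)" for N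
  unfolding p_def t_def by measurable
 have pt0: "p N u >= 0" "t N u >= 0" for N u by(auto simp:p_def t_def sum_nonneg)
 have fW: "finite W" using W fin finite_subset by blast
 have int_le: "(\<integral>\<^sup>+u. ennreal (p N u + dl * t N u) \<partial>PM Lam) <= ennreal ?X + ennreal e" for N
 proof -
  have "(\<integral>\<^sup>+u. ennreal (p N u) \<partial>PM Lam) = ennreal (eps powr (- sg)) * (\<Sum>w\<in>W. FM Lam (z N) a w)"
   unfolding p_def FM_def
   by(subst nn_integral_sum[symmetric]) (auto simp:nn_integral_cmult[symmetric] ennreal_mult sum_nonneg simp flip: sum_ennreal intro!:nn_integral_cong)
  also have "... <= ennreal (eps powr (- sg)) * (\<Sum>w\<in>W. ennreal (2 * A0 * th ^ r))"
   using W by(intro mult_left_mono sum_mono FM_decay z a) auto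
  also have "... = ennreal ?X"
   using A0_nonneg theta_nonneg by(simp add:ennreal_of_nat_eq_real_of_nat ennreal_mult[symmetric] mult_ac)
  finally have 1: "(\<integral>\<^sup>+u. ennreal (p N u) \<partial>PM Lam) <= ennreal ?X" .
  have "(\<integral>\<^sup>+u. ennreal (t N u) \<partial>PM Lam) = (\<Sum>b\<in>sites Lam. \<integral>\<^sup>+u. ennreal (cmod (gr Lam (z N) u b b) powr sg) \<partial>PM Lam)"
   unfolding t_def by(subst nn_integral_sum[symmetric]) (auto intro!:nn_integral_cong)
  also have "... <= (\<Sum>b\<in>sites Lam. FM Lam (z N) b (fst b))"
   unfolding FM_def
   by(intro sum_mono nn_integral_mono ennreal_leI) (auto intro!:member_le_sum[of _ UNIV "%j. cmod (gr Lam (z N) _ _ (_, j)) powr sg"])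
  also have "... <= (\<Sum>b\<in>sites Lam. ennreal (2 * A0 * th ^ 0))" by(intro sum_mono FM_decay z) auto
  also have "... = ennreal Y"
   using A0_nonneg by(simp add:Y_def card_cartesian_product ennreal_of_nat_eq_real_of_nat ennreal_mult[symmetric] mult_ac flip: of_nat_mult)
  finally have 2: "(\<integral>\<^sup>+u. ennreal (t N u) \<partial>PM Lam) <= ennreal Y" .
  have "(\<integral>\<^sup>+u. ennreal (p N u + dl * t N u) \<partial>PM Lam) = (\<integral>\<^sup>+u. ennreal (p N u) \<partial>PM Lam) + ennreal dl * (\<integral>\<^sup>+u. ennreal (t N u) \<partial>PM Lam)"
   using pt0 dl by(simp add:nn_integral_add nn_integral_cmult ennreal_mult)
  also have "... <= ennreal ?X + ennreal dl * ennreal Y" by(intro add_mono mult_left_mono 1 2) simp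
  also have "ennreal dl * ennreal Y <= ennreal e"
   using dl Y `e > 0` by(simp add:ennreal_mult[symmetric] ennreal_leI dl_def field_simps)
  finally show ?thesis by(simp add:add_left_mono)
 qed
 have pw: "indicator ?E u <= liminf (%N. ennreal (p N u + dl * t N u))" for u
 proof (cases "u : ?E")
  case True
  let ?D = "%z. sdet (sites Lam) (shifted (hent u) z)" and ?A = "%z. sadj (sites Lam) (shifted (hent u) z) a"
  have "1 <= liminf (%N. ennreal (p N u + dl * t N u))"
  proof (cases "?D (of_real x) = 0")
   case True
   hence "filterlim (%z. \<Sum>b\<in>sites Lam. gr Lam z u b b) at_infinity (at (of_real x))"
    using fin by(intro green_trace_blowup hent_hermitian) auto
   hence "filterlim (%N. \<Sum>b\<in>sites Lam. gr Lam (z N) u b b) at_infinity sequentially"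
    using z_at by(rule filterlim_compose)
   hence "\<forall>\<^sub>F N in sequentially. (1 / dl) powr (1 / sg) <= cmod (\<Sum>b\<in>sites Lam. gr Lam (z N) u b b)"
    by(simp add:filterlim_at_infinity_conv_norm_at_top filterlim_at_top)
   hence "\<forall>\<^sub>F N in sequentially. 1 <= ennreal (p N u + dl * t N u)"
   proof (rule eventually_mono)
    fix N assume "(1 / dl) powr (1 / sg) <= cmod (\<Sum>b\<in>sites Lam. gr Lam (z N) u b b)"
    hence "((1 / dl) powr (1 / sg)) powr sg <= (\<Sum>b\<in>sites Lam. cmod (gr Lam (z N) u b b)) powr sg"
     using sg by(intro powr_mono2 order_trans[OF _ norm_sum]) auto
    also have "... <= t N u" unfolding t_def using sg by(intro powr_sum_le) auto
    also have "((1 / dl) powr (1 / sg)) powr sg = 1 / dl" using sg dl by(simp add:powr_powr)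
    finally have "1 <= dl * t N u" using dl by(simp add:field_simps)
    thus "1 <= ennreal (p N u + dl * t N u)" using pt0[of N u] by(subst ennreal_1[symmetric], intro ennreal_leI) linarith
   qed
   thus ?thesis by(rule Liminf_bounded)
  next
   case False
   have lim: "(%N. gr Lam (z N) u a b) ----> gr Lam (of_real x) u a b" for b
    unfolding green_def by(intro tendsto_divide isCont_tendsto_compose[OF sdet_sadj_continuous(1)] isCont_tendsto_compose[OF sdet_sadj_continuous(2)] zlim False)
   let ?p = "eps powr (- sg) * (\<Sum>w\<in>W. \<Sum>j\<in>UNIV. cmod (gr Lam (of_real x) u a (w, j)) powr sg)"
   have "(%N. p N u) ----> ?p" unfolding p_def using sg by(intro tendsto_intros tendsto_powr' tendsto_norm lim) auto
   hence l1: "liminf (%N. ennreal (p N u)) = ennreal ?p" by(intro lim_imp_Liminf tendsto_ennrealI) auto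
   have l2: "liminf (%N. ennreal (p N u)) <= liminf (%N. ennreal (p N u + dl * t N u))"
    using pt0 dl by(intro Liminf_mono always_eventually allI ennreal_leI) simp
   have "ennreal 1 <= ennreal ?p"
   proof -
    have "eps^2 * (cmod (?D (of_real x)))^2 <= (\<Sum>b\<in>sites W. (cmod (?A (of_real x) b))^2)"
     using `u : ?E` by(simp add:reson_def)
    hence "eps^2 <= (\<Sum>b\<in>sites W. (cmod (gr Lam (of_real x) u a b))^2)"
     using False by(simp add:green_def norm_divide power_divide sum_divide_distrib[symmetric] pos_le_divide_eq)
    hence "(eps^2) powr (sg / 2) <= (\<Sum>b\<in>sites W. (cmod (gr Lam (of_real x) u a b))^2) powr (sg / 2)"
     using sg by(intro powr_mono2) auto
    also have "... <= (\<Sum>b\<in>sites W. ((cmod (gr Lam (of_real x) u a b))^2) powr (sg / 2))"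
     using sg by(intro powr_sum_le) auto
    also have "... = (\<Sum>w\<in>W. \<Sum>j\<in>UNIV. cmod (gr Lam (of_real x) u a (w, j)) powr sg)"
     by(subst sum.cartesian_product) (auto intro!:sum.cong simp: powr_powr simp flip: powr_numeral)
    also have "(eps^2) powr (sg / 2) = eps powr sg" using eps by(simp add:powr_powr flip: powr_numeral)
    finally have "eps powr (- sg) * eps powr sg <= ?p" by(intro mult_left_mono) auto
    thus ?thesis using eps by(intro ennreal_leI) (simp add:powr_minus)
   qed
   from order_trans[OF this l2[unfolded l1]] show ?thesis by(simp only: ennreal_1)
  qed
  thus ?thesis using True by simp
 qed simp
 have "emeasure (PM Lam) ?E = (\<integral>\<^sup>+u. indicator ?E u \<partial>PM Lam)" by(rule nn_integral_indicator[symmetric]) measurable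
 also have "... <= (\<integral>\<^sup>+u. liminf (%N. ennreal (p N u + dl * t N u)) \<partial>PM Lam)" by(rule nn_integral_mono) (rule pw)
 also have "... <= liminf (%N. \<integral>\<^sup>+u. ennreal (p N u + dl * t N u) \<partial>PM Lam)" by(rule nn_integral_liminf) measurable
 also have "... <= limsup (%N. \<integral>\<^sup>+u. ennreal (p N u + dl * t N u) \<partial>PM Lam)" by(rule Liminf_le_Limsup) simp
 also have "... <= ennreal ?X + ennreal e" by(rule Limsup_bounded) (simp add:int_le)
 finally show "emeasure (PM Lam) ?E <= ennreal ?X + ennreal e" .
qed

end

end

section \<open>Resonances of two boxes\<close>

lemma exists_level_measurable:
 fixes F :: "'w => real => real"
 assumes m[measurable]: "!!x. (%w. F w x) : borel_measurable M" and F: "!!w. continuous_on UNIV (F w)" and c: "c > 0"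
 shows "{w : space M. \<exists>x\<in>{-c..c}. 0 <= F w x} : sets M"
proof -
 have "(\<exists>x\<in>{-c..c}. 0 <= F w x) \<longleftrightarrow> (\<forall>n::nat. \<exists>x\<in>\<rat> \<inter> {-c..c}. - inverse (real (Suc n)) < F w x)" for w
 proof
  assume "\<exists>x\<in>{-c..c}. 0 <= F w x"
  then obtain x where x: "x : {-c..c}" "0 <= F w x" by blast
  show "\<forall>n::nat. \<exists>x\<in>\<rat> \<inter> {-c..c}. - inverse (real (Suc n)) < F w x"
  proof
   fix n
   have "open {y. - inverse (real (Suc n)) < F w y}" using F[of w] by(intro open_Collect_less continuous_intros)
   moreover have "- inverse (real (Suc n)) < F w x" using x(2) by(simp add:less_le_trans[of _ 0])
   ultimately obtain e where e: "e > 0" "!!y. abs (y - x) < e ==> - inverse (real (Suc n)) < F w y"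
    by(auto simp:open_dist dist_real_def)
   have "max (-c) (x - e) < min c (x + e)" using x e c by auto
   then obtain r where "r : \<rat>" "max (-c) (x - e) < r" "r < min c (x + e)" using Rats_dense_in_real by blast
   thus "\<exists>x\<in>\<rat> \<inter> {-c..c}. - inverse (real (Suc n)) < F w x" by(intro bexI[of _ r] e(2)) auto
  qed
 next
  assume *: "\<forall>n::nat. \<exists>x\<in>\<rat> \<inter> {-c..c}. - inverse (real (Suc n)) < F w x"
  obtain x where x: "x : {-c..c}" "!!y. y : {-c..c} ==> F w y <= F w x"
   using continuous_attains_sup[of "{-c..c}" "F w"] continuous_on_subset[OF F[of w]] c by auto
  have "0 <= F w x"
  proof (rule ccontr)
   assume "~ 0 <= F w x"
   then obtain n where "inverse (real (Suc n)) < - F w x" using reals_Archimedean[of "- F w x"] by auto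
   moreover obtain y where "y : {-c..c}" "- inverse (real (Suc n)) < F w y" using * by blast
   ultimately show False using x(2)[of y] by linarith
  qed
  thus "\<exists>x\<in>{-c..c}. 0 <= F w x" using x by blast
 qed
 hence "{w : space M. \<exists>x\<in>{-c..c}. 0 <= F w x} = (\<Inter>n::nat. \<Union>x\<in>\<rat> \<inter> {-c..c}. {w : space M. - inverse (real (Suc n)) < F w x})"
  by auto
 also have "... : sets M" by(intro sets.countable_INT' sets.countable_UN' countable_Int1 countable_rat image_subsetI) auto
 finally show ?thesis .
qed

text \<open>
 Two independent random closed sets of energies, each given by the sign of a function with at most
 \<open>N\<close> zeros, are unlikely to meet: the lowest common point is an end of the window or a zero of one
 of the functions.
\<close>

lemma random_sets_meet:
 fixes f :: "'a => real => real" and h :: "'b => real => real" and p :: ennreal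
 assumes "prob_space P" "prob_space Q" and c: "c > 0"
  and f[measurable]: "!!x. (%a. f a x) : borel_measurable P" and h[measurable]: "!!x. (%b. h b x) : borel_measurable Q"
  and cont: "!!a. continuous_on UNIV (f a)" "!!b. continuous_on UNIV (h b)"
  and zeros: "!!a. finite {x. f a x = 0} & card {x. f a x = 0} <= N" "!!b. finite {x. h b x = 0} & card {x. h b x = 0} <= N"
  and p: "!!x. abs x <= c ==> emeasure P {a : space P. 0 <= f a x} <= p" "!!x. abs x <= c ==> emeasure Q {b : space Q. 0 <= h b x} <= p"
 defines "E \<equiv> {w : space (P \<Otimes>\<^sub>M Q). \<exists>x\<in>{-c..c}. 0 <= min (f (fst w) x) (h (snd w) x)}"
 shows "E : sets (P \<Otimes>\<^sub>M Q)" "emeasure (P \<Otimes>\<^sub>M Q) E <= (2 * of_nat N + 1) * p"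
proof -
 interpret P: prob_space P by fact
 interpret Q: prob_space Q by fact
 interpret pq: pair_sigma_finite P Q by unfold_locales
 let ?PQ = "P \<Otimes>\<^sub>M Q"
 show E: "E : sets ?PQ" unfolding E_def using cont by(intro exists_level_measurable c continuous_intros) measurable
 \<comment> \<open>An energy is a zero of one function and resonant for the other.\<close>
 define E1 E2 where "E1 = {w : space ?PQ. \<exists>x\<in>{-c..c}. 0 <= min (- ((f (fst w) x)^2)) (h (snd w) x)}"
  and "E2 = {w : space ?PQ. \<exists>x\<in>{-c..c}. 0 <= min (f (fst w) x) (- ((h (snd w) x)^2))}"
 define E0 where "E0 = {w : space ?PQ. 0 <= f (fst w) (- c)}"
 have E12: "E1 : sets ?PQ" "E2 : sets ?PQ"
  unfolding E1_def E2_def using cont by(intro exists_level_measurable c continuous_intros; measurable)+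
 have E0: "E0 : sets ?PQ" unfolding E0_def by measurable
 have "E \<subseteq> E0 \<union> (E1 \<union> E2)"
 proof
  fix w assume w: "w : E"
  let ?F = "%x. min (f (fst w) x) (h (snd w) x)"
  have F: "continuous_on UNIV ?F" by(intro continuous_on_min cont)
  let ?K = "{-c..c} \<inter> {x. 0 <= ?F x}"
  have "closed {x. 0 <= ?F x}" using F by(intro closed_Collect_le continuous_on_const)
  hence "compact ?K" by(intro compact_Int_closed) auto
  moreover have "?K ~= {}" using w by(auto simp:E_def)
  ultimately obtain x where x: "x : ?K" "!!y. y : ?K ==> x <= y" using compact_attains_inf[of ?K] by blast
  have "x = - c \<or> ?F x <= 0"
  proof (rule ccontr)
   assume "~ (x = - c \<or> ?F x <= 0)"
   hence "- c < x" "0 < ?F x" using x by auto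
   moreover have "open {x. 0 < ?F x}" using F by(intro open_Collect_less continuous_on_const)
   ultimately obtain e where e: "e > 0" "!!y. abs (y - x) < e ==> 0 < ?F y" by(auto simp:open_dist dist_real_def)
   define y where "y = max (-c) (x - e / 2)"
   have "y < x" "abs (y - x) < e" "- c <= y" using `- c < x` e(1) by(auto simp:y_def)
   hence "y : ?K" using e(2)[of y] x(1) by auto
   thus False using x(2)[of y] `y < x` by simp
  qed
  then consider "x = - c" | "f (fst w) x = 0" | "h (snd w) x = 0" using x(1) by(auto simp:min_def split: if_splits)
  thus "w : E0 \<union> (E1 \<union> E2)" using x(1) w by cases (auto simp:E_def E0_def E1_def E2_def intro!:bexI[of _ x])
 qed
 hence "emeasure ?PQ E <= emeasure ?PQ E0 + (emeasure ?PQ E1 + emeasure ?PQ E2)"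
  using E0 E12 by(intro order_trans[OF emeasure_mono order_trans[OF emeasure_subadditive add_left_mono[OF emeasure_subadditive]]]) auto
 also have "... <= p + (of_nat N * p + of_nat N * p)"
 proof (intro add_mono)
  have "E0 = {a : space P. 0 <= f a (- c)} \<times> space Q" by(auto simp:E0_def space_pair_measure)
  thus "emeasure ?PQ E0 <= p" using p(1)[of "- c"] c by(simp add:Q.emeasure_pair_measure_Times Q.emeasure_space_1)
  show "emeasure ?PQ E1 <= of_nat N * p"
  proof -
   have "emeasure Q (Pair a -` E1) <= of_nat N * p" if "a : space P" for a
   proof -
    have "emeasure Q (Pair a -` E1) <= emeasure Q (\<Union>x\<in>{x. f a x = 0} \<inter> {-c..c}. {b : space Q. 0 <= h b x})"
     using zeros(1)[of a] by(intro emeasure_mono) (auto simp:E1_def space_pair_measure)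
    also have "... <= (\<Sum>x\<in>{x. f a x = 0} \<inter> {-c..c}. emeasure Q {b : space Q. 0 <= h b x})"
     using zeros(1)[of a] by(intro emeasure_subadditive_finite) auto
    also have "... <= (\<Sum>x\<in>{x. f a x = 0} \<inter> {-c..c}. p)" by(intro sum_mono p(2)) (auto simp:abs_le_iff)
    also have "... <= of_nat N * p"
     using zeros(1)[of a] card_mono[of "{x. f a x = 0}" "{x. f a x = 0} \<inter> {-c..c}"] by(simp add:mult_right_mono)
    finally show ?thesis .
   qed
   hence "(\<integral>\<^sup>+a. emeasure Q (Pair a -` E1) \<partial>P) <= (\<integral>\<^sup>+a. of_nat N * p \<partial>P)" by(rule nn_integral_mono)
   thus ?thesis using E12 by(simp add:Q.emeasure_pair_measure_alt P.emeasure_space_1)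
  qed
  show "emeasure ?PQ E2 <= of_nat N * p"
  proof -
   have "emeasure P ((%a. (a, b)) -` E2) <= of_nat N * p" if "b : space Q" for b
   proof -
    have "emeasure P ((%a. (a, b)) -` E2) <= emeasure P (\<Union>x\<in>{x. h b x = 0} \<inter> {-c..c}. {a : space P. 0 <= f a x})"
     using zeros(2)[of b] by(intro emeasure_mono) (auto simp:E2_def space_pair_measure)
    also have "... <= (\<Sum>x\<in>{x. h b x = 0} \<inter> {-c..c}. emeasure P {a : space P. 0 <= f a x})"
     using zeros(2)[of b] by(intro emeasure_subadditive_finite) auto
    also have "... <= (\<Sum>x\<in>{x. h b x = 0} \<inter> {-c..c}. p)" by(intro sum_mono p(1)) (auto simp:abs_le_iff)
    also have "... <= of_nat N * p"
     using zeros(2)[of b] card_mono[of "{x. h b x = 0}" "{x. h b x = 0} \<inter> {-c..c}"] by(simp add:mult_right_mono)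
    finally show ?thesis .
   qed
   hence "(\<integral>\<^sup>+b. emeasure P ((%a. (a, b)) -` E2) \<partial>Q) <= (\<integral>\<^sup>+b. of_nat N * p \<partial>Q)" by(rule nn_integral_mono)
   thus ?thesis using E12 by(simp add:pq.emeasure_pair_measure_alt2 Q.emeasure_space_1)
  qed
 qed
 also have "... = (2 * of_nat N + 1) * p" unfolding mult_2 distrib_right by(simp only: mult_1 ac_simps)
 finally show "emeasure ?PQ E <= (2 * of_nat N + 1) * p" .
qed

lemma poly_Re_Im:
 "Re (poly p (of_real x)) = poly (map_poly Re p) x" "Im (poly p (of_real x)) = poly (map_poly Im p) x"
 by(induction p) (simp_all add: map_poly_pCons)

context anderson
begin

context
 fixes Lam :: "(int ^ 'd) set"
 assumes fin: "finite Lam"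
begin

lemma reson_poly:
 assumes "W \<subseteq> Lam"
 shows "\<exists>p. degree p <= 2 * card (sites Lam) & (\<forall>x. reson Lam W eps a u x = poly p x)"
proof -
 define sq where "sq = (%p. (map_poly Re p)^2 + (map_poly Im p)^2)"
 have sq: "(cmod (poly p (of_real x)))^2 = poly (sq p) x" for p x by(simp add:sq_def cmod_power2 poly_Re_Im)
 have dsq: "degree (sq p) <= 2 * n" if "degree p <= n" for p n
 proof -
  have "degree ((map_poly r p)^2) <= 2 * n" for r :: "complex => real"
   using degree_power_le[of "map_poly r p" 2] map_poly_degree_leq[of r p] that by linarith
  thus ?thesis unfolding sq_def by(intro degree_add_le)
 qed
 have d: "degree (shifted_poly (hent u) i j) <= 1" for i j by(simp add:shifted_poly_def)
 define D S where "D = sdet (sites Lam) (shifted_poly (hent u))" and "S = sadj (sites Lam) (shifted_poly (hent u)) a"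
 have deg: "degree D <= card (sites Lam)" "degree (S b) <= card (sites Lam)" for b
  using degree_sdet[of "sites Lam" "shifted_poly (hent u)" "%_. 1"] degree_sadj[of "sites Lam" "shifted_poly (hent u)" "%_. 1" a b] fin d
  by(auto simp:D_def S_def)
 have "finite W" using assms fin finite_subset by blast
 hence "degree ((\<Sum>b\<in>sites W. sq (S b)) - smult (eps^2) (sq D)) <= 2 * card (sites Lam)"
  by(intro degree_diff_le degree_sum_le order_trans[OF degree_smult_le] dsq deg) simp
 moreover have "reson Lam W eps a u x = poly ((\<Sum>b\<in>sites W. sq (S b)) - smult (eps^2) (sq D)) x" for x
  by(simp add:reson_def sq[symmetric] poly_sum D_def S_def poly_sdet poly_sadj poly_shifted)
 ultimately show ?thesis by blast
qed

lemma reson_continuous: "W \<subseteq> Lam ==> continuous_on UNIV (reson Lam W eps a u)"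
proof -
 assume "W \<subseteq> Lam"
 from reson_poly[OF this] obtain p where "!!x. reson Lam W eps a u x = poly p x" by blast
 hence "reson Lam W eps a u = poly p" by(rule ext)
 thus ?thesis by(auto intro:continuous_intros)
qed

text \<open>At energies beyond the norm of the box Hamiltonian the Green function is small; so the
 resonance function is not the zero polynomial.\<close>

lemma reson_neg:
 assumes eps: "eps > 0" and a: "a : sites Lam" and W: "W \<subseteq> Lam"
 shows "\<exists>x. reson Lam W eps a u x < 0"
proof -
 let ?D = "sdet (sites Lam) (shifted_poly (hent u))"
 have fS: "finite (sites Lam)" using fin by simp
 have "poly ?D \<i> ~= 0"
  unfolding poly_sdet poly_shifted by(rule sdet_shifted_nonzero[where h="hent u", OF fS hent_hermitian]) simp
 hence "finite {z. poly ?D z = 0}" by(intro poly_roots_finite) auto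
 hence "finite (of_real -` {z. poly ?D z = 0} :: real set)" by(rule finite_vimageI) (simp add:inj_on_def)
 define n where "n = (\<Sum>b\<in>sites Lam. \<Sum>c\<in>sites Lam. cmod (hent u b c))"
 have "infinite ({n + 1 / eps<..} - of_real -` {z. poly ?D z = 0} :: real set)"
  using \<open>finite (of_real -` _)\<close> infinite_Ioi by(rule Diff_infinite_finite)
 then obtain x :: real where x: "n + 1 / eps < x" "poly ?D (of_real x) ~= 0" by(auto dest:infinite_imp_nonempty)
 let ?d = "sdet (sites Lam) (shifted (hent u) (of_real x))" and ?G = "gr Lam (of_real x) u a"
 have d: "?d ~= 0" using x(2) by(simp add:poly_sdet poly_shifted)
 define U where "U = (\<Sum>b\<in>sites Lam. cmod (?G b))"
 have n0: "n >= 0" by(simp add:n_def sum_nonneg)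
 have "x * cmod (?G c) <= (if a = c then 1 else 0) + (\<Sum>b\<in>sites Lam. cmod (?G b) * cmod (hent u b c))" if c: "c : sites Lam" for c
 proof -
  have "(\<Sum>b\<in>sites Lam. ?G b * hent u b c) - ?G c * of_real x = (if a = c then 1 else 0)"
   using green_mult[OF fS a c d] c fS
   by(simp add:shifted_def right_diff_distrib sum_subtractf if_distrib[of "%x. _ * x"] cong: if_cong)
  hence "?G c * of_real x = (\<Sum>b\<in>sites Lam. ?G b * hent u b c) - (if a = c then 1 else 0)" by(simp add:algebra_simps)
  hence "cmod (?G c * of_real x) <= cmod (\<Sum>b\<in>sites Lam. ?G b * hent u b c) + (if a = c then 1 else 0)"
   using norm_triangle_ineq4[of "\<Sum>b\<in>sites Lam. ?G b * hent u b c" "if a = c then 1 else 0"] by(auto split: if_splits)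
  also have "cmod (\<Sum>b\<in>sites Lam. ?G b * hent u b c) <= (\<Sum>b\<in>sites Lam. cmod (?G b) * cmod (hent u b c))"
   by(rule sum_norm_le) (simp add:norm_mult)
  finally have "cmod (?G c) * abs x <= (if a = c then 1 else 0) + (\<Sum>b\<in>sites Lam. cmod (?G b) * cmod (hent u b c))"
   by(simp add:norm_mult)
  moreover have "x * cmod (?G c) <= cmod (?G c) * abs x" unfolding mult.commute[of x] by(rule mult_left_mono) auto
  ultimately show ?thesis by linarith
 qed
 hence "x * U <= (\<Sum>c\<in>sites Lam. (if a = c then 1 else 0) + (\<Sum>b\<in>sites Lam. cmod (?G b) * cmod (hent u b c)))"
  unfolding U_def sum_distrib_left by(rule sum_mono)
 also have "... = 1 + (\<Sum>b\<in>sites Lam. cmod (?G b) * (\<Sum>c\<in>sites Lam. cmod (hent u b c)))"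
  using fS a by(simp add:sum.distrib sum_distrib_left) (rule sum.swap)
 also have "... <= 1 + (\<Sum>b\<in>sites Lam. cmod (?G b) * n)"
  unfolding n_def using fS
  by(intro add_left_mono sum_mono mult_left_mono member_le_sum[of _ _ "%b. \<Sum>c\<in>sites Lam. cmod (hent u b c)"]) (auto simp:sum_nonneg)
 also have "... = 1 + U * n" by(simp add:U_def sum_distrib_right)
 finally have "U * (x - n) <= 1" by(simp add:algebra_simps)
 moreover have "1 / eps < x - n" using x(1) by simp
 ultimately have U: "U < eps"
 proof -
  assume "U * (x - n) <= 1" "1 / eps < x - n"
  have "x - n > 0" using `1 / eps < x - n` eps less_trans[of 0 "1 / eps" "x - n"] by simp
  hence "U <= 1 / (x - n)" using `U * (x - n) <= 1` by(simp add:pos_le_divide_eq)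
  also have "... < eps" using `1 / eps < x - n` `x - n > 0` eps by(simp add:field_simps)
  finally show ?thesis .
 qed
 have "(\<Sum>b\<in>sites W. (cmod (?G b))^2) <= (\<Sum>b\<in>sites Lam. cmod (?G b) * U)"
 proof (rule order_trans[OF sum_mono2])
  show "sites W \<subseteq> sites Lam" using W by auto
  show "(\<Sum>b\<in>sites Lam. (cmod (?G b))^2) <= (\<Sum>b\<in>sites Lam. cmod (?G b) * U)"
   unfolding power2_eq_square U_def using fS by(intro sum_mono mult_left_mono member_le_sum[of _ _ "%b. cmod (?G b)"]) auto
 qed (use fS in auto)
 also have "... = U * U" by(simp add:sum_distrib_right[symmetric] U_def)
 also have "... < eps^2" using U by(simp add:power2_eq_square U_def sum_nonneg mult_strict_mono')
 finally have "(cmod ?d)^2 * (\<Sum>b\<in>sites W. (cmod (?G b))^2) < (cmod ?d)^2 * eps^2"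
  using d by(intro mult_strict_left_mono) auto
 moreover have "(cmod ?d)^2 * (cmod (?G b))^2 = (cmod (sadj (sites Lam) (shifted (hent u) (of_real x)) a b))^2" for b
  using d by(simp add:green_def norm_divide power_divide)
 ultimately have "reson Lam W eps a u x < 0" by(simp add:reson_def sum_distrib_left mult.commute)
 thus ?thesis by blast
qed

lemma reson_zeros:
 assumes "eps > 0" "a : sites Lam" "W \<subseteq> Lam"
 shows "finite {x. reson Lam W eps a u x = 0} & card {x. reson Lam W eps a u x = 0} <= 2 * card (sites Lam)"
proof -
 obtain p where p: "degree p <= 2 * card (sites Lam)" "!!x. reson Lam W eps a u x = poly p x"
  using reson_poly[OF assms(3), of eps a u] by blast
 have "p ~= 0" using reson_neg[OF assms, of u] p(2) by force
 thus ?thesis using poly_roots_finite[of p] card_poly_roots_bound[of p] p by simp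
qed

lemma reson_restrict: "W \<subseteq> Lam ==> reson Lam W eps a (restrict u Lam) x = reson Lam W eps a u x"
proof -
 have s: "shifted (hent (restrict u Lam)) z i j = shifted (hent u) z i j" if "i : sites Lam" for z i j
  using that by(auto simp:shifted_def hent_def)
 hence "sdet (sites Lam) (shifted (hent (restrict u Lam)) z) = sdet (sites Lam) (shifted (hent u) z)"
  "sadj (sites Lam) (shifted (hent (restrict u Lam)) z) a b = sadj (sites Lam) (shifted (hent u) z) a b" for z b
  unfolding sadj_def by(auto intro!:sdet_cong)
 thus ?thesis unfolding reson_def by simp
qed

end

text \<open>For an independent field, resonances of two disjoint boxes at a common energy are
 improbable.\<close>

lemma double_resonance:
 fixes v :: "int ^ 'd => 'w => real" and p :: ennreal
 assumes "prob_space M" and indep: "prob_space.indep_vars M (%_. borel) v UNIV" and distr: "!!n. distr M borel (v n) = mu"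
  and c0: "c > 0" and eps: "eps > 0"
  and Lam: "finite Lam" "finite Lam'" "Lam \<inter> Lam' = {}" and a: "a : sites Lam" "a' : sites Lam'" and W: "W \<subseteq> Lam" "W' \<subseteq> Lam'"
  and N: "2 * card (sites Lam) <= N" "2 * card (sites Lam') <= N"
  and p: "!!x. abs x <= c ==> emeasure (PM Lam) {u : space (PM Lam). 0 <= reson Lam W eps a u x} <= p"
   "!!x. abs x <= c ==> emeasure (PM Lam') {u : space (PM Lam'). 0 <= reson Lam' W' eps a' u x} <= p"
 defines "F \<equiv> {w : space M. \<exists>x\<in>{-c..c}. 0 <= reson Lam W eps a (%n. v n w) x & 0 <= reson Lam' W' eps a' (%n. v n w) x}"
 shows "F : sets M" "emeasure M F <= (2 * of_nat N + 1) * p"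
proof -
 interpret M: prob_space M by fact
 have v: "v n : borel_measurable M" for n using indep by(simp add:M.indep_vars_def)
 define X where "X = (%Lam w. restrict (%n. v n w) Lam)"
 have X: "X Lam : measurable M (PM Lam)" for Lam
  unfolding X_def by(intro measurable_restrict) (simp add:v measurable_cong_sets[OF refl sets_mu])
 have dX: "distr M (PM Lam) (X Lam) = PM Lam" if "Lam ~= {}" for Lam
 proof -
  have "M.indep_vars (%_. borel) v Lam" by(rule M.indep_vars_subset[OF indep]) simp
  hence "distr M (PiM Lam (%_. borel)) (X Lam) = PiM Lam (%n. distr M borel (v n))"
   unfolding X_def using M.indep_vars_iff_distr_eq_PiM'[OF that, of v "%_. borel"] v by simp
  moreover have "sets (PM Lam) = sets (PiM Lam (%_. borel :: real measure))" by(intro sets_PiM_cong) auto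
  ultimately show ?thesis by(simp add:distr cong: distr_cong)
 qed
 have ne: "Lam ~= {}" "Lam' ~= {}" using a by auto
 have "M.indep_var (PiM Lam (%_. borel)) (X Lam) (PiM Lam' (%_. borel)) (X Lam')"
  unfolding X_def by(rule M.indep_var_restrict[OF indep Lam(3)]) auto
 hence "M.indep_var (PM Lam) (X Lam) (PM Lam') (X Lam')"
  by(simp add:M.indep_var_eq X sets_PiM_cong[of _ _ "%_. mu" "%_. borel"] cong: measurable_cong_sets)
 hence pair: "distr M (PM Lam \<Otimes>\<^sub>M PM Lam') (%w. (X Lam w, X Lam' w)) = PM Lam \<Otimes>\<^sub>M PM Lam'"
  using M.indep_var_distribution_eq[of "PM Lam" "X Lam" "PM Lam'" "X Lam'"] dX[OF ne(1)] dX[OF ne(2)] by simp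
 note rs = random_sets_meet[OF prob_PM[of Lam] prob_PM[of Lam'] c0 reson_measurable reson_measurable
   reson_continuous[OF Lam(1) W(1)] reson_continuous[OF Lam(2) W(2)] _ _ p, of N]
 let ?E = "{w : space (PM Lam \<Otimes>\<^sub>M PM Lam'). \<exists>x\<in>{-c..c}. 0 <= min (reson Lam W eps a (fst w) x) (reson Lam' W' eps a' (snd w) x)}"
 have z: "finite {x. reson Lam W eps a u x = 0} & card {x. reson Lam W eps a u x = 0} <= N"
  "finite {x. reson Lam' W' eps a' u x = 0} & card {x. reson Lam' W' eps a' u x = 0} <= N" for u
  using reson_zeros[OF Lam(1) eps a(1) W(1), of u] reson_zeros[OF Lam(2) eps a(2) W(2), of u] N by auto
 have E: "?E : sets (PM Lam \<Otimes>\<^sub>M PM Lam')" "emeasure (PM Lam \<Otimes>\<^sub>M PM Lam') ?E <= (2 * of_nat N + 1) * p"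
  using rs z by auto
 have XX: "(%w. (X Lam w, X Lam' w)) : measurable M (PM Lam \<Otimes>\<^sub>M PM Lam')" using X by(intro measurable_Pair)
 have F: "F = (%w. (X Lam w, X Lam' w)) -` ?E \<inter> space M"
  using measurable_space[OF XX] by(auto simp:F_def X_def reson_restrict Lam W)
 show "F : sets M" unfolding F by(rule measurable_sets[OF XX E(1)])
 show "emeasure M F <= (2 * of_nat N + 1) * p"
  using E(2) unfolding F emeasure_distr[OF XX E(1), symmetric] pair .
qed

end

section \<open>Spectral projections on nonresonant energies\<close>

context anderson
begin

context
 fixes Lam W :: "(int ^ 'd) set" and u :: "int ^ 'd => real"
 assumes fin: "finite Lam" and W: "W \<subseteq> Lam"
  and bdry: "!!n n'. n : Lam ==> n' ~: Lam ==> adjacent n n' ==> n : W"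
begin

text \<open>The indices of the sites that neighbour \<open>W\<close>, which contain the outer
 boundary of the box.\<close>

definition outer :: "((int ^ 'd) \<times> 'k) set" where
 "outer = sites (\<Union>w\<in>W. {n'. adjacent w n'})"

lemma finite_outer: "finite outer" and card_outer: "card outer <= card W * nbr TYPE('d) * CARD('k)"
proof -
 have fW: "finite W" using W fin finite_subset by blast
 thus "finite outer" unfolding outer_def by(intro finite_cartesian_product finite_UN_I) (auto simp:finite_adjacent)
 have "card {n'. adjacent w n'} <= nbr TYPE('d)" for w :: "int ^ 'd" using card_adjacent_le[of UNIV w] by simp
 hence "card (\<Union>w\<in>W. {n'. adjacent w n'}) <= card W * nbr TYPE('d)"
  using order_trans[OF card_UN_le[OF fW] sum_bounded_above[where K="nbr TYPE('d)"], of "%w. {n'. adjacent w n'}"] by simp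
 thus "card outer <= card W * nbr TYPE('d) * CARD('k)" unfolding outer_def by(simp add:card_cartesian_product)
qed

text \<open>The contribution to the equation at a site of the box from its neighbours outside.\<close>

definition leak :: "('d, 'k) l2 => (int ^ 'd) \<times> 'k => complex" where
 "leak phi b = of_real (inverse g) * (\<Sum>n'\<in>{n'. adjacent (fst b) n'} - Lam. \<Sum>j\<in>UNIV. K (fst b - n') $ snd b $ j * fld phi n' $ j)"

lemma leak_0: "n : Lam ==> n ~: W ==> leak phi (n, i) = 0"
 using bdry by(auto simp:leak_def intro!:sum.neutral)

lemma leak_le: "b : sites W ==> cmod (leak phi b) <= max CK 0 / g * (\<Sum>c\<in>outer. cmod (fld phi (fst c) $ snd c))"
proof -
 assume b: "b : sites W"
 let ?N = "{n'. adjacent (fst b) n'} - Lam"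
 have "cmod (\<Sum>n'\<in>?N. \<Sum>j\<in>UNIV. K (fst b - n') $ snd b $ j * fld phi n' $ j) <= (\<Sum>n'\<in>?N. \<Sum>j\<in>UNIV. max CK 0 * cmod (fld phi n' $ j))"
  by(intro sum_norm_le) (auto simp:norm_mult intro!:mult_right_mono cmod_K_entry)
 also have "... = max CK 0 * (\<Sum>c\<in>sites ?N. cmod (fld phi (fst c) $ snd c))"
  by(simp add:sum_distrib_left sum.cartesian_product case_prod_beta)
 also have "... <= max CK 0 * (\<Sum>c\<in>outer. cmod (fld phi (fst c) $ snd c))"
  using b by(intro mult_left_mono sum_mono2 finite_outer) (auto simp:outer_def)
 finally have "inverse g * cmod (\<Sum>n'\<in>?N. \<Sum>j\<in>UNIV. K (fst b - n') $ snd b $ j * fld phi n' $ j) <= inverse g * (max CK 0 * (\<Sum>c\<in>outer. cmod (fld phi (fst c) $ snd c)))"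
  using g by(intro mult_left_mono) auto
 thus ?thesis using g by(simp add:leak_def norm_mult norm_inverse divide_inverse mult_ac)
qed

lemma opH_in_box:
 assumes phi: "phi : domH u" and n: "n : Lam"
 shows "fld (opH u phi - x *\<^sub>R phi) n $ i = (\<Sum>c\<in>sites Lam. shifted (hent u) (of_real x) (n, i) c * fld phi (fst c) $ snd c) + leak phi (n, i)"
proof -
 let ?K = "%n'. \<Sum>j\<in>UNIV. of_real (inverse g) * K (n - n') $ i $ j * fld phi n' $ j"
 have "fld (hop phi) n $ i = (\<Sum>n'\<in>{n'. adjacent n n'}. ?K n')"
  by(simp add:fld_hop matrix_vector_mult_def scaleR_conv_of_real[where 'a=complex] sum_distrib_left mult.assoc)
 also have "... = (\<Sum>n'\<in>{n'. adjacent n n'} \<inter> Lam. ?K n') + (\<Sum>n'\<in>{n'. adjacent n n'} - Lam. ?K n')"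
  by(rule sum.Int_Diff[OF finite_adjacent])
 also have "(\<Sum>n'\<in>{n'. adjacent n n'} - Lam. ?K n') = leak phi (n, i)" by(simp add:leak_def sum_distrib_left mult.assoc)
 also have "(\<Sum>n'\<in>{n'. adjacent n n'} \<inter> Lam. ?K n') = (\<Sum>n'\<in>Lam - {n}. \<Sum>j\<in>UNIV. shifted (hent u) (of_real x) (n, i) (n', j) * fld phi n' $ j)"
 proof (rule sum.mono_neutral_cong_left)
  show "{n'. adjacent n n'} \<inter> Lam \<subseteq> Lam - {n}" by(auto simp:adjacent_def l1_dist_def)
 qed (use fin in \<open>auto simp:shifted_def hent_def intro!:sum.neutral sum.cong simp: adjacent_def split: if_splits\<close>)
 finally have hop: "fld (hop phi) n $ i = (\<Sum>n'\<in>Lam - {n}. \<Sum>j\<in>UNIV. shifted (hent u) (of_real x) (n, i) (n', j) * fld phi n' $ j) + leak phi (n, i)" .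
 have "fld (opH u phi - x *\<^sub>R phi) n $ i = (\<Sum>j\<in>UNIV. pot (u n) $ i $ j * fld phi n $ j) - of_real x * fld phi n $ i + fld (hop phi) n $ i"
  using fld_opH[OF phi] by(simp add:fld_minus scaleR_l2.rep_eq matrix_vector_mult_def scaleR_conv_of_real[of x "_ $ _"])
 also have "(\<Sum>j\<in>UNIV. pot (u n) $ i $ j * fld phi n $ j) - of_real x * fld phi n $ i = (\<Sum>j\<in>UNIV. shifted (hent u) (of_real x) (n, i) (n, j) * fld phi n $ j)"
  by(simp add:shifted_def hent_def left_diff_distrib sum_subtractf if_distrib[of "%x. x * _"] cong: if_cong)
 also have "... + fld (hop phi) n $ i = (\<Sum>n'\<in>Lam. \<Sum>j\<in>UNIV. shifted (hent u) (of_real x) (n, i) (n', j) * fld phi n' $ j) + leak phi (n, i)"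
  unfolding hop by(subst sum.remove[OF fin n]) simp
 finally show ?thesis by(simp add:sum.cartesian_product case_prod_beta)
qed

text \<open>
 Where the box is not resonant, an approximate eigenvector is controlled at the centre by its size
 just outside the box, with a factor \<open>eps / g\<close>.
\<close>

lemma approx_eigen_bound:
 assumes phi: "phi : domH u" and a: "a : sites Lam" and eps: "eps >= 0"
  and d: "sdet (sites Lam) (shifted (hent u) (of_real x)) ~= 0" and L: "(\<Sum>b\<in>sites Lam. cmod (gr Lam (of_real x) u a b)) <= L"
  and G: "!!b. b : sites W ==> cmod (gr Lam (of_real x) u a b) <= eps"
 shows "cmod (cinner (delta a) phi) <= L * norm (opH u phi - x *\<^sub>R phi)
  + (real (card (sites W)) * (eps * (max CK 0 / g))) * (\<Sum>c\<in>outer. cmod (cinner (delta c) phi))"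
proof -
 let ?G = "gr Lam (of_real x) u a" and ?M = "shifted (hent u) (of_real x)" and ?psi = "opH u phi - x *\<^sub>R phi"
 let ?f = "%phi c. fld phi (fst c) $ snd c"
 have fS: "finite (sites Lam)" using fin by simp
 have "?f phi a = (\<Sum>c\<in>sites Lam. (\<Sum>b\<in>sites Lam. ?G b * ?M b c) * ?f phi c)"
  using green_mult[OF fS a _ d] a fS by(simp add:if_distrib[of "%x. x * _"] cong: if_cong sum.cong)
 also have "... = (\<Sum>b\<in>sites Lam. ?G b * (\<Sum>c\<in>sites Lam. ?M b c * ?f phi c))"
  unfolding sum_distrib_left sum_distrib_right by(subst sum.swap) (simp add:mult.assoc)
 also have "... = (\<Sum>b\<in>sites Lam. ?G b * (?f ?psi b - leak phi b))" using opH_in_box[OF phi] by(intro sum.cong) auto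
 also have "... = (\<Sum>b\<in>sites Lam. ?G b * ?f ?psi b) - (\<Sum>b\<in>sites Lam. ?G b * leak phi b)"
  by(simp add:right_diff_distrib sum_subtractf)
 also have "(\<Sum>b\<in>sites Lam. ?G b * leak phi b) = (\<Sum>b\<in>sites W. ?G b * leak phi b)"
  by(rule sum.mono_neutral_right) (use fS W leak_0 in auto)
 finally have "cmod (?f phi a) <= cmod (\<Sum>b\<in>sites Lam. ?G b * ?f ?psi b) + cmod (\<Sum>b\<in>sites W. ?G b * leak phi b)"
  by(simp add:norm_triangle_ineq4)
 also have "cmod (\<Sum>b\<in>sites Lam. ?G b * ?f ?psi b) <= (\<Sum>b\<in>sites Lam. cmod (?G b) * norm ?psi)"
  by(rule sum_norm_le) (auto simp:norm_mult intro!:mult_left_mono order_trans[OF Finite_Cartesian_Product.norm_nth_le norm_fld_le])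
 also have "... <= L * norm ?psi" unfolding sum_distrib_right[symmetric] by(intro mult_right_mono L) simp
 also have "cmod (\<Sum>b\<in>sites W. ?G b * leak phi b) <= (\<Sum>b\<in>sites W. eps * (max CK 0 / g * (\<Sum>c\<in>outer. cmod (?f phi c))))"
  using G leak_le eps by(intro sum_norm_le) (simp only: norm_mult, intro mult_mono, auto)
 finally show ?thesis by(simp add:cinner_delta mult_ac)
qed

lemma norm_PE_nonresonant:
 assumes I: "I : sets borel" "I \<subseteq> {-c..c}" and a: "a : sites Lam" and eps: "eps > 0"
 defines "S \<equiv> {x : I. reson Lam W eps a u x < 0}"
 shows "S : sets borel" "norm (PE u S (delta a)) <= 2 * (real CARD('k))^2 * nbr TYPE('d) * max CK 0 * (real (card W))^2 * (eps / g)"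
proof -
 interpret spectral "PE u" "domH u" "opH u" by(rule spectral_PE)
 let ?M = "%x::real. shifted (hent u) (of_real x)" and ?r = "reson Lam W eps a u"
 have "finite W" using fin W finite_subset by blast
 hence fS: "finite (sites Lam)" "finite (sites W)" using fin by auto
 have [measurable]: "?r : borel_measurable borel" by(rule borel_measurable_continuous_onI[OF reson_continuous[OF fin W]])
 \<comment> \<open>On \<open>T n\<close> the determinant is bounded away from zero, so the Green function is uniformly bounded.\<close>
 define T where "T = (%n. {x : I. ?r x <= - inverse (real (Suc n))})"
 have [measurable]: "I : sets borel" by fact
 have T: "T n : sets borel" for n unfolding T_def by measurable
 show "S : sets borel" unfolding S_def by measurable
 define C where "C = real (card (sites W)) * (eps * (max CK 0 / g))"
 have C: "C >= 0" using eps g by(simp add:C_def)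
 have cont: "continuous_on {-c..c} (%x. \<Sum>b\<in>sites Lam. cmod (sadj (sites Lam) (?M x) a b))"
  unfolding continuous_on_eq_continuous_within poly_shifted[symmetric] poly_sadj[symmetric] by(auto intro!:continuous_intros)
 obtain B where B: "!!x. x : {-c..c} ==> (\<Sum>b\<in>sites Lam. cmod (sadj (sites Lam) (?M x) a b)) <= B"
  using compact_imp_bounded[OF compact_continuous_image[OF cont compact_Icc]] unfolding bounded_iff by(metis abs_le_D1 image_eqI real_norm_def)
 have bound: "norm (PE u (T n) (delta a)) <= 2 * C * real (card outer)" for n
 proof -
  define dl where "dl = inverse (real (Suc n))"
  have dl: "dl > 0" by(simp add:dl_def)
  define L where "L = max B 0 * (eps / sqrt dl)"
  have "(norm (PE u (T n) (delta a)))^2 <= 2 * C^2 * (real (card outer))^2"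
  proof (rule norm_E_approx_eigen[OF T _ finite_outer _ _ C])
   show "abs x <= c" if "x : T n" for x using that I by(auto simp:T_def abs_le_iff)
   show "L >= 0" using eps dl by(simp add:L_def)
   fix x phi assume x: "x : T n" and phi: "phi : domH u"
   let ?d = "sdet (sites Lam) (?M x)" and ?s = "sadj (sites Lam) (?M x) a"
   have "(\<Sum>b\<in>sites W. (cmod (?s b))^2) + dl <= eps^2 * (cmod ?d)^2" using x by(simp add:T_def reson_def dl_def)
   hence s: "(\<Sum>b\<in>sites W. (cmod (?s b))^2) <= (eps * cmod ?d)^2" and d: "dl <= (eps * cmod ?d)^2"
    using dl sum_nonneg[of "sites W" "%b. (cmod (?s b))^2"] by(auto simp:power_mult_distrib)
   have sd: "sqrt dl <= eps * cmod ?d" using d eps by(simp add:real_sqrt_le_iff real_le_lsqrt)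
   hence dpos: "cmod ?d > 0" using dl eps by(metis less_le_trans mult_zero_right norm_ge_zero not_less order_less_le real_sqrt_gt_zero)
   have G: "cmod (gr Lam (of_real x) u a b) <= eps" if "b : sites W" for b
   proof -
    have "(cmod (?s b))^2 <= (eps * cmod ?d)^2" using member_le_sum[OF that, of "%b. (cmod (?s b))^2"] fS s by simp
    hence "cmod (?s b) <= eps * cmod ?d" by(rule power2_le_imp_le) (use eps in simp)
    thus ?thesis using dpos by(simp add:green_def norm_divide divide_le_eq)
   qed
   have "(\<Sum>b\<in>sites Lam. cmod (gr Lam (of_real x) u a b)) = (\<Sum>b\<in>sites Lam. cmod (?s b)) / cmod ?d"
    by(simp add:green_def norm_divide sum_divide_distrib)
   also have "... <= max B 0 / (sqrt dl / eps)"
    using B[of x] x I dpos sd dl eps by(intro frac_le) (auto simp:T_def divide_le_eq mult.commute)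
   also have "... = L" by(simp add:L_def)
   finally have "(\<Sum>b\<in>sites Lam. cmod (gr Lam (of_real x) u a b)) <= L" .
   thus "cmod (cinner (delta a) phi) <= L * norm (opH u phi - x *\<^sub>R phi) + C * (\<Sum>b\<in>outer. cmod (cinner (delta b) phi))"
    unfolding C_def using eps dpos by(intro approx_eigen_bound phi a G) auto
  qed (simp add:norm_delta)
  also have "... <= (2 * C * real (card outer))^2" by(simp add:power_mult_distrib)
  finally show ?thesis by(rule power2_le_imp_le) (use C in simp)
 qed
 have "S = (\<Union>n. T n)"
 proof (intro set_eqI iffI)
  fix x assume "x : S"
  then obtain n where "inverse (real (Suc n)) < - ?r x" using reals_Archimedean[of "- ?r x"] by(auto simp:S_def)
  thus "x : (\<Union>n. T n)" using `x : S` by(auto simp:S_def T_def intro!:exI[of _ n])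
 qed (auto simp:S_def T_def intro:le_less_trans)
 moreover have "incseq T" unfolding incseq_def T_def by(auto intro:order_trans[OF _ le_imp_neg_le[OF le_imp_inverse_le]])
 ultimately have "(%n. norm (PE u (T n) (delta a))) ----> norm (PE u S (delta a))" using norm_E_Union_tendsto[OF T] by simp
 hence "norm (PE u S (delta a)) <= 2 * C * real (card outer)" by(rule LIMSEQ_le_const2) (use bound in auto)
 also have "... <= 2 * C * (real (card W) * nbr TYPE('d) * real CARD('k))"
  using card_outer C by(intro mult_left_mono) (auto simp flip: of_nat_mult)
 also have "... = 2 * (real CARD('k))^2 * nbr TYPE('d) * max CK 0 * (real (card W))^2 * (eps / g)"
  by(simp add:C_def card_cartesian_product power2_eq_square)
 finally show "norm (PE u S (delta a)) <= ..." .
qed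

end

end

section \<open>Balls in the lattice\<close>

text \<open>Balls and spheres for the distance on the lattice.\<close>

definition lball :: "int ^ 'd::finite => nat => (int ^ 'd) set" where
 "lball n R = {x. l1_dist x n <= int R}"

definition lsphere :: "int ^ 'd::finite => nat => (int ^ 'd) set" where
 "lsphere n R = {x. l1_dist x n = int R}"

lemma finite_lball: "finite (lball n R)" and card_lball: "card (lball n R) <= (2 * R + 1) ^ CARD('d)"
 for n :: "int ^ 'd::finite"
proof -
 let ?P = "PiE UNIV (%i. {n $ i - int R..n $ i + int R})"
 have sub: "vec_nth ` lball n R \<subseteq> ?P"
 proof (rule image_subsetI)
  fix x assume "x : lball n R"
  hence "abs (x $ i - n $ i) <= int R" for i
   using member_le_sum[of i UNIV "%i. abs (x $ i - n $ i)"] by(simp add:lball_def l1_dist_def)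
  thus "vec_nth x : ?P" by(simp add:abs_le_iff PiE_UNIV_domain algebra_simps)
 qed
 have fin: "finite ?P" by(intro finite_PiE) auto
 have inj: "inj_on vec_nth (lball n R)" by(simp add:inj_on_def vec_eq_iff)
 show "finite (lball n R)" using finite_imageD[OF finite_subset[OF sub fin] inj] .
 have "card (lball n R) <= card ?P" using card_mono[OF fin sub] by(simp add:card_image[OF inj])
 also have "card ?P = (2 * R + 1) ^ CARD('d)" by(simp add:card_PiE nat_add_distrib nat_mult_distrib)
 finally show "card (lball n R) <= (2 * R + 1) ^ CARD('d)" .
qed

lemma lsphere_subset: "lsphere n R \<subseteq> lball n R"
 by(auto simp:lsphere_def lball_def)

lemma lball_boundary: "x : lball n R ==> y ~: lball n R ==> adjacent x y ==> x : lsphere n R"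
 using l1_dist_triangle[of y n x] l1_dist_commute[of x y] by(simp add:lball_def lsphere_def adjacent_def)

lemma lball_disjoint: "int (2 * R) < l1_dist m n ==> lball m R \<inter> lball n R = {}"
proof (rule ccontr)
 assume d: "int (2 * R) < l1_dist m n" and "lball m R \<inter> lball n R ~= {}"
 then obtain x where "x : lball m R" "x : lball n R" by blast
 thus False using d l1_dist_triangle[of m n x] l1_dist_commute[of m x] by(simp add:lball_def)
qed

lemma summable_lattice_decay: "summable (%r. real (2 * r + 1) ^ p * (1 / 2) ^ r)"
proof -
 define y where "y = (3 / 2 :: real) powr (1 / (p + 1))"
 have y: "y > 1" by(simp add:y_def)
 have yp: "y ^ (p + 1) = 3 / 2" unfolding y_def by(subst powr_realpow[symmetric]) (auto simp:powr_powr)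
 define h where "h = min 1 ((y - 1) / 2)"
 have h: "h > 0" "h <= 1" "2 * h <= y - 1" using y by(auto simp:h_def min_def)
 have "real (2 * r + 1) ^ p * (1 / 2) ^ r <= (1 / h) ^ p * (3 / 4) ^ r" for r
 proof -
  have "h * real (2 * r + 1) <= 1 + real r * (y - 1)" using h mult_left_mono[OF h(3), of "real r"] by(simp add:algebra_simps)
  also have "... <= y ^ r" using Bernoulli_inequality[of "y - 1" r] y by simp
  finally have "real (2 * r + 1) <= y ^ r / h" using h by(simp add:field_simps)
  hence "real (2 * r + 1) ^ p <= (y ^ r / h) ^ p" by(intro power_mono) auto
  also have "... = (1 / h) ^ p * (y ^ p) ^ r" by(simp add:power_divide flip: power_mult) (simp add:mult.commute)
  also have "... <= (1 / h) ^ p * (3 / 2) ^ r"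
   using y h power_increasing[of p "p + 1" y, unfolded yp] by(intro mult_left_mono power_mono) auto
  finally have "real (2 * r + 1) ^ p * (1 / 2) ^ r <= (1 / h) ^ p * (3 / 2) ^ r * (1 / 2) ^ r" by(intro mult_right_mono) auto
  also have "... = (1 / h) ^ p * (3 / 4) ^ r" by(simp add:mult.assoc flip: power_mult_distrib)
  finally show ?thesis .
 qed
 moreover have "norm (real (2 * r + 1) ^ p * (1 / 2) ^ r) = real (2 * r + 1) ^ p * (1 / 2) ^ r" for r
  unfolding real_norm_def by(rule abs_of_nonneg) simp
 moreover have "summable (%r. (1 / h) ^ p * (3 / 4 :: real) ^ r)" by(intro summable_mult summable_geometric) simp
 ultimately show ?thesis by(metis (no_types, lifting) summable_comparison_test')
qed

lemma lattice_sum_finite: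
 fixes m :: "int ^ 'd::finite" and f :: "(int ^ 'd) \<times> 'k::finite => real"
 assumes f: "!!b. f b <= C * (real (2 * nat (l1_dist (fst b) m) + 1) ^ p * (1 / 2) ^ nat (l1_dist (fst b) m))" and C: "C >= 0"
 shows "(\<integral>\<^sup>+b. ennreal (f b) \<partial>count_space UNIV) < \<infinity>"
proof -
 define h where "h = (%r. C * (real (2 * r + 1) ^ p * (1 / 2) ^ r))"
 let ?S = "%r. lsphere m r \<times> (UNIV :: 'k set)"
 have fin: "finite (?S r)" for r using finite_subset[OF lsphere_subset finite_lball] by(intro finite_cartesian_product) auto
 have card: "real (card (?S r)) <= real CARD('k) * real (2 * r + 1) ^ CARD('d)" for r
 proof -
  have "card (lsphere m r) <= (2 * r + 1) ^ CARD('d)"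
   using card_mono[OF finite_lball lsphere_subset] card_lball order_trans by blast
  hence "card (?S r) <= CARD('k) * (2 * r + 1) ^ CARD('d)" by(simp add:card_cartesian_product)
  thus ?thesis by(metis of_nat_le_iff of_nat_mult of_nat_power)
 qed
 have h0: "h r >= 0" for r using C by(simp add:h_def)
 have "(\<integral>\<^sup>+b. ennreal (f b) \<partial>count_space UNIV) <= (\<integral>\<^sup>+b. (\<Sum>r. ennreal (h r) * indicator (?S r) b) \<partial>count_space UNIV)"
 proof (rule nn_integral_mono)
  fix b :: "(int ^ 'd) \<times> 'k"
  let ?r = "nat (l1_dist (fst b) m)"
  have "b : ?S ?r" using l1_dist_nonneg[of "fst b" m] by(auto simp:lsphere_def mem_Times_iff)
  hence "ennreal (f b) <= (\<Sum>r\<in>{?r}. ennreal (h r) * indicator (?S r) b)" using f[of b] by(simp add:h_def ennreal_leI)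
  also have "... <= (\<Sum>r. ennreal (h r) * indicator (?S r) b)" by(rule sum_le_suminf) auto
  finally show "ennreal (f b) <= (\<Sum>r. ennreal (h r) * indicator (?S r) b)" .
 qed
 also have "... = (\<Sum>r. \<integral>\<^sup>+b. ennreal (h r) * indicator (?S r) b \<partial>count_space UNIV)"
  by(rule nn_integral_suminf) simp
 also have "... = (\<Sum>r. ennreal (h r * real (card (?S r))))"
  using fin h0 by(simp add:nn_integral_cmult_indicator ennreal_of_nat_eq_real_of_nat ennreal_mult del: card_cartesian_product)
 also have "... < \<infinity>"
 proof -
  have "summable (%r. h r * real (card (?S r)))"
  proof (rule summable_comparison_test')
   show "summable (%r. C * real CARD('k) * (real (2 * r + 1) ^ (p + CARD('d)) * (1 / 2) ^ r))"
    by(intro summable_mult summable_lattice_decay)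
   show "norm (h r * real (card (?S r))) <= C * real CARD('k) * (real (2 * r + 1) ^ (p + CARD('d)) * (1 / 2) ^ r)" for r
    using mult_left_mono[OF card[of r] h0[of r]]
    unfolding real_norm_def abs_of_nonneg[OF mult_nonneg_nonneg[OF h0 of_nat_0_le_iff]] by(simp add:h_def power_add mult_ac del: card_cartesian_product)
  qed
  thus ?thesis using h0 by(subst suminf_ennreal2) auto
 qed
 finally show ?thesis .
qed

lemma parseval_delta:
 "(\<integral>\<^sup>+b. ennreal ((cmod (cinner (delta b) (x :: ('d::finite, 'k::finite) l2)))^2) \<partial>count_space UNIV) = ennreal ((norm x)^2)"
proof -
 let ?f = "%n. (norm (fld x n))^2"
 have s: "?f summable_on UNIV" using fld[of x] by(simp add:ell2_def)
 hence "Infinite_Set_Sum.abs_summable_on ?f UNIV" by(subst abs_summable_equivalent[symmetric]) simp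
 hence "(\<integral>\<^sup>+n. ennreal (?f n) \<partial>count_space UNIV) = ennreal ((norm x)^2)"
  by(simp add:nn_integral_conv_infsetsum infsetsum_infsum norm_l2_sq)
 moreover have "(\<integral>\<^sup>+i. ennreal ((cmod (fld x n $ i))^2) \<partial>count_space UNIV) = ennreal (?f n)" for n
  by(simp add:nn_integral_count_space_finite sum_ennreal norm_vec_def L2_set_def sum_nonneg)
 ultimately show ?thesis by(subst nn_integral_fst_count_space[symmetric]) (simp add:cinner_delta)
qed

section \<open>Dynamical localisation\<close>

context anderson
begin

abbreviation rad :: "nat => nat" where "rad r \<equiv> (r - 1) div 2"

text \<open>For sites at distance \<open>r\<close> the boxes have radius \<open>rad r\<close>, the
 largest one that makes them disjoint. The level balances two requirements: both \<open>level r /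
 g\<close> and the probability bound \<open>level r powr (- sg) * th ^ rad r\<close> must be at most
 \<open>g powr (- (s\<^sup>2 * r / 8))\<close>, up to \<open>D1 ^ r\<close>.\<close>

definition level :: "nat => real" where
 "level r = g powr (3 * s * r / 8 - rad r)"

text \<open>The resonance function of the box of scale \<open>r\<close> centred at the site of
 \<open>a\<close>, between \<open>a\<close> and the sphere bounding the box.\<close>

definition Res :: "nat => (int ^ 'd) \<times> 'k => (int ^ 'd => real) => real => real" where
 "Res r a u x = reson (lball (fst a) (rad r)) (lsphere (fst a) (rad r)) (level r) a u x"

text \<open>The constants \<open>D1\<close> and \<open>C4\<close> do not depend on
 \<open>g\<close>.\<close>

definition D1 :: real where
 "D1 = max 1 (A0 * real CARD('k) * max CK 0 powr sg * nbr TYPE('d))"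

text \<open>The common bound, up to powers of \<open>r\<close>, for the probability of a double
 resonance and for the spectral projections off it.\<close>

definition rate :: "nat => real" where
 "rate r = D1 ^ r * g powr (- (s^2 * r / 8))"

definition C4 :: real where
 "C4 = 2 * (real CARD('k))^2 * nbr TYPE('d) * max CK 0"

lemma C4_nonneg: "C4 >= 0" and level_pos: "level r > 0" and D1: "D1 >= 1" and rate_nonneg: "rate r >= 0"
 using g by(simp_all add: C4_def level_def D1_def rate_def)

lemma card_rad:
 fixes n :: "int ^ 'd"
 assumes "r >= 1"
 shows "real (card (lball n (rad r))) <= real r ^ CARD('d)" "real (card (lsphere n (rad r))) <= real r ^ CARD('d)"
proof -
 have "2 * rad r + 1 <= r" using assms by linarith
 hence "(2 * rad r + 1) ^ CARD('d) <= r ^ CARD('d)" by(intro power_mono) auto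
 hence "card (lball n (rad r)) <= r ^ CARD('d)" using card_lball[of n "rad r"] by linarith
 thus 1: "real (card (lball n (rad r))) <= real r ^ CARD('d)" by(metis of_nat_le_iff of_nat_power)
 show "real (card (lsphere n (rad r))) <= real r ^ CARD('d)"
  using 1 card_mono[OF finite_lball lsphere_subset, of n "rad r"] by linarith
qed

lemma theta_eq: "th = (A0 * real CARD('k) * max CK 0 powr sg * nbr TYPE('d)) * g powr (- sg)"
 using g by(simp add:th_def b0_def powr_divide powr_minus field_simps)

lemma fin_boxes: "finite (lball n (rad r))" "finite (sites (lball n (rad r)))" "fst a : lball (fst a) (rad r)" for n :: "int ^ 'd"
 by(simp_all add: finite_lball, simp add:lball_def)

lemma site_in: "a : sites (lball (fst a) (rad r))"
 using fin_boxes(3) by(cases a) auto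

context
 assumes g1: "1 <= g"
begin

lemma Res_prob:
 assumes th: "th <= 1 / 2" and r: "r >= 1" and x: "abs x <= c"
 shows "emeasure (PM (lball (fst a) (rad r))) {u : space (PM (lball (fst a) (rad r))). 0 <= Res r a u x} <= ennreal (2 * A0 * (real r ^ CARD('d) * rate r))"
proof -
 let ?D = "A0 * real CARD('k) * max CK 0 powr sg * nbr TYPE('d)" and ?R = "rad r" and ?W = "lsphere (fst a) (rad r)"
 have D0: "?D >= 0" using A0_nonneg by simp
 have "th ^ ?R * level r powr (- sg) = ?D ^ ?R * (g powr (- sg * ?R) * g powr ((3 * s * r / 8 - ?R) * - sg))"
  using g by(simp add:theta_eq power_mult_distrib powr_power level_def powr_powr mult.commute[of s])
 also have "... = ?D ^ ?R * g powr (- (s^2 * r / 8))"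
 proof -
  have "- sg * ?R + (3 * s * r / 8 - ?R) * - sg = - (s^2 * r / 8)" by(simp add:field_simps power2_eq_square)
  thus ?thesis by(simp only: powr_add[symmetric])
 qed
 also have "... <= rate r"
 proof -
  have "?D ^ ?R <= D1 ^ ?R" using D0 by(intro power_mono) (auto simp:D1_def)
  also have "... <= D1 ^ r" using D1 by(intro power_increasing) auto
  finally show ?thesis unfolding rate_def by(rule mult_right_mono) simp
 qed
 finally have *: "th ^ ?R * level r powr (- sg) <= rate r" .
 have "emeasure (PM (lball (fst a) ?R)) {u : space (PM (lball (fst a) ?R)). 0 <= Res r a u x} <= ennreal (card ?W * (2 * A0 * th ^ ?R) * level r powr (- sg))"
  unfolding Res_def by(rule reson_prob[OF fin_boxes(1) th x level_pos site_in lsphere_subset]) (simp add:lsphere_def)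
 also have "... <= ennreal (2 * A0 * (real r ^ CARD('d) * rate r))"
 proof (rule ennreal_leI)
  have "2 * A0 * (card ?W * (th ^ ?R * level r powr (- sg))) <= 2 * A0 * (real r ^ CARD('d) * rate r)"
   using A0_nonneg theta_nonneg by(intro mult_left_mono mult_mono * card_rad r) auto
  thus "card ?W * (2 * A0 * th ^ ?R) * level r powr (- sg) <= 2 * A0 * (real r ^ CARD('d) * rate r)" by(simp add:mult_ac)
 qed
 finally show ?thesis .
qed

lemma Res_norm:
 assumes I: "I : sets borel" "I \<subseteq> {-c..c}" and r: "r >= 1"
 shows "{x : I. Res r a u x < 0} : sets borel"
  "norm (PE u {x : I. Res r a u x < 0} (delta a)) <= C4 * (real r ^ (2 * CARD('d)) * rate r)"
proof -
 let ?R = "rad r" and ?W = "lsphere (fst a) (rad r)"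
 have *: "{x : I. Res r a u x < 0} : sets borel"
  "norm (PE u {x : I. Res r a u x < 0} (delta a)) <= 2 * (real CARD('k))^2 * nbr TYPE('d) * max CK 0 * (real (card ?W))^2 * (level r / g)"
  unfolding Res_def by(rule norm_PE_nonresonant[OF fin_boxes(1) lsphere_subset _ I site_in level_pos], erule (2) lball_boundary)+
 show "{x : I. Res r a u x < 0} : sets borel" by(rule *(1))
 have "real r * (3 * s + s^2) <= real r * 4" using s power_le_one[of s 2] by(intro mult_left_mono) auto
 moreover have "real r / 2 <= real ?R + 1" by linarith
 ultimately have e: "3 * s * r / 8 - ?R - 1 <= - (s^2 * r / 8)" by(simp add:algebra_simps)
 have "level r / g = g powr (3 * s * r / 8 - ?R - 1)" using g by(simp add:level_def powr_diff)
 also have "... <= 1 * g powr (- (s^2 * r / 8))" using e g1 by(simp add:powr_mono)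
 also have "... <= rate r" unfolding rate_def using D1 by(intro mult_right_mono one_le_power) auto
 finally have l: "level r / g <= rate r" .
 have "norm (PE u {x : I. Res r a u x < 0} (delta a)) <= C4 * ((real (card ?W))^2 * (level r / g))"
  using *(2) by(simp add:C4_def mult_ac)
 also have "... <= C4 * ((real r ^ CARD('d))^2 * rate r)"
  using C4_nonneg level_pos[of r] g by(intro mult_left_mono mult_mono power_mono card_rad r l) auto
 also have "(real r ^ CARD('d))^2 = real r ^ (2 * CARD('d))" by(simp add:mult.commute flip: power_mult)
 finally show "norm (PE u {x : I. Res r a u x < 0} (delta a)) <= C4 * (real r ^ (2 * CARD('d)) * rate r)" .
qed

context
 fixes M :: "'w measure" and v :: "int ^ 'd => 'w => real" and I :: "real set"
 assumes M: "prob_space M" and indep: "prob_space.indep_vars M (%_. borel) v UNIV" and distr: "!!n. distr M borel (v n) = mu"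
  and c0: "c > 0" and th: "th <= 1 / 2" and I: "I : sets borel" "I \<subseteq> {-c..c}"
begin

text \<open>The event that boxes around \<open>a\<close> and \<open>b\<close> are resonant at a
 common energy.\<close>

definition meet :: "nat => (int ^ 'd) \<times> 'k => (int ^ 'd) \<times> 'k => 'w set" where
 "meet r a b = {w : space M. \<exists>x\<in>{-c..c}. 0 <= Res r a (%n. v n w) x & 0 <= Res r b (%n. v n w) x}"

lemma
 assumes r: "r >= 1" and d: "l1_dist (fst a) (fst b) = int r"
 shows sets_meet: "meet r a b : sets M"
  and emeasure_meet: "emeasure M (meet r a b) <= ennreal (10 * real CARD('k) * A0 * (real r ^ (2 * CARD('d)) * rate r))"
proof -
 let ?N = "2 * (CARD('k) * r ^ CARD('d))" and ?p = "2 * A0 * (real r ^ CARD('d) * rate r)"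
 have N: "2 * card (sites (lball n (rad r))) <= ?N" for n :: "int ^ 'd"
  using card_rad(1)[OF r, of n] by(simp add:card_cartesian_product flip: of_nat_power)
 have disj: "lball (fst a) (rad r) \<inter> lball (fst b) (rad r) = {}" using d r by(intro lball_disjoint) linarith
 note * = double_resonance[OF M indep distr c0 level_pos fin_boxes(1) fin_boxes(1) disj site_in site_in lsphere_subset lsphere_subset N N
   Res_prob[OF th r, unfolded Res_def] Res_prob[OF th r, unfolded Res_def]]
 show "meet r a b : sets M" unfolding meet_def Res_def by(rule *(1))
 have "emeasure M (meet r a b) <= (2 * of_nat ?N + 1) * ennreal ?p" unfolding meet_def Res_def by(rule *(2))
 also have "(2 * of_nat ?N + 1 :: ennreal) = of_nat (2 * ?N + 1)" by simp
 also have "... = ennreal (2 * real ?N + 1)" unfolding ennreal_of_nat_eq_real_of_nat by simp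
 also have "... * ennreal ?p = ennreal ((2 * real ?N + 1) * ?p)" using A0_nonneg rate_nonneg by(subst ennreal_mult) auto
 also have "... <= ennreal (5 * real CARD('k) * real r ^ CARD('d) * ?p)"
 proof (intro ennreal_leI mult_right_mono)
  have "1 * 1 <= real CARD('k) * real r ^ CARD('d)" using r by(intro mult_mono one_le_power) (auto simp:Suc_le_eq)
  thus "2 * real ?N + 1 <= 5 * real CARD('k) * real r ^ CARD('d)" by simp
 qed (use A0_nonneg rate_nonneg in auto)
 also have "5 * real CARD('k) * real r ^ CARD('d) * ?p = 10 * real CARD('k) * A0 * (real r ^ (2 * CARD('d)) * rate r)"
  unfolding mult_2[of "CARD('d)"] power_add by simp
 finally show "emeasure M (meet r a b) <= ..." .
qed

lemma norm_PE_off_meet: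
 assumes r: "r >= 1" and Z: "Z : sets borel" "Z \<subseteq> I" "!!x. x : Z ==> 0 <= Res r a (%n. v n w) x"
  and w: "w : space M" "w ~: meet r a b"
 shows "norm (PE (%n. v n w) Z (delta b)) <= C4 * (real r ^ (2 * CARD('d)) * rate r)"
proof -
 let ?u = "%n. v n w" and ?S = "{x : I. Res r b (%n. v n w) x < 0}"
 interpret pvm "PE ?u" by(rule pvm_PE)
 note S = Res_norm[OF I r, where a=b and u="?u"]
 have "Z \<subseteq> ?S" using Z w I(2) by(force simp: meet_def not_le[symmetric])
 hence "PE ?u Z (delta b) = PE ?u Z (PE ?u ?S (delta b))" unfolding E_Int[OF S(1) Z(1)] by(simp add:Int_absorb1)
 thus ?thesis using norm_E_le[OF Z(1), of "PE ?u ?S (delta b)"] S(2) by simp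
qed

lemma dynamical_bound:
 assumes r: "r >= 1" and d: "l1_dist m n = int r"
 shows "(\<integral>\<^sup>+w. (SUP t\<in>{0::real..}. ennreal (mat_norm
      (block (op_exp (\<i> * of_real t) (hamiltonian_on A B K g (%l. v l w) I)) m n))) \<partial>M)
  <= ennreal ((real CARD('k))^2 * (4 * C4 + 20 * real CARD('k) * A0) * (real r ^ (2 * CARD('d)) * rate r))"
proof -
 let ?X = "real r ^ (2 * CARD('d)) * rate r" and ?F = "%i j. meet r (m, i) (n, j)"
 have X: "?X >= 0" using rate_nonneg by simp
 have mn: "m ~= n" using d r by auto
 have [measurable]: "?F i j : sets M" for i j by(rule sets_meet) (use r d in auto)
 have entry: "cmod (block (op_exp (\<i> * of_real t) (hamiltonian_on A B K g (%l. v l w) I)) m n $ i $ j) <= 4 * C4 * ?X + 2 * indicator (?F i j) w"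
  if w: "w : space M" for t w i j
 proof -
  let ?u = "%l. v l w" and ?a = "(m, i)" and ?b = "(n, j)"
  interpret spectral "PE ?u" "domH ?u" "opH ?u" by(rule spectral_PE)
  note e = expform_bound[OF I c, of t "delta ?a" "delta ?b"]
  have "cmod (expform I (\<i> * of_real t) (delta ?a) (delta ?b)) <= 4 * C4 * ?X" if "w ~: ?F i j"
  proof -
   let ?S = "{x : I. Res r ?a ?u x < 0}"
   note S = Res_norm[OF I r, where a="?a" and u="?u"]
   have S': "I - ?S : sets borel" using S(1) I(1) by auto
   have "cmod (expform I (\<i> * of_real t) (delta ?a) (delta ?b)) <= 2 * norm (PE ?u ?S (delta ?a)) * 1 + 2 * 1 * norm (PE ?u (I - ?S) (delta ?b))"
    using expform_split_bound[OF I c S(1) S', of t "delta ?a" "delta ?b"] by auto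
   also have "... <= 2 * (C4 * ?X) * 1 + 2 * 1 * (C4 * ?X)"
    by(intro add_mono mult_left_mono mult_right_mono S(2) norm_PE_off_meet[OF r S' _ _ w that]) auto
   finally show ?thesis by(simp add:mult_ac)
  qed
  thus ?thesis
   using e X C4_nonneg by(cases "w : ?F i j") (auto simp:block_entry[OF I c] cinner_delta_delta[OF mn] intro:add_increasing)
 qed
 have "(\<integral>\<^sup>+w. (SUP t\<in>{0::real..}. ennreal (mat_norm (block (op_exp (\<i> * of_real t) (hamiltonian_on A B K g (%l. v l w) I)) m n))) \<partial>M)
  <= (\<integral>\<^sup>+w. (\<Sum>i\<in>UNIV. \<Sum>j\<in>UNIV. ennreal (4 * C4 * ?X) + 2 * indicator (?F i j) w) \<partial>M)"
 proof (intro nn_integral_mono SUP_least)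
  fix w t assume w: "w : space M"
  have "mat_norm (block (op_exp (\<i> * of_real t) (hamiltonian_on A B K g (%l. v l w) I)) m n) <= (\<Sum>i\<in>UNIV. \<Sum>j\<in>UNIV. 4 * C4 * ?X + 2 * indicator (?F i j) w)"
   by(rule order_trans[OF mat_norm_le_sum]) (intro sum_mono entry w)
  hence "ennreal (mat_norm (block (op_exp (\<i> * of_real t) (hamiltonian_on A B K g (%l. v l w) I)) m n)) <= ennreal (\<Sum>i\<in>UNIV. \<Sum>j\<in>UNIV. 4 * C4 * ?X + 2 * indicator (?F i j) w)"
   by(rule ennreal_leI)
  also have "... = (\<Sum>i\<in>UNIV. \<Sum>j\<in>UNIV. ennreal (4 * C4 * ?X) + 2 * indicator (?F i j) w)"
   using X C4_nonneg by(simp add:sum_ennreal[symmetric] sum_nonneg ennreal_mult ennreal_indicator)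
  finally show "ennreal (mat_norm (block (op_exp (\<i> * of_real t) (hamiltonian_on A B K g (%l. v l w) I)) m n)) <= ..." .
 qed
 also have "... = (\<Sum>i\<in>UNIV. \<Sum>j\<in>UNIV. ennreal (4 * C4 * ?X) + 2 * emeasure M (?F i j))"
  by(simp add:nn_integral_sum nn_integral_add nn_integral_cmult prob_space.emeasure_space_1[OF M])
 also have "... <= (\<Sum>i\<in>(UNIV::'k set). \<Sum>j\<in>(UNIV::'k set). ennreal (4 * C4 * ?X) + 2 * ennreal (10 * real CARD('k) * A0 * ?X))"
  by(intro sum_mono add_left_mono mult_left_mono emeasure_meet) (use r d in auto)
 also have "... = (\<Sum>i\<in>(UNIV::'k set). \<Sum>j\<in>(UNIV::'k set). ennreal ((4 * C4 + 20 * real CARD('k) * A0) * ?X))"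
 proof (intro sum.cong refl)
  have "2 * ennreal (10 * real CARD('k) * A0 * ?X) = ennreal (2 * (10 * real CARD('k) * A0 * ?X))"
   using X A0_nonneg by(subst ennreal_mult) auto
  thus "ennreal (4 * C4 * ?X) + 2 * ennreal (10 * real CARD('k) * A0 * ?X) = ennreal ((4 * C4 + 20 * real CARD('k) * A0) * ?X)"
   using X C4_nonneg A0_nonneg by(simp add:ennreal_plus[symmetric] distrib_right del: ennreal_plus)
 qed
 also have "... = ennreal ((real CARD('k))^2 * (4 * C4 + 20 * real CARD('k) * A0) * ?X)"
 proof -
  define y where "y = (4 * C4 + 20 * real CARD('k) * A0) * ?X"
  have "y >= 0" using X C4_nonneg A0_nonneg by(simp add:y_def)
  thus ?thesis
   unfolding mult.assoc[of "(real CARD('k))^2"] y_def[symmetric]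
   by(simp add:ennreal_of_nat_eq_real_of_nat ennreal_mult power2_eq_square mult.assoc)
 qed
 finally show ?thesis .
qed

context
 assumes g2: "2 * D1 <= g powr (s^2 / 8)"
begin

lemma rate_le: "rate r <= (1 / 2) ^ r"
proof -
 have "rate r = (D1 / g powr (s^2 / 8)) ^ r"
  using g by(simp add:rate_def power_divide powr_power powr_minus_divide mult.commute[of "real r"])
 also have "... <= (1 / 2) ^ r" using g2 D1 g by(intro power_mono) (auto simp:divide_le_eq)
 finally show ?thesis .
qed

lemma power_rate_le: "real r ^ p * rate r <= real (2 * r + 1) ^ p * (1 / 2) ^ r"
 by(intro mult_mono rate_le power_mono rate_nonneg) auto

lemma square_tail:
 assumes "0 <= y" "y <= C4 * (real r ^ (2 * CARD('d)) * rate r)"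
 shows "y^2 <= C4^2 * (real (2 * r + 1) ^ (4 * CARD('d)) * (1 / 2) ^ r)"
proof -
 let ?t = "real (2 * r + 1) ^ (2 * CARD('d))"
 have "y <= C4 * (?t * (1 / 2) ^ r)" by(rule order_trans[OF assms(2)]) (intro mult_left_mono power_rate_le C4_nonneg)
 hence "y^2 <= (C4 * (?t * (1 / 2) ^ r))^2" using assms(1) by(rule power_mono)
 also have "... = C4^2 * (?t^2 * ((1 / 2) ^ r * (1 / 2) ^ r))" by(simp add:power_mult_distrib power2_eq_square mult_ac)
 also have "... <= C4^2 * (?t^2 * (1 * (1 / 2) ^ r))" by(intro mult_left_mono mult_right_mono power_le_one) auto
 also have "?t^2 = real (2 * r + 1) ^ (4 * CARD('d))" by(subst power_mult[symmetric]) simp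
 finally show ?thesis by simp
qed

text \<open>Almost surely, once the scale is large, no box centred at \<open>a\<close> is resonant
 at a common energy with a box of the same scale at the corresponding distance.\<close>

lemma eventually_off_meet:
 "AE w in M. eventually (%r. \<forall>b. l1_dist (fst a) (fst b) = int r --> r >= 1 --> w ~: meet r a b) sequentially"
proof -
 interpret M: prob_space M by(rule M)
 define G where "G = (%r. if r = 0 then {} else (\<Union>b\<in>sites (lsphere (fst a) r). meet r a b))"
 let ?c = "10 * real CARD('k) * A0"
 have c: "?c >= 0" using A0_nonneg by simp
 have fin: "finite (sites (lsphere (fst a) r))" for r using finite_subset[OF lsphere_subset finite_lball] by(intro finite_cartesian_product) auto
 have d: "l1_dist (fst a) (fst b) = int r" if "b : sites (lsphere (fst a) r)" for b r
  using that by(auto simp:lsphere_def l1_dist_commute[of "fst a"])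
 have G: "G r : sets M" for r using fin d by(auto simp:G_def intro!:sets.finite_UN sets_meet)
 have mG: "measure M (G r) <= (real CARD('k) * ?c) * (real (2 * r + 1) ^ (3 * CARD('d)) * (1 / 2) ^ r)" for r
 proof (cases "r = 0")
  case False
  let ?X = "?c * (real r ^ (2 * CARD('d)) * rate r)"
  have "measure M (meet r a b) <= ?X" if "b : sites (lsphere (fst a) r)" for b
   using emeasure_meet[OF _ d[OF that]] False c rate_nonneg[of r] by(simp add:M.emeasure_eq_measure ennreal_le_iff)
  moreover have "measure M (G r) <= (\<Sum>b\<in>sites (lsphere (fst a) r). measure M (meet r a b))"
   using False d unfolding G_def by(simp, intro M.finite_measure_subadditive_finite fin) (auto intro!:sets_meet)
  ultimately have "measure M (G r) <= (\<Sum>b\<in>sites (lsphere (fst a) r). ?X)" by(meson order_trans sum_mono)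
  also have "... <= real CARD('k) * real (2 * r + 1) ^ CARD('d) * ?X"
  proof -
   have "card (lsphere (fst a) r) <= (2 * r + 1) ^ CARD('d)"
    using card_mono[OF finite_lball lsphere_subset, of "fst a" r] card_lball[of "fst a" r] by linarith
   hence "card (sites (lsphere (fst a) r)) <= CARD('k) * (2 * r + 1) ^ CARD('d)" by(simp add:card_cartesian_product)
   hence "real (card (sites (lsphere (fst a) r))) <= real CARD('k) * real (2 * r + 1) ^ CARD('d)"
    by(metis of_nat_le_iff of_nat_mult of_nat_power)
   thus ?thesis unfolding sum_constant
    by(rule mult_right_mono) (intro mult_nonneg_nonneg c rate_nonneg zero_le_power of_nat_0_le_iff)
  qed
  also have "... <= real CARD('k) * real (2 * r + 1) ^ CARD('d) * (?c * (real (2 * r + 1) ^ (2 * CARD('d)) * (1 / 2) ^ r))"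
   by(intro mult_left_mono power_rate_le c) auto
  also have "... = (real CARD('k) * ?c) * ((real (2 * r + 1) ^ CARD('d) * real (2 * r + 1) ^ (2 * CARD('d))) * (1 / 2) ^ r)"
   by(simp only: mult_ac)
  also have "real (2 * r + 1) ^ CARD('d) * real (2 * r + 1) ^ (2 * CARD('d)) = real (2 * r + 1) ^ (3 * CARD('d))"
   by(subst power_add[symmetric]) simp
  finally show ?thesis .
 qed (simp add:G_def A0_nonneg)
 have "summable (%r. (real CARD('k) * ?c) * (real (2 * r + 1) ^ (3 * CARD('d)) * (1 / 2) ^ r))"
  by(intro summable_mult summable_lattice_decay)
 hence "summable (%r. measure M (G r))" by(rule summable_comparison_test'[where N=0]) (use mG in simp)
 hence "AE w in M. eventually (%r. w : space M - G r) sequentially"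
  by(intro borel_cantelli_AE1 G) (auto simp:M.emeasure_eq_measure)
 thus ?thesis
 proof (rule AE_mp, intro AE_I2 impI)
  fix w assume "eventually (%r. w : space M - G r) sequentially"
  thus "eventually (%r. \<forall>b. l1_dist (fst a) (fst b) = int r --> r >= 1 --> w ~: meet r a b) sequentially"
   by(rule eventually_mono) (auto simp:G_def lsphere_def l1_dist_commute[of "fst a"] split: if_splits)
 qed
qed

text \<open>Energies resonant at \<open>a\<close> on all large scales carry an atomic spectral
 projection; the others carry no mass of \<open>delta a\<close>.\<close>

lemma atomic_at_site:
 assumes w: "w : space M"
  and ev: "eventually (%r. \<forall>b. l1_dist (fst a) (fst b) = int r --> r >= 1 --> w ~: meet r a b) sequentially"
 shows "\<exists>X. countable X & PE (%n. v n w) (I - X) (delta a) = 0"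
proof -
 let ?u = "%n. v n w"
 interpret pvm "PE ?u" by(rule pvm_PE)
 obtain r1' where "\<forall>r\<ge>r1'. \<forall>b. l1_dist (fst a) (fst b) = int r --> r >= 1 --> w ~: meet r a b"
  using ev by(auto simp:eventually_sequentially)
 then obtain r1 where r1: "r1 >= 1" "!!r b. r >= r1 ==> l1_dist (fst a) (fst b) = int r ==> w ~: meet r a b"
  by(metis max.bounded_iff max.cobounded1)
 define S where "S = (%r. if r = 0 then {} else {x : I. Res r a ?u x < 0})"
 have S[measurable]: "S r : sets borel" for r using Res_norm(1)[OF I] by(simp add:S_def)
 have nS: "(norm (PE ?u (S r) (delta a)))^2 <= C4^2 * (real (2 * r + 1) ^ (4 * CARD('d)) * (1 / 2) ^ r)" for r
 proof (cases "r = 0")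
  case False
  hence "r >= 1" by simp
  from square_tail[OF norm_ge_zero Res_norm(2)[OF I this, where a=a and u="?u"]] False show ?thesis by(simp only: S_def if_False)
 qed (simp add:S_def)
 define Z where "Z = (%r0. I - (\<Union>r\<in>{r0..}. S r))"
 have Z: "Z r0 : sets borel" for r0 unfolding Z_def using I by measurable
 have "\<exists>X. countable X & (\<forall>x. PE ?u (Z r0 - X) x = 0)" if r0: "r0 >= r1" for r0
 proof (rule finite_trace_atomic[OF Z parseval_delta])
  have pos: "0 <= Res r a ?u x" if "x : Z r0" "r >= r0" for x r
   using that r0 r1 by(auto simp:Z_def S_def not_less split: if_splits)
  show "(\<integral>\<^sup>+b. ennreal ((norm (PE ?u (Z r0) (delta b)))^2) \<partial>count_space UNIV) < \<infinity>"
  proof (rule lattice_sum_finite)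
   fix b :: "(int ^ 'd) \<times> 'k"
   let ?r = "nat (l1_dist (fst b) (fst a))" and ?t = "%r. real (2 * r + 1) ^ (4 * CARD('d)) * (1 / 2) ^ r"
   have d: "l1_dist (fst a) (fst b) = int ?r" using l1_dist_nonneg l1_dist_commute by(metis nat_0_le)
   show "(norm (PE ?u (Z r0) (delta b)))^2 <= (C4^2 + 2 ^ r0) * ?t ?r"
   proof (cases "?r >= r0")
    case True
    have "norm (PE ?u (Z r0) (delta b)) <= C4 * (real ?r ^ (2 * CARD('d)) * rate ?r)"
    proof (rule norm_PE_off_meet[where a=a])
     show "?r >= 1" using True r0 r1(1) by linarith
     show "w ~: meet ?r a b" by(rule r1(2)[OF _ d]) (use True r0 in linarith)
    qed (use True pos Z w in \<open>auto simp:Z_def\<close>)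
    hence "(norm (PE ?u (Z r0) (delta b)))^2 <= C4^2 * ?t ?r" by(intro square_tail) auto
    also have "... <= (C4^2 + 2 ^ r0) * ?t ?r" by(intro mult_right_mono) auto
    finally show ?thesis .
   next
    case False
    have "(norm (PE ?u (Z r0) (delta b)))^2 <= 1" using norm_E_le[OF Z, of r0 "delta b"] by(simp add:power_le_one)
    also have "1 <= 2 ^ ?r * (1 / 2 :: real) ^ ?r" by(simp flip: power_mult_distrib)
    also have "... <= 2 ^ r0 * (1 / 2) ^ ?r" using False by(intro mult_right_mono power_increasing) auto
    also have "... = 2 ^ r0 * (1 * (1 / 2) ^ ?r)" by simp
    also have "... <= (C4^2 + 2 ^ r0) * ?t ?r" by(intro mult_mono mult_right_mono one_le_power) auto
    finally show ?thesis .
   qed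
  qed auto
 qed
 then obtain X where X: "!!r0. r0 >= r1 ==> countable (X r0)" "!!r0 x. r0 >= r1 ==> PE ?u (Z r0 - X r0) x = 0" by metis
 have cX: "countable (\<Union>r0\<in>{r1..}. X r0)" using X by(intro countable_UN) auto
 have bor: "Y : sets borel" if "countable Y" for Y :: "real set" by(rule sets.countable[OF _ that]) auto
 let ?m = "smeas (PE ?u) (delta a)"
 have fm: "finite_measure ?m" by(rule finite_measure_smeas)
 have "summable (%r. C4^2 * (real (2 * r + 1) ^ (4 * CARD('d)) * (1 / 2) ^ r))" by(intro summable_mult summable_lattice_decay)
 hence "summable (%r. measure ?m (S r))"
  by(rule summable_comparison_test'[where N=0]) (use nS S in \<open>simp add:measure_smeas\<close>)
 hence "AE x in ?m. eventually (%r. x : space ?m - S r) sequentially"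
  using finite_measure.emeasure_finite[OF fm] by(intro borel_cantelli_AE1) (auto simp:less_top)
 moreover have "AE x in ?m. \<forall>r0. r0 >= r1 --> x ~: Z r0 - X r0"
 proof (unfold AE_all_countable, intro allI)
  fix r0
  show "AE x in ?m. r0 >= r1 --> x ~: Z r0 - X r0"
  proof (cases "r0 >= r1")
   case True
   hence "Z r0 - X r0 : sets borel" using Z bor[OF X(1)] by auto
   hence "Z r0 - X r0 : null_sets ?m" using X(2)[OF True] by(simp add:null_sets_def emeasure_smeas)
   thus ?thesis using AE_not_in by fastforce
  qed simp
 qed
 ultimately have "AE x in ?m. x ~: I - (\<Union>r0\<in>{r1..}. X r0)"
 proof eventually_elim
  case (elim x)
  then obtain R where R: "!!r. r >= R ==> x ~: S r" by(auto simp:eventually_sequentially)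
  have "x : Z (max R r1)" if "x : I" using R that by(auto simp:Z_def)
  thus ?case using elim(2) by fastforce
 qed
 moreover have IX: "I - (\<Union>r0\<in>{r1..}. X r0) : sets borel" using I(1) bor[OF cX] by auto
 ultimately have "emeasure ?m (I - (\<Union>r0\<in>{r1..}. X r0)) = 0"
  by(subst (asm) AE_iff_measurable[where N="I - (\<Union>r0\<in>{r1..}. X r0)"]) (auto simp:smeas_def)
 hence "PE ?u (I - (\<Union>r0\<in>{r1..}. X r0)) (delta a) = 0" using IX by(simp add:emeasure_smeas)
 thus ?thesis using cX by blast
qed

lemma pure_point:
 "AE w in M. pure_point_spectrum_in (hamiltonian_domain A B K g (%n. v n w)) (hamiltonian A B K g (%n. v n w)) I"
proof -
 have "AE w in M. \<forall>a. eventually (%r. \<forall>b. l1_dist (fst a) (fst b) = int r --> r >= 1 --> w ~: meet r a b) sequentially"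
  unfolding AE_all_countable by(intro allI eventually_off_meet)
 thus ?thesis
 proof (rule AE_mp, intro AE_I2 impI)
  fix w assume w: "w : space M" and "\<forall>a. eventually (%r. \<forall>b. l1_dist (fst a) (fst b) = int r --> r >= 1 --> w ~: meet r a b) sequentially"
  hence "\<forall>a. \<exists>X. countable X & PE (%n. v n w) (I - X) (delta a) = 0" using atomic_at_site by blast
  then obtain Y where Y: "!!a. countable (Y a)" "!!a. PE (%n. v n w) (I - Y a) (delta a) = 0" by metis
  let ?u = "%n. v n w"
  interpret pvm "PE ?u" by(rule pvm_PE)
  define X where "X = (\<Union>a. Y a)"
  have X: "countable X" unfolding X_def using Y by(intro countable_UN) auto
  have bor: "I - Y : sets borel" if "countable Y" for Y using sets.countable[OF _ that, of borel] I(1) by auto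
  have 0: "PE ?u (I - X) (delta a) = 0" for a
  proof -
   have "PE ?u (I - X) (delta a) = PE ?u (I - X) (PE ?u (I - Y a) (delta a))"
    unfolding E_Int[OF bor[OF Y(1)] bor[OF X]] by(rule arg_cong[where f="%S. PE ?u S _"]) (auto simp:X_def)
   thus ?thesis using E_simps[OF bor[OF X]] by(simp add:Y(2))
  qed
  have "PE ?u (I - X) x = 0" for x
  proof -
   have "cinner (delta a) (PE ?u (I - X) x) = 0" for a unfolding selfadj[OF bor[OF X]] by(simp add:0)
   hence "ennreal ((norm (PE ?u (I - X) x))^2) = 0" by(subst parseval_delta[symmetric]) simp
   thus ?thesis by simp
  qed
  hence "emeasure (scalar_spectral_measure (hproj ?u) (fld x)) (I - X) = 0" for x
   unfolding smeas_PE[symmetric] using bor[OF X] by(simp add:emeasure_smeas)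
  hence "emeasure (scalar_spectral_measure (hproj ?u) psi) (I - X) = 0" if "psi : ell2" for psi
   using mk_l2_inverse[OF that] by metis
  thus "pure_point_spectrum_in (hamiltonian_domain A B K g ?u) (hamiltonian A B K g ?u) I"
   using X unfolding pure_point_spectrum_in_def hamiltonian_projection_def by blast
 qed
qed

end

end

end

end

section \<open>Localisation at large coupling\<close>

theorem corollary1p1p2:
  fixes M :: "'w measure"
    and v :: "int ^ 'd \<Rightarrow> 'w \<Rightarrow> real"
    and \<mu> :: "real measure"
    and A B :: "complex ^ 'k ^ 'k"
    and K :: "int ^ 'd \<Rightarrow> complex ^ 'k ^ 'k"
    and \<alpha> q s C\<^sub>A\<^sub>1 C\<^sub>A\<^sub>2 C\<^sub>B\<^sub>1 C\<^sub>B\<^sub>2 C\<^sub>B\<^sub>3 :: real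
    and I :: "real set"
  assumes "prob_space M"
    and indep: "prob_space.indep_vars M (\<lambda>_. borel) v UNIV"
    and distr: "\<And>n. distr M borel (v n) = \<mu>"
    and "\<alpha> > 0" and "q > 0"
    and A1: "\<And>\<epsilon> t. \<epsilon> > 0 \<Longrightarrow> measure \<mu> {t - \<epsilon>..t + \<epsilon>} \<le> C\<^sub>A\<^sub>1 * \<epsilon> powr \<alpha>"
    and A2: "(\<integral>\<^sup>+x. ennreal (\<bar>x\<bar> powr q) \<partial>\<mu>) \<le> ennreal C\<^sub>A\<^sub>2"
    and "hermitian A" and "hermitian B"
    and B1: "invertible A" "mat_norm A \<le> C\<^sub>B\<^sub>1" "mat_norm (matrix_inv A) \<le> C\<^sub>B\<^sub>1"
    and B2: "mat_norm B \<le> C\<^sub>B\<^sub>2"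
    and B3: "\<And>m n. adjacent m n \<Longrightarrow> K (n - m) = conj_transpose (K (m - n))"
            "\<And>m n. adjacent m n \<Longrightarrow> mat_norm (K (m - n)) \<le> C\<^sub>B\<^sub>3"
    and "0 < s" and "s \<le> \<alpha> * q / (2 * real CARD('k) * \<alpha> + real CARD('k) * q)"
    and I: "is_interval I" "bounded I" "I \<noteq> {}"
  shows "\<exists>C>0. \<forall>g>0.
    g \<ge> C * real CARD('d) powr (1 / s) / (1 + (INF x\<in>I. \<bar>x\<bar>)) \<longrightarrow>
    (\<forall>m n. m \<noteq> n \<longrightarrow>
       (\<lambda>\<omega>. SUP t\<in>{0::real..}. ennreal (mat_norm
            (block (op_exp (\<i> * of_real t) (hamiltonian_on A B K g (\<lambda>l. v l \<omega>) I)) m n)))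
         \<in> borel_measurable M \<and>
       (\<integral>\<^sup>+\<omega>. (SUP t\<in>{0::real..}. ennreal (mat_norm
            (block (op_exp (\<i> * of_real t) (hamiltonian_on A B K g (\<lambda>l. v l \<omega>) I)) m n))) \<partial>M)
         \<le> ennreal (C * real_of_int (l1_dist m n) ^ (2 * CARD('d)) *
              (C * real CARD('d) / (g powr s * (1 + (INF x\<in>I. \<bar>x\<bar>)) powr s))
                powr (s * real_of_int (l1_dist m n) / 8))) \<and>
    (AE \<omega> in M. pure_point_spectrum_in
       (hamiltonian_domain A B K g (\<lambda>l. v l \<omega>)) (hamiltonian A B K g (\<lambda>l. v l \<omega>)) I)"
proof -
 let ?k = "real CARD('k)" and ?d = "real CARD('d)"
 interpret M: prob_space M by fact
 have v: "v n : borel_measurable M" for n using indep by(simp add:M.indep_vars_def)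
 have mu: "prob_space \<mu>" "sets \<mu> = sets borel" using M.prob_space_distr[OF v, of undefined] distr[of undefined] by auto
 interpret \<mu>: prob_space \<mu> by(rule mu)
 interpret \<mu>: holder_measure \<mu> \<alpha> q C\<^sub>A\<^sub>1 C\<^sub>A\<^sub>2 by unfold_locales (use mu `\<alpha> > 0` `q > 0` A1 A2 in auto)
 have "s * (?k * (2 * \<alpha> + q)) <= \<alpha> * q"
  using `s <= _` `\<alpha> > 0` `q > 0` by(simp add:pos_le_divide_eq algebra_simps add_pos_pos)
 hence ks: "?k * s * (2 * \<alpha> + q) <= \<alpha> * q" by(simp add:mult_ac)
 have "?k * s * q < ?k * s * (2 * \<alpha> + q)" using `0 < s` `\<alpha> > 0` by simp
 hence s1: "?k * s < \<alpha>" using ks `q > 0` mult_less_cancel_right_pos by(metis le_less_trans less_le_trans)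
 have "?k * s * (2 * \<alpha>) <= ?k * s * (2 * \<alpha> + q)" using `0 < s` `q > 0` by simp
 hence "\<alpha> * (2 * ?k * s) <= \<alpha> * q" using ks by(simp add:mult_ac)
 hence s2: "2 * ?k * s <= q" using `\<alpha> > 0` by simp
 have "1 * s <= ?k * s" using `0 < s` by(intro mult_right_mono) (auto simp:Suc_le_eq)
 hence s3: "s <= 1" using s1 \<mu>.alpha_le_1 by simp
 obtain kp where kp: "kp > 0" "!!P Q T. degree P <= CARD('k) ==> degree Q <= CARD('k) ==> Q ~= 0 ==> T : sets borel ==> measure \<mu> T <= kp ==>
   (\<integral>\<^sup>+x. ennreal (cmod (poly P (of_real x) / poly Q (of_real x)) powr (s / 3)) \<partial>\<mu>) \<le>
   2 * (\<integral>\<^sup>+x. ennreal (cmod (poly P (of_real x) / poly Q (of_real x)) powr (s / 3)) * indicator (- T) x \<partial>\<mu>)"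
  using \<mu>.decoupling[OF `0 < s` s2 s1] by(auto simp:Suc_le_eq)
 obtain b where b: "!!x. x : I ==> \<bar>x\<bar> <= b" using I(2) by(auto simp:bounded_iff)
 define c where "c = max 1 b"
 have cI: "c > 0" "I \<subseteq> {-c..c}" using b by(force simp: c_def abs_le_iff)+
 have Ib: "I : sets borel" using I(1) by(rule real_interval_borel_measurable)
 obtain C1 where C1: "C1 >= 0" "!!z. abs (Re z) <= c ==> \<bar>Im z\<bar> <= 1 ==> \<exists>T\<in>sets borel. measure \<mu> T <= kp &
  (\<forall>x y. x ~: T --> (\<Sum>j\<in>UNIV. cmod (y j)) \<le>
    C1 * (\<Sum>l\<in>UNIV. cmod (\<Sum>j\<in>UNIV. y j * ((x *\<^sub>R A + B) $ j $ l - (if j = l then z else 0)))))"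
  using \<mu>.single_site[OF B1(1) kp(1), of c B] by auto
 define a where "a = (INF x\<in>I. abs x)"
 have a: "a >= 0" unfolding a_def using I(3) by(intro cINF_greatest) auto
 define a0 where "a0 = 2 * ?k * C1 powr (s / 3)"
 define b1 where "b1 = max 1 (a0 * ?k * max C\<^sub>B\<^sub>3 0 powr (s / 3) * nbr TYPE('d))"
 define C3 where "C3 = ?k^2 * (4 * (2 * ?k^2 * nbr TYPE('d) * max C\<^sub>B\<^sub>3 0) + 20 * ?k * a0)"
 \<comment> \<open>Above this threshold \<open>rate r\<close> is at most \<open>(1 / 2) ^ r\<close>.\<close>
 define g0 where "g0 = (2 * b1) powr (8 / s^2)"
 define C where "C = C3 + 1 + g0 * (1 + a) + b1 powr (8 / s) * (1 + a) powr s"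
 have b1: "b1 >= 1" by(simp add:b1_def)
 have C3: "C3 >= 0" by(auto simp:C3_def a0_def)
 have g0: "g0 >= 1" using b1 by(simp add:g0_def ge_one_powr_ge_zero)
 have C: "C > 0" "C3 <= C" "g0 * (1 + a) <= C" "b1 powr (8 / s) * (1 + a) powr s <= C" "C >= 0"
  using C3 g0 a by(auto simp:C_def add_nonneg_pos add_pos_nonneg add_increasing add_increasing2)
 have d1: "?d >= 1" by(simp add:Suc_le_eq)
 show ?thesis
 proof (intro exI[of _ C] conjI allI impI C(1))
  fix g :: real
  assume g: "g > 0" and "g >= C * ?d powr (1 / s) / (1 + (INF x\<in>I. abs x))"
  hence "C * ?d powr (1 / s) <= g * (1 + a)" using a by(simp add:a_def[symmetric] pos_divide_le_eq)
  moreover have "g0 * (1 + a) * 1 <= C * ?d powr (1 / s)" using C d1 a g0 `0 < s` by(intro mult_mono ge_one_powr_ge_zero) auto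
  ultimately have "g0 * (1 + a) <= g * (1 + a)" by simp
  hence gg: "g0 <= g" by(rule mult_right_le_imp_le) (use a in simp)
  hence g1: "1 <= g" using g0 by simp
  interpret anderson A B K g C\<^sub>B\<^sub>3 \<mu> \<alpha> q C\<^sub>A\<^sub>1 C\<^sub>A\<^sub>2 s kp C1 c
   by unfold_locales (use `hermitian A` `hermitian B` B3 g `0 < s` s3 C1 cI kp(2) in auto)
  have A0_eq: "a0 = A0" and D1_eq: "b1 = D1" by(simp_all add: a0_def b1_def A0_def D1_def)
  have g2: "2 * D1 <= g powr (s^2 / 8)"
  proof -
   have "2 * D1 = g0 powr (s^2 / 8)" using b1 `0 < s` by(simp add:g0_def powr_powr D1_eq)
   also have "... <= g powr (s^2 / 8)" using gg g0 by(intro powr_mono2) auto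
   finally show ?thesis .
  qed
  have th: "th <= 1 / 2"
  proof -
   have "s * s <= s * 1" using s3 `0 < s` by(intro mult_left_mono) auto
   hence "g powr (s^2 / 8) <= g powr (s / 3)" using g1 `0 < s` by(intro powr_mono) (auto simp:power2_eq_square)
   hence "2 * D1 <= g powr (s / 3)" using g2 by simp
   moreover have "a0 * ?k * max C\<^sub>B\<^sub>3 0 powr (s / 3) * nbr TYPE('d) <= D1" by(simp add:D1_def A0_eq)
   ultimately show ?thesis unfolding theta_eq A0_eq using g by(simp add:powr_minus field_simps)
  qed
  show "AE \<omega> in M. pure_point_spectrum_in (hamiltonian_domain A B K g (%l. v l \<omega>)) (hamiltonian A B K g (%l. v l \<omega>)) I"
   by(rule pure_point[OF g1 `prob_space M` indep distr cI(1) th Ib cI(2) g2])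
  fix m n :: "int ^ 'd" assume mn: "m ~= n"
  let ?S = "%\<omega>. SUP t\<in>{0::real..}. ennreal (mat_norm (block (op_exp (\<i> * of_real t) (hamiltonian_on A B K g (%l. v l \<omega>) I)) m n))"
  show "?S : borel_measurable M" by(rule sup_measurable[OF v Ib cI(2)]) (use cI in simp)
  define r where "r = nat (l1_dist m n)"
  have r: "l1_dist m n = int r" by(simp add:r_def l1_dist_nonneg)
  have "l1_dist m n ~= 0" using mn by(auto simp:l1_dist_def sum_nonneg_eq_0_iff vec_eq_iff)
  hence r1: "r >= 1" using r by auto
  have "(\<integral>\<^sup>+\<omega>. ?S \<omega> \<partial>M) <= ennreal (C3 * (real r ^ (2 * CARD('d)) * rate r))"
   using dynamical_bound[OF g1 `prob_space M` indep distr cI(1) th Ib cI(2) r1 r] by(simp only: C3_def A0_eq C4_def)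
  also have "... <= ennreal (C * real_of_int (l1_dist m n) ^ (2 * CARD('d)) *
       (C * ?d / (g powr s * (1 + (INF x\<in>I. abs x)) powr s)) powr (s * real_of_int (l1_dist m n) / 8))"
  proof (rule ennreal_leI)
   have "rate r = (b1 powr (8 / s) * g powr (- s)) powr (s * r / 8)"
    using b1 g `0 < s` by(simp add:rate_def D1_eq powr_mult powr_powr powr_realpow power2_eq_square mult.assoc)
   also have "... <= (C * ?d / (g powr s * (1 + a) powr s)) powr (s * r / 8)"
   proof (intro powr_mono2)
    have "b1 powr (8 / s) * (1 + a) powr s * 1 <= C * ?d" using C d1 by(intro mult_mono) auto
    thus "b1 powr (8 / s) * g powr (- s) <= C * ?d / (g powr s * (1 + a) powr s)" using g a by(simp add:powr_minus field_simps)
   qed (use `0 < s` in auto)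
   finally have "rate r <= (C * ?d / (g powr s * (1 + a) powr s)) powr (s * r / 8)" .
   hence "C3 * (real r ^ (2 * CARD('d)) * rate r) <= C * (real r ^ (2 * CARD('d)) * (C * ?d / (g powr s * (1 + a) powr s)) powr (s * r / 8))"
    using C C3 rate_nonneg by(intro mult_mono) auto
   thus "C3 * (real r ^ (2 * CARD('d)) * rate r) <= C * real_of_int (l1_dist m n) ^ (2 * CARD('d)) *
       (C * ?d / (g powr s * (1 + (INF x\<in>I. abs x)) powr s)) powr (s * real_of_int (l1_dist m n) / 8)"
    by(simp only: r a_def of_int_of_nat_eq mult.assoc)
  qed
  finally show "(\<integral>\<^sup>+\<omega>. ?S \<omega> \<partial>M) <= ..." .
 qed
qed


end
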